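(* Let $k$ be a field of characteristic $p>0$, let $R=k[x_1,\dots,x_n]$ with its standard grading, and let $\mathfrak{m}=(x_1,\dots,x_n)$. Let $I_1,\dots,I_s$ be homogeneous ideals of $R$, let $i_0,i_1,\dots,i_s$ be non-negative integers, and define functors $T_j=H^{i_j}_{I_j}(-)$ for $1\le j\le s$ and $T=T_1\circ\cdots\circ T_s$. Then, as a graded $R$-module, the local cohomology module $H^{i_0}_{\mathfrak{m}}(T(R))$, with its natural grading, is isomorphic (by a degree-preserving $R$-module isomorphism) to ${}^*E(n)^c$ for some $c<\infty$.
   Context: $R=k[x_1,\dots,x_n]$ is graded with $\deg x_i=1$ and $k$ in degree $0$. A graded $R$-module is an $R$-module $M=\bigoplus_{i\in\mathbb{Z}}M_i$ with $R_iM_j\subseteq M_{i+j}$ for all $i,j$; a homomorphism $\varphi:M\to N$ of graded modules is degree preserving if $\varphi(M_i)\subseteq N_i$ for all $i\in\mathbb{Z}$. For a graded module $M$ and $t\in\mathbb{Z}$, $M(t)$ is the shifted module with $M(t)_i=M_{i+t}$. For a homogeneous ideal $I$ of $R$ and a graded $R$-module $M$, $H^i_I(M)$ denotes the $i$-th local cohomology module of $M$ with support in $I$. It carries a natural grading: it can be computed by applying the $I$-torsion functor to a resolution of $M$ by injective objects of the category of graded $R$-modules and degree-preserving maps (equivalently, by the Čech complex on homogeneous generators of $I$). Iterating, $H^{i_0}_{\mathfrak{m}}(T(R))$ is naturally a graded $R$-module. ${}^*E={}^*E(R/\mathfrak{m})$ denotes the ${}^*$injective hull of $R/\mathfrak{m}$,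 i.e. the injective hull of $R/\mathfrak{m}$ (with $R/\mathfrak{m}=k$ in degree $0$) in the category of graded $R$-modules and degree-preserving maps; concretely, $({}^*E)_i=\operatorname{Hom}_k(R_{-i},k)$ for $i\in\mathbb{Z}$ with the natural $R$-action, so its socle lies in degree $0$. ${}^*E(n)^c$ is the direct sum of $c$ copies of ${}^*E(n)$. *)

theory Defs
  imports "HOL-Algebra.Module" "HOL-Algebra.Ideal" "HOL-Library.Poly_Mapping"
begin

section \<open>The graded polynomial ring\<close>

text \<open>
  A polynomial is a finitely supported map from exponent vectors to coefficients; the type has a
  variable for every natural number, and \<open>k[x\<^sub>1,\<dots>,x\<^sub>n]\<close> is the subring using only
  the variables with index \<open>< n\<close>.
\<close>

type_synonym 'k mpoly = "(nat \<Rightarrow>\<^sub>0 nat) \<Rightarrow>\<^sub>0 'k"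

definition poly_ring :: "nat \<Rightarrow> 'k::field mpoly ring" where
  "poly_ring n =
     \<lparr>carrier = {p. \<forall>m\<in>Poly_Mapping.keys p. Poly_Mapping.keys m \<subseteq> {..<n}},
      monoid.mult = (*), one = 1, ring.zero = 0, add = (+)\<rparr>"

definition monom_deg :: "(nat \<Rightarrow>\<^sub>0 nat) \<Rightarrow> nat" where
  "monom_deg m = (\<Sum>i\<in>Poly_Mapping.keys m. Poly_Mapping.lookup m i)"

definition homog :: "nat \<Rightarrow> int \<Rightarrow> 'k::field mpoly set" where
  "homog n d = {p \<in> carrier (poly_ring n). \<forall>m\<in>Poly_Mapping.keys p. int (monom_deg m) = d}"

definition pvar :: "nat \<Rightarrow> 'k::field mpoly" where
  "pvar i = Poly_Mapping.single (Poly_Mapping.single i 1) 1"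

definition pconst :: "'k::field \<Rightarrow> 'k mpoly" where
  "pconst c = Poly_Mapping.single 0 c"

definition homogeneous_ideal :: "nat \<Rightarrow> 'k::field mpoly set \<Rightarrow> bool" where
  "homogeneous_ideal n I \<longleftrightarrow>
     ideal I (poly_ring n) \<and> I = genideal (poly_ring n) {f \<in> I. \<exists>d. f \<in> homog n d}"

definition irrelevant_ideal :: "nat \<Rightarrow> 'k::field mpoly set" where
  "irrelevant_ideal n = genideal (poly_ring n) (pvar ` {..<n})"

section \<open>Graded modules\<close>

text \<open>
  The fields \<open>mult\<close> and \<open>one\<close>, which the record \<^typ>\<open>('a, 'b) module\<close>
  inherits from rings, play no role and are left undefined below.
\<close>

record ('a, 'b) gmod = "('a, 'b) module" +
  hcomp :: "int \<Rightarrow> 'b set"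

definition graded_module :: "nat \<Rightarrow> ('k::field mpoly, 'b) gmod \<Rightarrow> bool" where
  "graded_module n M \<longleftrightarrow>
     module (poly_ring n) M \<and>
     (\<forall>d. subgroup (hcomp M d) (add_monoid M)) \<and>
     (\<forall>x\<in>carrier M. \<exists>!u. (\<forall>d. u d \<in> hcomp M d) \<and> finite {d. u d \<noteq> \<zero>\<^bsub>M\<^esub>} \<and>
        x = (\<Oplus>\<^bsub>M\<^esub>d\<in>{d. u d \<noteq> \<zero>\<^bsub>M\<^esub>}. u d)) \<and>
     (\<forall>d e. \<forall>a\<in>homog n d. \<forall>x\<in>hcomp M e. a \<odot>\<^bsub>M\<^esub> x \<in> hcomp M (d + e))"

definition graded_hom ::
    "nat \<Rightarrow> ('k::field mpoly, 'b) gmod \<Rightarrow> ('k mpoly, 'c) gmod \<Rightarrow> ('b \<Rightarrow> 'c) set" where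
  "graded_hom n M N =
     {\<phi>. \<phi> \<in> carrier M \<rightarrow> carrier N \<and>
         (\<forall>x\<in>carrier M. \<forall>y\<in>carrier M. \<phi> (x \<oplus>\<^bsub>M\<^esub> y) = \<phi> x \<oplus>\<^bsub>N\<^esub> \<phi> y) \<and>
         (\<forall>a\<in>carrier (poly_ring n). \<forall>x\<in>carrier M. \<phi> (a \<odot>\<^bsub>M\<^esub> x) = a \<odot>\<^bsub>N\<^esub> \<phi> x) \<and>
         (\<forall>d. \<phi> ` hcomp M d \<subseteq> hcomp N d)}"

definition graded_iso :: "nat \<Rightarrow> ('k::field mpoly, 'b) gmod \<Rightarrow> ('k mpoly, 'c) gmod \<Rightarrow> bool" where
  "graded_iso n M N \<longleftrightarrow>
     graded_module n M \<and> graded_module n N \<and>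
     (\<exists>\<phi>\<in>graded_hom n M N. \<exists>\<psi>\<in>graded_hom n N M.
        (\<forall>x\<in>carrier M. \<psi> (\<phi> x) = x) \<and> (\<forall>y\<in>carrier N. \<phi> (\<psi> y) = y))"

definition ring_gmod :: "nat \<Rightarrow> ('k::field mpoly, 'k mpoly) gmod" where
  "ring_gmod n =
     \<lparr>carrier = carrier (poly_ring n), monoid.mult = undefined, one = undefined,
      ring.zero = 0, add = (+), smult = (*), hcomp = homog n\<rparr>"

definition gmod_shift :: "int \<Rightarrow> ('a, 'b) gmod \<Rightarrow> ('a, 'b) gmod" where
  "gmod_shift t M = M\<lparr>hcomp := \<lambda>i. hcomp M (i + t)\<rparr>"

text \<open>Direct sum of a family indexed by a finite set \<open>A\<close>.\<close>

definition gmod_dsum :: "'i set \<Rightarrow> ('i \<Rightarrow> ('a, 'b) gmod) \<Rightarrow> ('a, 'i \<Rightarrow> 'b) gmod" where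
  "gmod_dsum A M =
     \<lparr>carrier = (\<Pi>\<^sub>E i\<in>A. carrier (M i)), monoid.mult = undefined, one = undefined,
      ring.zero = (\<lambda>i\<in>A. \<zero>\<^bsub>M i\<^esub>),
      add = (\<lambda>u v. \<lambda>i\<in>A. u i \<oplus>\<^bsub>M i\<^esub> v i),
      smult = (\<lambda>a u. \<lambda>i\<in>A. a \<odot>\<^bsub>M i\<^esub> u i),
      hcomp = (\<lambda>d. \<Pi>\<^sub>E i\<in>A. hcomp (M i) d)\<rparr>"

text \<open>\<open>Z / B\<close> for submodules \<open>B \<subseteq> Z\<close> of \<open>M\<close>.\<close>

definition subquotient :: "('a, 'b) gmod \<Rightarrow> 'b set \<Rightarrow> 'b set \<Rightarrow> ('a, 'b set) gmod" where
  "subquotient M Z B =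
     \<lparr>carrier = (\<lambda>z. B +>\<^bsub>M\<^esub> z) ` Z, monoid.mult = undefined, one = undefined,
      ring.zero = B,
      add = (\<lambda>X Y. X <+>\<^bsub>M\<^esub> Y),
      smult = (\<lambda>a X. \<Union>x\<in>X. B +>\<^bsub>M\<^esub> (a \<odot>\<^bsub>M\<^esub> x)),
      hcomp = (\<lambda>d. (\<lambda>z. B +>\<^bsub>M\<^esub> z) ` (Z \<inter> hcomp M d))\<rparr>"

text \<open>The graded module structure carried over along a map injective on the carrier.\<close>

definition gmod_image :: "('b \<Rightarrow> 'c) \<Rightarrow> ('a, 'b) gmod \<Rightarrow> ('a, 'c) gmod" where
  "gmod_image \<phi> M =
     (let \<psi> = inv_into (carrier M) \<phi> in
      \<lparr>carrier = \<phi> ` carrier M, monoid.mult = undefined, one = undefined,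
       ring.zero = \<phi> \<zero>\<^bsub>M\<^esub>,
       add = (\<lambda>x y. \<phi> (\<psi> x \<oplus>\<^bsub>M\<^esub> \<psi> y)),
       smult = (\<lambda>a x. \<phi> (a \<odot>\<^bsub>M\<^esub> \<psi> x)),
       hcomp = (\<lambda>d. \<phi> ` hcomp M d)\<rparr>)"

section \<open>Localization at the powers of one homogeneous element\<close>

text \<open>\<open>(x, k)\<close> represents \<open>x / f\<^sup>k\<close>.\<close>

definition loc_rel ::
    "('k::field mpoly, 'b) gmod \<Rightarrow> 'k mpoly \<Rightarrow> (('b \<times> nat) \<times> ('b \<times> nat)) set" where
  "loc_rel M f =
     {((x, k), (y, l)). x \<in> carrier M \<and> y \<in> carrier M \<and>
        (\<exists>t. f ^ (t + l) \<odot>\<^bsub>M\<^esub> x = f ^ (t + k) \<odot>\<^bsub>M\<^esub> y)}"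

definition frac :: "('k::field mpoly, 'b) gmod \<Rightarrow> 'k mpoly \<Rightarrow> 'b \<Rightarrow> nat \<Rightarrow> ('b \<times> nat) set" where
  "frac M f x k = loc_rel M f `` {(x, k)}"

text \<open>
  \<open>x / f\<^sup>k\<close> has degree \<open>deg x - k * deg f\<close>. The zero polynomial is homogeneous of every
  degree, which is harmless since localizing at it gives the zero module.
\<close>

definition localization ::
    "nat \<Rightarrow> ('k::field mpoly, 'b) gmod \<Rightarrow> 'k mpoly \<Rightarrow> ('k mpoly, ('b \<times> nat) set) gmod" where
  "localization n M f =
     \<lparr>carrier = (carrier M \<times> UNIV) // loc_rel M f, monoid.mult = undefined, one = undefined,
      ring.zero = frac M f \<zero>\<^bsub>M\<^esub> 0,
      add = (\<lambda>X Y. \<Union>(x, k)\<in>X. \<Union>(y, l)\<in>Y.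
               frac M f (f ^ l \<odot>\<^bsub>M\<^esub> x \<oplus>\<^bsub>M\<^esub> f ^ k \<odot>\<^bsub>M\<^esub> y) (k + l)),
      smult = (\<lambda>a X. \<Union>(x, k)\<in>X. frac M f (a \<odot>\<^bsub>M\<^esub> x) k),
      hcomp = (\<lambda>d. {frac M f x k | x k e. f \<in> homog n e \<and> x \<in> hcomp M (d + int k * e)})\<rparr>"

text \<open>The canonical map \<open>M\<^sub>f \<rightarrow> M\<^sub>f\<^sub>g\<close>.\<close>

definition loc_map ::
    "('k::field mpoly, 'b) gmod \<Rightarrow> 'k mpoly \<Rightarrow> 'k mpoly \<Rightarrow> ('b \<times> nat) set \<Rightarrow> ('b \<times> nat) set" where
  "loc_map M f g X = (\<Union>(x, k)\<in>X. frac M (f * g) (g ^ k \<odot>\<^bsub>M\<^esub> x) k)"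

section \<open>Local cohomology by the Cech complex\<close>

definition faces :: "'k mpoly list \<Rightarrow> nat \<Rightarrow> nat set set" where
  "faces fs p = {S. S \<subseteq> {..<length fs} \<and> card S = p}"

definition face_prod :: "'k::field mpoly list \<Rightarrow> nat set \<Rightarrow> 'k mpoly" where
  "face_prod fs S = (\<Prod>j\<in>S. fs ! j)"

definition cech_cochains ::
    "nat \<Rightarrow> 'k::field mpoly list \<Rightarrow> ('k mpoly, 'b) gmod \<Rightarrow> nat
       \<Rightarrow> ('k mpoly, nat set \<Rightarrow> ('b \<times> nat) set) gmod" where
  "cech_cochains n fs M p = gmod_dsum (faces fs p) (\<lambda>S. localization n M (face_prod fs S))"

definition cech_diff ::
    "nat \<Rightarrow> 'k::field mpoly list \<Rightarrow> ('k mpoly, 'b) gmod \<Rightarrow> nat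
       \<Rightarrow> (nat set \<Rightarrow> ('b \<times> nat) set) \<Rightarrow> (nat set \<Rightarrow> ('b \<times> nat) set)" where
  "cech_diff n fs M p \<sigma> =
     (\<lambda>T\<in>faces fs (Suc p). let L = localization n M (face_prod fs T) in
        \<Oplus>\<^bsub>L\<^esub>j\<in>T. (- 1) ^ card {l \<in> T. l < j} \<odot>\<^bsub>L\<^esub>
          loc_map M (face_prod fs (T - {j})) (fs ! j) (\<sigma> (T - {j})))"

definition cech_cocycles ::
    "nat \<Rightarrow> 'k::field mpoly list \<Rightarrow> ('k mpoly, 'b) gmod \<Rightarrow> nat
       \<Rightarrow> (nat set \<Rightarrow> ('b \<times> nat) set) set" where
  "cech_cocycles n fs M p =
     {\<sigma> \<in> carrier (cech_cochains n fs M p).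
        cech_diff n fs M p \<sigma> = \<zero>\<^bsub>cech_cochains n fs M (Suc p)\<^esub>}"

definition cech_coboundaries ::
    "nat \<Rightarrow> 'k::field mpoly list \<Rightarrow> ('k mpoly, 'b) gmod \<Rightarrow> nat
       \<Rightarrow> (nat set \<Rightarrow> ('b \<times> nat) set) set" where
  "cech_coboundaries n fs M p =
     (case p of
        0 \<Rightarrow> {\<zero>\<^bsub>cech_cochains n fs M 0\<^esub>}
      | Suc q \<Rightarrow> cech_diff n fs M q ` carrier (cech_cochains n fs M q))"

definition cech_cohomology ::
    "nat \<Rightarrow> 'k::field mpoly list \<Rightarrow> nat \<Rightarrow> ('k mpoly, 'b) gmod
       \<Rightarrow> ('k mpoly, (nat set \<Rightarrow> ('b \<times> nat) set) set) gmod" where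
  "cech_cohomology n fs p M =
     subquotient (cech_cochains n fs M p) (cech_cocycles n fs M p) (cech_coboundaries n fs M p)"

definition homogeneous_generators :: "nat \<Rightarrow> 'k::field mpoly set \<Rightarrow> 'k mpoly list \<Rightarrow> bool" where
  "homogeneous_generators n I fs \<longleftrightarrow>
     (\<forall>f\<in>set fs. \<exists>d. f \<in> homog n d) \<and> genideal (poly_ring n) (set fs) = I"

text \<open>
  Up to graded isomorphism, Cech cohomology does not depend on the chosen homogeneous generators
  (which exist, the ring being Noetherian), so one choice of them is made for each ideal.
  To make \<open>H\<^sup>p\<^sub>I\<close> iterable, its values, which are cosets of functions into sets of
  fractions, are copied to the type the given module lives in. That type is infinite, so it has
  room for a copy of the Cech cohomology, as is proved first.
\<close>

context includes cardinal_syntax begin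

lemma card_Times_le:
  fixes U :: "'u set"
  assumes "infinite U" "|A| \<le>o |U|" "|B| \<le>o |U|"
  shows "|A \<times> B| \<le>o |U|"
  using assms by (intro card_of_Times_ordLeq_infinite_Field)
    (simp_all add: Field_card_of card_of_card_order_on)

lemma card_PiE_le:
  fixes C :: "'i \<Rightarrow> 'c set" and U :: "'u set"
  assumes "finite A" "infinite U" "\<And>i. i \<in> A \<Longrightarrow> |C i| \<le>o |U|"
  shows "|\<Pi>\<^sub>E i\<in>A. C i| \<le>o |U|"
  using assms(1,3)
proof (induction A rule: finite_induct)
  case empty
  have "U \<noteq> {}" using assms(2) by auto
  then show ?case by (simp add: card_of_singl_ordLeq)
next
  case (insert a A)
  have "|C a \<times> (\<Pi>\<^sub>E i\<in>A. C i)| \<le>o |U|"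
    using insert assms(2) by (intro card_Times_le) auto
  moreover have "|\<Pi>\<^sub>E i\<in>insert a A. C i| \<le>o |C a \<times> (\<Pi>\<^sub>E i\<in>A. C i)|"
    unfolding PiE_insert_eq by (rule card_of_image)
  ultimately show ?case by (rule ordLeq_transitive[rotated])
qed

lemma card_localization_le:
  fixes M :: "('k::field mpoly, 'b) gmod"
  assumes "infinite (UNIV :: 'b set)"
  shows "|carrier (localization n M f)| \<le>o |UNIV :: 'b set|"
proof -
  have "|carrier (localization n M f)| \<le>o |carrier M \<times> (UNIV :: nat set)|"
    using card_of_image[of "\<lambda>z. loc_rel M f `` {z}" "carrier M \<times> UNIV"]
    by (simp add: localization_def quotient_def UNION_singleton_eq_range)
  moreover have "|carrier M \<times> (UNIV :: nat set)| \<le>o |UNIV :: 'b set|"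
    using assms card_of_mono1[OF subset_UNIV, of "carrier M"]
    by (intro card_Times_le) (simp_all add: infinite_iff_card_of_nat)
  ultimately show ?thesis by (rule ordLeq_transitive)
qed

lemma ex_inj_on_cech_cohomology:
  fixes M :: "('k::field mpoly, 'b) gmod"
  assumes "infinite (UNIV :: 'b set)"
  shows "\<exists>\<phi> :: _ \<Rightarrow> 'b. inj_on \<phi> (carrier (cech_cohomology n fs p M))"
proof -
  have "finite (faces fs p)" by (simp add: faces_def)
  then have "|carrier (cech_cochains n fs M p)| \<le>o |UNIV :: 'b set|"
    unfolding cech_cochains_def gmod_dsum_def partial_object.simps
    using assms by (intro card_PiE_le card_localization_le)
  then have "|cech_cocycles n fs M p| \<le>o |UNIV :: 'b set|"
    by (rule ordLeq_transitive[rotated]) (rule card_of_mono1, auto simp: cech_cocycles_def)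
  moreover have "|carrier (cech_cohomology n fs p M)| \<le>o |cech_cocycles n fs M p|"
    unfolding cech_cohomology_def subquotient_def partial_object.simps by (rule card_of_image)
  ultimately have "|carrier (cech_cohomology n fs p M)| \<le>o |UNIV :: 'b set|"
    by (rule ordLeq_transitive[rotated])
  then show ?thesis by (auto simp: card_of_ordLeq[symmetric])
qed

end

lemma infinite_UNIV_mpoly: "infinite (UNIV :: 'k::field mpoly set)"
proof -
  have "inj (pvar :: nat \<Rightarrow> 'k mpoly)"
  proof (rule injI)
    fix i j assume "pvar i = (pvar j :: 'k mpoly)"
    then have "Poly_Mapping.keys (pvar i :: 'k mpoly) = Poly_Mapping.keys (pvar j :: 'k mpoly)"
      by simp
    then have "Poly_Mapping.single i (1::nat) = Poly_Mapping.single j 1"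
      by (simp add: pvar_def)
    then have "Poly_Mapping.keys (Poly_Mapping.single i (1::nat)) =
               Poly_Mapping.keys (Poly_Mapping.single j (1::nat))" by simp
    then show "i = j" by simp
  qed
  then show ?thesis using infinite_super[OF subset_UNIV] infinite_iff_countable_subset by auto
qed

definition local_cohomology ::
    "nat \<Rightarrow> 'k::field mpoly set \<Rightarrow> nat \<Rightarrow> ('k mpoly, 'b) gmod \<Rightarrow> ('k mpoly, 'b) gmod" where
  "local_cohomology n I p M =
     (let fs = (SOME fs. homogeneous_generators n I fs);
          H = cech_cohomology n fs p M;
          \<phi> = (SOME \<phi>. inj_on \<phi> (carrier H))
      in gmod_image \<phi> H)"

section \<open>The *injective hull of the residue field\<close>

text \<open>
  The graded \<open>k\<close>-dual of the polynomial ring. The direct sum over \<open>i\<close> of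
  \<open>Hom\<^sub>k(R\<^sub>-\<^sub>i, k)\<close> is represented by the \<open>k\<close>-linear functionals on the whole ring
  that vanish on all but finitely many graded pieces.
\<close>

definition starE :: "nat \<Rightarrow> ('k::field mpoly, 'k mpoly \<Rightarrow> 'k) gmod" where
  "starE n =
     (let R = carrier (poly_ring n);
          E = {\<phi> \<in> extensional R.
                 (\<forall>p\<in>R. \<forall>q\<in>R. \<phi> (p + q) = \<phi> p + \<phi> q) \<and>
                 (\<forall>c. \<forall>p\<in>R. \<phi> (pconst c * p) = c * \<phi> p) \<and>
                 finite {d. \<exists>p\<in>homog n d. \<phi> p \<noteq> 0}}
      in \<lparr>carrier = E, monoid.mult = undefined, one = undefined,
          ring.zero = (\<lambda>p\<in>R. 0),
          add = (\<lambda>\<phi> \<psi>. \<lambda>p\<in>R. \<phi> p + \<psi> p),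
          smult = (\<lambda>a \<phi>. \<lambda>p\<in>R. \<phi> (a * p)),
          hcomp = (\<lambda>i. {\<phi> \<in> E. \<forall>d. d \<noteq> - i \<longrightarrow> (\<forall>p\<in>homog n d. \<phi> p = 0)})\<rparr>)"

end

theory Submission
  imports Defs "HOL-Computational_Algebra.Primes"
begin

text \<open>
  Let \<open>q\<close> be a power of \<open>p\<close>. The ring \<open>R\<close> is free over the subring \<open>R\<^sup>(\<^sup>q\<^sup>)\<close> of polynomials in the
  \<open>x\<^sub>i\<^sup>q\<close>, with the monomials \<open>x\<^sup>a\<close>, \<open>a\<^sub>i < q\<close>, as a basis. Since \<open>f\<^sup>q\<close> lies in \<open>R\<^sup>(\<^sup>q\<^sup>)\<close> for every
  \<open>f\<close>, localization and cohomology of Cech complexes preserve the graded modules that have, for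
  each \<open>q\<close>, a decomposition \<open>M = \<Oplus> x\<^sup>a N\<close> with an \<open>R\<^sup>(\<^sup>q\<^sup>)\<close>-module \<open>N\<close> that lives in degrees divisible
  by \<open>q\<close>; so \<open>M = H\<^sup>i\<^sub>\<mm>(T(R))\<close> is one of them. An element \<open>v\<close> killed by all variables must
  have the form \<open>x\<^sub>1\<^sup>q\<^sup>-\<^sup>1 \<cdots> x\<^sub>n\<^sup>q\<^sup>-\<^sup>1 v'\<close> with \<open>v' \<in> N\<close>, hence its degree is \<open>-n\<close> modulo \<open>q\<close> for all
  \<open>q\<close>, and is \<open>-n\<close>. As \<open>M\<close> is torsion, its socle is \<open>V = M\<^sub>-\<^sub>n\<close>, and sending \<open>m\<close> to the functional
  \<open>r \<mapsto> (r m)\<^sub>-\<^sub>n\<close> embeds \<open>M\<close> into the graded dual \<open>Hom(R, V)(n)\<close>; the elements \<open>x\<^sup>b v'\<close> show that this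
  is onto. Finally, \<open>dim V\<close> is finite because there is a bound, independent of \<open>q\<close> and of the finite set
  \<open>S \<subseteq> M\<close>, for the dimension of the span of the coefficients in \<open>N\<close> of the elements of \<open>S\<close> when \<open>q\<close> is large,
  and this property, too, passes to localizations and subquotients.
\<close>

section \<open>Polynomials\<close>

text \<open>The obstacle is finiteness: localizing destroys finite generation. What survives is
  linear growth in \<open>q\<close>. At level \<open>q\<close> a finite set of elements is expressed
  by at most \<open>C\<close> homogeneous generators from the coefficient module, multiplied by
  polynomials with exponents below \<open>C * q\<close>. Inverting \<open>f\<close> keeps this
  shape, because x / f^K = (f^(q-K) x) / f^q, the new denominator lies in R^(q), and the exponents
  of f^(q-K) are linear in \<open>q\<close>; so \<open>C\<close> grows by a constant that depends on
  \<open>f\<close> alone. Dividing an exponent below \<open>C * q\<close> by \<open>q\<close> leaves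
  a quotient below \<open>C\<close>, which is why the coefficients of the given elements span at
  most C^n * C dimensions, whatever \<open>q\<close> is. The levels for different \<open>q\<close>
  are chosen independently of each other. The Cech differential maps coefficient modules to
  coefficient modules, and by uniqueness of coefficients it therefore commutes with their
  extraction. The grading itself is the level q = 1, so grading and descent are transported by the
  same lemmas.\<close>

lemma poly_ring_simps [simp]:
  "monoid.mult (poly_ring n) = (*)" "one (poly_ring n) = 1"
  "ring.zero (poly_ring n) = 0" "add (poly_ring n) = (+)"
  by (simp_all add: poly_ring_def)

lemma in_poly_ring_iff:
  "p \<in> carrier (poly_ring n) \<longleftrightarrow> (\<forall>m\<in>Poly_Mapping.keys p. Poly_Mapping.keys m \<subseteq> {..<n})"
  by (simp add: poly_ring_def)

lemma keys_add_nat: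
  fixes a b :: "nat \<Rightarrow>\<^sub>0 nat"
  shows "Poly_Mapping.keys (a + b) = Poly_Mapping.keys a \<union> Poly_Mapping.keys b"
  by (auto simp: in_keys_iff lookup_add)

lemma poly_ring_zero [simp, intro]: "0 \<in> carrier (poly_ring n)"
  by (simp add: in_poly_ring_iff)

lemma poly_ring_one [simp, intro]: "1 \<in> carrier (poly_ring n)"
  by (simp add: in_poly_ring_iff)

lemma poly_ring_add [simp, intro]:
  "a \<in> carrier (poly_ring n) \<Longrightarrow> b \<in> carrier (poly_ring n) \<Longrightarrow> a + b \<in> carrier (poly_ring n)"
  using Poly_Mapping.keys_add[of a b] unfolding in_poly_ring_iff by blast

lemma poly_ring_uminus [simp, intro]:
  fixes a :: "'k::field mpoly"
  assumes "a \<in> carrier (poly_ring n)" shows "- a \<in> carrier (poly_ring n)"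
proof -
  have "Poly_Mapping.keys (- a) = Poly_Mapping.keys a" by (auto simp: in_keys_iff)
  then show ?thesis using assms by (simp add: in_poly_ring_iff)
qed

lemma poly_ring_mult [simp, intro]:
  "a \<in> carrier (poly_ring n) \<Longrightarrow> b \<in> carrier (poly_ring n) \<Longrightarrow> a * b \<in> carrier (poly_ring n)"
  unfolding in_poly_ring_iff using Poly_Mapping.keys_mult[of a b] by (fastforce simp: keys_add_nat)

lemma poly_ring_power [simp, intro]:
  "a \<in> carrier (poly_ring n) \<Longrightarrow> a ^ t \<in> carrier (poly_ring n)"
  by (induction t) auto

lemma poly_ring_prod [intro]:
  "(\<And>i. i \<in> A \<Longrightarrow> f i \<in> carrier (poly_ring n)) \<Longrightarrow> prod f A \<in> carrier (poly_ring n)"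
  by (induction A rule: infinite_finite_induct) auto

lemma cring_poly_ring: "cring (poly_ring n :: 'k::field mpoly ring)"
proof (rule cringI)
  show "abelian_group (poly_ring n :: 'k mpoly ring)"
  proof (rule abelian_groupI)
    fix x :: "'k mpoly" assume "x \<in> carrier (poly_ring n)"
    then show "\<exists>y\<in>carrier (poly_ring n). y \<oplus>\<^bsub>poly_ring n\<^esub> x = \<zero>\<^bsub>poly_ring n\<^esub>"
      by (intro bexI[of _ "- x"]) auto
  qed (auto simp: algebra_simps)
  show "comm_monoid (poly_ring n :: 'k mpoly ring)"
    by (rule comm_monoidI) (auto simp: algebra_simps)
qed (auto simp: algebra_simps)

section \<open>Monomials and exponent vectors\<close>

definition xpow :: "(nat \<Rightarrow>\<^sub>0 nat) \<Rightarrow> 'k::field mpoly" where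
  "xpow a = Poly_Mapping.single a 1"

definition exps :: "nat \<Rightarrow> (nat \<Rightarrow>\<^sub>0 nat) set" where
  "exps n = {a. Poly_Mapping.keys a \<subseteq> {..<n}}"

text \<open>It has two roles: for a power \<open>q\<close> of the characteristic its monomials are
  the basis of R over the polynomials in the x_i^q, and for other bounds it measures the exponents
  of a polynomial.\<close>

definition box :: "nat \<Rightarrow> nat \<Rightarrow> (nat \<Rightarrow>\<^sub>0 nat) set" where
  "box n q = {a \<in> exps n. \<forall>i<n. Poly_Mapping.lookup a i < q}"

lemma boxD: "a \<in> box n q \<Longrightarrow> a \<in> exps n" by (simp add: box_def)

lemma exps_zero [simp]: "0 \<in> exps n" by (simp add: exps_def)

lemma exps_add: "a + b \<in> exps n \<longleftrightarrow> a \<in> exps n \<and> b \<in> exps n"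
  by (simp add: exps_def keys_add_nat)

lemma exps_lookup: "a \<in> exps n \<Longrightarrow> i \<ge> n \<Longrightarrow> Poly_Mapping.lookup a i = 0"
  by (auto simp: exps_def in_keys_iff subset_iff not_less[symmetric])

lemma exps_iff: "a \<in> exps n \<longleftrightarrow> (\<forall>i\<ge>n. Poly_Mapping.lookup a i = 0)"
  by (auto simp: exps_def in_keys_iff subset_iff not_less[symmetric])

lemma exps_single [simp]: "i < n \<Longrightarrow> Poly_Mapping.single i k \<in> exps n"
  by (simp add: exps_def)

text \<open>This makes a descent datum with q = 1 the same thing as a grading: the only coefficients
  are those at the exponent 0.\<close>

lemma box_one [simp]: "box n (Suc 0) = {0}"
proof -
  have "a = 0" if "a \<in> box n (Suc 0)" for a
  proof (rule poly_mapping_eqI)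
    fix i show "Poly_Mapping.lookup a i = Poly_Mapping.lookup 0 i"
      using that exps_lookup[of a n i] by (cases "i < n") (auto simp: box_def)
  qed
  then show ?thesis by (auto simp: box_def)
qed

lemma finite_box: "finite (box n q)"
proof -
  have "inj_on Poly_Mapping.lookup (box n q)" by (auto simp: inj_on_def)
  moreover have "Poly_Mapping.lookup ` box n q \<subseteq> {f. \<forall>i. (i \<in> {..<n} \<longrightarrow> f i \<in> {..<q}) \<and> (i \<notin> {..<n} \<longrightarrow> f i = 0)}"
    by (auto simp: box_def exps_iff)
  moreover have "finite {f. \<forall>i. (i \<in> {..<n} \<longrightarrow> f i \<in> {..<q}) \<and> (i \<notin> {..<n} \<longrightarrow> f i = (0::nat))}"
    by (rule finite_set_of_finite_funs) auto
  ultimately show ?thesis by (meson finite_imageD finite_subset)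
qed

lemma keys_poly_ring: "f \<in> carrier (poly_ring n) \<Longrightarrow> a \<in> Poly_Mapping.keys f \<Longrightarrow> a \<in> exps n"
  by (auto simp: in_poly_ring_iff exps_def)

lemma single_in_poly_ring [intro]: "a \<in> exps n \<Longrightarrow> Poly_Mapping.single a c \<in> carrier (poly_ring n)"
  by (auto simp: in_poly_ring_iff exps_def)

lemma xpow_in_poly_ring [intro]: "a \<in> exps n \<Longrightarrow> xpow a \<in> carrier (poly_ring n)"
  by (auto simp: xpow_def)

lemma pconst_in_poly_ring [simp, intro]: "pconst c \<in> carrier (poly_ring n)"
  by (auto simp: pconst_def)

lemma pvar_in_poly_ring [intro]: "i < n \<Longrightarrow> pvar i \<in> carrier (poly_ring n)"
  by (auto simp: pvar_def)

lemma single_conv: "Poly_Mapping.single a c = pconst c * xpow a"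
  by (simp add: pconst_def xpow_def mult_single)

lemma xpow_add: "xpow (a + b) = xpow a * xpow b"
  by (simp add: xpow_def mult_single)

lemma xpow_zero [simp]: "xpow 0 = 1" by (simp add: xpow_def)

lemma pvar_conv: "pvar i = xpow (Poly_Mapping.single i 1)"
  by (simp add: pvar_def xpow_def)

lemma pconst_zero [simp]: "pconst 0 = 0" by (simp add: pconst_def)
lemma pconst_one [simp]: "pconst 1 = 1" by (simp add: pconst_def)
lemma pconst_add: "pconst (c + d) = pconst c + pconst d" by (simp add: pconst_def single_add)
lemma pconst_mult: "pconst (c * d) = pconst c * pconst d" by (simp add: pconst_def mult_single)
lemma pconst_uminus: "pconst (- c) = - pconst c" by (simp add: pconst_def single_uminus)

lemma poly_mapping_sum_singles:
  fixes f :: "'a \<Rightarrow>\<^sub>0 'b::comm_monoid_add"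
  shows "(\<Sum>a\<in>Poly_Mapping.keys f. Poly_Mapping.single a (Poly_Mapping.lookup f a)) = f"
proof (rule poly_mapping_eqI)
  fix b
  have "(\<Sum>a\<in>Poly_Mapping.keys f. Poly_Mapping.lookup f a when a = b) = Poly_Mapping.lookup f b"
    by (cases "b \<in> Poly_Mapping.keys f")
       (auto simp: when_def sum.delta in_keys_iff intro: sum.neutral)
  then show "Poly_Mapping.lookup (\<Sum>a\<in>Poly_Mapping.keys f. Poly_Mapping.single a (Poly_Mapping.lookup f a)) b
      = Poly_Mapping.lookup f b"
    by (simp add: lookup_sum lookup_single)
qed

text \<open>The monomials stay inside the support of the given \<open>f\<close>, so any condition on
  its exponents (which variables occur, bounds, divisibility by \<open>q\<close>) is available in
  the induction step.\<close>

lemma poly_keys_induct [case_names zero add]: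
  fixes f :: "'a \<Rightarrow>\<^sub>0 'b::comm_monoid_add"
  assumes "Q 0"
    and "\<And>a c g. a \<in> Poly_Mapping.keys f \<Longrightarrow> Poly_Mapping.keys g \<subseteq> Poly_Mapping.keys f \<Longrightarrow> Q g \<Longrightarrow>
           Q (Poly_Mapping.single a c + g)"
  shows "Q f"
proof -
  let ?s = "\<lambda>A. \<Sum>a\<in>A. Poly_Mapping.single a (Poly_Mapping.lookup f a)"
  have keys: "Poly_Mapping.keys (?s A) \<subseteq> A" if "finite A" for A
    using that
  proof (induction A rule: finite_induct)
    case (insert a A)
    then show ?case
      using Poly_Mapping.keys_add[of "Poly_Mapping.single a (Poly_Mapping.lookup f a)" "?s A"]
      by (auto split: if_splits)
  qed simp
  have "A \<subseteq> Poly_Mapping.keys f \<Longrightarrow> Q (?s A)" if "finite A" for A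
    using that
  proof (induction A rule: finite_induct)
    case (insert a A)
    then show ?case using keys[of A] assms(2)[of a "?s A"] by auto
  qed (simp add: assms)
  from this[of "Poly_Mapping.keys f"] show ?thesis by (simp add: poly_mapping_sum_singles)
qed

section \<open>Degrees and homogeneous polynomials\<close>

lemma monom_deg_eq_sum:
  assumes "finite A" "Poly_Mapping.keys a \<subseteq> A"
  shows "monom_deg a = (\<Sum>i\<in>A. Poly_Mapping.lookup a i)"
  unfolding monom_deg_def using assms by (intro sum.mono_neutral_left) (auto simp: in_keys_iff)

lemma monom_deg_exps: "a \<in> exps n \<Longrightarrow> monom_deg a = (\<Sum>i<n. Poly_Mapping.lookup a i)"
  by (rule monom_deg_eq_sum) (auto simp: exps_def)

lemma monom_deg_add: "monom_deg (a + b) = monom_deg a + monom_deg b"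
proof -
  let ?A = "Poly_Mapping.keys a \<union> Poly_Mapping.keys b"
  have "monom_deg (a + b) = (\<Sum>i\<in>?A. Poly_Mapping.lookup (a + b) i)"
    by (rule monom_deg_eq_sum) (auto simp: keys_add_nat)
  also have "\<dots> = monom_deg a + monom_deg b"
    by (subst (1 2) monom_deg_eq_sum[of ?A]) (auto simp: lookup_add sum.distrib)
  finally show ?thesis .
qed

lemma monom_deg_zero [simp]: "monom_deg 0 = 0" by (simp add: monom_deg_def)
lemma monom_deg_single [simp]: "monom_deg (Poly_Mapping.single i k) = k" by (simp add: monom_deg_def)

lemma finite_monomials: "finite {a \<in> exps n. int (monom_deg a) = d}"
proof (rule finite_subset[OF _ finite_box[of n "Suc (nat d)"]], rule subsetI)
  fix m assume "m \<in> {m \<in> exps n. int (monom_deg m) = d}"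
  then have m: "m \<in> exps n" "int (monom_deg m) = d" by auto
  have "Poly_Mapping.lookup m i \<le> nat d" if "i < n" for i
  proof -
    have "Poly_Mapping.lookup m i \<le> monom_deg m"
      unfolding monom_deg_exps[OF m(1)] using that by (intro member_le_sum) auto
    then show ?thesis using m(2) by linarith
  qed
  then show "m \<in> box n (Suc (nat d))" using m by (simp add: box_def less_Suc_eq_le)
qed

lemma homog_in_poly_ring: "f \<in> homog n d \<Longrightarrow> f \<in> carrier (poly_ring n)" by (simp add: homog_def)

lemma homog_zero [simp]: "0 \<in> homog n d" by (simp add: homog_def)
lemma homog_one [simp]: "1 \<in> homog n 0" by (simp add: homog_def)

lemma homog_single: "a \<in> exps n \<Longrightarrow> Poly_Mapping.single a c \<in> homog n (int (monom_deg a))"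
  by (auto simp: homog_def)

lemma homog_xpow: "a \<in> exps n \<Longrightarrow> xpow a \<in> homog n (int (monom_deg a))"
  by (auto simp: xpow_def homog_single)

lemma homog_pconst: "pconst c \<in> homog n 0"
  using homog_single[of 0 n c] by (simp add: pconst_def)

lemma homog_add: "f \<in> homog n d \<Longrightarrow> g \<in> homog n d \<Longrightarrow> f + g \<in> homog n d"
  using Poly_Mapping.keys_add[of f g] by (auto simp: homog_def)

lemma homog_mult: "f \<in> homog n d \<Longrightarrow> g \<in> homog n e \<Longrightarrow> f * g \<in> homog n (d + e)"
  using Poly_Mapping.keys_mult[of f g] by (fastforce simp: homog_def monom_deg_add)

lemma homog_power: "f \<in> homog n d \<Longrightarrow> f ^ k \<in> homog n (int k * d)"
proof (induction k)
  case (Suc k)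
  from homog_mult[OF Suc.prems Suc.IH[OF Suc.prems]] show ?case by (simp add: algebra_simps)
qed simp

lemma homog_prod: "finite A \<Longrightarrow> (\<And>i. i \<in> A \<Longrightarrow> f i \<in> homog n (d i)) \<Longrightarrow> prod f A \<in> homog n (sum d A)"
  by (induction A rule: finite_induct) (auto simp: homog_mult)

lemma ex_key: "f \<noteq> 0 \<Longrightarrow> \<exists>a. a \<in> Poly_Mapping.keys f"
  by (metis in_keys_iff lookup_zero poly_mapping_eqI)

lemma homog_unique: "f \<in> homog n d \<Longrightarrow> f \<in> homog n e \<Longrightarrow> f \<noteq> 0 \<Longrightarrow> d = e"
proof -
  assume *: "f \<in> homog n d" "f \<in> homog n e" "f \<noteq> 0"
  then obtain a where "a \<in> Poly_Mapping.keys f" by (metis ex_key)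
  then show ?thesis using * by (auto simp: homog_def)
qed

section \<open>Frobenius powers and the subring of polynomials in the q-th powers of the
  variables\<close>

definition expscale :: "nat \<Rightarrow> (nat \<Rightarrow>\<^sub>0 nat) \<Rightarrow> (nat \<Rightarrow>\<^sub>0 nat)" where
  "expscale k a = Poly_Mapping.map ((*) k) a"

lemma lookup_expscale [simp]: "Poly_Mapping.lookup (expscale k a) i = k * Poly_Mapping.lookup a i"
  by (simp add: expscale_def Poly_Mapping.map.rep_eq when_def)

lemma single_power: "Poly_Mapping.single a c ^ k = Poly_Mapping.single (expscale k a) (c ^ k)"
proof (induction k)
  case 0
  have "expscale 0 a = 0" by (rule poly_mapping_eqI) simp
  then show ?case by simp
next
  case (Suc k)
  have "expscale (Suc k) a = a + expscale k a" by (rule poly_mapping_eqI) (simp add: lookup_add)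
  then show ?case using Suc by (simp add: mult_single)
qed

lemma xpow_power: "xpow a ^ k = xpow (expscale k a)"
  by (simp add: xpow_def single_power)

lemma exps_expscale [intro]: "a \<in> exps n \<Longrightarrow> expscale k a \<in> exps n"
  by (simp add: exps_iff)

lemma monom_deg_expscale: "a \<in> exps n \<Longrightarrow> monom_deg (expscale k a) = k * monom_deg a"
  by (simp add: monom_deg_exps[OF exps_expscale] monom_deg_exps sum_distrib_left)

text \<open>The coefficients are arbitrary elements of \<open>k\<close>, not q-th powers. Hence
  constants belong to this ring, and coefficient modules are vector spaces over \<open>k\<close>
  even when \<open>k\<close> is not perfect.\<close>

definition frob_polys :: "nat \<Rightarrow> nat \<Rightarrow> 'k::field mpoly set" where
  "frob_polys n q = {r \<in> carrier (poly_ring n).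
     \<forall>a\<in>Poly_Mapping.keys r. \<forall>i. q dvd Poly_Mapping.lookup a i}"

text \<open>Each variable is bounded separately, instead of the total degree, to fit the
  coordinatewise division of exponents by \<open>q\<close>. The bound is strict, so
  \<open>bounded_polys n (Suc d)\<close> means exponents at most \<open>d\<close>.\<close>

definition bounded_polys :: "nat \<Rightarrow> nat \<Rightarrow> 'k::field mpoly set" where
  "bounded_polys n m = {r. Poly_Mapping.keys r \<subseteq> box n m}"

lemma frob_polys_1: "frob_polys n (Suc 0) = carrier (poly_ring n)"
  by (auto simp: frob_polys_def)

lemma frob_polysD: "r \<in> frob_polys n q \<Longrightarrow> r \<in> carrier (poly_ring n)"
  by (simp add: frob_polys_def)

lemma frob_polys_pconst: "pconst c \<in> frob_polys n q"
  by (auto simp: frob_polys_def pconst_def)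

lemma frob_polys_xpow: "a \<in> exps n \<Longrightarrow> xpow (expscale q a) \<in> frob_polys n q"
  by (auto simp: frob_polys_def xpow_def exps_expscale)

lemma frob_polys_add: "f \<in> frob_polys n q \<Longrightarrow> g \<in> frob_polys n q \<Longrightarrow> f + g \<in> frob_polys n q"
  using Poly_Mapping.keys_add[of f g] by (auto simp: frob_polys_def)

lemma frob_polys_mult: "f \<in> frob_polys n q \<Longrightarrow> g \<in> frob_polys n q \<Longrightarrow> f * g \<in> frob_polys n q"
  using Poly_Mapping.keys_mult[of f g] by (fastforce simp: frob_polys_def lookup_add)

lemma frob_polys_power: "f \<in> frob_polys n q \<Longrightarrow> f ^ k \<in> frob_polys n q"
  by (induction k) (use frob_polys_pconst[of 1 n q] in \<open>auto simp: frob_polys_mult\<close>)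

text \<open>Transfers the prime characteristic to the polynomial ring, where (f + g)^q = f^q + g^q
  is applied.\<close>

lemma CHAR_mpoly: "CHAR('k::field mpoly) = CHAR('k)"
proof (rule CHAR_eqI)
  show "of_nat CHAR('k) = (0 :: 'k mpoly)"
    by (simp flip: single_of_nat)
  show "CHAR('k) dvd n" if "of_nat n = (0 :: 'k mpoly)" for n
  proof -
    have "Poly_Mapping.single 0 (of_nat n :: 'k) = (0 :: 'k mpoly)" using that by simp
    then have "Poly_Mapping.lookup (Poly_Mapping.single (0 :: nat \<Rightarrow>\<^sub>0 nat) (of_nat n :: 'k)) 0
        = Poly_Mapping.lookup (0 :: 'k mpoly) 0" by (simp only:)
    then have "(of_nat n :: 'k) = 0" unfolding lookup_single_eq lookup_zero .
    then show ?thesis by (simp add: of_nat_eq_0_iff_char_dvd)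
  qed
qed

lemma frobenius_add:
  assumes "CHAR('k::field) = p" "p > 0"
  shows "(f + g :: 'k mpoly) ^ (p ^ e) = f ^ (p ^ e) + g ^ (p ^ e)"
proof -
  have "prime CHAR('k)" using assms prime_CHAR_semidom[where ?'a = 'k] by simp
  then show ?thesis using freshmans_dream'[where ?'a = "'k mpoly" and m = "p ^ e"] assms
    by (simp add: CHAR_mpoly)
qed

text \<open>Raising to the power q = p^e is additive, which reduces the claim to a single term c
  x^a, whose power is c^q x^(q a).\<close>

lemma frobenius_power_in_frob_polys:
  fixes f :: "'k::field mpoly"
  assumes "CHAR('k) = p" "p > 0" and f: "f \<in> carrier (poly_ring n)"
  shows "f ^ (p ^ e) \<in> frob_polys n (p ^ e)"
proof (rule poly_keys_induct[of _ f])
  have "p ^ e > 0" using assms by simp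
  then show "0 ^ p ^ e \<in> frob_polys n (p ^ e)"
    by (simp add: frob_polys_def zero_power)
next
  fix a :: "nat \<Rightarrow>\<^sub>0 nat" and c :: 'k and g :: "'k mpoly"
  assume "a \<in> Poly_Mapping.keys f" and g: "g ^ p ^ e \<in> frob_polys n (p ^ e)"
  then have "a \<in> exps n" using f keys_poly_ring by blast
  then have "Poly_Mapping.single a c ^ (p ^ e) \<in> frob_polys n (p ^ e)"
    unfolding single_power by (simp add: frob_polys_def exps_expscale single_in_poly_ring)
  then show "(Poly_Mapping.single a c + g) ^ p ^ e \<in> frob_polys n (p ^ e)"
    using g by (simp add: frobenius_add[OF assms(1,2)] frob_polys_add)
qed

section \<open>Exponent bounds and division of exponents by q\<close>

lemma bounded_polysD: "r \<in> bounded_polys n m \<Longrightarrow> r \<in> carrier (poly_ring n)"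
  by (auto simp: bounded_polys_def in_poly_ring_iff box_def exps_def)

lemma box_mono: "m \<le> m' \<Longrightarrow> box n m \<subseteq> box n m'"
  by (fastforce simp: box_def)

lemma bounded_polys_mono: "m \<le> m' \<Longrightarrow> bounded_polys n m \<subseteq> bounded_polys n m'"
  using box_mono[of m m' n] by (auto simp: bounded_polys_def)

lemma bounded_polys_mult:
  assumes "f \<in> bounded_polys n m" "g \<in> bounded_polys n (Suc d)"
  shows "f * g \<in> bounded_polys n (m + d)"
proof -
  have "a + b \<in> box n (m + d)" if "a \<in> box n m" "b \<in> box n (Suc d)" for a b
    using that by (fastforce simp: box_def exps_add lookup_add)
  then show ?thesis using assms Poly_Mapping.keys_mult[of f g] unfolding bounded_polys_def by blast
qed

lemma bounded_polys_mult_power: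
  assumes "r \<in> bounded_polys n m" "f \<in> bounded_polys n (Suc d)"
  shows "f ^ k * r \<in> bounded_polys n (m + k * d)"
proof (induction k)
  case (Suc k)
  from bounded_polys_mult[OF this assms(2)] show ?case by (simp add: algebra_simps)
qed (use assms in simp)

lemma ex_box: "finite A \<Longrightarrow> A \<subseteq> exps n \<Longrightarrow> \<exists>m. A \<subseteq> box n m"
proof (induction A rule: finite_induct)
  case (insert a A)
  then obtain m where m: "A \<subseteq> box n m" by auto
  let ?m = "Suc (\<Sum>i<n. Poly_Mapping.lookup a i)"
  have "a \<in> box n ?m"
    using insert.prems by (auto simp: box_def less_Suc_eq_le intro: member_le_sum)
  then have "insert a A \<subseteq> box n (m + ?m)"
    using m box_mono[of m "m + ?m" n] box_mono[of ?m "m + ?m" n] by auto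
  then show ?case by blast
qed auto

lemma ex_bounded_polys:
  assumes "f \<in> carrier (poly_ring n)" shows "\<exists>m. f \<in> bounded_polys n (Suc m)"
proof -
  obtain m where "Poly_Mapping.keys f \<subseteq> box n m"
    using ex_box[of "Poly_Mapping.keys f" n] keys_poly_ring[OF assms] by auto
  then show ?thesis using box_mono[of m "Suc m" n] by (auto simp: bounded_polys_def)
qed

text \<open>Coordinatewise division with remainder. The last clause turns an exponent bound
  \<open>L * q\<close> into the bound \<open>L\<close> for the quotient; this is where
  \<open>q\<close> disappears from the dimension estimates.\<close>

lemma exps_divmod:
  assumes "b \<in> exps n" "q > 0"
  obtains a h where "a \<in> box n q" "h \<in> exps n" "b = a + expscale q h"
    "\<And>L. b \<in> box n (L * q) \<Longrightarrow> h \<in> box n L"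
proof -
  define a where "a = Poly_Mapping.map (\<lambda>x. x mod q) b"
  define h where "h = Poly_Mapping.map (\<lambda>x. x div q) b"
  have la: "Poly_Mapping.lookup a i = Poly_Mapping.lookup b i mod q"
    and lh: "Poly_Mapping.lookup h i = Poly_Mapping.lookup b i div q" for i
    by (simp_all add: a_def h_def Poly_Mapping.map.rep_eq when_def)
  have 1: "a \<in> box n q" "h \<in> exps n" using assms by (auto simp: box_def exps_iff la lh)
  moreover have "b = a + expscale q h" by (rule poly_mapping_eqI) (simp add: lookup_add la lh)
  moreover have "h \<in> box n L" if "b \<in> box n (L * q)" for L
    using that 1 assms(2) by (simp add: box_def lh div_less_iff_less_mult)
  ultimately show thesis by (rule that)
qed

section \<open>Modules over the polynomial ring\<close>

locale pmodule =
  fixes n :: nat and M :: "('k::field mpoly, 'b) gmod" (structure)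
  assumes is_module: "module (poly_ring n) M"

sublocale pmodule \<subseteq> module "poly_ring n" M
  by (rule is_module)

text \<open>Additive inverses come from the action of -1 together with
  \<open>0 \<odot> x = \<zero>\<close>, so none has to be exhibited for localizations, direct sums
  and quotients.\<close>

lemma pmoduleI:
  fixes M :: "('k::field mpoly, 'b) gmod" (structure)
  assumes zero: "\<zero> \<in> carrier M"
    and closed: "\<And>x y. x \<in> carrier M \<Longrightarrow> y \<in> carrier M \<Longrightarrow> x \<oplus> y \<in> carrier M"
    and assoc: "\<And>x y z. x \<in> carrier M \<Longrightarrow> y \<in> carrier M \<Longrightarrow> z \<in> carrier M \<Longrightarrow>
        (x \<oplus> y) \<oplus> z = x \<oplus> (y \<oplus> z)"
    and comm: "\<And>x y. x \<in> carrier M \<Longrightarrow> y \<in> carrier M \<Longrightarrow> x \<oplus> y = y \<oplus> x"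
    and l_zero: "\<And>x. x \<in> carrier M \<Longrightarrow> \<zero> \<oplus> x = x"
    and sm: "\<And>a x. a \<in> carrier (poly_ring n) \<Longrightarrow> x \<in> carrier M \<Longrightarrow> a \<odot> x \<in> carrier M"
    and sm_l: "\<And>a b x. a \<in> carrier (poly_ring n) \<Longrightarrow> b \<in> carrier (poly_ring n) \<Longrightarrow> x \<in> carrier M \<Longrightarrow>
        (a + b) \<odot> x = a \<odot> x \<oplus> b \<odot> x"
    and sm_r: "\<And>a x y. a \<in> carrier (poly_ring n) \<Longrightarrow> x \<in> carrier M \<Longrightarrow> y \<in> carrier M \<Longrightarrow>
        a \<odot> (x \<oplus> y) = a \<odot> x \<oplus> a \<odot> y"
    and sm_m: "\<And>a b x. a \<in> carrier (poly_ring n) \<Longrightarrow> b \<in> carrier (poly_ring n) \<Longrightarrow> x \<in> carrier M \<Longrightarrow>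
        (a * b) \<odot> x = a \<odot> (b \<odot> x)"
    and sm_1: "\<And>x. x \<in> carrier M \<Longrightarrow> 1 \<odot> x = x"
    and sm_0: "\<And>x. x \<in> carrier M \<Longrightarrow> 0 \<odot> x = \<zero>"
  shows "pmodule n M"
proof (rule pmodule.intro)
  show "module (poly_ring n) M"
  proof (rule moduleI)
    show "abelian_group M"
    proof (rule abelian_groupI)
      fix x assume x: "x \<in> carrier M"
      have "(- 1) \<odot> x \<oplus> x = ((- 1) + 1) \<odot> x"
        by (subst sm_l) (use x in \<open>auto simp: sm_1\<close>)
      then show "\<exists>y\<in>carrier M. y \<oplus> x = \<zero>"
        using x by (intro bexI[of _ "(- 1) \<odot> x"] sm) (auto simp: sm_0)
    qed (use assms in auto)
  qed (use assms cring_poly_ring in auto)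
qed

context pmodule
begin

lemma sm_add_left: "a \<in> carrier (poly_ring n) \<Longrightarrow> b \<in> carrier (poly_ring n) \<Longrightarrow> x \<in> carrier M \<Longrightarrow>
    (a + b) \<odot> x = a \<odot> x \<oplus> b \<odot> x"
  using smult_l_distr[of a b x] by simp

lemma sm_mult: "a \<in> carrier (poly_ring n) \<Longrightarrow> b \<in> carrier (poly_ring n) \<Longrightarrow> x \<in> carrier M \<Longrightarrow>
    (a * b) \<odot> x = a \<odot> (b \<odot> x)"
  using smult_assoc1[of a b x] by simp

lemma sm_one [simp]: "x \<in> carrier M \<Longrightarrow> 1 \<odot> x = x"
  using smult_one[of x] by simp

lemma sm_zero [simp]: "x \<in> carrier M \<Longrightarrow> 0 \<odot> x = \<zero>"
  using smult_l_null[of x] by simp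

lemma sm_commute: "a \<in> carrier (poly_ring n) \<Longrightarrow> b \<in> carrier (poly_ring n) \<Longrightarrow> x \<in> carrier M \<Longrightarrow>
    a \<odot> (b \<odot> x) = b \<odot> (a \<odot> x)"
  by (metis mult.commute sm_mult)

lemma sm_uminus_one: "x \<in> carrier M \<Longrightarrow> (- 1) \<odot> x = \<ominus> x"
proof -
  assume x: "x \<in> carrier M"
  have "(- 1) \<odot> x \<oplus> x = ((- 1) + 1) \<odot> x"
    by (subst sm_add_left) (use x in auto)
  then have "(- 1) \<odot> x \<oplus> x = \<zero>" using x by simp
  then show ?thesis using x M.minus_equality[of "(- 1) \<odot> x" x] by simp
qed

lemma sm_uminus: "a \<in> carrier (poly_ring n) \<Longrightarrow> x \<in> carrier M \<Longrightarrow> (- a) \<odot> x = \<ominus> (a \<odot> x)"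
  using sm_mult[of "- 1" a x] by (simp add: sm_uminus_one)

lemma minus_eq_zero_iff: "x \<in> carrier M \<Longrightarrow> y \<in> carrier M \<Longrightarrow> x \<ominus> y = \<zero> \<longleftrightarrow> x = y"
proof -
  assume x: "x \<in> carrier M" "y \<in> carrier M"
  have "x = y" if "x \<ominus> y = \<zero>"
  proof -
    have "x = (x \<ominus> y) \<oplus> y" using x by (simp add: a_minus_def M.a_assoc M.l_neg)
    then show ?thesis using that x by simp
  qed
  then show ?thesis using x by (auto simp: a_minus_def M.r_neg)
qed

end

definition submod :: "nat \<Rightarrow> ('k::field mpoly, 'b) gmod \<Rightarrow> 'b set \<Rightarrow> bool" where
  "submod n M Z \<longleftrightarrow> Z \<subseteq> carrier M \<and> \<zero>\<^bsub>M\<^esub> \<in> Z \<and> (\<forall>x\<in>Z. \<forall>y\<in>Z. x \<oplus>\<^bsub>M\<^esub> y \<in> Z) \<and>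
     (\<forall>a\<in>carrier (poly_ring n). \<forall>x\<in>Z. a \<odot>\<^bsub>M\<^esub> x \<in> Z)"

definition kspace :: "('k::field mpoly, 'b) gmod \<Rightarrow> 'b set \<Rightarrow> bool" where
  "kspace M U \<longleftrightarrow> U \<subseteq> carrier M \<and> \<zero>\<^bsub>M\<^esub> \<in> U \<and> (\<forall>x\<in>U. \<forall>y\<in>U. x \<oplus>\<^bsub>M\<^esub> y \<in> U) \<and>
     (\<forall>c. \<forall>x\<in>U. pconst c \<odot>\<^bsub>M\<^esub> x \<in> U)"

lemma kspaceD:
  assumes "kspace M U"
  shows "U \<subseteq> carrier M" "x \<in> U \<Longrightarrow> x \<in> carrier M" "\<zero>\<^bsub>M\<^esub> \<in> U" "x \<in> U \<Longrightarrow> y \<in> U \<Longrightarrow> x \<oplus>\<^bsub>M\<^esub> y \<in> U"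
    "x \<in> U \<Longrightarrow> pconst c \<odot>\<^bsub>M\<^esub> x \<in> U"
  using assms by (auto simp: kspace_def)

lemma submodD:
  assumes "submod n M U"
  shows "U \<subseteq> carrier M" "x \<in> U \<Longrightarrow> x \<in> carrier M" "\<zero>\<^bsub>M\<^esub> \<in> U" "x \<in> U \<Longrightarrow> y \<in> U \<Longrightarrow> x \<oplus>\<^bsub>M\<^esub> y \<in> U"
    "a \<in> carrier (poly_ring n) \<Longrightarrow> x \<in> U \<Longrightarrow> a \<odot>\<^bsub>M\<^esub> x \<in> U"
  using assms by (auto simp: submod_def)

lemma submod_kspace: "submod n M U \<Longrightarrow> kspace M U"
  by (auto simp: submod_def kspace_def)

lemma (in pmodule) submod_carrier: "submod n M (carrier M)"
  by (auto simp: submod_def)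

lemma (in pmodule) kspace_uminus: "kspace M U \<Longrightarrow> x \<in> U \<Longrightarrow> \<ominus> x \<in> U"
  using kspaceD(5)[of M U x "- 1"] kspaceD(2)[of M U x] by (simp add: pconst_uminus sm_uminus_one)

lemma (in pmodule) kspace_minus: "kspace M U \<Longrightarrow> x \<in> U \<Longrightarrow> y \<in> U \<Longrightarrow> x \<ominus> y \<in> U"
  by (simp add: a_minus_def kspace_uminus kspaceD)

text \<open>Finite sums with repetition, without an index set or coefficients, so that statements
  about generation become inductions. Depending on the set this is a k-span, a sum of pieces x^a N,
  or a span over bounded polynomials.\<close>

inductive_set asum :: "('b, 'm) ring_scheme \<Rightarrow> 'b set \<Rightarrow> 'b set"
  for M :: "('b, 'm) ring_scheme" and X :: "'b set" where
  asum_zero: "\<zero>\<^bsub>M\<^esub> \<in> asum M X"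
| asum_step: "x \<in> X \<Longrightarrow> s \<in> asum M X \<Longrightarrow> x \<oplus>\<^bsub>M\<^esub> s \<in> asum M X"

lemma asum_mono: "x \<in> asum M X \<Longrightarrow> X \<subseteq> Y \<Longrightarrow> x \<in> asum M Y"
  by (induction rule: asum.induct) (auto intro: asum.intros)

context pmodule
begin

lemma asum_in_carrier: "x \<in> asum M X \<Longrightarrow> X \<subseteq> carrier M \<Longrightarrow> x \<in> carrier M"
  by (induction rule: asum.induct) auto

lemma asum_base: "x \<in> X \<Longrightarrow> X \<subseteq> carrier M \<Longrightarrow> x \<in> asum M X"
  using asum_step[of x X "\<zero>" M] asum_zero[of M X] by auto

lemma asum_add:
  assumes "x \<in> asum M X" "y \<in> asum M X" "X \<subseteq> carrier M"
  shows "x \<oplus> y \<in> asum M X"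
  using assms
proof (induction rule: asum.induct)
  case asum_zero
  then show ?case using asum_in_carrier by simp
next
  case (asum_step x s)
  then have "(x \<oplus> s) \<oplus> y = x \<oplus> (s \<oplus> y)"
    using asum_in_carrier[of s] asum_in_carrier[of y] by (intro M.a_assoc) auto
  then show ?case using asum_step by (auto intro: asum.asum_step)
qed

lemma asum_subset_kspace: "x \<in> asum M X \<Longrightarrow> X \<subseteq> U \<Longrightarrow> kspace M U \<Longrightarrow> x \<in> U"
  by (induction rule: asum.induct) (auto simp: kspaceD)

lemma asum_finsum:
  assumes "finite A" "\<And>i. i \<in> A \<Longrightarrow> f i \<in> asum M X" "X \<subseteq> carrier M"
  shows "(\<Oplus>i\<in>A. f i) \<in> asum M X"
  using assms(1,2)
proof (induction A rule: finite_induct)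
  case (insert a A)
  then have "f \<in> A \<rightarrow> carrier M" "f a \<in> carrier M" using asum_in_carrier assms(3) by auto
  then show ?case using insert assms(3) by (simp add: asum_add)
qed (simp add: asum_zero)

end

text \<open>Additivity of the map suffices, and a generator may go to a sum of generators. So one
  lemma serves multiplication by a fixed polynomial, passage to fractions with a fixed denominator,
  and the inclusion of a summand.\<close>

lemma asum_map:
  fixes M :: "('k::field mpoly, 'b) gmod" and M' :: "('k mpoly, 'c) gmod"
  assumes M: "pmodule n M" and M': "pmodule n M'"
    and X: "X \<subseteq> carrier M" and Y: "Y \<subseteq> carrier M'"
    and zero: "\<phi> \<zero>\<^bsub>M\<^esub> = \<zero>\<^bsub>M'\<^esub>"
    and add: "\<And>x y. x \<in> carrier M \<Longrightarrow> y \<in> carrier M \<Longrightarrow> \<phi> (x \<oplus>\<^bsub>M\<^esub> y) = \<phi> x \<oplus>\<^bsub>M'\<^esub> \<phi> y"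
    and gen: "\<And>x. x \<in> X \<Longrightarrow> \<phi> x \<in> asum M' Y"
    and x: "x \<in> asum M X"
  shows "\<phi> x \<in> asum M' Y"
  using x
proof (induction rule: asum.induct)
  case asum_zero
  then show ?case by (simp add: zero asum.asum_zero)
next
  case (asum_step x s)
  moreover have "s \<in> carrier M" "x \<in> carrier M"
    using pmodule.asum_in_carrier[OF M asum_step(2) X] asum_step(1) X by auto
  ultimately show ?case using pmodule.asum_add[OF M'] Y gen by (simp add: add)
qed

section \<open>Frobenius descent\<close>

text \<open>
  \<open>N d\<close> is the part of degree \<open>q * d\<close> of a module over the polynomials in the \<open>x\<^sub>i\<^sup>q\<close>, and \<open>\<kappa> a d\<close> extracts
  the component in \<open>N d\<close> of the coefficient at \<open>x\<^sup>a\<close>. For \<open>q = 1\<close> this is just a grading.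
\<close>

locale frob_level = pmodule n M for n :: nat and M :: "('k::field mpoly, 'b) gmod" (structure) +
  fixes q :: nat and N :: "int \<Rightarrow> 'b set" and \<kappa> :: "(nat \<Rightarrow>\<^sub>0 nat) \<Rightarrow> int \<Rightarrow> 'b \<Rightarrow> 'b"
  assumes q_pos: "q > 0"
    and kspace_N: "kspace M (N d)"
    and kap_in: "a \<in> box n q \<Longrightarrow> x \<in> carrier M \<Longrightarrow> \<kappa> a d x \<in> N d"
    and kap_add: "a \<in> box n q \<Longrightarrow> x \<in> carrier M \<Longrightarrow> y \<in> carrier M \<Longrightarrow>
        \<kappa> a d (x \<oplus> y) = \<kappa> a d x \<oplus> \<kappa> a d y"
    and kap_xpow: "a \<in> box n q \<Longrightarrow> a' \<in> box n q \<Longrightarrow> u \<in> N d' \<Longrightarrow>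
        \<kappa> a d (xpow a' \<odot> u) = (if a = a' \<and> d = d' then u else \<zero>)"
    and generate: "carrier M \<subseteq> asum M {xpow a \<odot> u |a u d. a \<in> box n q \<and> u \<in> N d}"
    and N_hcomp: "N d \<subseteq> hcomp M (int q * d)"
    and N_smult: "r \<in> frob_polys n q \<Longrightarrow> r \<in> homog n (int q * c) \<Longrightarrow> u \<in> N d \<Longrightarrow> r \<odot> u \<in> N (d + c)"

lemma (in pmodule) additive_zero:
  assumes "pmodule n M'" "\<phi> \<in> carrier M \<rightarrow> carrier M'"
    and "\<And>x y. x \<in> carrier M \<Longrightarrow> y \<in> carrier M \<Longrightarrow> \<phi> (x \<oplus> y) = \<phi> x \<oplus>\<^bsub>M'\<^esub> \<phi> y"
  shows "\<phi> \<zero> = \<zero>\<^bsub>M'\<^esub>"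
proof -
  interpret M': pmodule n M' by fact
  have "\<phi> \<zero> \<in> carrier M'" using assms(2) by auto
  moreover have "\<phi> \<zero> = \<phi> \<zero> \<oplus>\<^bsub>M'\<^esub> \<phi> \<zero>" using assms(3)[of "\<zero>" "\<zero>"] by simp
  ultimately show ?thesis by simp
qed

context frob_level
begin

lemma N_carrier: "u \<in> N d \<Longrightarrow> u \<in> carrier M"
  using kspace_N kspaceD by blast

lemma kap_closed [simp]: "a \<in> box n q \<Longrightarrow> x \<in> carrier M \<Longrightarrow> \<kappa> a d x \<in> carrier M"
  using kap_in N_carrier by blast

lemma kap_zero: "a \<in> box n q \<Longrightarrow> \<kappa> a d \<zero> = \<zero>"
  by (rule additive_zero[of M]) (auto simp: kap_add pmodule_axioms)

lemma xpow_box [simp, intro]: "a \<in> box n q \<Longrightarrow> xpow a \<in> carrier (poly_ring n)"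
  by (intro xpow_in_poly_ring boxD)

lemma gens_carrier: "{xpow a \<odot> u |a u d. a \<in> box n q \<and> u \<in> N d} \<subseteq> carrier M"
  using N_carrier by (auto intro!: smult_closed xpow_in_poly_ring boxD)

text \<open>Additive statements about coefficients need only be checked on elements x^a u with
  \<open>u\<close> in one piece of \<open>N\<close>, where \<open>kap_xpow\<close> computes every
  coefficient.\<close>

lemma generate_induct [consumes 1, case_names zero add]:
  assumes "x \<in> carrier M" "Q \<zero>"
    and "\<And>a u d s. a \<in> box n q \<Longrightarrow> u \<in> N d \<Longrightarrow> xpow a \<odot> u \<in> carrier M \<Longrightarrow> s \<in> carrier M \<Longrightarrow> Q s
         \<Longrightarrow> Q (xpow a \<odot> u \<oplus> s)"
  shows "Q x"
proof -
  have "x \<in> asum M {xpow a \<odot> u |a u d. a \<in> box n q \<and> u \<in> N d}" using assms(1) generate by auto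
  then have "x \<in> carrier M \<and> Q x"
  proof (induction rule: asum.induct)
    case (asum_step x s)
    then obtain a u d where x: "x = xpow a \<odot> u" "a \<in> box n q" "u \<in> N d" by auto
    then have "x \<in> carrier M" using N_carrier by (auto intro!: smult_closed xpow_in_poly_ring boxD)
    then show ?case using asum_step x assms(3)[of a u d s] by auto
  qed (use assms in auto)
  then show ?thesis by simp
qed

text \<open>Coefficients are unique, so a map that commutes with the basis monomials and carries
  \<open>N\<close> to \<open>N'\<close> carries coefficients to coefficients; \<open>c\<close> is
  the shift of the degree index. It is applied to multiplication by an element of R^(q) and, with c
  = 0, to the Cech differential.\<close>

lemma kap_commute:
  assumes M': "frob_level n M' q N' \<kappa>'"
    and \<phi>: "\<phi> \<in> carrier M \<rightarrow> carrier M'"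
    and add: "\<And>x y. x \<in> carrier M \<Longrightarrow> y \<in> carrier M \<Longrightarrow> \<phi> (x \<oplus> y) = \<phi> x \<oplus>\<^bsub>M'\<^esub> \<phi> y"
    and xp: "\<And>a u. a \<in> box n q \<Longrightarrow> u \<in> carrier M \<Longrightarrow> \<phi> (xpow a \<odot> u) = xpow a \<odot>\<^bsub>M'\<^esub> \<phi> u"
    and N: "\<And>d u. u \<in> N d \<Longrightarrow> \<phi> u \<in> N' (d + c)"
    and a: "a \<in> box n q" and x: "x \<in> carrier M"
  shows "\<kappa>' a (d + c) (\<phi> x) = \<phi> (\<kappa> a d x)"
proof -
  interpret M': frob_level n M' q N' \<kappa>' by fact
  have \<phi>0: "\<phi> \<zero> = \<zero>\<^bsub>M'\<^esub>" using additive_zero[OF M'.pmodule_axioms \<phi> add] .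
  from x show ?thesis
  proof (induction rule: generate_induct)
    case zero
    then show ?case using a by (simp add: \<phi>0 kap_zero M'.kap_zero)
  next
    case (add a' u d' s)
    have u: "u \<in> carrier M" using add N_carrier by blast
    have c: "\<phi> (xpow a' \<odot> u) \<in> carrier M'" "\<phi> s \<in> carrier M'" using \<phi> add by auto
    have "\<kappa>' a (d + c) (\<phi> (xpow a' \<odot> u)) = \<phi> (\<kappa> a d (xpow a' \<odot> u))"
      using add a u by (simp add: xp kap_xpow M'.kap_xpow[OF _ _ N] \<phi>0)
    then show ?case using add a c
      by (simp add: assms(3) M'.kap_add kap_add)
  qed
qed

lemma kap_smult:
  assumes "r \<in> frob_polys n q" "r \<in> homog n (int q * c)" "a \<in> box n q" "x \<in> carrier M"
  shows "\<kappa> a (d + c) (r \<odot> x) = r \<odot> \<kappa> a d x"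
proof (rule kap_commute[OF frob_level_axioms])
  have r: "r \<in> carrier (poly_ring n)" using assms frob_polysD by blast
  then show "(\<odot>) r \<in> carrier M \<rightarrow> carrier M" by auto
  show "r \<odot> (x \<oplus> y) = r \<odot> x \<oplus> r \<odot> y" if "x \<in> carrier M" "y \<in> carrier M" for x y
    using that r by (simp add: smult_r_distr)
  show "r \<odot> (xpow a \<odot> u) = xpow a \<odot> (r \<odot> u)" if "a \<in> box n q" "u \<in> carrier M" for a u
    using that r by (intro sm_commute xpow_in_poly_ring boxD) auto
  show "r \<odot> u \<in> N (d + c)" if "u \<in> N d" for u d
    using N_smult assms that by simp
qed (use assms in auto)

lemma kap_pconst:
  assumes "a \<in> box n q" "x \<in> carrier M"
  shows "\<kappa> a d (pconst c \<odot> x) = pconst c \<odot> \<kappa> a d x"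
  using kap_smult[of "pconst c" 0 a x d] frob_polys_pconst[of c n q] homog_pconst[of c n] assms by simp

lemma kap_uminus: "a \<in> box n q \<Longrightarrow> x \<in> carrier M \<Longrightarrow> \<kappa> a d (\<ominus> x) = \<ominus> \<kappa> a d x"
  using kap_pconst[of a x d "- 1"] by (simp add: pconst_uminus sm_uminus_one)

lemma kap_minus: "a \<in> box n q \<Longrightarrow> x \<in> carrier M \<Longrightarrow> y \<in> carrier M \<Longrightarrow>
    \<kappa> a d (x \<ominus> y) = \<kappa> a d x \<ominus> \<kappa> a d y"
  by (simp add: a_minus_def kap_add kap_uminus)

text \<open>Unlike \<open>generate\<close>, this expresses \<open>x\<close> through its own
  coefficients. It is what makes a submodule that is stable under \<kappa> inherit the
  decomposition.\<close>

lemma in_asum_kap: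
  assumes "x \<in> carrier M"
  shows "x \<in> asum M {xpow a \<odot> \<kappa> a d x |a d. a \<in> box n q}"
proof -
  let ?X = "\<lambda>x. {xpow a \<odot> \<kappa> a d x |a d. a \<in> box n q}"
  have car: "?X x \<subseteq> carrier M" if "x \<in> carrier M" for x
    using that by (auto intro!: smult_closed xpow_in_poly_ring boxD)
  \<comment> \<open>The expansion is asserted over every finite index set containing a suitable
    \<open>F\<close>: adding a summand enlarges the support, and the expansion of \<open>s\<close>
    must then be read over the larger set.\<close>
  have fin: "\<exists>F. finite F \<and> F \<subseteq> box n q \<times> UNIV \<and> (\<forall>G. finite G \<and> F \<subseteq> G \<and> G \<subseteq> box n q \<times> UNIV \<longrightarrow>
      x = (\<Oplus>j\<in>G. xpow (fst j) \<odot> \<kappa> (fst j) (snd j) x))" using assms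
  proof (induction rule: generate_induct)
    case zero
    have "(\<Oplus>j\<in>G. xpow (fst j) \<odot> \<kappa> (fst j) (snd j) \<zero>) = \<zero>" if "G \<subseteq> box n q \<times> UNIV" for G
      by (rule M.add.finprod_one_eqI)
         (use that in \<open>auto simp: kap_zero intro!: smult_r_null xpow_in_poly_ring boxD\<close>)
    then show ?case by (intro exI[of _ "{}"]) auto
  next
    case (add a u d s)
    from add.IH obtain F where F: "finite F" "F \<subseteq> box n q \<times> UNIV"
      "\<forall>G. finite G \<and> F \<subseteq> G \<and> G \<subseteq> box n q \<times> UNIV \<longrightarrow> s = (\<Oplus>j\<in>G. xpow (fst j) \<odot> \<kappa> (fst j) (snd j) s)"
      by (elim exE conjE)
    have "xpow a \<odot> u \<oplus> s = (\<Oplus>j\<in>G. xpow (fst j) \<odot> \<kappa> (fst j) (snd j) (xpow a \<odot> u \<oplus> s))"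
      if G: "finite G" "insert (a, d) F \<subseteq> G" "G \<subseteq> box n q \<times> UNIV" for G
    proof -
      have Gb: "fst j \<in> box n q" if "j \<in> G" for j using G(3) that by auto
      have adG: "(a, d) \<in> G" using G by auto
      have "(\<Oplus>j\<in>G. xpow (fst j) \<odot> \<kappa> (fst j) (snd j) (xpow a \<odot> u \<oplus> s)) =
            (\<Oplus>j\<in>G. (xpow (fst j) \<odot> \<kappa> (fst j) (snd j) (xpow a \<odot> u)) \<oplus>
                   (xpow (fst j) \<odot> \<kappa> (fst j) (snd j) s))"
        using Gb add(2,3,4)
        by (intro M.finsum_cong') (auto simp: kap_add smult_r_distr)
      also have "\<dots> = (\<Oplus>j\<in>G. (xpow (fst j) \<odot> \<kappa> (fst j) (snd j) (xpow a \<odot> u))) \<oplus>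
                   (\<Oplus>j\<in>G. (xpow (fst j) \<odot> \<kappa> (fst j) (snd j) s))"
        using Gb add(2,3,4)
        by (intro M.finsum_addf) auto
      also have "(\<Oplus>j\<in>G. (xpow (fst j) \<odot> \<kappa> (fst j) (snd j) s)) = s"
        using F(3) G by simp
      also have "(\<Oplus>j\<in>G. (xpow (fst j) \<odot> \<kappa> (fst j) (snd j) (xpow a \<odot> u))) =
           (\<Oplus>j\<in>G. if (a, d) = j then xpow a \<odot> u else \<zero>)"
        using Gb add(1,2,3) adG
        by (intro M.finsum_cong') (auto simp: kap_xpow)
      also have "\<dots> = xpow a \<odot> u"
        using G add by (intro M.finsum_singleton) auto
      finally show ?thesis by simp
    qed
    then show ?case using F add(1) by (intro exI[of _ "insert (a, d) F"]) auto
  qed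
  then obtain F where F: "finite F" "F \<subseteq> box n q \<times> UNIV"
    "x = (\<Oplus>j\<in>F. xpow (fst j) \<odot> \<kappa> (fst j) (snd j) x)" by blast
  have "(\<Oplus>j\<in>F. xpow (fst j) \<odot> \<kappa> (fst j) (snd j) x) \<in> asum M (?X x)"
  proof (rule asum_finsum[OF F(1) _ car[OF assms]], rule asum_base[OF _ car[OF assms]])
    fix j assume "j \<in> F"
    then have "fst j \<in> box n q" using F(2) by auto
    then show "xpow (fst j) \<odot> \<kappa> (fst j) (snd j) x \<in> ?X x" by blast
  qed
  then show ?thesis using F(3) by simp
qed

end

section \<open>Subquotients\<close>

text \<open>The map exhibits \<open>Q\<close> as a quotient of the submodule \<open>Z\<close>, with
  no mention of cosets. It covers the cohomology modules, which live on an arbitrary copy of a set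
  of cosets, and, with \<open>Z\<close> the whole module, the isomorphism constructed at the
  end.\<close>

definition presents ::
    "nat \<Rightarrow> ('k::field mpoly, 'b) gmod \<Rightarrow> 'b set \<Rightarrow> ('b \<Rightarrow> 'c) \<Rightarrow> ('k mpoly, 'c) gmod \<Rightarrow> bool" where
  "presents n M Z \<pi> Q \<longleftrightarrow> submod n M Z \<and> carrier Q = \<pi> ` Z \<and> \<zero>\<^bsub>Q\<^esub> = \<pi> \<zero>\<^bsub>M\<^esub> \<and>
     (\<forall>x\<in>Z. \<forall>y\<in>Z. \<pi> x \<oplus>\<^bsub>Q\<^esub> \<pi> y = \<pi> (x \<oplus>\<^bsub>M\<^esub> y)) \<and>
     (\<forall>a\<in>carrier (poly_ring n). \<forall>x\<in>Z. a \<odot>\<^bsub>Q\<^esub> \<pi> x = \<pi> (a \<odot>\<^bsub>M\<^esub> x)) \<and>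
     (\<forall>d. hcomp Q d = \<pi> ` (Z \<inter> hcomp M d))"

lemma presents_pmodule:
  assumes "pmodule n M" "presents n M Z \<pi> Q" shows "pmodule n Q"
proof -
  interpret pmodule n M by fact
  have Z: "submod n M Z" and Q: "carrier Q = \<pi> ` Z" "\<zero>\<^bsub>Q\<^esub> = \<pi> \<zero>\<^bsub>M\<^esub>"
    "\<And>x y. x \<in> Z \<Longrightarrow> y \<in> Z \<Longrightarrow> \<pi> x \<oplus>\<^bsub>Q\<^esub> \<pi> y = \<pi> (x \<oplus>\<^bsub>M\<^esub> y)"
    "\<And>a x. a \<in> carrier (poly_ring n) \<Longrightarrow> x \<in> Z \<Longrightarrow> a \<odot>\<^bsub>Q\<^esub> \<pi> x = \<pi> (a \<odot>\<^bsub>M\<^esub> x)"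
    using assms(2) by (auto simp: presents_def)
  note Zc = submodD[OF Z]
  show ?thesis
  proof (rule pmoduleI, unfold Q(1,2))
    show "\<pi> \<zero>\<^bsub>M\<^esub> \<in> \<pi> ` Z" using Zc by auto
  qed (auto simp: Q Zc M.a_assoc sm_add_left smult_r_distr sm_mult intro!: arg_cong[of _ _ \<pi>] M.a_comm)
qed

text \<open>If extraction of coefficients preserves both the submodule and the kernel, it descends
  to the quotient, and the images of the coefficient modules are again coefficient modules.\<close>

lemma (in frob_level) presents_frob_level:
  assumes pres: "presents n M Z \<pi> Q"
    and Z: "\<And>a d x. a \<in> box n q \<Longrightarrow> x \<in> Z \<Longrightarrow> \<kappa> a d x \<in> Z"
    and B: "\<And>a d x. a \<in> box n q \<Longrightarrow> x \<in> Z \<Longrightarrow> \<pi> x = \<zero>\<^bsub>Q\<^esub> \<Longrightarrow> \<pi> (\<kappa> a d x) = \<zero>\<^bsub>Q\<^esub>"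
  obtains \<kappa>' where "frob_level n Q q (\<lambda>d. \<pi> ` (Z \<inter> N d)) \<kappa>'"
    "\<And>a d x. a \<in> box n q \<Longrightarrow> x \<in> Z \<Longrightarrow> \<kappa>' a d (\<pi> x) = \<pi> (\<kappa> a d x)"
proof -
  have sub: "submod n M Z" and Q: "carrier Q = \<pi> ` Z" "\<zero>\<^bsub>Q\<^esub> = \<pi> \<zero>\<^bsub>M\<^esub>"
    "\<And>x y. x \<in> Z \<Longrightarrow> y \<in> Z \<Longrightarrow> \<pi> x \<oplus>\<^bsub>Q\<^esub> \<pi> y = \<pi> (x \<oplus>\<^bsub>M\<^esub> y)"
    "\<And>a x. a \<in> carrier (poly_ring n) \<Longrightarrow> x \<in> Z \<Longrightarrow> a \<odot>\<^bsub>Q\<^esub> \<pi> x = \<pi> (a \<odot>\<^bsub>M\<^esub> x)"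
    "\<And>d. hcomp Q d = \<pi> ` (Z \<inter> hcomp M d)"
    using pres by (auto simp: presents_def)
  note Zc = submodD[OF sub]
  interpret Q: pmodule n Q using presents_pmodule[OF pmodule_axioms pres] .
  have minus: "x \<ominus> y \<in> Z" if "x \<in> Z" "y \<in> Z" for x y
    using kspace_minus[OF submod_kspace[OF sub]] that .
  define \<kappa>' where "\<kappa>' = (\<lambda>a d y. \<pi> (\<kappa> a d (SOME z. z \<in> Z \<and> \<pi> z = y)))"
  \<comment> \<open>Independence of the preimage: two preimages differ by an element of the kernel,
    and coefficients are additive.\<close>
  have wd: "\<pi> (\<kappa> a d x) = \<pi> (\<kappa> a d y)" if "\<pi> x = \<pi> y" "x \<in> Z" "y \<in> Z" "a \<in> box n q" for a d x y
  proof -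
    have e: "\<pi> u = \<pi> (u \<ominus> v) \<oplus>\<^bsub>Q\<^esub> \<pi> v" if "u \<in> Z" "v \<in> Z" for u v
    proof -
      have "u \<ominus> v \<oplus> v = u" using that Zc(2) by (simp add: a_minus_def M.a_assoc M.l_neg)
      then show ?thesis using that minus by (simp add: Q(3))
    qed
    have "\<pi> (x \<ominus> y) \<in> carrier Q" "\<pi> y \<in> carrier Q" using that minus Q(1) by auto
    moreover have "\<pi> y = \<pi> (x \<ominus> y) \<oplus>\<^bsub>Q\<^esub> \<pi> y" using e[of x y] that by simp
    ultimately have "\<pi> (x \<ominus> y) = \<zero>\<^bsub>Q\<^esub>" by (metis Q.M.add.l_cancel_one' Q.M.a_comm)
    then have "\<pi> (\<kappa> a d (x \<ominus> y)) = \<zero>\<^bsub>Q\<^esub>" using B that minus by simp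
    then have "\<pi> (\<kappa> a d x \<ominus> \<kappa> a d y) = \<zero>\<^bsub>Q\<^esub>" using that Zc(2) by (simp add: kap_minus)
    moreover have "\<pi> (\<kappa> a d y) \<in> carrier Q" using Z that Q(1) by auto
    ultimately show ?thesis using e[of "\<kappa> a d x" "\<kappa> a d y"] Z that by simp
  qed
  have \<kappa>': "\<kappa>' a d (\<pi> x) = \<pi> (\<kappa> a d x)" if "a \<in> box n q" "x \<in> Z" for a d x
  proof -
    let ?z = "SOME z. z \<in> Z \<and> \<pi> z = \<pi> x"
    have "?z \<in> Z \<and> \<pi> ?z = \<pi> x" by (rule someI_ex) (use that in auto)
    then show ?thesis using wd[of ?z x a d] that by (simp add: \<kappa>'_def)
  qed
  have "frob_level n Q q (\<lambda>d. \<pi> ` (Z \<inter> N d)) \<kappa>'"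
  proof
    show "q > 0" by (rule q_pos)
    show "kspace Q (\<pi> ` (Z \<inter> N d))" for d
      using kspaceD[OF kspace_N[of d]] Zc by (auto simp: kspace_def Q)
    show "\<kappa>' a d x \<in> \<pi> ` (Z \<inter> N d)" if "a \<in> box n q" "x \<in> carrier Q" for a d x
      using that Q(1) Z kap_in Zc(2) by (auto simp: \<kappa>')
    show "\<kappa>' a d (x \<oplus>\<^bsub>Q\<^esub> y) = \<kappa>' a d x \<oplus>\<^bsub>Q\<^esub> \<kappa>' a d y"
      if "a \<in> box n q" "x \<in> carrier Q" "y \<in> carrier Q" for a d x y
      using that Z by (auto simp: Q \<kappa>' Zc kap_add)
    show "\<kappa>' a d (xpow a' \<odot>\<^bsub>Q\<^esub> u) = (if a = a' \<and> d = d' then u else \<zero>\<^bsub>Q\<^esub>)"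
      if "a \<in> box n q" "a' \<in> box n q" "u \<in> \<pi> ` (Z \<inter> N d')" for a a' d d' u
    proof -
      from that obtain v where v: "v \<in> Z" "v \<in> N d'" "u = \<pi> v" by auto
      have x: "xpow a' \<in> carrier (poly_ring n)" using that by (intro xpow_in_poly_ring boxD)
      then have "\<kappa>' a d (xpow a' \<odot>\<^bsub>Q\<^esub> u) = \<pi> (\<kappa> a d (xpow a' \<odot> v))"
        using v that Q(4)[OF x v(1)] Zc(5)[OF x v(1)] \<kappa>'[of a] by simp
      then show ?thesis using v that by (simp add: kap_xpow Q(2))
    qed
    show "carrier Q \<subseteq> asum Q {xpow a \<odot>\<^bsub>Q\<^esub> u |a u d. a \<in> box n q \<and> u \<in> \<pi> ` (Z \<inter> N d)}"
    proof
      fix y assume "y \<in> carrier Q"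
      then obtain x where x: "x \<in> Z" "y = \<pi> x" using Q by auto
      let ?Y = "{xpow a \<odot>\<^bsub>Q\<^esub> u |a u d. a \<in> box n q \<and> u \<in> \<pi> ` (Z \<inter> N d)}"
      have Y: "?Y \<subseteq> carrier Q"
        by (auto simp: Q(1) intro!: Q.smult_closed[unfolded Q(1)] xpow_in_poly_ring boxD)
      \<comment> \<open>Membership in \<open>Z\<close> is carried through the induction because
        \<pi> is known to be additive only there.\<close>
      have "z \<in> Z \<and> \<pi> z \<in> asum Q ?Y" if "z \<in> asum M {xpow a \<odot> \<kappa> a d x |a d. a \<in> box n q}" for z
        using that
      proof (induction rule: asum.induct)
        case asum_zero
        then show ?case by (simp add: Zc flip: Q(2)) (rule asum.asum_zero)
      next
        case (asum_step z s)
        then obtain a d where z: "z = xpow a \<odot> \<kappa> a d x" "a \<in> box n q" by auto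
        have xa: "xpow a \<in> carrier (poly_ring n)" using z by (intro xpow_in_poly_ring boxD)
        have k: "\<kappa> a d x \<in> Z \<inter> N d" using Z z x kap_in Zc(2) by auto
        have zZ: "z \<in> Z" using z k xa Zc by auto
        have "\<pi> z = xpow a \<odot>\<^bsub>Q\<^esub> \<pi> (\<kappa> a d x)" using z k Q(4)[OF xa] by simp
        then have "\<pi> z \<in> ?Y" using k z by blast
        moreover have "\<pi> (z \<oplus> s) = \<pi> z \<oplus>\<^bsub>Q\<^esub> \<pi> s" using zZ asum_step Q by simp
        ultimately show ?case using zZ asum_step Zc asum.asum_step[of "\<pi> z" ?Y "\<pi> s" Q] by simp
      qed
      from this[OF in_asum_kap] x Zc show "y \<in> asum Q ?Y" by auto
    qed
    show "\<pi> ` (Z \<inter> N d) \<subseteq> hcomp Q (int q * d)" for d using N_hcomp[of d] by (auto simp: Q)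
    show "r \<odot>\<^bsub>Q\<^esub> u \<in> \<pi> ` (Z \<inter> N (d + c))"
      if "r \<in> frob_polys n q" "r \<in> homog n (int q * c)" "u \<in> \<pi> ` (Z \<inter> N d)" for r c u d
      using that N_smult frob_polysD[OF that(1)] Zc by (auto simp: Q)
  qed
  from that[OF this \<kappa>'] show thesis .
qed

section \<open>Localization\<close>

locale ploc = pmodule n M for n :: nat and M :: "('k::field mpoly, 'b) gmod" (structure) +
  fixes f :: "'k mpoly"
  assumes f_in [simp, intro]: "f \<in> carrier (poly_ring n)"
begin

abbreviation "L \<equiv> localization n M f"

lemma pow_sm: "x \<in> carrier M \<Longrightarrow> f ^ j \<odot> (f ^ k \<odot> x) = f ^ (j + k) \<odot> x"
  by (simp add: power_add sm_mult)

lemma loc_rel_iff: "((x, k), (y, l)) \<in> loc_rel M f \<longleftrightarrow>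
    x \<in> carrier M \<and> y \<in> carrier M \<and> (\<exists>t. f ^ (t + l) \<odot> x = f ^ (t + k) \<odot> y)"
  by (simp add: loc_rel_def)

lemma equiv_loc_rel: "equiv (carrier M \<times> UNIV) (loc_rel M f)"
proof (rule equivI)
  show "loc_rel M f \<subseteq> (carrier M \<times> UNIV) \<times> carrier M \<times> UNIV"
    by (auto simp: loc_rel_def)
  show "refl_on (carrier M \<times> UNIV) (loc_rel M f)"
    by (auto simp: refl_on_def loc_rel_def)
  show "sym (loc_rel M f)"
    by (rule symI) (auto simp: loc_rel_def intro: sym)
  show "trans (loc_rel M f)"
  proof (rule transI, clarsimp simp: loc_rel_iff)
    fix x k y l z m t s
    assume c: "x \<in> carrier M" "y \<in> carrier M" "z \<in> carrier M"
      and t: "f ^ (t + l) \<odot> x = f ^ (t + k) \<odot> y" and s: "f ^ (s + m) \<odot> y = f ^ (s + l) \<odot> z"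
    \<comment> \<open>Multiply the first relation by f^(s+m) and the second by f^(t+k); both then
      contain the same multiple of \<open>y\<close>.\<close>
    have "f ^ ((t + s + l) + m) \<odot> x = f ^ (s + m) \<odot> (f ^ (t + l) \<odot> x)"
      using c by (simp add: pow_sm add_ac)
    also have "\<dots> = f ^ (s + m) \<odot> (f ^ (t + k) \<odot> y)" by (simp only: t)
    also have "\<dots> = f ^ (t + k) \<odot> (f ^ (s + m) \<odot> y)"
      using c by (simp add: pow_sm add_ac)
    also have "\<dots> = f ^ (t + k) \<odot> (f ^ (s + l) \<odot> z)" by (simp only: s)
    also have "\<dots> = f ^ ((t + s + l) + k) \<odot> z"
      using c by (simp add: pow_sm add_ac)
    finally show "\<exists>t. f ^ (t + m) \<odot> x = f ^ (t + k) \<odot> z" by blast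
  qed
qed

lemma frac_eq_iff:
  assumes "x \<in> carrier M" "y \<in> carrier M"
  shows "frac M f x k = frac M f y l \<longleftrightarrow> (\<exists>t. f ^ (t + l) \<odot> x = f ^ (t + k) \<odot> y)"
  using eq_equiv_class_iff[OF equiv_loc_rel, of "(x, k)" "(y, l)"] assms
  by (simp add: frac_def loc_rel_iff)

lemma frac_eqI:
  assumes "f ^ (t + l) \<odot> x = f ^ (t + k) \<odot> y" "x \<in> carrier M" "y \<in> carrier M"
  shows "frac M f x k = frac M f y l"
  using assms frac_eq_iff by blast

lemma in_frac_iff: "(y, l) \<in> frac M f x k \<longleftrightarrow> ((x, k), (y, l)) \<in> loc_rel M f"
  by (simp add: frac_def)

text \<open>Operations on fractions are defined as unions over all representatives. If the value is
  the same for each representative, the union is that value, so this is the well-definedness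
  principle for fractions.\<close>

lemma UN_frac:
  assumes "x \<in> carrier M"
    and "\<And>y l t. y \<in> carrier M \<Longrightarrow> f ^ (t + l) \<odot> x = f ^ (t + k) \<odot> y \<Longrightarrow> F x k = F y l"
  shows "(\<Union>(y, l)\<in>frac M f x k. F y l) = F x k"
proof -
  have "(x, k) \<in> frac M f x k" using assms(1) by (auto simp: in_frac_iff loc_rel_iff)
  moreover have "F x k = F y l" if yl: "(y, l) \<in> frac M f x k" for y l
  proof -
    obtain t where "y \<in> carrier M" "f ^ (t + l) \<odot> x = f ^ (t + k) \<odot> y"
      using yl by (auto simp: in_frac_iff loc_rel_iff)
    then show ?thesis by (rule assms(2))
  qed
  ultimately show ?thesis by blast
qed

lemma carrier_loc: "carrier L = {frac M f x k |x k. x \<in> carrier M}"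
  by (auto simp: localization_def quotient_def frac_def)

lemma frac_closed [simp, intro]: "x \<in> carrier M \<Longrightarrow> frac M f x k \<in> carrier L"
  by (auto simp: carrier_loc)

lemma zero_loc: "\<zero>\<^bsub>L\<^esub> = frac M f \<zero> 0"
  by (simp add: localization_def)

lemma frac_shift: "x \<in> carrier M \<Longrightarrow> frac M f (f ^ j \<odot> x) (j + k) = frac M f x k"
  by (auto simp: frac_eq_iff pow_sm add_ac)

lemma frac_zero [simp]: "frac M f \<zero> k = \<zero>\<^bsub>L\<^esub>"
  by (auto simp: frac_eq_iff zero_loc)

lemma frac_eq_zero_iff: "x \<in> carrier M \<Longrightarrow> frac M f x k = \<zero>\<^bsub>L\<^esub> \<longleftrightarrow> (\<exists>t. f ^ t \<odot> x = \<zero>)"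
  using frac_eq_iff[of x \<zero> k 0] by (simp add: smult_r_null)

lemma smult_frac:
  assumes "a \<in> carrier (poly_ring n)" "x \<in> carrier M"
  shows "a \<odot>\<^bsub>L\<^esub> frac M f x k = frac M f (a \<odot> x) k"
proof -
  have "a \<odot>\<^bsub>L\<^esub> frac M f x k = (\<Union>(y, l)\<in>frac M f x k. frac M f (a \<odot> y) l)"
    by (simp add: localization_def del: frac_zero)
  also have "\<dots> = frac M f (a \<odot> x) k"
  proof (rule UN_frac)
    fix y l t assume y: "y \<in> carrier M" "f ^ (t + l) \<odot> x = f ^ (t + k) \<odot> y"
    have "f ^ (t + l) \<odot> (a \<odot> x) = a \<odot> (f ^ (t + l) \<odot> x)"
      using assms by (intro sm_commute) auto
    also have "\<dots> = f ^ (t + k) \<odot> (a \<odot> y)"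
      unfolding y(2) using y(1) assms by (intro sm_commute) auto
    finally show "frac M f (a \<odot> x) k = frac M f (a \<odot> y) l"
      by (rule frac_eqI) (use y(1) assms in auto)
  qed (use assms in auto)
  finally show ?thesis .
qed

lemma add_frac:
  assumes "x \<in> carrier M" "y \<in> carrier M"
  shows "frac M f x k \<oplus>\<^bsub>L\<^esub> frac M f y l = frac M f (f ^ l \<odot> x \<oplus> f ^ k \<odot> y) (k + l)"
proof -
  have 1: "(\<Union>(y, l)\<in>frac M f y l. frac M f (f ^ l \<odot> x \<oplus> f ^ k \<odot> y) (k + l)) =
        frac M f (f ^ l \<odot> x \<oplus> f ^ k \<odot> y) (k + l)" if x: "x \<in> carrier M" for x k
  proof (rule UN_frac)
    fix z m t assume z: "z \<in> carrier M" "f ^ (t + m) \<odot> y = f ^ (t + l) \<odot> z"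
    have "f ^ (t + (k + m)) \<odot> (f ^ l \<odot> x \<oplus> f ^ k \<odot> y) =
          f ^ (t + (k + m) + l) \<odot> x \<oplus> f ^ (k + k) \<odot> (f ^ (t + m) \<odot> y)"
      using x z(1) assms by (simp add: smult_r_distr pow_sm add_ac)
    also have "\<dots> = f ^ (t + (k + l)) \<odot> (f ^ m \<odot> x \<oplus> f ^ k \<odot> z)"
      unfolding z(2) using x z(1) assms by (simp add: smult_r_distr pow_sm add_ac)
    finally show "frac M f (f ^ l \<odot> x \<oplus> f ^ k \<odot> y) (k + l) = frac M f (f ^ m \<odot> x \<oplus> f ^ k \<odot> z) (k + m)"
      by (rule frac_eqI) (use x z(1) assms in auto)
  qed fact
  have "frac M f x k \<oplus>\<^bsub>L\<^esub> frac M f y l =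
      (\<Union>(x, k)\<in>frac M f x k. \<Union>(y, l)\<in>frac M f y l. frac M f (f ^ l \<odot> x \<oplus> f ^ k \<odot> y) (k + l))"
    by (simp add: localization_def del: frac_zero)
  also have "\<dots> = (\<Union>(y, l)\<in>frac M f y l. frac M f (f ^ l \<odot> x \<oplus> f ^ k \<odot> y) (k + l))"
  proof (rule UN_frac)
    fix z m t assume z: "z \<in> carrier M" "f ^ (t + m) \<odot> x = f ^ (t + k) \<odot> z"
    have "f ^ (t + (m + l)) \<odot> (f ^ l \<odot> x \<oplus> f ^ k \<odot> y) =
          f ^ (l + l) \<odot> (f ^ (t + m) \<odot> x) \<oplus> f ^ (t + (m + l) + k) \<odot> y"
      using z(1) assms by (simp add: smult_r_distr pow_sm add_ac)
    also have "\<dots> = f ^ (t + (k + l)) \<odot> (f ^ l \<odot> z \<oplus> f ^ m \<odot> y)"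
      unfolding z(2) using z(1) assms by (simp add: smult_r_distr pow_sm add_ac)
    finally have "frac M f (f ^ l \<odot> x \<oplus> f ^ k \<odot> y) (k + l) = frac M f (f ^ l \<odot> z \<oplus> f ^ m \<odot> y) (m + l)"
      by (rule frac_eqI) (use z(1) assms in auto)
    then show "(\<Union>(y, l)\<in>frac M f y l. frac M f (f ^ l \<odot> x \<oplus> f ^ k \<odot> y) (k + l)) =
       (\<Union>(y, l)\<in>frac M f y l. frac M f (f ^ l \<odot> z \<oplus> f ^ m \<odot> y) (m + l))"
      using 1[of z m] 1[of x k] z assms by simp
  qed fact
  finally show ?thesis using 1[of x k] assms by simp
qed

lemma add_frac_same:
  assumes "x \<in> carrier M" "y \<in> carrier M"
  shows "frac M f x k \<oplus>\<^bsub>L\<^esub> frac M f y k = frac M f (x \<oplus> y) k"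
proof -
  have "frac M f x k \<oplus>\<^bsub>L\<^esub> frac M f y k = frac M f (f ^ k \<odot> (x \<oplus> y)) (k + k)"
    using assms by (simp add: add_frac smult_r_distr)
  then show ?thesis using assms by (simp add: frac_shift)
qed

text \<open>Over a common denominator fractions add by adding numerators, so identities in the
  localization reduce to identities in the module.\<close>

lemma ex_denominator:
  assumes "finite A" "A \<subseteq> carrier L"
  obtains K where "\<And>X. X \<in> A \<Longrightarrow> \<exists>x\<in>carrier M. X = frac M f x K"
proof -
  have "\<exists>K. \<forall>X\<in>A. \<exists>x\<in>carrier M. X = frac M f x K"
    using assms
  proof (induction A rule: finite_induct)
    case (insert X A)
    then obtain K where K: "\<forall>X\<in>A. \<exists>x\<in>carrier M. X = frac M f x K" by auto
    from insert obtain x k where x: "x \<in> carrier M" "X = frac M f x k" by (auto simp: carrier_loc)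
    have "X = frac M f (f ^ K \<odot> x) (K + k)" using x by (simp add: frac_shift)
    moreover have "\<exists>y\<in>carrier M. Y = frac M f y (K + k)" if "Y \<in> A" for Y
    proof -
      from K that obtain y where y: "y \<in> carrier M" "Y = frac M f y K" by auto
      then have "Y = frac M f (f ^ k \<odot> y) (K + k)" using frac_shift[of y k K] by (simp add: add.commute)
      then show ?thesis using y by blast
    qed
    ultimately show ?case using x by (intro exI[of _ "K + k"]) auto
  qed simp
  then show thesis using that by blast
qed

lemma pmodule_loc: "pmodule n L"
proof (rule pmoduleI)
  show "\<zero>\<^bsub>L\<^esub> \<in> carrier L" unfolding zero_loc by blast
  fix X Y Z a b
  assume X: "X \<in> carrier L"
  then obtain x k where x: "x \<in> carrier M" "X = frac M f x k" by (auto simp: carrier_loc)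
  show "\<zero>\<^bsub>L\<^esub> \<oplus>\<^bsub>L\<^esub> X = X"
    using x add_frac_same[of "\<zero>" x k] by simp
  show "1 \<odot>\<^bsub>L\<^esub> X = X" "0 \<odot>\<^bsub>L\<^esub> X = \<zero>\<^bsub>L\<^esub>"
    unfolding x(2) smult_frac[OF poly_ring_one x(1)] smult_frac[OF poly_ring_zero x(1)]
    using x(1) by simp_all
  show "(a + b) \<odot>\<^bsub>L\<^esub> X = a \<odot>\<^bsub>L\<^esub> X \<oplus>\<^bsub>L\<^esub> b \<odot>\<^bsub>L\<^esub> X"
    "(a * b) \<odot>\<^bsub>L\<^esub> X = a \<odot>\<^bsub>L\<^esub> (b \<odot>\<^bsub>L\<^esub> X)"
    if "a \<in> carrier (poly_ring n)" "b \<in> carrier (poly_ring n)"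
    using that x by (simp_all add: smult_frac add_frac_same sm_add_left sm_mult)
  show "a \<odot>\<^bsub>L\<^esub> X \<in> carrier L" if "a \<in> carrier (poly_ring n)"
    using that x by (simp add: smult_frac)
  assume Y: "Y \<in> carrier L"
  obtain K where "\<And>W. W \<in> {X, Y} \<Longrightarrow> \<exists>x\<in>carrier M. W = frac M f x K"
    using ex_denominator[of "{X, Y}"] X Y by auto
  then obtain x y where xy: "x \<in> carrier M" "y \<in> carrier M" "X = frac M f x K" "Y = frac M f y K"
    by (metis insertI1 insertI2)
  then show "X \<oplus>\<^bsub>L\<^esub> Y \<in> carrier L" by (simp add: add_frac_same)
  show "X \<oplus>\<^bsub>L\<^esub> Y = Y \<oplus>\<^bsub>L\<^esub> X" using xy by (simp add: add_frac_same M.a_comm)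
  show "a \<odot>\<^bsub>L\<^esub> (X \<oplus>\<^bsub>L\<^esub> Y) = a \<odot>\<^bsub>L\<^esub> X \<oplus>\<^bsub>L\<^esub> a \<odot>\<^bsub>L\<^esub> Y" if "a \<in> carrier (poly_ring n)"
    using that xy by (simp add: add_frac_same smult_frac smult_r_distr)
  assume Z: "Z \<in> carrier L"
  obtain K where "\<And>W. W \<in> {X, Y, Z} \<Longrightarrow> \<exists>x\<in>carrier M. W = frac M f x K"
    using ex_denominator[of "{X, Y, Z}"] X Y Z by auto
  then obtain x y z where xy: "x \<in> carrier M" "y \<in> carrier M" "z \<in> carrier M"
      "X = frac M f x K" "Y = frac M f y K" "Z = frac M f z K"
    by (metis insertI1 insertI2)
  then show "X \<oplus>\<^bsub>L\<^esub> Y \<oplus>\<^bsub>L\<^esub> Z = X \<oplus>\<^bsub>L\<^esub> (Y \<oplus>\<^bsub>L\<^esub> Z)" by (simp add: add_frac_same M.a_assoc)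
qed

lemma loc_map_frac:
  assumes g: "g \<in> carrier (poly_ring n)" and x: "x \<in> carrier M"
  shows "loc_map M f g (frac M f x k) = frac M (f * g) (g ^ k \<odot> x) k"
  unfolding loc_map_def
proof (rule UN_frac[OF x])
  fix y l t assume y: "y \<in> carrier M" "f ^ (t + l) \<odot> x = f ^ (t + k) \<odot> y"
  interpret fg: ploc n M "f * g" by unfold_locales (use g in auto)
  have e: "(f * g) ^ (t + j) \<odot> (g ^ i \<odot> z) = g ^ (t + i + j) \<odot> (f ^ (t + j) \<odot> z)"
    if "z \<in> carrier M" for i j z
    using that g by (simp add: power_mult_distrib power_add algebra_simps flip: sm_mult)
  have "(f * g) ^ (t + l) \<odot> (g ^ k \<odot> x) = (f * g) ^ (t + k) \<odot> (g ^ l \<odot> y)"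
    unfolding e[OF x] e[OF y(1)] y(2) by (simp add: add_ac)
  then show "frac M (f * g) (g ^ k \<odot> x) k = frac M (f * g) (g ^ l \<odot> y) l"
    by (rule fg.frac_eqI) (use x y(1) g in auto)
qed

end

text \<open>Here \<open>c\<close> is the degree of \<open>f\<close>. Denominators are restricted to
  powers of f^q, which lie in R^(q). An element of N-degree d + k c has degree q (d + k c), and
  division by f^(q k) brings it to q d.\<close>

definition loc_N :: "('k::field mpoly, 'b) gmod \<Rightarrow> nat \<Rightarrow> (int \<Rightarrow> 'b set) \<Rightarrow> 'k mpoly \<Rightarrow> int \<Rightarrow> int \<Rightarrow> ('b \<times> nat) set set"
  where "loc_N M q N f c d = {frac M f u (q * k) |u k. u \<in> N (d + int k * c)}"

lemma (in ploc) hcomp_loc: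
  assumes f: "f \<in> homog n c" and N: "\<And>d. kspace M (hcomp M d)"
  shows "hcomp L d = loc_N M (Suc 0) (hcomp M) f c d"
proof -
  have "frac M f x k \<in> loc_N M (Suc 0) (hcomp M) f c d"
    if "f \<in> homog n e" "x \<in> hcomp M (d + int k * e)" for x k e
  \<comment> \<open>The zero polynomial is homogeneous of every degree, so \<open>e\<close> may
    differ from \<open>c\<close>; but then every fraction is zero.\<close>
  proof (cases "f = 0")
    case True
    have x: "x \<in> carrier M" using N kspaceD that by blast
    then have "f ^ 1 \<odot> x = \<zero>" using True by simp
    then have "frac M f x k = \<zero>\<^bsub>L\<^esub>" using x frac_eq_zero_iff by blast
    then have "frac M f x k = frac M f \<zero> (Suc 0 * 0)" by simp
    moreover have "\<zero> \<in> hcomp M (d + int 0 * c)" using N kspaceD by blast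
    ultimately show ?thesis unfolding loc_N_def by blast
  next
    case False
    then have "e = c" using homog_unique f that by blast
    then show ?thesis using that by (auto simp: loc_N_def)
  qed
  then show ?thesis using f by (auto simp: localization_def loc_N_def simp del: frac_zero)
qed

locale frob_loc = frob_level n M q N \<kappa> + ploc n M f
  for n :: nat and M :: "('k::field mpoly, 'b) gmod" (structure) and q N \<kappa> and f :: "'k mpoly" +
  fixes c :: int
  assumes f_homog: "f \<in> homog n c" and f_frob: "f ^ q \<in> frob_polys n q"
begin

lemma pow_frob: "f ^ (q * j) \<in> frob_polys n q" "f ^ (q * j) \<in> homog n (int q * (int j * c))"
  using frob_polys_power[OF f_frob, of j] homog_power[OF f_homog, of "q * j"]
  by (simp_all only: power_mult of_nat_mult mult.assoc)

lemma pow_N: "u \<in> N d \<Longrightarrow> f ^ (q * j) \<odot> u \<in> N (d + int j * c)"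
  using N_smult pow_frob by blast

lemma kap_pow: "a \<in> box n q \<Longrightarrow> x \<in> carrier M \<Longrightarrow>
    \<kappa> a (d + int j * c) (f ^ (q * j) \<odot> x) = f ^ (q * j) \<odot> \<kappa> a d x"
  using kap_smult pow_frob by blast

lemma q_split: "q * k = (q - 1) * k + k"
  using q_pos by (cases q) auto

text \<open>Before extracting coefficients, x / f^k is rewritten as (f^((q-1) k) x) / f^(q k): the
  denominator is now a power of f^q, and multiplication by such a power commutes with
  extraction.\<close>

definition loc_kap :: "(nat \<Rightarrow>\<^sub>0 nat) \<Rightarrow> int \<Rightarrow> ('b \<times> nat) set \<Rightarrow> ('b \<times> nat) set" where
  "loc_kap a d X = (\<Union>(x, k)\<in>X. frac M f (\<kappa> a (d + int k * c) (f ^ ((q - 1) * k) \<odot> x)) (q * k))"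

lemma loc_kap_frac:
  assumes "a \<in> box n q" "x \<in> carrier M"
  shows "loc_kap a d (frac M f x k) = frac M f (\<kappa> a (d + int k * c) (f ^ ((q - 1) * k) \<odot> x)) (q * k)"
  unfolding loc_kap_def
proof (rule UN_frac[OF assms(2)])
  fix y l t assume y: "y \<in> carrier M" "f ^ (t + l) \<odot> x = f ^ (t + k) \<odot> y"
  \<comment> \<open>Both representatives are brought over a common power of f^q. The right-hand side
    depends on \<open>x\<close> only through f^(t+l) x and is otherwise symmetric in
    \<open>k\<close> and \<open>l\<close>.\<close>
  have e: "f ^ (q * t + q * l) \<odot> \<kappa> a (d + int k * c) (f ^ ((q - 1) * k) \<odot> x) =
     \<kappa> a (d + int (t + k + l) * c) (f ^ ((q - 1) * (t + k + l)) \<odot> (f ^ (t + l) \<odot> x))"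
    if "x \<in> carrier M" for x k l
  proof -
    have "f ^ (q * (t + l)) \<odot> \<kappa> a (d + int k * c) (f ^ ((q - 1) * k) \<odot> x) =
       \<kappa> a (d + int k * c + int (t + l) * c) (f ^ (q * (t + l)) \<odot> (f ^ ((q - 1) * k) \<odot> x))"
      using assms that by (intro kap_pow[symmetric]) auto
    also have "d + int k * c + int (t + l) * c = d + int (t + k + l) * c"
      by (simp add: algebra_simps)
    also have "f ^ (q * (t + l)) \<odot> (f ^ ((q - 1) * k) \<odot> x) =
        f ^ ((q - 1) * (t + k + l)) \<odot> (f ^ (t + l) \<odot> x)"
      unfolding q_split[of "t + l"] using that by (simp add: pow_sm algebra_simps)
    finally show ?thesis by (simp add: distrib_left)
  qed
  have "f ^ (q * t + q * l) \<odot> \<kappa> a (d + int k * c) (f ^ ((q - 1) * k) \<odot> x) =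
     f ^ (q * t + q * k) \<odot> \<kappa> a (d + int l * c) (f ^ ((q - 1) * l) \<odot> y)"
    unfolding e[OF assms(2)] e[OF y(1)] y(2) by (simp add: add_ac)
  then show "frac M f (\<kappa> a (d + int k * c) (f ^ ((q - 1) * k) \<odot> x)) (q * k) =
    frac M f (\<kappa> a (d + int l * c) (f ^ ((q - 1) * l) \<odot> y)) (q * l)"
    by (rule frac_eqI) (use y(1) assms in auto)
qed

lemma loc_N_carrier: "u \<in> loc_N M q N f c d \<Longrightarrow> u \<in> carrier L"
  by (auto simp: loc_N_def N_carrier)

lemma frob_level_loc: "frob_level n L q (loc_N M q N f c) loc_kap"
proof -
  interpret L: pmodule n L by (rule pmodule_loc)
  show ?thesis
  proof
    show "q > 0" by (rule q_pos)
    show "kspace L (loc_N M q N f c d)" for d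
      unfolding kspace_def
    proof (intro conjI ballI allI)
      show "loc_N M q N f c d \<subseteq> carrier L" using loc_N_carrier by auto
      have "\<zero>\<^bsub>L\<^esub> = frac M f \<zero> (q * 0)" by simp
      then show "\<zero>\<^bsub>L\<^esub> \<in> loc_N M q N f c d"
        unfolding loc_N_def using kspaceD(3)[OF kspace_N] by blast
      fix X assume "X \<in> loc_N M q N f c d"
      then obtain x k where x: "X = frac M f x (q * k)" "x \<in> N (d + int k * c)"
        by (auto simp: loc_N_def)
      then have xc: "x \<in> carrier M" using N_carrier by blast
      show "pconst a \<odot>\<^bsub>L\<^esub> X \<in> loc_N M q N f c d" for a
        unfolding x(1) smult_frac[OF pconst_in_poly_ring xc] loc_N_def
        using kspaceD(5)[OF kspace_N x(2)] by blast
      fix Y assume "Y \<in> loc_N M q N f c d"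
      then obtain y l where y: "Y = frac M f y (q * l)" "y \<in> N (d + int l * c)"
        by (auto simp: loc_N_def)
      then have yc: "y \<in> carrier M" using N_carrier by blast
      have "X \<oplus>\<^bsub>L\<^esub> Y = frac M f (f ^ (q * l) \<odot> x \<oplus> f ^ (q * k) \<odot> y) (q * (k + l))"
        using x y xc yc by (simp add: add_frac distrib_left)
      moreover have "f ^ (q * l) \<odot> x \<oplus> f ^ (q * k) \<odot> y \<in> N (d + int (k + l) * c)"
        using pow_N[OF x(2), of l] pow_N[OF y(2), of k] kspaceD(4)[OF kspace_N]
        by (simp add: algebra_simps)
      ultimately show "X \<oplus>\<^bsub>L\<^esub> Y \<in> loc_N M q N f c d" unfolding loc_N_def by blast
    qed
    show "loc_kap a d X \<in> loc_N M q N f c d" if "a \<in> box n q" "X \<in> carrier L" for a d X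
    proof -
      from that obtain x k where x: "X = frac M f x k" "x \<in> carrier M" by (auto simp: carrier_loc)
      then have "\<kappa> a (d + int k * c) (f ^ ((q - 1) * k) \<odot> x) \<in> N (d + int k * c)"
        using kap_in that by simp
      then show ?thesis using x that unfolding loc_N_def by (auto simp: loc_kap_frac)
    qed
    show "loc_kap a d (X \<oplus>\<^bsub>L\<^esub> Y) = loc_kap a d X \<oplus>\<^bsub>L\<^esub> loc_kap a d Y"
      if XY: "a \<in> box n q" "X \<in> carrier L" "Y \<in> carrier L" for a d X Y
    proof -
      obtain K where "\<And>W. W \<in> {X, Y} \<Longrightarrow> \<exists>x\<in>carrier M. W = frac M f x K"
        using ex_denominator[of "{X, Y}"] XY by auto
      then obtain x y where xy: "x \<in> carrier M" "y \<in> carrier M" "X = frac M f x K" "Y = frac M f y K"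
        by (metis insertI1 insertI2)
      then show ?thesis using XY
        by (simp add: add_frac_same loc_kap_frac smult_r_distr kap_add)
    qed
    show "loc_kap a d (xpow a' \<odot>\<^bsub>L\<^esub> U) = (if a = a' \<and> d = d' then U else \<zero>\<^bsub>L\<^esub>)"
      if a: "a \<in> box n q" "a' \<in> box n q" and U: "U \<in> loc_N M q N f c d'" for a a' d d' U
    proof -
      from U obtain u k where u: "U = frac M f u (q * k)" "u \<in> N (d' + int k * c)"
        by (auto simp: loc_N_def)
      then have uc: "u \<in> carrier M" using N_carrier by blast
      \<comment> \<open>For the denominator f^(q k), \<open>loc_kap\<close> multiplies the numerator
        by f^((q-1) q k). This is again a power of f^q, so the numerator \<open>v\<close> stays in
        \<open>N\<close> and \<open>kap_xpow\<close> applies to x^a' v.\<close>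
      define v where "v = f ^ (q * ((q - 1) * k)) \<odot> u"
      have "v \<in> N (d' + int k * c + int ((q - 1) * k) * c)"
        unfolding v_def using pow_N u by blast
      also have "d' + int k * c + int ((q - 1) * k) * c = d' + int (q * k) * c"
        by (subst q_split) (simp add: algebra_simps)
      finally have v: "v \<in> N (d' + int (q * k) * c)" .
      have e: "(q - 1) * (q * k) = q * ((q - 1) * k)" by simp
      have "f ^ ((q - 1) * (q * k)) \<odot> (xpow a' \<odot> u) = xpow a' \<odot> v"
        unfolding v_def e using a uc by (intro sm_commute) auto
      then have "loc_kap a d (xpow a' \<odot>\<^bsub>L\<^esub> U) = frac M f (\<kappa> a (d + int (q * k) * c) (xpow a' \<odot> v)) (q * (q * k))"
        using a uc u by (simp add: smult_frac loc_kap_frac)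
      also have "\<dots> = (if a = a' \<and> d = d' then frac M f v (q * (q * k)) else \<zero>\<^bsub>L\<^esub>)"
        by (subst kap_xpow[OF a v]) auto
      also have "frac M f v (q * (q * k)) = U"
      proof -
        have "q * (q * k) = q * ((q - 1) * k) + q * k" by (subst q_split[of k]) (simp add: algebra_simps)
        then show ?thesis unfolding v_def using u uc frac_shift by simp
      qed
      finally show ?thesis .
    qed
    show "carrier L \<subseteq> asum L {xpow a \<odot>\<^bsub>L\<^esub> u |a u d. a \<in> box n q \<and> u \<in> loc_N M q N f c d}" (is "_ \<subseteq> asum L ?Y")
    proof
      fix X assume "X \<in> carrier L"
      then obtain x k where x: "X = frac M f x k" "x \<in> carrier M" by (auto simp: carrier_loc)
      \<comment> \<open>With numerator \<open>y\<close> the denominator becomes f^(q k), and a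
        decomposition of \<open>y\<close> in the module decomposes the fraction.\<close>
      define y where "y = f ^ ((q - 1) * k) \<odot> x"
      have y: "y \<in> carrier M" using x by (simp add: y_def)
      have "X = frac M f y (q * k)"
        unfolding y_def q_split[of k] using x by (simp add: frac_shift)
      moreover have "frac M f y (q * k) \<in> asum L ?Y"
      proof (rule asum_map[OF pmodule_axioms pmodule_loc])
        show "y \<in> asum M {xpow a \<odot> u |a u d. a \<in> box n q \<and> u \<in> N d}" using y generate by auto
        show Y: "?Y \<subseteq> carrier L"
          using loc_N_carrier by (auto intro!: L.smult_closed)
        show "frac M f z (q * k) \<in> asum L ?Y"
          if "z \<in> {xpow a \<odot> u |a u d. a \<in> box n q \<and> u \<in> N d}" for z
        proof -
          from that obtain a u d where z: "z = xpow a \<odot> u" "a \<in> box n q" "u \<in> N d" by auto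
          have "frac M f z (q * k) = xpow a \<odot>\<^bsub>L\<^esub> frac M f u (q * k)"
            using z N_carrier[OF z(3)] by (simp add: smult_frac)
          moreover have "frac M f u (q * k) \<in> loc_N M q N f c (d - int k * c)"
          proof -
            have "u \<in> N (d - int k * c + int k * c)" using z by simp
            then show ?thesis unfolding loc_N_def by blast
          qed
          ultimately have "frac M f z (q * k) \<in> ?Y" using z by blast
          then show ?thesis by (rule L.asum_base) fact
        qed
      qed (rule gens_carrier, auto simp: add_frac_same)
      ultimately show "X \<in> asum L ?Y" by simp
    qed
    show "loc_N M q N f c d \<subseteq> hcomp L (int q * d)" for d
    proof
      fix X assume "X \<in> loc_N M q N f c d"
      then obtain x k where x: "X = frac M f x (q * k)" "x \<in> N (d + int k * c)"
        by (auto simp: loc_N_def)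
      then have "x \<in> hcomp M (int q * d + int (q * k) * c)"
        using N_hcomp[of "d + int k * c"] by (auto simp: algebra_simps)
      then show "X \<in> hcomp L (int q * d)"
        using x(1) f_homog unfolding localization_def gmod.simps mem_Collect_eq by blast
    qed
    show "r \<odot>\<^bsub>L\<^esub> U \<in> loc_N M q N f c (d + e)"
      if "r \<in> frob_polys n q" "r \<in> homog n (int q * e)" "U \<in> loc_N M q N f c d" for r e U d
    proof -
      from that(3) obtain u k where u: "U = frac M f u (q * k)" "u \<in> N (d + int k * c)"
        by (auto simp: loc_N_def)
      then have "r \<odot>\<^bsub>L\<^esub> U = frac M f (r \<odot> u) (q * k)"
        using that N_carrier frob_polysD smult_frac by metis
      moreover have "r \<odot> u \<in> N (d + e + int k * c)"
        using N_smult[OF that(1,2) u(2)] by (simp add: algebra_simps)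
      ultimately show ?thesis unfolding loc_N_def by blast
    qed
  qed
qed

end

section \<open>Finite direct sums\<close>

lemma gmod_dsum_simps [simp]:
  "carrier (gmod_dsum A Mf) = (\<Pi>\<^sub>E i\<in>A. carrier (Mf i))"
  "\<zero>\<^bsub>gmod_dsum A Mf\<^esub> = (\<lambda>i\<in>A. \<zero>\<^bsub>Mf i\<^esub>)"
  "u \<oplus>\<^bsub>gmod_dsum A Mf\<^esub> v = (\<lambda>i\<in>A. u i \<oplus>\<^bsub>Mf i\<^esub> v i)"
  "a \<odot>\<^bsub>gmod_dsum A Mf\<^esub> u = (\<lambda>i\<in>A. a \<odot>\<^bsub>Mf i\<^esub> u i)"
  "hcomp (gmod_dsum A Mf) d = (\<Pi>\<^sub>E i\<in>A. hcomp (Mf i) d)"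
  by (simp_all add: gmod_dsum_def)

lemma pmodule_dsum:
  fixes Mf :: "'i \<Rightarrow> ('k::field mpoly, 'b) gmod"
  assumes "\<And>i. i \<in> A \<Longrightarrow> pmodule n (Mf i)"
  shows "pmodule n (gmod_dsum A Mf)"
proof -
  have ag: "i \<in> A \<Longrightarrow> abelian_group (Mf i)" "i \<in> A \<Longrightarrow> abelian_monoid (Mf i)" for i
    using assms[of i] by (auto simp: pmodule_def module_def abelian_group_def)
  show ?thesis
  proof (rule pmoduleI)
    fix x y z assume xyz: "x \<in> carrier (gmod_dsum A Mf)" "y \<in> carrier (gmod_dsum A Mf)"
      "z \<in> carrier (gmod_dsum A Mf)"
    show "x \<oplus>\<^bsub>gmod_dsum A Mf\<^esub> y \<oplus>\<^bsub>gmod_dsum A Mf\<^esub> z =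
        x \<oplus>\<^bsub>gmod_dsum A Mf\<^esub> (y \<oplus>\<^bsub>gmod_dsum A Mf\<^esub> z)"
      using xyz by (auto simp: fun_eq_iff PiE_iff intro!: abelian_monoid.a_assoc ag)
  next
    fix x y assume xy: "x \<in> carrier (gmod_dsum A Mf)" "y \<in> carrier (gmod_dsum A Mf)"
    show "x \<oplus>\<^bsub>gmod_dsum A Mf\<^esub> y = y \<oplus>\<^bsub>gmod_dsum A Mf\<^esub> x"
      using xy by (auto simp: fun_eq_iff PiE_iff intro!: abelian_monoid.a_comm ag)
    show "x \<oplus>\<^bsub>gmod_dsum A Mf\<^esub> y \<in> carrier (gmod_dsum A Mf)"
      using xy by (auto simp: PiE_iff intro!: abelian_monoid.a_closed ag)
  next
    fix x assume "x \<in> carrier (gmod_dsum A Mf)"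
    then have x: "x \<in> extensional A" "\<And>i. i \<in> A \<Longrightarrow> x i \<in> carrier (Mf i)" by (auto simp: PiE_iff)
    show "\<zero>\<^bsub>gmod_dsum A Mf\<^esub> \<oplus>\<^bsub>gmod_dsum A Mf\<^esub> x = x"
      using x by (auto simp: fun_eq_iff extensional_def abelian_monoid.l_zero[OF ag(2)])
    show "1 \<odot>\<^bsub>gmod_dsum A Mf\<^esub> x = x"
      using x by (auto simp: fun_eq_iff extensional_def pmodule.sm_one[OF assms])
    show "0 \<odot>\<^bsub>gmod_dsum A Mf\<^esub> x = \<zero>\<^bsub>gmod_dsum A Mf\<^esub>"
      using x by (auto simp: fun_eq_iff pmodule.sm_zero[OF assms])
  next
    fix a x assume "a \<in> carrier (poly_ring n :: 'k mpoly ring)" "x \<in> carrier (gmod_dsum A Mf)"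
    then show "a \<odot>\<^bsub>gmod_dsum A Mf\<^esub> x \<in> carrier (gmod_dsum A Mf)"
      using assms by (auto simp: PiE_iff intro!: module.smult_closed[OF pmodule.is_module])
  next
    fix a b x assume "a \<in> carrier (poly_ring n :: 'k mpoly ring)" "b \<in> carrier (poly_ring n :: 'k mpoly ring)"
      "x \<in> carrier (gmod_dsum A Mf)"
    then show "(a + b) \<odot>\<^bsub>gmod_dsum A Mf\<^esub> x = a \<odot>\<^bsub>gmod_dsum A Mf\<^esub> x \<oplus>\<^bsub>gmod_dsum A Mf\<^esub> b \<odot>\<^bsub>gmod_dsum A Mf\<^esub> x"
      "(a * b) \<odot>\<^bsub>gmod_dsum A Mf\<^esub> x = a \<odot>\<^bsub>gmod_dsum A Mf\<^esub> (b \<odot>\<^bsub>gmod_dsum A Mf\<^esub> x)"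
      by (auto simp: PiE_iff fun_eq_iff intro!: pmodule.sm_add_left[OF assms] pmodule.sm_mult[OF assms])
  next
    fix a x y assume "a \<in> carrier (poly_ring n :: 'k mpoly ring)" "x \<in> carrier (gmod_dsum A Mf)"
      "y \<in> carrier (gmod_dsum A Mf)"
    then show "a \<odot>\<^bsub>gmod_dsum A Mf\<^esub> (x \<oplus>\<^bsub>gmod_dsum A Mf\<^esub> y) =
        a \<odot>\<^bsub>gmod_dsum A Mf\<^esub> x \<oplus>\<^bsub>gmod_dsum A Mf\<^esub> a \<odot>\<^bsub>gmod_dsum A Mf\<^esub> y"
      using assms by (auto simp: PiE_iff fun_eq_iff intro!: module.smult_r_distr[OF pmodule.is_module])
  next
    show "\<zero>\<^bsub>gmod_dsum A Mf\<^esub> \<in> carrier (gmod_dsum A Mf)"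
      by (auto intro!: abelian_monoid.zero_closed ag)
  qed
qed

definition dsum_in :: "'i set \<Rightarrow> ('i \<Rightarrow> ('a, 'b) gmod) \<Rightarrow> 'i \<Rightarrow> 'b \<Rightarrow> 'i \<Rightarrow> 'b" where
  "dsum_in A Mf i x = (\<lambda>j\<in>A. if j = i then x else \<zero>\<^bsub>Mf j\<^esub>)"

text \<open>An element of a finite direct sum is the sum of its components put back by the
  inclusions \<open>dsum_in\<close>, so generation can be tested in each summand.\<close>

lemma asum_dsum:
  assumes A: "finite A" and M: "\<And>i. i \<in> A \<Longrightarrow> pmodule n (Mf i)"
    and X: "\<And>i. i \<in> A \<Longrightarrow> X i \<subseteq> carrier (Mf i)"
    and \<sigma>: "\<sigma> \<in> carrier (gmod_dsum A Mf)" "\<And>i. i \<in> A \<Longrightarrow> \<sigma> i \<in> asum (Mf i) (X i)"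
    and Y: "Y \<subseteq> carrier (gmod_dsum A Mf)" "\<And>i x. i \<in> A \<Longrightarrow> x \<in> X i \<Longrightarrow> dsum_in A Mf i x \<in> Y"
  shows "\<sigma> \<in> asum (gmod_dsum A Mf) Y"
proof -
  interpret D: pmodule n "gmod_dsum A Mf" by (rule pmodule_dsum) fact
  have ag: "i \<in> A \<Longrightarrow> abelian_monoid (Mf i)" for i
    using M[of i] by (auto simp: pmodule_def module_def abelian_group_def)
  have in_car: "dsum_in A Mf i x \<in> carrier (gmod_dsum A Mf)" if "i \<in> A" "x \<in> carrier (Mf i)" for i x
    using that by (auto simp: dsum_in_def abelian_monoid.zero_closed[OF ag])
  have in_sum: "dsum_in A Mf i x \<in> asum (gmod_dsum A Mf) Y" if "i \<in> A" "x \<in> asum (Mf i) (X i)" for i x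
  proof (rule asum_map[OF M pmodule_dsum, where X = "X i" and \<phi> = "dsum_in A Mf i"])
    show "dsum_in A Mf i \<zero>\<^bsub>Mf i\<^esub> = \<zero>\<^bsub>gmod_dsum A Mf\<^esub>"
      by (auto simp: dsum_in_def fun_eq_iff)
    show "dsum_in A Mf i (x \<oplus>\<^bsub>Mf i\<^esub> y) = dsum_in A Mf i x \<oplus>\<^bsub>gmod_dsum A Mf\<^esub> dsum_in A Mf i y"
      if "x \<in> carrier (Mf i)" "y \<in> carrier (Mf i)" for x y
      using that by (auto simp: dsum_in_def fun_eq_iff abelian_monoid.l_zero[OF ag] abelian_monoid.zero_closed[OF ag])
    show "dsum_in A Mf i x \<in> asum (gmod_dsum A Mf) Y" if "x \<in> X i" for x
      using Y that \<open>i \<in> A\<close> by (intro D.asum_base) auto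
  qed (use that M X Y in auto)
  \<comment> \<open>Truncations of \<sigma> to more and more indices; B = A gives \<sigma>
    itself.\<close>
  have "(\<lambda>i\<in>A. if i \<in> B then \<sigma> i else \<zero>\<^bsub>Mf i\<^esub>) \<in> asum (gmod_dsum A Mf) Y"
    if "finite B" "B \<subseteq> A" for B
    using that
  proof (induction B rule: finite_induct)
    case empty
    then show ?case using asum_zero[of "gmod_dsum A Mf" Y] by (simp add: restrict_def)
  next
    case (insert i B)
    have "dsum_in A Mf i (\<sigma> i) \<oplus>\<^bsub>gmod_dsum A Mf\<^esub> (\<lambda>i\<in>A. if i \<in> B then \<sigma> i else \<zero>\<^bsub>Mf i\<^esub>)
       \<in> asum (gmod_dsum A Mf) Y"
      by (rule D.asum_add[OF in_sum insert.IH Y(1)]) (use insert \<sigma>(2) in auto)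
    moreover have "dsum_in A Mf i (\<sigma> i) \<oplus>\<^bsub>gmod_dsum A Mf\<^esub> (\<lambda>i\<in>A. if i \<in> B then \<sigma> i else \<zero>\<^bsub>Mf i\<^esub>)
       = (\<lambda>j\<in>A. if j \<in> insert i B then \<sigma> j else \<zero>\<^bsub>Mf j\<^esub>)"
    proof -
      have "\<sigma> j \<oplus>\<^bsub>Mf j\<^esub> \<zero>\<^bsub>Mf j\<^esub> = \<sigma> j" "\<zero>\<^bsub>Mf j\<^esub> \<oplus>\<^bsub>Mf j\<^esub> \<sigma> j = \<sigma> j"
        "\<zero>\<^bsub>Mf j\<^esub> \<oplus>\<^bsub>Mf j\<^esub> \<zero>\<^bsub>Mf j\<^esub> = \<zero>\<^bsub>Mf j\<^esub>" if "j \<in> A" for j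
        using \<sigma>(1) that
        by (auto simp: PiE_iff abelian_monoid.l_zero[OF ag] abelian_monoid.r_zero[OF ag] abelian_monoid.zero_closed[OF ag])
      then show ?thesis using insert by (auto simp: dsum_in_def fun_eq_iff)
    qed
    ultimately show ?case by (simp add: restrict_def)
  qed
  from this[of A] A have "(\<lambda>i\<in>A. if i \<in> A then \<sigma> i else \<zero>\<^bsub>Mf i\<^esub>) \<in> asum (gmod_dsum A Mf) Y" by simp
  moreover have "(\<lambda>i\<in>A. if i \<in> A then \<sigma> i else \<zero>\<^bsub>Mf i\<^esub>) = \<sigma>"
    using \<sigma>(1) by (auto simp: fun_eq_iff PiE_iff extensional_def)
  ultimately show ?thesis by simp
qed

lemma frob_level_dsum:
  assumes A: "finite A" and q: "q > 0" and M: "\<And>i. i \<in> A \<Longrightarrow> frob_level n (Mf i) q (N i) (\<kappa> i)"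
    and pm: "\<And>i. i \<in> A \<Longrightarrow> pmodule n (Mf i)"
  shows "frob_level n (gmod_dsum A Mf) q (\<lambda>d. \<Pi>\<^sub>E i\<in>A. N i d) (\<lambda>a d \<sigma>. \<lambda>i\<in>A. \<kappa> i a d (\<sigma> i))"
proof -
  let ?D = "gmod_dsum A Mf"
  interpret D: pmodule n ?D using pmodule_dsum pm .
  note Nk = kspaceD[OF frob_level.kspace_N[OF M]]
  show ?thesis
  proof
    show "q > 0" by fact
    show "kspace ?D (\<Pi>\<^sub>E i\<in>A. N i d)" for d
      unfolding kspace_def by (auto simp: PiE_iff intro: Nk(2) Nk(3) Nk(4) Nk(5))
    show "(\<lambda>i\<in>A. \<kappa> i a d (x i)) \<in> (\<Pi>\<^sub>E i\<in>A. N i d)" if "a \<in> box n q" "x \<in> carrier ?D" for a d x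
      using that by (auto simp: PiE_iff intro!: frob_level.kap_in[OF M])
    show "(\<lambda>i\<in>A. \<kappa> i a d ((x \<oplus>\<^bsub>?D\<^esub> y) i)) = (\<lambda>i\<in>A. \<kappa> i a d (x i)) \<oplus>\<^bsub>?D\<^esub> (\<lambda>i\<in>A. \<kappa> i a d (y i))"
      if "a \<in> box n q" "x \<in> carrier ?D" "y \<in> carrier ?D" for a d x y
      using that by (auto simp: PiE_iff fun_eq_iff intro!: frob_level.kap_add[OF M])
    show "(\<lambda>i\<in>A. \<kappa> i a d ((xpow a' \<odot>\<^bsub>?D\<^esub> u) i)) = (if a = a' \<and> d = d' then u else \<zero>\<^bsub>?D\<^esub>)"
      if "a \<in> box n q" "a' \<in> box n q" "u \<in> (\<Pi>\<^sub>E i\<in>A. N i d')" for a a' d d' u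
      using that by (auto simp: PiE_iff fun_eq_iff extensional_def frob_level.kap_xpow[OF M, where d' = d'])
    show "carrier ?D \<subseteq> asum ?D {xpow a \<odot>\<^bsub>?D\<^esub> u |a u d. a \<in> box n q \<and> u \<in> (\<Pi>\<^sub>E i\<in>A. N i d)}"
      (is "_ \<subseteq> asum _ ?Y")
    proof
      fix \<sigma> assume \<sigma>: "\<sigma> \<in> carrier ?D"
      show "\<sigma> \<in> asum ?D ?Y"
      proof (rule asum_dsum[OF A pm, where X = "\<lambda>i. {xpow a \<odot>\<^bsub>Mf i\<^esub> u |a u d. a \<in> box n q \<and> u \<in> N i d}"])
        fix i assume i: "i \<in> A"
        show "{xpow a \<odot>\<^bsub>Mf i\<^esub> u |a u d. a \<in> box n q \<and> u \<in> N i d} \<subseteq> carrier (Mf i)"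
          by (rule frob_level.gens_carrier[OF M]) fact
        show "\<sigma> i \<in> asum (Mf i) {xpow a \<odot>\<^bsub>Mf i\<^esub> u |a u d. a \<in> box n q \<and> u \<in> N i d}"
          using frob_level.generate[OF M[OF i]] \<sigma> i by auto
        fix x assume "x \<in> {xpow a \<odot>\<^bsub>Mf i\<^esub> u |a u d. a \<in> box n q \<and> u \<in> N i d}"
        then obtain a u d where x: "x = xpow a \<odot>\<^bsub>Mf i\<^esub> u" "a \<in> box n q" "u \<in> N i d" by auto
        have xa: "xpow a \<in> carrier (poly_ring n)" using x by (intro xpow_in_poly_ring boxD)
        have "dsum_in A Mf i x = xpow a \<odot>\<^bsub>?D\<^esub> dsum_in A Mf i u"
          using module.smult_r_null[OF pmodule.is_module[OF pm] xa]
          by (auto simp: dsum_in_def fun_eq_iff x(1))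
        moreover have "dsum_in A Mf i u \<in> (\<Pi>\<^sub>E i\<in>A. N i d)"
          using x Nk(3) by (auto simp: dsum_in_def)
        ultimately show "dsum_in A Mf i x \<in> ?Y" using x(2) by blast
      next
        show "?Y \<subseteq> carrier ?D"
        proof
          fix y assume "y \<in> ?Y"
          then obtain a u d where y: "y = xpow a \<odot>\<^bsub>?D\<^esub> u" "a \<in> box n q" "u \<in> (\<Pi>\<^sub>E i\<in>A. N i d)" by auto
          have "u \<in> carrier ?D" using y(3) Nk(2) by (auto simp: PiE_iff)
          then show "y \<in> carrier ?D" using y(1,2) by (metis D.smult_closed xpow_in_poly_ring boxD)
        qed
      qed (use \<sigma> in auto)
    qed
    show "(\<Pi>\<^sub>E i\<in>A. N i d) \<subseteq> hcomp ?D (int q * d)" for d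
      using frob_level.N_hcomp[OF M] by (auto simp: PiE_iff)
    show "r \<odot>\<^bsub>?D\<^esub> u \<in> (\<Pi>\<^sub>E i\<in>A. N i (d + c))"
      if "r \<in> frob_polys n q" "r \<in> homog n (int q * c)" "u \<in> (\<Pi>\<^sub>E i\<in>A. N i d)" for r c u d
      using that by (auto simp: PiE_iff intro!: frob_level.N_smult[OF M])
  qed
qed

section \<open>Linear algebra over the ground field\<close>

definition kspan :: "('k::field mpoly, 'b) gmod \<Rightarrow> 'b set \<Rightarrow> 'b set" where
  "kspan M Y = asum M {pconst c \<odot>\<^bsub>M\<^esub> y |c y. y \<in> Y}"

context pmodule
begin

lemma kspan_gens: "Y \<subseteq> carrier M \<Longrightarrow> {pconst c \<odot> y |c y. y \<in> Y} \<subseteq> carrier M"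
  by auto

lemma kspace_kspan:
  assumes "Y \<subseteq> carrier M" shows "kspace M (kspan M Y)"
  unfolding kspace_def
proof (intro conjI ballI allI)
  note g = kspan_gens[OF assms]
  show "kspan M Y \<subseteq> carrier M" using asum_in_carrier[OF _ g] by (auto simp: kspan_def)
  show "\<zero> \<in> kspan M Y" by (simp add: kspan_def asum_zero)
  fix x assume x: "x \<in> kspan M Y"
  show "x \<oplus> y \<in> kspan M Y" if "y \<in> kspan M Y" for y
    using x that asum_add[OF _ _ g] by (simp add: kspan_def)
  show "pconst c \<odot> x \<in> kspan M Y" for c
    unfolding kspan_def
  proof (rule asum_map[OF pmodule_axioms pmodule_axioms g g, where \<phi> = "\<lambda>x. pconst c \<odot> x"])
    show "x \<in> asum M {pconst c \<odot> y |c y. y \<in> Y}" using x by (simp add: kspan_def)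
    show "pconst c \<odot> z \<in> asum M {pconst c \<odot> y |c y. y \<in> Y}" if z: "z \<in> {pconst c \<odot> y |c y. y \<in> Y}" for z
    proof -
      from z obtain a y where "z = pconst a \<odot> y" "y \<in> Y" by auto
      then have "pconst c \<odot> z = pconst (c * a) \<odot> y" using assms by (auto simp: pconst_mult sm_mult)
      then show ?thesis using \<open>y \<in> Y\<close> by (intro asum_base[OF _ g]) auto
    qed
  qed (auto simp: smult_r_distr)
qed

lemma kspan_base: "Y \<subseteq> carrier M \<Longrightarrow> y \<in> Y \<Longrightarrow> y \<in> kspan M Y"
proof -
  assume y: "Y \<subseteq> carrier M" "y \<in> Y"
  then have "y = pconst 1 \<odot> y" by auto
  then have "y \<in> {pconst c \<odot> y |c y. y \<in> Y}" using y by blast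
  then show ?thesis unfolding kspan_def using kspan_gens y by (intro asum_base) auto
qed

lemma kspan_subset: "kspace M U \<Longrightarrow> Y \<subseteq> U \<Longrightarrow> kspan M Y \<subseteq> U"
proof
  assume U: "kspace M U" "Y \<subseteq> U"
  have "{pconst c \<odot> y |c y. y \<in> Y} \<subseteq> U" using kspaceD(5)[OF U(1)] U(2) by blast
  then show "x \<in> U" if "x \<in> kspan M Y" for x
    using that asum_subset_kspace U(1) unfolding kspan_def by blast
qed

lemma kspan_mono: "Y \<subseteq> Y' \<Longrightarrow> kspan M Y \<subseteq> kspan M Y'"
  unfolding kspan_def by (intro subsetI, erule asum_mono) auto

lemma kspan_insertE:
  assumes "u \<in> kspan M (insert y Y)" and Y: "insert y Y \<subseteq> carrier M"
  obtains c s where "s \<in> kspan M Y" "u = pconst c \<odot> y \<oplus> s"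
proof -
  have Yc: "Y \<subseteq> carrier M" "y \<in> carrier M" using Y by auto
  note k = kspaceD[OF kspace_kspan[OF Yc(1)]]
  have "\<exists>c s. s \<in> kspan M Y \<and> u = pconst c \<odot> y \<oplus> s"
    using assms(1) unfolding kspan_def[of M "insert y Y"]
  proof (induction rule: asum.induct)
    case asum_zero
    show ?case by (intro exI[of _ 0] exI[of _ \<zero>]) (use Yc k in simp)
  next
    case (asum_step x t)
    then obtain c s where s: "s \<in> kspan M Y" "t = pconst c \<odot> y \<oplus> s" by auto
    from asum_step obtain b z where z: "x = pconst b \<odot> z" "z \<in> insert y Y" by auto
    have sc: "s \<in> carrier M" "z \<in> carrier M" using s k(2) z Y by auto
    show ?case
    proof (cases "z = y")
      case True
      then have "x \<oplus> t = pconst (b + c) \<odot> y \<oplus> s"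
        using s z sc Yc by (simp add: pconst_add sm_add_left M.a_assoc)
      then show ?thesis using s by blast
    next
      case False
      then have "x \<oplus> t = pconst c \<odot> y \<oplus> (x \<oplus> s)"
        using s z sc Yc by (simp add: M.a_lcomm)
      moreover have "x \<oplus> s \<in> kspan M Y" using False z s k(4,5) kspan_base[OF Yc(1)] by auto
      ultimately show ?thesis by blast
    qed
  qed
  then show thesis using that by blast
qed

text \<open>Steinitz exchange by elimination: once some \<open>u0\<close> in \<open>U\<close>
  involves \<open>y\<close>, subtracting multiples of \<open>u0\<close> removes \<open>y\<close>
  from the other elements. Choosing the spanning vectors inside \<open>U\<close> later keeps
  generators inside a submodule although the bound comes from the ambient module.\<close>

lemma kspan_exchange:
  assumes "finite Y" "Y \<subseteq> carrier M" "U \<subseteq> kspan M Y"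
  shows "\<exists>W\<subseteq>U. finite W \<and> card W \<le> card Y \<and> U \<subseteq> kspan M W"
  using assms
proof (induction Y arbitrary: U rule: finite_induct)
  case empty
  have "kspan M {} \<subseteq> {\<zero>}" by (rule kspan_subset) (auto simp: kspace_def)
  moreover have "\<zero> \<in> kspan M {}" using kspaceD(3)[OF kspace_kspan[of "{}"]] by simp
  ultimately show ?case using empty by (intro exI[of _ "{}"]) auto
next
  case (insert y Y)
  have Yc: "Y \<subseteq> carrier M" "y \<in> carrier M" using insert by auto
  note k = kspaceD[OF kspace_kspan[OF Yc(1)]]
  show ?case
  proof (cases "U \<subseteq> kspan M Y")
    case True
    then obtain W where "W \<subseteq> U" "finite W" "card W \<le> card Y" "U \<subseteq> kspan M W"
      using insert.IH[of U] Yc by auto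
    then show ?thesis using insert by (intro exI[of _ W]) auto
  next
    case False
    then obtain u0 where u0: "u0 \<in> U" "u0 \<notin> kspan M Y" by auto
    obtain c0 s0 where s0: "s0 \<in> kspan M Y" "u0 = pconst c0 \<odot> y \<oplus> s0"
      using kspan_insertE insert.prems u0 by (metis subsetD)
    have Uc: "U \<subseteq> carrier M"
      using insert.prems kspaceD(1)[OF kspace_kspan[of "insert y Y"]] by auto
    have u0c: "u0 \<in> carrier M" and s0c: "s0 \<in> carrier M" using u0 s0 Uc k by auto
    have c0: "c0 \<noteq> 0"
    proof
      assume "c0 = 0"
      then have "u0 = s0" using s0 s0c Yc by simp
      then show False using u0 s0 by simp
    qed
    \<comment> \<open>The combinations u + t u0 from which \<open>y\<close> has disappeared; the
      induction hypothesis applies to them.\<close>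
    define U' where "U' = {v \<in> kspan M Y. \<exists>u\<in>U. \<exists>t. v = u \<oplus> pconst t \<odot> u0}"
    obtain W' where W': "W' \<subseteq> U'" "finite W'" "card W' \<le> card Y" "U' \<subseteq> kspan M W'"
      using insert.IH[of U'] Yc by (auto simp: U'_def)
    have "\<forall>w\<in>W'. \<exists>u t. u \<in> U \<and> w = u \<oplus> pconst t \<odot> u0" using W'(1) unfolding U'_def by blast
    then obtain g t where g: "\<And>w. w \<in> W' \<Longrightarrow> g w \<in> U \<and> w = g w \<oplus> pconst (t w) \<odot> u0" by metis
    define W where "W = insert u0 (g ` W')"
    have WU: "W \<subseteq> U" using g u0 by (auto simp: W_def)
    then have Wc: "W \<subseteq> carrier M" using Uc by auto
    note kW = kspaceD[OF kspace_kspan[OF Wc]]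
    have WkW: "W \<subseteq> kspan M W" using kspan_base[OF Wc] by blast
    have card: "card W \<le> card (insert y Y)"
    proof -
      have "card W \<le> Suc (card (g ` W'))" using W' by (simp add: W_def card_insert_if)
      also have "card (g ` W') \<le> card Y" using card_image_le[OF W'(2)] W'(3) le_trans by blast
      finally show ?thesis using insert by simp
    qed
    have "W' \<subseteq> kspan M W"
    proof
      fix w assume w: "w \<in> W'"
      have "g w \<in> kspan M W" "u0 \<in> kspan M W" using w WkW by (auto simp: W_def)
      then have "g w \<oplus> pconst (t w) \<odot> u0 \<in> kspan M W" using kW by blast
      then show "w \<in> kspan M W" using g[OF w] by simp
    qed
    then have W'W: "kspan M W' \<subseteq> kspan M W" by (rule kspan_subset[OF kspace_kspan[OF Wc]])
    have "U \<subseteq> kspan M W"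
    proof
      fix u assume u: "u \<in> U"
      obtain c s where s: "s \<in> kspan M Y" "u = pconst c \<odot> y \<oplus> s"
        using kspan_insertE insert.prems u by (metis subsetD)
      have uc: "u \<in> carrier M" "s \<in> carrier M" using u Uc s k by auto
      \<comment> \<open>The multiple of \<open>u0\<close> that cancels the
        \<open>y\<close>-component of \<open>u\<close>.\<close>
      define b where "b = - c / c0"
      have b: "b * c0 = - c" using c0 by (simp add: b_def)
      define v where "v = u \<oplus> pconst b \<odot> u0"
      have "pconst b \<odot> (pconst c0 \<odot> y) = \<ominus> (pconst c \<odot> y)"
        using Yc b by (simp add: pconst_uminus sm_uminus flip: sm_mult pconst_mult)
      then have "v = (pconst c \<odot> y \<oplus> s) \<oplus> (\<ominus> (pconst c \<odot> y) \<oplus> pconst b \<odot> s0)"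
        unfolding v_def s(2) s0(2) using Yc s0c by (simp add: smult_r_distr)
      also have "\<dots> = s \<oplus> pconst b \<odot> s0"
      proof -
        have "\<And>A B C. A \<in> carrier M \<Longrightarrow> B \<in> carrier M \<Longrightarrow> C \<in> carrier M \<Longrightarrow> (A \<oplus> B) \<oplus> (\<ominus> A \<oplus> C) = B \<oplus> C"
          by (metis M.a_ac(1,2) M.a_closed M.a_inv_closed M.r_neg2)
        then show ?thesis using uc s0c Yc by simp
      qed
      finally have "v \<in> kspan M Y" using s s0 k by simp
      then have "v \<in> kspan M W" using u W'(4) W'W by (auto simp: U'_def v_def)
      moreover have "u0 \<in> kspan M W" using WkW by (auto simp: W_def)
      ultimately have "v \<oplus> pconst (- b) \<odot> u0 \<in> kspan M W" using kW by blast
      moreover have "v \<oplus> pconst (- b) \<odot> u0 = u"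
        unfolding v_def using uc u0c by (simp add: pconst_uminus sm_uminus M.a_assoc M.r_neg)
      ultimately show "u \<in> kspan M W" by simp
    qed
    then show ?thesis using WU card W' by (intro exI[of _ W]) (auto simp: W_def)
  qed
qed

end

section \<open>Uniformly bounded descent data\<close>

text \<open>
  The crucial point of the following finiteness condition is that the bound \<open>C\<close> depends neither on
  the finite set \<open>S\<close> nor on the level \<open>e\<close>.
\<close>

definition span_bounded ::
    "nat \<Rightarrow> nat \<Rightarrow> ('k::field mpoly, 'b) gmod \<Rightarrow> 'b set \<Rightarrow> 'b set" where
  "span_bounded n m M W = asum M {r \<odot>\<^bsub>M\<^esub> w |r w. r \<in> bounded_polys n m \<and> w \<in> W}"

definition fin_gen :: "nat \<Rightarrow> nat \<Rightarrow> ('k::field mpoly, 'b) gmod \<Rightarrow> (nat \<Rightarrow> int \<Rightarrow> 'b set) \<Rightarrow> bool" where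
  "fin_gen n p M N \<longleftrightarrow> (\<exists>C. \<forall>S. finite S \<and> S \<subseteq> carrier M \<longrightarrow> (\<exists>e0. \<forall>e\<ge>e0. \<exists>W. finite W \<and> card W \<le> C \<and>
     W \<subseteq> (\<Union>d. N e d) \<and> S \<subseteq> span_bounded n (C * p ^ e) M W))"

text \<open>Requiring \<open>N 0 = hcomp M\<close> identifies the level q = 1 with the grading, to
  which \<open>N_hcomp\<close> ties every other level. On the carrier the coefficient maps are
  determined by \<open>N\<close>, so only their existence is asserted.\<close>

definition frob_struct :: "nat \<Rightarrow> nat \<Rightarrow> ('k::field mpoly, 'b) gmod \<Rightarrow> (nat \<Rightarrow> int \<Rightarrow> 'b set) \<Rightarrow> bool" where
  "frob_struct n p M N \<longleftrightarrow>
     (\<forall>e. \<exists>\<kappa>. frob_level n M (p ^ e) (N e) \<kappa>) \<and> N 0 = hcomp M \<and> fin_gen n p M N"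

lemma frob_struct_pmodule: "frob_struct n p M N \<Longrightarrow> pmodule n M"
  using frob_level.axioms(1) unfolding frob_struct_def by blast

lemma frob_struct_level:
  assumes "frob_struct n p M N"
  obtains \<kappa> where "\<And>e. frob_level n M (p ^ e) (N e) (\<kappa> e)"
  using assms unfolding frob_struct_def by metis

lemma frob_struct_fin_gen:
  assumes "frob_struct n p M N"
  obtains C where "\<And>S. finite S \<Longrightarrow> S \<subseteq> carrier M \<Longrightarrow> \<exists>e0. \<forall>e\<ge>e0. \<exists>W. finite W \<and> card W \<le> C \<and>
     W \<subseteq> (\<Union>d. N e d) \<and> S \<subseteq> span_bounded n (C * p ^ e) M W"
proof -
  obtain C where C: "\<forall>S. finite S \<and> S \<subseteq> carrier M \<longrightarrow> (\<exists>e0. \<forall>e\<ge>e0. \<exists>W. finite W \<and> card W \<le> C \<and>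
     W \<subseteq> (\<Union>d. N e d) \<and> S \<subseteq> span_bounded n (C * p ^ e) M W)"
    using assms unfolding frob_struct_def fin_gen_def by (elim conjE exE)
  show thesis by (rule that[of C]) (rule C[rule_format], simp)
qed

lemma bounded_gens:
  fixes M :: "('k::field mpoly, 'b) gmod"
  shows "pmodule n M \<Longrightarrow> W \<subseteq> carrier M \<Longrightarrow>
    {r \<odot>\<^bsub>M\<^esub> w |r w. r \<in> bounded_polys n m \<and> w \<in> W} \<subseteq> carrier M"
proof clarify
  fix r :: "'k mpoly" and w assume "pmodule n M" "W \<subseteq> carrier M" "r \<in> bounded_polys n m" "w \<in> W"
  then show "r \<odot>\<^bsub>M\<^esub> w \<in> carrier M"
    using module.smult_closed[OF pmodule.is_module, of n M r w] bounded_polysD[of r n m] by auto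
qed

section \<open>Descent data of the polynomial ring\<close>

lemma pmodule_ring: "pmodule n (ring_gmod n)"
  by (rule pmoduleI) (auto simp: ring_gmod_def algebra_simps)

lemma ring_gmod_simps [simp]:
  "carrier (ring_gmod n) = carrier (poly_ring n)" "\<zero>\<^bsub>ring_gmod n\<^esub> = 0"
  "x \<oplus>\<^bsub>ring_gmod n\<^esub> y = x + y" "a \<odot>\<^bsub>ring_gmod n\<^esub> x = a * x" "hcomp (ring_gmod n) = homog n"
  by (simp_all add: ring_gmod_def)

lemma frob_polys_zero: "0 \<in> frob_polys n q"
  by (simp add: frob_polys_def)

definition ring_N :: "nat \<Rightarrow> nat \<Rightarrow> int \<Rightarrow> 'k::field mpoly set" where
  "ring_N n q d = frob_polys n q \<inter> homog n (int q * d)"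

text \<open>For r with coefficients c_m, the coefficient at x^a collects c_(a+b) x^b over the
  exponents \<open>b\<close> divisible by \<open>q\<close>; the condition on the degree of
  \<open>b\<close> selects one graded piece of it.\<close>

definition ring_kap :: "nat \<Rightarrow> nat \<Rightarrow> (nat \<Rightarrow>\<^sub>0 nat) \<Rightarrow> int \<Rightarrow> 'k::field mpoly \<Rightarrow> 'k mpoly" where
  "ring_kap n q a d r = Abs_poly_mapping (\<lambda>b. Poly_Mapping.lookup r (a + b)
     when (\<forall>i. q dvd Poly_Mapping.lookup b i) \<and> int (monom_deg b) = int q * d)"

lemma lookup_ring_kap:
  "Poly_Mapping.lookup (ring_kap n q a d r) b = (Poly_Mapping.lookup r (a + b)
     when (\<forall>i. q dvd Poly_Mapping.lookup b i) \<and> int (monom_deg b) = int q * d)"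
proof -
  have "finite ((+) a -` Poly_Mapping.keys r)"
    by (rule finite_vimageI) (auto simp: inj_on_def)
  then have "finite {b. (Poly_Mapping.lookup r (a + b)
     when (\<forall>i. q dvd Poly_Mapping.lookup b i) \<and> int (monom_deg b) = int q * d) \<noteq> 0}"
    by (rule rev_finite_subset) (auto simp: when_def in_keys_iff)
  then show ?thesis unfolding ring_kap_def by simp
qed

lemma ring_kap_in: "r \<in> carrier (poly_ring n) \<Longrightarrow> ring_kap n q a d r \<in> ring_N n q d"
proof -
  assume r: "r \<in> carrier (poly_ring n)"
  have *: "b \<in> exps n \<and> (\<forall>i. q dvd Poly_Mapping.lookup b i) \<and> int (monom_deg b) = int q * d"
    if "b \<in> Poly_Mapping.keys (ring_kap n q a d r)" for b
  proof -
    have "a + b \<in> Poly_Mapping.keys r" "(\<forall>i. q dvd Poly_Mapping.lookup b i) \<and> int (monom_deg b) = int q * d"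
      using that by (auto simp: in_keys_iff lookup_ring_kap)
    then show ?thesis using keys_poly_ring[OF r] exps_add by blast
  qed
  then have "ring_kap n q a d r \<in> carrier (poly_ring n)" by (auto simp: in_poly_ring_iff exps_def)
  then show ?thesis using * by (auto simp: ring_N_def frob_polys_def homog_def)
qed

lemma ring_kap_add: "ring_kap n q a d (r + s) = ring_kap n q a d r + ring_kap n q a d s"
  by (rule poly_mapping_eqI) (simp add: lookup_ring_kap lookup_add when_def)

lemma ring_kap_xpow:
  fixes u :: "'k::field mpoly"
  assumes q: "q > 0" and a: "a \<in> box n q" "a' \<in> box n q" and u: "u \<in> ring_N n q d'"
  shows "ring_kap n q a d (xpow a' * u) = (if a = a' \<and> d = d' then u else 0)"
proof (rule poly_keys_induct[of _ u])
  show "ring_kap n q a d (xpow a' * 0) = (if a = a' \<and> d = d' then 0 else 0)"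
    by (rule poly_mapping_eqI) (simp add: lookup_ring_kap)
next
  fix b :: "nat \<Rightarrow>\<^sub>0 nat" and c :: 'k and g :: "'k mpoly"
  assume b: "b \<in> Poly_Mapping.keys u"
    and g: "ring_kap n q a d (xpow a' * g) = (if a = a' \<and> d = d' then g else 0)"
  have bq: "\<And>i. q dvd Poly_Mapping.lookup b i" "int (monom_deg b) = int q * d'" "b \<in> exps n"
    using b u keys_poly_ring[of u n b] by (auto simp: ring_N_def frob_polys_def homog_def)
  have "ring_kap n q a d (Poly_Mapping.single (a' + b) c) =
      (if a = a' \<and> d = d' then Poly_Mapping.single b c else 0)"
  proof (rule poly_mapping_eqI)
    fix m
    show "Poly_Mapping.lookup (ring_kap n q a d (Poly_Mapping.single (a' + b) c)) m =
       Poly_Mapping.lookup (if a = a' \<and> d = d' then Poly_Mapping.single b c else 0) m"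
    proof (cases "a' + b = a + m \<and> (\<forall>i. q dvd Poly_Mapping.lookup m i) \<and> int (monom_deg m) = int q * d")
      case True
      \<comment> \<open>Compare a' + b = a + m modulo \<open>q\<close>: \<open>b\<close> and
        \<open>m\<close> vanish, while \<open>a\<close> and \<open>a'\<close> are already
        reduced.\<close>
      have "a = a'"
      proof (rule poly_mapping_eqI)
        fix i
        have e: "Poly_Mapping.lookup a' i + Poly_Mapping.lookup b i = Poly_Mapping.lookup a i + Poly_Mapping.lookup m i"
          using True by (metis lookup_add)
        show "Poly_Mapping.lookup a i = Poly_Mapping.lookup a' i"
        proof (cases "i < n")
          case i: True
          then have "Poly_Mapping.lookup a i < q" "Poly_Mapping.lookup a' i < q" using a by (auto simp: box_def)
          moreover have "Poly_Mapping.lookup b i mod q = 0" "Poly_Mapping.lookup m i mod q = 0"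
            using bq True by (auto simp: mod_eq_0_iff_dvd)
          ultimately show ?thesis using e
            by (metis add.right_neutral mod_add_right_eq mod_less)
        next
          case False
          then show ?thesis using a[THEN boxD] exps_lookup by simp
        qed
      qed
      moreover from this True have "m = b" by simp
      moreover have "d = d'" using bq True \<open>m = b\<close> q by simp
      ultimately show ?thesis using True by (simp add: lookup_ring_kap)
    next
      case False
      have "\<not> (a = a' \<and> d = d' \<and> b = m)" using False bq by auto
      then show ?thesis using False by (auto simp: lookup_ring_kap lookup_single when_def)
    qed
  qed
  then show "ring_kap n q a d (xpow a' * (Poly_Mapping.single b c + g)) =
      (if a = a' \<and> d = d' then Poly_Mapping.single b c + g else 0)"
    using g by (simp add: distrib_left ring_kap_add xpow_def mult_single)
qed

lemma frob_level_ring: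
  assumes q: "q > 0"
  shows "frob_level n (ring_gmod n :: ('k::field mpoly, 'k mpoly) gmod) q (ring_N n q) (ring_kap n q)"
proof -
  let ?R = "ring_gmod n :: ('k mpoly, 'k mpoly) gmod"
  interpret R: pmodule n ?R by (rule pmodule_ring)
  show ?thesis
  proof
    show "q > 0" by fact
    show "kspace ?R (ring_N n q d)" for d
      using homog_mult[OF homog_pconst, of _ n "int q * d"] by (auto simp: kspace_def ring_N_def frob_polys_add homog_add frob_polys_mult
          frob_polys_pconst frob_polysD frob_polys_zero)
    show "ring_kap n q a d x \<in> ring_N n q d" if "x \<in> carrier ?R" for a d x
      using that by (auto intro: ring_kap_in)
    show "carrier ?R \<subseteq> asum ?R {xpow a \<odot>\<^bsub>?R\<^esub> u |a u d. a \<in> box n q \<and> u \<in> ring_N n q d}"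
    proof
      fix r :: "'k mpoly" assume "r \<in> carrier ?R"
      then have r: "r \<in> carrier (poly_ring n)" by simp
      show "r \<in> asum ?R {xpow a \<odot>\<^bsub>?R\<^esub> u |a u d. a \<in> box n q \<and> u \<in> ring_N n q d}"
      proof (rule poly_keys_induct[of _ r])
        show "0 \<in> asum ?R {xpow a \<odot>\<^bsub>?R\<^esub> u |a u d. a \<in> box n q \<and> u \<in> ring_N n q d}"
          using asum_zero[of ?R] by simp
        fix b :: "nat \<Rightarrow>\<^sub>0 nat" and c :: 'k and g
        assume b: "b \<in> Poly_Mapping.keys r"
          and g: "g \<in> asum ?R {xpow a \<odot>\<^bsub>?R\<^esub> u |a u d. a \<in> box n q \<and> u \<in> ring_N n q d}"
        have "b \<in> exps n" using keys_poly_ring r b .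
        then obtain a h where ah: "a \<in> box n q" "h \<in> exps n" "b = a + expscale q h"
          using exps_divmod q by metis
        have "Poly_Mapping.single (expscale q h) c \<in> ring_N n q (int (monom_deg h))"
          using ah homog_single[of "expscale q h" n c]
          by (auto simp: ring_N_def frob_polys_def exps_expscale monom_deg_expscale single_in_poly_ring)
        moreover have "Poly_Mapping.single b c = xpow a * Poly_Mapping.single (expscale q h) c"
          by (simp add: ah xpow_def mult_single)
        ultimately have "Poly_Mapping.single b c \<in> {xpow a \<odot>\<^bsub>?R\<^esub> u |a u d. a \<in> box n q \<and> u \<in> ring_N n q d}"
          using ah(1) by auto
        from asum_step[OF this g] show "Poly_Mapping.single b c + g \<in> asum ?R {xpow a \<odot>\<^bsub>?R\<^esub> u |a u d. a \<in> box n q \<and> u \<in> ring_N n q d}"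
          by simp
      qed
    qed
    show "r \<odot>\<^bsub>?R\<^esub> u \<in> ring_N n q (d + c)"
      if "r \<in> frob_polys n q" "r \<in> homog n (int q * c)" "u \<in> ring_N n q d" for r c u d
      using that homog_mult[of r n "int q * c" u "int q * d"]
      by (auto simp: ring_N_def frob_polys_mult algebra_simps)
  qed (use q in \<open>auto simp: ring_kap_add ring_kap_xpow ring_N_def\<close>)
qed

text \<open>The constant is C = 1 with the single generator 1: once \<open>p ^ e\<close> exceeds all
  exponents in the finite set, its elements are themselves bounded polynomials.\<close>

lemma fin_gen_ring:
  assumes "p > Suc 0"
  shows "fin_gen n p (ring_gmod n :: ('k::field mpoly, 'k mpoly) gmod) (\<lambda>e. ring_N n (p ^ e))"
proof -
  let ?R = "ring_gmod n :: ('k mpoly, 'k mpoly) gmod"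
  interpret R: pmodule n ?R by (rule pmodule_ring)
  have "\<exists>e0. \<forall>e\<ge>e0. \<exists>W. finite W \<and> card W \<le> 1 \<and> W \<subseteq> (\<Union>d. ring_N n (p ^ e) d) \<and> S \<subseteq> span_bounded n (1 * p ^ e) ?R W"
    if S: "finite S" "S \<subseteq> carrier ?R" for S
  proof -
    have "finite (\<Union>r\<in>S. Poly_Mapping.keys r)" "(\<Union>r\<in>S. Poly_Mapping.keys r) \<subseteq> exps n"
      using S keys_poly_ring by auto
    then obtain m where m: "(\<Union>r\<in>S. Poly_Mapping.keys r) \<subseteq> box n m" using ex_box by blast
    have "\<exists>W. finite W \<and> card W \<le> 1 \<and> W \<subseteq> (\<Union>d. ring_N n (p ^ e) d) \<and> S \<subseteq> span_bounded n (1 * p ^ e) ?R W"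
      if e: "e \<ge> m" for e
    proof (intro exI[of _ "{1}"] conjI)
      have "p ^ e \<ge> m" using e assms less_exp[of e] power_mono[of 2 p e] by linarith
      then have "S \<subseteq> bounded_polys n (p ^ e)"
        using m box_mono[of m "p ^ e" n] by (auto simp: bounded_polys_def)
      then show "S \<subseteq> span_bounded n (1 * p ^ e) ?R {1}"
        unfolding span_bounded_def
        by (intro subsetI R.asum_base) (auto dest: bounded_polysD)
      have "1 \<in> ring_N n (p ^ e) 0" using frob_polys_pconst[of 1 n "p ^ e"] by (simp add: ring_N_def)
      then show "{1} \<subseteq> (\<Union>d. ring_N n (p ^ e) d)" by blast
    qed auto
    then show ?thesis by blast
  qed
  then show ?thesis unfolding fin_gen_def by blast
qed

lemma frob_struct_ring:
  assumes "p > Suc 0"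
  shows "frob_struct n p (ring_gmod n :: ('k::field mpoly, 'k mpoly) gmod) (\<lambda>e. ring_N n (p ^ e))"
  unfolding frob_struct_def
proof (intro conjI allI exI)
  show "frob_level n (ring_gmod n :: ('k mpoly, 'k mpoly) gmod) (p ^ e) (ring_N n (p ^ e)) (ring_kap n (p ^ e))" for e
    using assms by (intro frob_level_ring) simp
  show "ring_N n (p ^ 0) = hcomp (ring_gmod n :: ('k mpoly, 'k mpoly) gmod)"
    by (auto simp: ring_N_def fun_eq_iff frob_polys_1 homog_in_poly_ring)
qed (rule fin_gen_ring[OF assms])

section \<open>Descent data of a localization\<close>

lemma (in ploc) asum_frac:
  assumes "x \<in> asum M X" "X \<subseteq> carrier M" "(\<lambda>y. frac M f y k) ` X \<subseteq> Y" "Y \<subseteq> carrier L"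
  shows "frac M f x k \<in> asum L Y"
proof (rule asum_map[OF pmodule_axioms pmodule_loc assms(2,4) _ _ _ assms(1), where \<phi> = "\<lambda>y. frac M f y k"])
  interpret L: pmodule n L by (rule pmodule_loc)
  show "frac M f x k \<in> asum L Y" if "x \<in> X" for x
    using that assms(3,4) by (intro L.asum_base) auto
qed (auto simp: add_frac_same)

text \<open>For the finiteness, let f^K be a common denominator and let \<open>D\<close> bound the
  exponents of \<open>f\<close>. Multiplying numerators by f^(q-K) raises exponents by at most (q -
  K) D, hence \<open>C + D\<close> serves for every finite set of fractions.\<close>

lemma frob_struct_loc:
  fixes M :: "('k::field mpoly, 'b) gmod"
  assumes char: "CHAR('k) = p" "p > Suc 0"
    and M: "frob_struct n p M N" and f: "f \<in> homog n c"
  shows "frob_struct n p (localization n M f) (\<lambda>e. loc_N M (p ^ e) (N e) f c)"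
proof -
  interpret M: pmodule n M by (rule frob_struct_pmodule[OF M])
  interpret ploc n M f by unfold_locales (use f homog_in_poly_ring in blast)
  interpret L: pmodule n L by (rule pmodule_loc)
  obtain \<kappa> where \<kappa>: "\<And>e. frob_level n M (p ^ e) (N e) (\<kappa> e)" using frob_struct_level M by blast
  have loc: "frob_loc n M (p ^ e) (N e) (\<kappa> e) f c" for e
    using \<kappa>[of e] ploc_axioms f frobenius_power_in_frob_polys[of p f n e] char
    by (auto simp: frob_loc_def frob_loc_axioms_def)
  have N0: "N 0 = hcomp M" using M by (simp add: frob_struct_def)
  show ?thesis
    unfolding frob_struct_def
  proof (intro conjI allI)
    show "\<exists>\<kappa>. frob_level n L (p ^ e) (loc_N M (p ^ e) (N e) f c) \<kappa>" for e
      using frob_loc.frob_level_loc[OF loc] by blast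
    have hk: "kspace M (hcomp M d)" for d using frob_level.kspace_N[OF \<kappa>[of 0], of d] N0 by simp
    show "loc_N M (p ^ 0) (N 0) f c = hcomp L"
      unfolding N0 by (rule ext) (simp add: hcomp_loc[OF f hk])
    obtain D where D: "f \<in> bounded_polys n (Suc D)" using ex_bounded_polys f_in by blast
    obtain C where C: "\<And>S. finite S \<Longrightarrow> S \<subseteq> carrier M \<Longrightarrow> \<exists>e0. \<forall>e\<ge>e0. \<exists>W. finite W \<and> card W \<le> C \<and>
       W \<subseteq> (\<Union>d. N e d) \<and> S \<subseteq> span_bounded n (C * p ^ e) M W"
      using frob_struct_fin_gen[OF M] by metis
    show "fin_gen n p L (\<lambda>e. loc_N M (p ^ e) (N e) f c)"
      unfolding fin_gen_def
    proof (rule exI[of _ "C + D"], intro allI impI, elim conjE)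
      fix S assume S: "finite S" "S \<subseteq> carrier L"
      then obtain K where K: "\<And>X. X \<in> S \<Longrightarrow> \<exists>x\<in>carrier M. X = frac M f x K" using ex_denominator by blast
      then obtain g where g: "\<And>X. X \<in> S \<Longrightarrow> g X \<in> carrier M \<and> X = frac M f (g X) K" by metis
      have "finite (g ` S)" "g ` S \<subseteq> carrier M" using S g by auto
      from C[OF this] obtain e0 where e0: "\<And>e. e \<ge> e0 \<Longrightarrow> \<exists>W. finite W \<and> card W \<le> C \<and>
         W \<subseteq> (\<Union>d. N e d) \<and> g ` S \<subseteq> span_bounded n (C * p ^ e) M W" by blast
      show "\<exists>e0. \<forall>e\<ge>e0. \<exists>W. finite W \<and> card W \<le> C + D \<and> W \<subseteq> (\<Union>d. loc_N M (p ^ e) (N e) f c d) \<and>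
              S \<subseteq> span_bounded n ((C + D) * p ^ e) L W"
      \<comment> \<open>Besides e >= e0 this gives p^e >= K, so that the subtraction in f^(q-K) is a
        genuine one.\<close>
      proof (intro exI[of _ "e0 + K"] allI impI)
        fix e assume e: "e \<ge> e0 + K"
        then obtain W where W: "finite W" "card W \<le> C" "W \<subseteq> (\<Union>d. N e d)"
          "g ` S \<subseteq> span_bounded n (C * p ^ e) M W" using e0[of e] by auto
        define q where "q = p ^ e"
        have qK: "q \<ge> K"
          unfolding q_def using e char less_exp[of e] power_mono[of 2 p e] by linarith
        have Wc: "W \<subseteq> carrier M" using W(3) frob_level.N_carrier[OF \<kappa>] by blast
        \<comment> \<open>The generators are w / f^q and not w / f^K, since denominators in the
          coefficient modules are powers of f^q; the degree index drops by \<open>c\<close>.\<close>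
        let ?W = "(\<lambda>w. frac M f w q) ` W"
        have "S \<subseteq> span_bounded n ((C + D) * q) L ?W"
        proof
          fix X assume X: "X \<in> S"
          define x where "x = g X"
          have x: "x \<in> carrier M" "X = frac M f x K" "x \<in> span_bounded n (C * q) M W"
            using g X W(4) by (auto simp: x_def q_def)
          have x1: "X = frac M f (f ^ (q - K) \<odot>\<^bsub>M\<^esub> x) q"
            using frac_shift[of x "q - K" K] x qK by simp
          have x2: "f ^ (q - K) \<odot>\<^bsub>M\<^esub> x \<in> asum M {r \<odot>\<^bsub>M\<^esub> w |r w. r \<in> bounded_polys n ((C + D) * q) \<and> w \<in> W}"
          proof (rule asum_map[OF M.pmodule_axioms M.pmodule_axioms bounded_gens bounded_gens,
                where \<phi> = "\<lambda>x. f ^ (q - K) \<odot>\<^bsub>M\<^esub> x"])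
            show "x \<in> asum M {r \<odot>\<^bsub>M\<^esub> w |r w. r \<in> bounded_polys n (C * q) \<and> w \<in> W}"
              using x by (simp add: span_bounded_def)
            fix z assume "z \<in> {r \<odot>\<^bsub>M\<^esub> w |r w. r \<in> bounded_polys n (C * q) \<and> w \<in> W}"
            then obtain r w where z: "z = r \<odot>\<^bsub>M\<^esub> w" "r \<in> bounded_polys n (C * q)" "w \<in> W" by auto
            have "f ^ (q - K) * r \<in> bounded_polys n (C * q + (q - K) * D)"
              by (rule bounded_polys_mult_power[OF z(2) D])
            moreover have "C * q + (q - K) * D \<le> (C + D) * q"
              by (simp add: algebra_simps)
            ultimately have "f ^ (q - K) * r \<in> bounded_polys n ((C + D) * q)"
              using bounded_polys_mono by blast
            moreover have "f ^ (q - K) \<odot>\<^bsub>M\<^esub> z = (f ^ (q - K) * r) \<odot>\<^bsub>M\<^esub> w"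
              using z(1,3) Wc bounded_polysD[OF z(2)] by (auto simp: M.sm_mult)
            ultimately show "f ^ (q - K) \<odot>\<^bsub>M\<^esub> z \<in> asum M {r \<odot>\<^bsub>M\<^esub> w |r w. r \<in> bounded_polys n ((C + D) * q) \<and> w \<in> W}"
              using z(3) by (intro M.asum_base[OF _ bounded_gens[OF M.pmodule_axioms Wc]]) blast
          qed (use M.pmodule_axioms Wc in \<open>auto simp: M.smult_r_distr\<close>)
          have x3: "(\<lambda>y. frac M f y q) ` {r \<odot>\<^bsub>M\<^esub> w |r w. r \<in> bounded_polys n ((C + D) * q) \<and> w \<in> W}
              \<subseteq> {r \<odot>\<^bsub>L\<^esub> w |r w. r \<in> bounded_polys n ((C + D) * q) \<and> w \<in> ?W}"
          proof clarify
            fix r :: "'k mpoly" and w assume "r \<in> bounded_polys n ((C + D) * q)" "w \<in> W"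
            then show "\<exists>r' w'. frac M f (r \<odot>\<^bsub>M\<^esub> w) q = r' \<odot>\<^bsub>L\<^esub> w' \<and> r' \<in> bounded_polys n ((C + D) * q) \<and> w' \<in> ?W"
              using Wc bounded_polysD[of r] smult_frac[of r w q, symmetric] by blast
          qed
          have x4: "?W \<subseteq> carrier L" using Wc by auto
          show "X \<in> span_bounded n ((C + D) * q) L ?W"
            unfolding span_bounded_def x1
            by (rule asum_frac[OF x2 bounded_gens[OF M.pmodule_axioms Wc] x3 bounded_gens[OF pmodule_loc x4]])
        qed
        moreover have "?W \<subseteq> (\<Union>d. loc_N M q (N e) f c d)"
        proof clarify
          fix w assume "w \<in> W"
          then obtain d where "w \<in> N e d" using W(3) by auto
          then have "w \<in> N e (d - c + int 1 * c)" by simp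
          then have "frac M f w (q * 1) \<in> loc_N M q (N e) f c (d - c)" unfolding loc_N_def by blast
          then show "frac M f w q \<in> (\<Union>d. loc_N M q (N e) f c d)" by auto
        qed
        moreover have "card ?W \<le> C + D" using card_image_le[OF W(1), of "\<lambda>w. frac M f w q"] W(2) by linarith
        ultimately show "\<exists>W. finite W \<and> card W \<le> C + D \<and> W \<subseteq> (\<Union>d. loc_N M (p ^ e) (N e) f c d) \<and>
              S \<subseteq> span_bounded n ((C + D) * p ^ e) L W"
          using W(1) unfolding q_def by blast
      qed
    qed
  qed
qed

section \<open>Descent data of a finite direct sum\<close>

lemma frob_struct_dsum:
  fixes Mf :: "'i \<Rightarrow> ('k::field mpoly, 'b) gmod"
  assumes A: "finite A" and p: "p > 0" and M: "\<And>i. i \<in> A \<Longrightarrow> frob_struct n p (Mf i) (N i)"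
  shows "frob_struct n p (gmod_dsum A Mf) (\<lambda>e d. \<Pi>\<^sub>E i\<in>A. N i e d)"
proof -
  let ?D = "gmod_dsum A Mf"
  note pm = frob_struct_pmodule[OF M]
  have "\<exists>\<kappa>. \<forall>e. frob_level n (Mf i) (p ^ e) (N i e) (\<kappa> e)" if "i \<in> A" for i
    using frob_struct_level[OF M[OF that]] by metis
  then obtain \<kappa> where \<kappa>: "\<And>i e. i \<in> A \<Longrightarrow> frob_level n (Mf i) (p ^ e) (N i e) (\<kappa> i e)" by metis
  show ?thesis
    unfolding frob_struct_def
  proof (intro conjI allI)
    show "\<exists>\<kappa>. frob_level n ?D (p ^ e) (\<lambda>d. \<Pi>\<^sub>E i\<in>A. N i e d) \<kappa>" for e
      by (rule exI, rule frob_level_dsum[where N = "\<lambda>i. N i e" and \<kappa> = "\<lambda>i. \<kappa> i e"])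
         (use A p \<kappa> pm in auto)
    show "(\<lambda>d. \<Pi>\<^sub>E i\<in>A. N i 0 d) = hcomp ?D"
      using M by (auto simp: fun_eq_iff frob_struct_def intro!: PiE_cong)
    have "\<exists>C. \<forall>S. finite S \<and> S \<subseteq> carrier (Mf i) \<longrightarrow> (\<exists>e0. \<forall>e\<ge>e0. \<exists>W. finite W \<and> card W \<le> C \<and>
       W \<subseteq> (\<Union>d. N i e d) \<and> S \<subseteq> span_bounded n (C * p ^ e) (Mf i) W)" if "i \<in> A" for i
      using M[OF that] unfolding frob_struct_def fin_gen_def by blast
    then obtain C where C: "\<And>i S. i \<in> A \<Longrightarrow> finite S \<Longrightarrow> S \<subseteq> carrier (Mf i) \<Longrightarrow> \<exists>e0. \<forall>e\<ge>e0. \<exists>W. finite W \<and> card W \<le> C i \<and>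
       W \<subseteq> (\<Union>d. N i e d) \<and> S \<subseteq> span_bounded n (C i * p ^ e) (Mf i) W" by metis
    have CA: "C i \<le> sum C A" if "i \<in> A" for i using member_le_sum[of i A C] A that by simp
    show "fin_gen n p ?D (\<lambda>e d. \<Pi>\<^sub>E i\<in>A. N i e d)"
      unfolding fin_gen_def
    \<comment> \<open>The sum of the constants bounds the total number of generators and dominates
      each single exponent bound.\<close>
    proof (rule exI[of _ "sum C A"], intro allI impI, elim conjE)
      fix S assume S: "finite S" "S \<subseteq> carrier ?D"
      have Si: "finite ((\<lambda>\<sigma>. \<sigma> i) ` S)" "(\<lambda>\<sigma>. \<sigma> i) ` S \<subseteq> carrier (Mf i)" if "i \<in> A" for i
        using S that by auto
      have "\<exists>e0. \<forall>e\<ge>e0. \<exists>W. finite W \<and> card W \<le> C i \<and>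
       W \<subseteq> (\<Union>d. N i e d) \<and> (\<lambda>\<sigma>. \<sigma> i) ` S \<subseteq> span_bounded n (C i * p ^ e) (Mf i) W" if "i \<in> A" for i
        using C[OF that Si[OF that]] .
      then obtain e0 where e0: "\<And>i e. i \<in> A \<Longrightarrow> e \<ge> e0 i \<Longrightarrow> \<exists>W. finite W \<and> card W \<le> C i \<and>
       W \<subseteq> (\<Union>d. N i e d) \<and> (\<lambda>\<sigma>. \<sigma> i) ` S \<subseteq> span_bounded n (C i * p ^ e) (Mf i) W" by metis
      show "\<exists>e0. \<forall>e\<ge>e0. \<exists>W. finite W \<and> card W \<le> sum C A \<and> W \<subseteq> (\<Union>d. \<Pi>\<^sub>E i\<in>A. N i e d) \<and>
              S \<subseteq> span_bounded n (sum C A * p ^ e) ?D W"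
      proof (intro exI[of _ "sum e0 A"] allI impI)
        fix e assume e: "e \<ge> sum e0 A"
        have "\<exists>W. finite W \<and> card W \<le> C i \<and>
          W \<subseteq> (\<Union>d. N i e d) \<and> (\<lambda>\<sigma>. \<sigma> i) ` S \<subseteq> span_bounded n (C i * p ^ e) (Mf i) W" if "i \<in> A" for i
          using e0[OF that, of e] e member_le_sum[of i A e0] A that by simp
        then obtain W where W: "\<And>i. i \<in> A \<Longrightarrow> finite (W i)" "\<And>i. i \<in> A \<Longrightarrow> card (W i) \<le> C i"
          "\<And>i. i \<in> A \<Longrightarrow> W i \<subseteq> (\<Union>d. N i e d)"
          "\<And>i. i \<in> A \<Longrightarrow> (\<lambda>\<sigma>. \<sigma> i) ` S \<subseteq> span_bounded n (C i * p ^ e) (Mf i) (W i)" by metis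
        have Wc: "W i \<subseteq> carrier (Mf i)" if "i \<in> A" for i
          using W(3)[OF that] frob_level.N_carrier[OF \<kappa>[OF that]] by blast
        define V where "V = (\<Union>i\<in>A. dsum_in A Mf i ` W i)"
        have zN: "\<zero>\<^bsub>Mf i\<^esub> \<in> N i e d" if "i \<in> A" for i d
          using kspaceD(3)[OF frob_level.kspace_N[OF \<kappa>[OF that]]] .
        have VN: "V \<subseteq> (\<Union>d. \<Pi>\<^sub>E i\<in>A. N i e d)"
        proof
          fix v assume "v \<in> V"
          then obtain i w where iw: "i \<in> A" "w \<in> W i" "v = dsum_in A Mf i w" by (auto simp: V_def)
          then obtain d where "w \<in> N i e d" using W(3) by blast
          then have "v \<in> (\<Pi>\<^sub>E i\<in>A. N i e d)" using iw zN by (auto simp: dsum_in_def)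
          then show "v \<in> (\<Union>d. \<Pi>\<^sub>E i\<in>A. N i e d)" by blast
        qed
        have Vc: "V \<subseteq> carrier ?D"
        proof
          fix v assume "v \<in> V"
          then obtain d where "v \<in> (\<Pi>\<^sub>E i\<in>A. N i e d)" using VN by blast
          then show "v \<in> carrier ?D" using frob_level.N_carrier[OF \<kappa>] by (auto simp: PiE_iff)
        qed
        have "card V \<le> (\<Sum>i\<in>A. card (dsum_in A Mf i ` W i))" unfolding V_def by (rule card_UN_le[OF A])
        also have "\<dots> \<le> sum C A"
          by (intro sum_mono le_trans[OF card_image_le[OF W(1)] W(2)])
        finally have cardV: "card V \<le> sum C A" .
        have "S \<subseteq> span_bounded n (sum C A * p ^ e) ?D V"
        proof
          fix \<sigma> assume \<sigma>: "\<sigma> \<in> S"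
          show "\<sigma> \<in> span_bounded n (sum C A * p ^ e) ?D V"
            unfolding span_bounded_def
          proof (rule asum_dsum[OF A pm, where X = "\<lambda>i. {r \<odot>\<^bsub>Mf i\<^esub> w |r w. r \<in> bounded_polys n (C i * p ^ e) \<and> w \<in> W i}"])
            show "\<sigma> \<in> carrier ?D" using \<sigma> S by auto
            fix i assume i: "i \<in> A"
            show "{r \<odot>\<^bsub>Mf i\<^esub> w |r w. r \<in> bounded_polys n (C i * p ^ e) \<and> w \<in> W i} \<subseteq> carrier (Mf i)"
              by (rule bounded_gens[OF pm[OF i] Wc[OF i]])
            show "\<sigma> i \<in> asum (Mf i) {r \<odot>\<^bsub>Mf i\<^esub> w |r w. r \<in> bounded_polys n (C i * p ^ e) \<and> w \<in> W i}"
              using W(4)[OF i] \<sigma> by (auto simp: span_bounded_def)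
            fix x assume "x \<in> {r \<odot>\<^bsub>Mf i\<^esub> w |r w. r \<in> bounded_polys n (C i * p ^ e) \<and> w \<in> W i}"
            then obtain r w where x: "x = r \<odot>\<^bsub>Mf i\<^esub> w" "r \<in> bounded_polys n (C i * p ^ e)" "w \<in> W i" by auto
            have "dsum_in A Mf i x = r \<odot>\<^bsub>?D\<^esub> dsum_in A Mf i w"
              using module.smult_r_null[OF pmodule.is_module[OF pm] bounded_polysD[OF x(2)]]
              by (auto simp: dsum_in_def fun_eq_iff x(1))
            moreover have "r \<in> bounded_polys n (sum C A * p ^ e)"
              using x(2) bounded_polys_mono[of "C i * p ^ e" "sum C A * p ^ e"] CA[OF i] by auto
            moreover have "dsum_in A Mf i w \<in> V" using x i by (auto simp: V_def)
            ultimately show "dsum_in A Mf i x \<in> {r \<odot>\<^bsub>?D\<^esub> w |r w. r \<in> bounded_polys n (sum C A * p ^ e) \<and> w \<in> V}" by blast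
          next
            show "{r \<odot>\<^bsub>?D\<^esub> w |r w. r \<in> bounded_polys n (sum C A * p ^ e) \<and> w \<in> V} \<subseteq> carrier ?D"
              by (rule bounded_gens[OF pmodule_dsum[OF pm] Vc])
          qed
        qed
        moreover have "finite V" using A W(1) by (auto simp: V_def)
        ultimately show "\<exists>W. finite W \<and> card W \<le> sum C A \<and> W \<subseteq> (\<Union>d. \<Pi>\<^sub>E i\<in>A. N i e d) \<and>
              S \<subseteq> span_bounded n (sum C A * p ^ e) ?D W"
          using cardV VN by blast
      qed
    qed
  qed
qed

section \<open>Descent data of a subquotient\<close>

context frob_level
begin

text \<open>Passing to a subquotient, generators have to be replaced by coefficients of the given elements,
  which remain in the submodule; these span a space of dimension at most \<open>C * card (box n C)\<close>.\<close>

lemma kap_in_kspan: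
  assumes W: "W \<subseteq> (\<Union>d. N d)" and x: "x \<in> span_bounded n (C * q) M W" and a: "a \<in> box n q"
  shows "\<kappa> a d x \<in> kspan M {xpow (expscale q h) \<odot> w |h w. h \<in> box n C \<and> w \<in> W}"
proof -
  let ?Y = "{xpow (expscale q h) \<odot> w |h w. h \<in> box n C \<and> w \<in> W}"
  have Wc: "W \<subseteq> carrier M" using W N_carrier by blast
  have xh: "(xpow (expscale q h) :: 'k mpoly) \<in> carrier (poly_ring n)" if "h \<in> box n C" for h
    using that by (intro xpow_in_poly_ring exps_expscale boxD)
  have Yc: "?Y \<subseteq> carrier M" using Wc xh by blast
  note kY = kspaceD[OF kspace_kspan[OF Yc]]
  \<comment> \<open>Having its coefficient in the span is a linear condition on an element, so it is
    enough to test products r w, and there the monomials of \<open>r\<close>.\<close>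
  define T where "T = {x \<in> carrier M. \<kappa> a d x \<in> kspan M ?Y}"
  have T: "kspace M T"
    unfolding kspace_def T_def using a kY by (auto simp: kap_zero kap_add kap_pconst)
  have "r \<odot> w \<in> T" if r: "r \<in> bounded_polys n (C * q)" and w: "w \<in> W" for r w
  proof (rule poly_keys_induct[of _ r])
    have wc: "w \<in> carrier M" using w Wc by auto
    show "0 \<odot> w \<in> T" using wc kspaceD(3)[OF T] by simp
    fix b :: "nat \<Rightarrow>\<^sub>0 nat" and c g
    assume b: "b \<in> Poly_Mapping.keys r" and g: "Poly_Mapping.keys g \<subseteq> Poly_Mapping.keys r" "g \<odot> w \<in> T"
    have bb: "b \<in> box n (C * q)" using b r by (auto simp: bounded_polys_def)
    have gP: "g \<in> carrier (poly_ring n)"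
      using g(1) r bounded_polysD[of g n "C * q"] by (auto simp: bounded_polys_def)
    obtain a' h where ah: "a' \<in> box n q" "h \<in> box n C" "b = a' + expscale q h"
      using exps_divmod[OF boxD[OF bb] q_pos] bb by metis
    obtain d' where d': "w \<in> N d'" using w W by blast
    \<comment> \<open>With b = a' + q h, the product (c x^b) w equals x^a' u, where \<open>u\<close>
      lies in a single piece of \<open>N\<close>; its coefficient at \<open>a\<close> is therefore
      \<open>u\<close> or zero.\<close>
    define u where "u = pconst c \<odot> (xpow (expscale q h) \<odot> w)"
    have "xpow (expscale q h) \<odot> w \<in> N (d' + int (monom_deg h))"
    proof (rule N_smult[OF frob_polys_xpow _ d'])
      show "h \<in> exps n" using ah boxD by blast
      then show "xpow (expscale q h) \<in> homog n (int q * int (monom_deg h))"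
        using homog_xpow[OF exps_expscale[of h n q]] by (simp add: monom_deg_expscale)
    qed
    then have uN: "u \<in> N (d' + int (monom_deg h))" unfolding u_def using kspaceD(5)[OF kspace_N] by blast
    have "Poly_Mapping.single b c = xpow a' * (pconst c * xpow (expscale q h))"
      by (simp add: single_conv ah xpow_add)
    then have e: "Poly_Mapping.single b c \<odot> w = xpow a' \<odot> u"
      unfolding u_def using ah xh wc by (simp add: sm_mult)
    have "u \<in> kspan M ?Y" unfolding u_def using ah w by (intro kY(5) kspan_base[OF Yc]) blast
    then have "\<kappa> a d (xpow a' \<odot> u) \<in> kspan M ?Y"
      using kap_xpow[OF a ah(1) uN] kY(3) by simp
    then have "Poly_Mapping.single b c \<odot> w \<in> T"
      unfolding e T_def using ah uN N_carrier by auto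
    then have "Poly_Mapping.single b c \<odot> w \<oplus> g \<odot> w \<in> T" using g kspaceD(4)[OF T] by blast
    then show "(Poly_Mapping.single b c + g) \<odot> w \<in> T"
      using sm_add_left[OF single_in_poly_ring[OF boxD[OF bb]] gP wc] by simp
  qed
  then have "{r \<odot> w |r w. r \<in> bounded_polys n (C * q) \<and> w \<in> W} \<subseteq> T" by blast
  then have "x \<in> T" using x asum_subset_kspace[OF _ _ T] by (simp add: span_bounded_def)
  then show ?thesis by (simp add: T_def)
qed

text \<open>One finite set serves all coefficients of all elements of \<open>T\<close>, and the
  bound on its size involves \<open>n\<close> and \<open>C\<close> alone, neither \<open>q\<close>
  nor \<open>T\<close>.\<close>

lemma kap_kspan_card:
  assumes "finite W" "W \<subseteq> (\<Union>d. N d)" "card W \<le> C" "T \<subseteq> span_bounded n (C * q) M W"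
  obtains Y where "finite Y" "Y \<subseteq> carrier M" "card Y \<le> card (box n C) * C"
    "\<And>a d x. a \<in> box n q \<Longrightarrow> x \<in> T \<Longrightarrow> \<kappa> a d x \<in> kspan M Y"
proof -
  let ?Y = "{xpow (expscale q h) \<odot> w |h w. h \<in> box n C \<and> w \<in> W}"
  have e: "?Y = (\<lambda>(h, w). xpow (expscale q h) \<odot> w) ` (box n C \<times> W)" by auto
  have f: "finite (box n C \<times> W)" using assms finite_box by auto
  have "card ?Y \<le> card (box n C \<times> W)" unfolding e by (rule card_image_le[OF f])
  also have "\<dots> \<le> card (box n C) * C" using assms(3) by (simp add: card_cartesian_product)
  finally have f3: "card ?Y \<le> card (box n C) * C" .
  have f1: "finite ?Y" unfolding e using f by auto
  have f2: "?Y \<subseteq> carrier M"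
  proof clarify
    fix h w assume hw: "h \<in> box n C" "w \<in> W"
    then obtain d where "w \<in> N d" using assms(2) by blast
    then show "xpow (expscale q h) \<odot> w \<in> carrier M" using hw N_carrier
      by (intro smult_closed xpow_in_poly_ring exps_expscale boxD[of h n C]) auto
  qed
  have f4: "\<kappa> a d x \<in> kspan M ?Y" if "a \<in> box n q" "x \<in> T" for a d x
    by (rule kap_in_kspan[OF assms(2)]) (use that assms(4) in auto)
  show thesis by (rule that[OF f1 f2 f3 f4])
qed

end

lemma asum_presents:
  assumes "pmodule n M" "presents n M Z \<pi> Q" "X \<subseteq> Z" "x \<in> asum M X" "\<pi> ` X \<subseteq> Y"
  shows "\<pi> x \<in> asum Q Y"
proof -
  interpret pmodule n M by fact
  have Z: "submod n M Z" and Q: "\<zero>\<^bsub>Q\<^esub> = \<pi> \<zero>\<^bsub>M\<^esub>"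
    "\<And>x y. x \<in> Z \<Longrightarrow> y \<in> Z \<Longrightarrow> \<pi> x \<oplus>\<^bsub>Q\<^esub> \<pi> y = \<pi> (x \<oplus>\<^bsub>M\<^esub> y)"
    using assms(2) by (auto simp: presents_def)
  from assms(4) have "x \<in> Z \<and> \<pi> x \<in> asum Q Y"
  proof (induction rule: asum.induct)
    case asum_zero
    then show ?case using submodD(3)[OF Z] asum.asum_zero[of Q Y] Q by simp
  next
    case (asum_step x s)
    then have "x \<in> Z" "\<pi> x \<in> Y" using assms(3,5) by auto
    then show ?case using asum_step asum.asum_step[of "\<pi> x" Y "\<pi> s" Q] Q submodD(4)[OF Z] by auto
  qed
  then show ?thesis ..
qed

text \<open>Lift the given elements to \<open>Z\<close>. The exchange lemma picks boundedly many
  coefficients of the lifts that span all of them; these lie in \<open>Z\<close> and in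
  \<open>N\<close>, and each lift is recovered from them with the monomials x^a of the box.\<close>

lemma frob_struct_presents:
  fixes M :: "('k::field mpoly, 'b) gmod"
  assumes M: "frob_struct n p M N" and \<kappa>: "\<And>e. frob_level n M (p ^ e) (N e) (\<kappa> e)"
    and pres: "presents n M Z \<pi> Q"
    and Z: "\<And>e a d x. a \<in> box n (p ^ e) \<Longrightarrow> x \<in> Z \<Longrightarrow> \<kappa> e a d x \<in> Z"
    and B: "\<And>e a d x. a \<in> box n (p ^ e) \<Longrightarrow> x \<in> Z \<Longrightarrow> \<pi> x = \<zero>\<^bsub>Q\<^esub> \<Longrightarrow> \<pi> (\<kappa> e a d x) = \<zero>\<^bsub>Q\<^esub>"
  shows "frob_struct n p Q (\<lambda>e d. \<pi> ` (Z \<inter> N e d))"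
  unfolding frob_struct_def
proof (intro conjI allI)
  interpret pmodule n M using M frob_struct_pmodule by blast
  have Zc: "Z \<subseteq> carrier M" and Qc: "carrier Q = \<pi> ` Z"
    and Qs: "\<And>a x. a \<in> carrier (poly_ring n) \<Longrightarrow> x \<in> Z \<Longrightarrow> a \<odot>\<^bsub>Q\<^esub> \<pi> x = \<pi> (a \<odot>\<^bsub>M\<^esub> x)"
    and Zs: "submod n M Z"
    using pres by (auto simp: presents_def submod_def)
  show "\<exists>\<kappa>. frob_level n Q (p ^ e) (\<lambda>d. \<pi> ` (Z \<inter> N e d)) \<kappa>" for e
    using frob_level.presents_frob_level[OF \<kappa> pres, of e] Z B by metis
  show "(\<lambda>d. \<pi> ` (Z \<inter> N 0 d)) = hcomp Q"
    using M pres by (auto simp: frob_struct_def presents_def)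
  obtain C where C: "\<And>S. finite S \<Longrightarrow> S \<subseteq> carrier M \<Longrightarrow> \<exists>e0. \<forall>e\<ge>e0. \<exists>W. finite W \<and> card W \<le> C \<and>
     W \<subseteq> (\<Union>d. N e d) \<and> S \<subseteq> span_bounded n (C * p ^ e) M W"
    using frob_struct_fin_gen[OF M] by metis
  \<comment> \<open>The successor keeps the constant positive, so that the exponents of x^a, which
    are below \<open>p ^ e\<close>, are below \<open>?C * p ^ e\<close> as well.\<close>
  let ?C = "Suc (card (box n C) * C)"
  show "fin_gen n p Q (\<lambda>e d. \<pi> ` (Z \<inter> N e d))"
    unfolding fin_gen_def
  proof (rule exI[of _ ?C], intro allI impI, elim conjE)
    fix S assume S: "finite S" "S \<subseteq> carrier Q"
    then obtain T where T: "T \<subseteq> Z" "finite T" "S = \<pi> ` T" using Qc finite_subset_image by metis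
    then obtain e0 where e0: "\<And>e. e \<ge> e0 \<Longrightarrow> \<exists>W. finite W \<and> card W \<le> C \<and>
         W \<subseteq> (\<Union>d. N e d) \<and> T \<subseteq> span_bounded n (C * p ^ e) M W" using C[of T] Zc by auto
    show "\<exists>e0. \<forall>e\<ge>e0. \<exists>W. finite W \<and> card W \<le> ?C \<and> W \<subseteq> (\<Union>d. \<pi> ` (Z \<inter> N e d)) \<and>
            S \<subseteq> span_bounded n (?C * p ^ e) Q W"
    proof (intro exI[of _ e0] allI impI)
      fix e assume "e \<ge> e0"
      then obtain W where W: "finite W" "card W \<le> C" "W \<subseteq> (\<Union>d. N e d)"
          "T \<subseteq> span_bounded n (C * p ^ e) M W" using e0[of e] by metis
      interpret l: frob_level n M "p ^ e" "N e" "\<kappa> e" by (rule \<kappa>)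
      obtain Y where Y: "finite Y" "Y \<subseteq> carrier M" "card Y \<le> card (box n C) * C"
        "\<And>a d x. a \<in> box n (p ^ e) \<Longrightarrow> x \<in> T \<Longrightarrow> \<kappa> e a d x \<in> kspan M Y"
        using l.kap_kspan_card[OF W(1,3,2,4)] by blast
      define U where "U = {\<kappa> e a d x |a d x. a \<in> box n (p ^ e) \<and> x \<in> T}"
      have "U \<subseteq> kspan M Y" using Y(4) by (auto simp: U_def)
      then obtain V where V: "V \<subseteq> U" "finite V" "card V \<le> card Y" "U \<subseteq> kspan M V"
        using kspan_exchange[OF Y(1,2)] by metis
      have UZ: "U \<subseteq> Z" using Z T(1) by (auto simp: U_def)
      have UN: "U \<subseteq> (\<Union>d. N e d)" proof
        fix u assume "u \<in> U"
        then obtain a d x where u: "u = \<kappa> e a d x" "a \<in> box n (p ^ e)" "x \<in> T" by (auto simp: U_def)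
        then have "u \<in> N e d" using l.kap_in[of a x d] T(1) Zc by auto
        then show "u \<in> (\<Union>d. N e d)" by blast
      qed
      have Vc: "V \<subseteq> carrier M" using V(1) UZ Zc by auto
      let ?X = "{r \<odot>\<^bsub>M\<^esub> w |r w. r \<in> bounded_polys n (?C * p ^ e) \<and> w \<in> V}"
      note g = bounded_gens[OF pmodule_axioms Vc, of "?C * p ^ e"]
      have "S \<subseteq> span_bounded n (?C * p ^ e) Q (\<pi> ` V)"
      proof
        fix y assume "y \<in> S"
        then obtain x where x: "x \<in> T" "y = \<pi> x" using T by auto
        have xc: "x \<in> carrier M" using x T Zc by auto
        have gen: "xpow a \<odot>\<^bsub>M\<^esub> v \<in> asum M ?X" if a: "a \<in> box n (p ^ e)" and v: "v \<in> kspan M V" for a v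
        proof (rule asum_map[OF pmodule_axioms pmodule_axioms kspan_gens[OF Vc] g, where \<phi> = "\<lambda>v. xpow a \<odot>\<^bsub>M\<^esub> v"])
          have xa: "xpow a \<in> carrier (poly_ring n)" using a by simp
          show "v \<in> asum M {pconst c \<odot>\<^bsub>M\<^esub> y |c y. y \<in> V}" using v by (simp add: kspan_def)
          fix z assume "z \<in> {pconst c \<odot>\<^bsub>M\<^esub> y |c y. y \<in> V}"
          then obtain c w where z: "z = pconst c \<odot>\<^bsub>M\<^esub> w" "w \<in> V" by auto
          have "xpow a \<odot>\<^bsub>M\<^esub> z = Poly_Mapping.single a c \<odot>\<^bsub>M\<^esub> w"
            using z Vc sm_mult[OF xa pconst_in_poly_ring, of w c] by (auto simp: single_conv mult.commute)
          moreover have "a \<in> box n (?C * p ^ e)" using a box_mono[of "p ^ e" "?C * p ^ e" n] by auto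
          then have "Poly_Mapping.single a c \<in> bounded_polys n (?C * p ^ e)"
            by (auto simp: bounded_polys_def)
          ultimately have "xpow a \<odot>\<^bsub>M\<^esub> z \<in> ?X" using z by blast
          then show "xpow a \<odot>\<^bsub>M\<^esub> z \<in> asum M ?X" by (rule asum_base[OF _ g])
        qed (use a in \<open>auto simp: smult_r_distr\<close>)
        have y1: "x \<in> asum M ?X"
        proof -
          have "{xpow a \<odot>\<^bsub>M\<^esub> \<kappa> e a d x |a d. a \<in> box n (p ^ e)} \<subseteq> asum M ?X"
          proof clarify
            fix a d assume a: "a \<in> box n (p ^ e)"
            then have "\<kappa> e a d x \<in> kspan M V" using V(4) x by (auto simp: U_def)
            then show "xpow a \<odot>\<^bsub>M\<^esub> \<kappa> e a d x \<in> asum M ?X" using gen a by blast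
          qed
          moreover have "z \<in> asum M ?X" if "z \<in> asum M X" "X \<subseteq> asum M ?X" for z X
            using that
          proof (induction rule: asum.induct)
            case (asum_step x s)
            then show ?case by (intro asum_add[OF _ _ g]) auto
          qed (rule asum.asum_zero)
          ultimately show ?thesis using l.in_asum_kap[OF xc] by blast
        qed
        have y2: "?X \<subseteq> Z" using V(1) UZ submodD(5)[OF Zs] bounded_polysD by blast
        have y3: "\<pi> ` ?X \<subseteq> {r \<odot>\<^bsub>Q\<^esub> w |r w. r \<in> bounded_polys n (?C * p ^ e) \<and> w \<in> \<pi> ` V}"
        proof clarify
          fix r :: "'k mpoly" and w assume rw: "r \<in> bounded_polys n (?C * p ^ e)" "w \<in> V"
          have "\<pi> (r \<odot>\<^bsub>M\<^esub> w) = r \<odot>\<^bsub>Q\<^esub> \<pi> w" using Qs[OF bounded_polysD[OF rw(1)]] rw(2) V(1) UZ by auto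
          then show "\<exists>r' w'. \<pi> (r \<odot>\<^bsub>M\<^esub> w) = r' \<odot>\<^bsub>Q\<^esub> w' \<and> r' \<in> bounded_polys n (?C * p ^ e) \<and> w' \<in> \<pi> ` V"
            using rw by blast
        qed
        show "y \<in> span_bounded n (?C * p ^ e) Q (\<pi> ` V)"
          unfolding span_bounded_def x(2) by (rule asum_presents[OF pmodule_axioms pres y2 y1 y3])
      qed
      moreover have "card (\<pi> ` V) \<le> ?C" using card_image_le[OF V(2), of \<pi>] V(3) Y(3) by linarith
      moreover have "\<pi> ` V \<subseteq> (\<Union>d. \<pi> ` (Z \<inter> N e d))"
      proof clarify
        fix v assume "v \<in> V"
        then have "v \<in> Z" "v \<in> (\<Union>d. N e d)" using V(1) UZ UN by auto
        then show "\<pi> v \<in> (\<Union>d. \<pi> ` (Z \<inter> N e d))" by auto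
      qed
      ultimately show "\<exists>W. finite W \<and> card W \<le> ?C \<and> W \<subseteq> (\<Union>d. \<pi> ` (Z \<inter> N e d)) \<and>
            S \<subseteq> span_bounded n (?C * p ^ e) Q W"
        using V(2) by blast
    qed
  qed
qed

section \<open>Additive maps and alternating double sums\<close>

lemma (in pmodule) additive_finsum:
  assumes M': "pmodule n M'" and \<phi>: "\<phi> \<in> carrier M \<rightarrow> carrier M'"
    and add: "\<And>x y. x \<in> carrier M \<Longrightarrow> y \<in> carrier M \<Longrightarrow> \<phi> (x \<oplus> y) = \<phi> x \<oplus>\<^bsub>M'\<^esub> \<phi> y"
    and A: "finite A" "f \<in> A \<rightarrow> carrier M"
  shows "\<phi> (finsum M f A) = finsum M' (\<lambda>i. \<phi> (f i)) A"
proof -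
  interpret M': pmodule n M' by fact
  from A show ?thesis
  proof (induction A rule: finite_induct)
    case empty
    then show ?case using additive_zero[OF M' \<phi> add] by simp
  next
    case (insert a A)
    have "(\<lambda>i. \<phi> (f i)) \<in> A \<rightarrow> carrier M'" "\<phi> (f a) \<in> carrier M'" using insert \<phi> by auto
    then show ?case using insert by (simp add: add Pi_iff)
  qed
qed

text \<open>The cancellation behind d d = 0. Each newly inserted index contributes a row and a
  column, which cancel term by term; the argument never divides by 2 and so holds in every
  characteristic.\<close>

lemma (in pmodule) antisym_finsum:
  assumes "finite U" and "\<And>i j. i \<in> U \<Longrightarrow> j \<in> U \<Longrightarrow> i \<noteq> j \<Longrightarrow> t i j \<in> carrier M \<and> t i j \<oplus> t j i = \<zero>"
  shows "(\<Oplus>i\<in>U. \<Oplus>j\<in>U - {i}. t i j) = \<zero>"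
  using assms
proof (induction U rule: finite_induct)
  case (insert a U)
  have t: "t i j \<in> carrier M" if "i \<in> insert a U" "j \<in> insert a U" "i \<noteq> j" for i j
    using insert.prems that by blast
  have c1: "(\<lambda>j. t a j) \<in> U \<rightarrow> carrier M" "(\<lambda>i. t i a) \<in> U \<rightarrow> carrier M" using t insert(2) by auto
  have c2: "(\<Oplus>j\<in>U - {i}. t i j) \<in> carrier M" if "i \<in> U" for i
    using t that by (intro M.finsum_closed) auto
  have c3: "(\<Oplus>j\<in>insert a U - {i}. t i j) \<in> carrier M" if "i \<in> insert a U" for i
    using t that by (intro M.finsum_closed) auto
  have c0: "(\<Oplus>j\<in>U. t a j) \<in> carrier M" using c1(1) by (rule M.finsum_closed)
  have "(\<Oplus>i\<in>insert a U. \<Oplus>j\<in>insert a U - {i}. t i j) =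
      (\<Oplus>j\<in>insert a U - {a}. t a j) \<oplus> (\<Oplus>i\<in>U. \<Oplus>j\<in>insert a U - {i}. t i j)"
    by (rule M.finsum_insert) (use insert(1,2) c0 c3 in auto)
  also have "insert a U - {a} = U" using insert by auto
  also have "(\<Oplus>i\<in>U. \<Oplus>j\<in>insert a U - {i}. t i j) = (\<Oplus>i\<in>U. t i a \<oplus> (\<Oplus>j\<in>U - {i}. t i j))"
  proof (rule M.finsum_cong')
    fix i assume i: "i \<in> U"
    then have "insert a U - {i} = insert a (U - {i})" using insert by auto
    moreover have "(\<Oplus>j\<in>insert a (U - {i}). t i j) = t i a \<oplus> (\<Oplus>j\<in>U - {i}. t i j)"
      using insert i t by (intro M.finsum_insert) auto
    ultimately show "(\<Oplus>j\<in>insert a U - {i}. t i j) = t i a \<oplus> (\<Oplus>j\<in>U - {i}. t i j)" by simp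
  qed (use t c2 insert in auto)
  also have "\<dots> = (\<Oplus>i\<in>U. t i a) \<oplus> (\<Oplus>i\<in>U. \<Oplus>j\<in>U - {i}. t i j)"
    using c1 c2 by (intro M.finsum_addf) auto
  also have "(\<Oplus>i\<in>U. \<Oplus>j\<in>U - {i}. t i j) = \<zero>"
    using insert.prems by (intro insert.IH) blast
  also have "(\<Oplus>i\<in>U. t a i) \<oplus> ((\<Oplus>i\<in>U. t i a) \<oplus> \<zero>) = (\<Oplus>i\<in>U. t a i \<oplus> t i a)"
    using c1 M.finsum_addf[of "\<lambda>i. t a i" U "\<lambda>i. t i a"] M.finsum_closed[of "\<lambda>i. t i a" U] by simp
  also have "\<dots> = (\<Oplus>i\<in>U. \<zero>)"
    using insert.prems insert(2) by (intro M.finsum_cong') auto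
  finally show ?case by simp
qed simp

section \<open>The Cech complex\<close>

locale cech = pmodule n M for n :: nat and M :: "('k::field mpoly, 'b) gmod" (structure) +
  fixes fs :: "'k mpoly list"
  assumes fs_in: "set fs \<subseteq> carrier (poly_ring n)"
begin

abbreviation "F \<equiv> face_prod fs"
abbreviation "L S \<equiv> localization n M (F S)"
abbreviation "fr S \<equiv> frac M (F S)"
abbreviation "rho T j \<equiv> loc_map M (F (T - {j})) (fs ! j)"
abbreviation "C p \<equiv> cech_cochains n fs M p"
abbreviation "d p \<equiv> cech_diff n fs M p"

definition eps :: "nat set \<Rightarrow> nat \<Rightarrow> 'k mpoly" where
  "eps T j = (- 1) ^ card {l \<in> T. l < j}"

lemma nth_in: "j < length fs \<Longrightarrow> fs ! j \<in> carrier (poly_ring n)"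
  using fs_in nth_mem by blast

lemma finite_face: "S \<subseteq> {..<length fs} \<Longrightarrow> finite S"
  using finite_subset by blast

lemma F_in: "S \<subseteq> {..<length fs} \<Longrightarrow> F S \<in> carrier (poly_ring n)"
  unfolding face_prod_def by (rule poly_ring_prod) (use nth_in in auto)

lemma ploc_F: "S \<subseteq> {..<length fs} \<Longrightarrow> ploc n M (F S)"
  using F_in pmodule_axioms by (auto simp: ploc_def ploc_axioms_def)

text \<open>Adjoining the factor f_j leads to the localization at a product; this equality of
  polynomials identifies that target with the module attached to \<open>T\<close>.\<close>

lemma F_remove: "T \<subseteq> {..<length fs} \<Longrightarrow> j \<in> T \<Longrightarrow> F (T - {j}) * fs ! j = F T"
  unfolding face_prod_def using prod.remove[OF finite_face, of T j "\<lambda>j. fs ! j"] by (simp add: mult.commute)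

lemma rho_fr:
  assumes T: "T \<subseteq> {..<length fs}" "j \<in> T" and x: "x \<in> carrier M"
  shows "rho T j (fr (T - {j}) x k) = fr T ((fs ! j) ^ k \<odot> x) k"
proof -
  have "ploc n M (F (T - {j}))" by (rule ploc_F) (use T in auto)
  then show ?thesis using ploc.loc_map_frac[OF _ nth_in x, of _ j k] F_remove[OF T] T by auto
qed

lemma carrier_L_cases:
  assumes "S \<subseteq> {..<length fs}" "X \<in> carrier (L S)"
  obtains x k where "x \<in> carrier M" "X = fr S x k"
  using ploc.carrier_loc[OF ploc_F[OF assms(1)]] assms(2) by auto

lemma carrier_L_cases2:
  assumes "S \<subseteq> {..<length fs}" "X \<in> carrier (L S)" "Y \<in> carrier (L S)"
  obtains x y k where "x \<in> carrier M" "y \<in> carrier M" "X = fr S x k" "Y = fr S y k"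
proof -
  obtain K where "\<And>W. W \<in> {X, Y} \<Longrightarrow> \<exists>x\<in>carrier M. W = fr S x K"
    using ploc.ex_denominator[OF ploc_F[OF assms(1)], of "{X, Y}"] assms by auto
  then show thesis using that by (metis insertI1 insertI2)
qed

lemma rho_closed:
  assumes T: "T \<subseteq> {..<length fs}" "j \<in> T" and X: "X \<in> carrier (L (T - {j}))"
  shows "rho T j X \<in> carrier (L T)"
proof -
  have T': "T - {j} \<subseteq> {..<length fs}" using T by auto
  obtain x k where x: "x \<in> carrier M" "X = fr (T - {j}) x k" using carrier_L_cases[OF T' X] .
  have "(fs ! j) ^ k \<odot> x \<in> carrier M" using x T nth_in by (intro smult_closed poly_ring_power) auto
  then show ?thesis using rho_fr[OF T x(1)] x(2) ploc.frac_closed[OF ploc_F[OF T(1)]] by simp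
qed

lemma rho_add:
  assumes T: "T \<subseteq> {..<length fs}" "j \<in> T" and X: "X \<in> carrier (L (T - {j}))" "Y \<in> carrier (L (T - {j}))"
  shows "rho T j (X \<oplus>\<^bsub>L (T - {j})\<^esub> Y) = rho T j X \<oplus>\<^bsub>L T\<^esub> rho T j Y"
proof -
  have T': "T - {j} \<subseteq> {..<length fs}" using T by auto
  obtain x y k where x: "x \<in> carrier M" "y \<in> carrier M" "X = fr (T - {j}) x k" "Y = fr (T - {j}) y k"
    using carrier_L_cases2[OF T' X] .
  have j: "(fs ! j) ^ k \<in> carrier (poly_ring n)" using T nth_in by auto
  show ?thesis
    using x j rho_fr[OF T] ploc.add_frac_same[OF ploc_F[OF T']] ploc.add_frac_same[OF ploc_F[OF T(1)]]
    by (simp add: smult_r_distr)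
qed

lemma rho_smult:
  assumes T: "T \<subseteq> {..<length fs}" "j \<in> T" and X: "X \<in> carrier (L (T - {j}))" and a: "a \<in> carrier (poly_ring n)"
  shows "rho T j (a \<odot>\<^bsub>L (T - {j})\<^esub> X) = a \<odot>\<^bsub>L T\<^esub> rho T j X"
proof -
  have T': "T - {j} \<subseteq> {..<length fs}" using T by auto
  obtain x k where x: "x \<in> carrier M" "X = fr (T - {j}) x k" using carrier_L_cases[OF T' X] .
  have j: "(fs ! j) ^ k \<in> carrier (poly_ring n)" using T nth_in by auto
  show ?thesis
    using x j a rho_fr[OF T] ploc.smult_frac[OF ploc_F[OF T']] ploc.smult_frac[OF ploc_F[OF T(1)]]
    by (simp add: sm_commute)
qed

lemma rho_commute:
  assumes U: "U \<subseteq> {..<length fs}" "i \<in> U" "j \<in> U" "i \<noteq> j" and X: "X \<in> carrier (L (U - {i} - {j}))"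
  shows "rho U i (rho (U - {i}) j X) = rho U j (rho (U - {j}) i X)"
proof -
  have U': "U - {i} - {j} \<subseteq> {..<length fs}" "U - {i} \<subseteq> {..<length fs}" "U - {j} \<subseteq> {..<length fs}"
    using U by auto
  obtain x k where x: "x \<in> carrier M" "X = fr (U - {i} - {j}) x k" using carrier_L_cases[OF U'(1) X] .
  have ij: "(fs ! j) ^ k \<in> carrier (poly_ring n)" "(fs ! i) ^ k \<in> carrier (poly_ring n)" using U nth_in by auto
  have sw: "U - {i} - {j} = U - {j} - {i}" by auto
  have "rho U i (rho (U - {i}) j X) = fr U ((fs ! i) ^ k \<odot> ((fs ! j) ^ k \<odot> x)) k"
    using rho_fr[OF U'(2), of j x k] rho_fr[OF U(1,2), of "(fs ! j) ^ k \<odot> x" k] x U ij by simp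
  moreover have "rho U j (rho (U - {j}) i X) = fr U ((fs ! j) ^ k \<odot> ((fs ! i) ^ k \<odot> x)) k"
    using rho_fr[OF U'(3), of i x k] rho_fr[OF U(1,3), of "(fs ! i) ^ k \<odot> x" k] x U ij sw by simp
  ultimately show ?thesis using sm_commute[OF ij x(1)] by simp
qed

lemma eps_in [simp]: "eps T j \<in> carrier (poly_ring n)"
  by (auto simp: eps_def)

lemma eps_square: "eps T j * eps T j = 1"
  by (simp add: eps_def flip: power_add)

text \<open>For i < j, deleting \<open>j\<close> leaves the number of indices below \<open>i\<close>
  unchanged, while deleting \<open>i\<close> lowers the number of indices below \<open>j\<close> by
  one.\<close>

lemma eps_swap:
  assumes "finite U" "i \<in> U" "j \<in> U" "i \<noteq> j"
  shows "eps U i * eps (U - {i}) j = - (eps U j * eps (U - {j}) i)"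
proof -
  have *: "eps U i * eps (U - {i}) j = - (eps U j * eps (U - {j}) i)"
    if "i < j" "i \<in> U" "j \<in> U" for i j
  proof -
    have "{l \<in> U - {j}. l < i} = {l \<in> U. l < i}" using that by auto
    then have 1: "eps (U - {j}) i = eps U i" by (simp add: eps_def)
    have "{l \<in> U. l < j} = insert i {l \<in> U - {i}. l < j}" using that by auto
    then have "card {l \<in> U. l < j} = Suc (card {l \<in> U - {i}. l < j})" using assms(1) by simp
    then have "eps U j = - eps (U - {i}) j" by (simp add: eps_def)
    then show ?thesis using 1 by simp
  qed
  show ?thesis
  proof (cases "i < j")
    case False
    then show ?thesis using *[of j i] assms by simp
  qed (use * assms in blast)
qed

lemma facesD: "S \<in> faces fs p \<Longrightarrow> S \<subseteq> {..<length fs}"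
  by (simp add: faces_def)

lemma finite_faces: "finite (faces fs p)"
  by (simp add: faces_def)

lemma faces_remove: "T \<in> faces fs (Suc p) \<Longrightarrow> j \<in> T \<Longrightarrow> T - {j} \<in> faces fs p"
  by (auto simp: faces_def finite_face)

lemma pmodule_L: "S \<subseteq> {..<length fs} \<Longrightarrow> pmodule n (L S)"
  using ploc.pmodule_loc ploc_F by blast

lemma pmodule_C: "pmodule n (C p)"
  unfolding cech_cochains_def by (rule pmodule_dsum) (auto intro: pmodule_L dest: facesD)

lemma C_simps [simp]:
  "carrier (C p) = (\<Pi>\<^sub>E S\<in>faces fs p. carrier (L S))"
  "\<zero>\<^bsub>C p\<^esub> = (\<lambda>S\<in>faces fs p. \<zero>\<^bsub>L S\<^esub>)"
  "u \<oplus>\<^bsub>C p\<^esub> v = (\<lambda>S\<in>faces fs p. u S \<oplus>\<^bsub>L S\<^esub> v S)"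
  "a \<odot>\<^bsub>C p\<^esub> u = (\<lambda>S\<in>faces fs p. a \<odot>\<^bsub>L S\<^esub> u S)"
  by (simp_all add: cech_cochains_def)

lemma d_eq:
  "d p \<sigma> = (\<lambda>T\<in>faces fs (Suc p). \<Oplus>\<^bsub>L T\<^esub>j\<in>T. eps T j \<odot>\<^bsub>L T\<^esub> rho T j (\<sigma> (T - {j})))"
  by (simp add: cech_diff_def eps_def Let_def)

lemma summand_closed:
  assumes "\<sigma> \<in> carrier (C p)" "T \<in> faces fs (Suc p)" "j \<in> T" "a \<in> carrier (poly_ring n)"
  shows "a \<odot>\<^bsub>L T\<^esub> rho T j (\<sigma> (T - {j})) \<in> carrier (L T)"
  using assms facesD[OF assms(2)] faces_remove[OF assms(2,3)]
  by (intro module.smult_closed[OF pmodule.is_module[OF pmodule_L]] rho_closed) (auto simp: PiE_iff)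

lemma d_closed:
  assumes "\<sigma> \<in> carrier (C p)" shows "d p \<sigma> \<in> carrier (C (Suc p))"
  unfolding d_eq C_simps
proof (rule PiE_I)
  fix T assume T: "T \<in> faces fs (Suc p)"
  interpret LT: pmodule n "L T" using pmodule_L[OF facesD[OF T]] .
  show "(\<lambda>T\<in>faces fs (Suc p). \<Oplus>\<^bsub>L T\<^esub>j\<in>T. eps T j \<odot>\<^bsub>L T\<^esub> rho T j (\<sigma> (T - {j}))) T \<in> carrier (L T)"
    using T summand_closed[OF assms T] by (auto intro!: LT.M.finsum_closed)
qed auto

lemma d_add:
  assumes "\<sigma> \<in> carrier (C p)" "\<tau> \<in> carrier (C p)"
  shows "d p (\<sigma> \<oplus>\<^bsub>C p\<^esub> \<tau>) = d p \<sigma> \<oplus>\<^bsub>C (Suc p)\<^esub> d p \<tau>"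
  unfolding d_eq C_simps
proof (rule restrict_ext)
  fix T assume T: "T \<in> faces fs (Suc p)"
  note Tl = facesD[OF T]
  interpret LT: pmodule n "L T" using pmodule_L[OF Tl] .
  have "(\<Oplus>\<^bsub>L T\<^esub>j\<in>T. eps T j \<odot>\<^bsub>L T\<^esub> rho T j ((\<lambda>S\<in>faces fs p. \<sigma> S \<oplus>\<^bsub>L S\<^esub> \<tau> S) (T - {j}))) =
     (\<Oplus>\<^bsub>L T\<^esub>j\<in>T. eps T j \<odot>\<^bsub>L T\<^esub> rho T j (\<sigma> (T - {j})) \<oplus>\<^bsub>L T\<^esub> eps T j \<odot>\<^bsub>L T\<^esub> rho T j (\<tau> (T - {j})))"
  proof (rule LT.M.finsum_cong')
    fix j assume j: "j \<in> T"
    have TS: "T - {j} \<in> faces fs p" using faces_remove[OF T j] .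
    have c: "\<sigma> (T - {j}) \<in> carrier (L (T - {j}))" "\<tau> (T - {j}) \<in> carrier (L (T - {j}))"
      using assms TS by auto
    show "eps T j \<odot>\<^bsub>L T\<^esub> rho T j ((\<lambda>S\<in>faces fs p. \<sigma> S \<oplus>\<^bsub>L S\<^esub> \<tau> S) (T - {j})) =
      eps T j \<odot>\<^bsub>L T\<^esub> rho T j (\<sigma> (T - {j})) \<oplus>\<^bsub>L T\<^esub> eps T j \<odot>\<^bsub>L T\<^esub> rho T j (\<tau> (T - {j}))"
      using TS c rho_add[OF Tl j c] rho_closed[OF Tl j] by (simp add: LT.smult_r_distr)
  qed (use summand_closed[OF assms(1) T] summand_closed[OF assms(2) T] in auto)
  also have "\<dots> = (\<Oplus>\<^bsub>L T\<^esub>j\<in>T. eps T j \<odot>\<^bsub>L T\<^esub> rho T j (\<sigma> (T - {j}))) \<oplus>\<^bsub>L T\<^esub>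
      (\<Oplus>\<^bsub>L T\<^esub>j\<in>T. eps T j \<odot>\<^bsub>L T\<^esub> rho T j (\<tau> (T - {j})))"
    using summand_closed[OF assms(1) T] summand_closed[OF assms(2) T]
    by (intro LT.M.finsum_addf) auto
  finally show "(\<Oplus>\<^bsub>L T\<^esub>j\<in>T. eps T j \<odot>\<^bsub>L T\<^esub> rho T j ((\<lambda>S\<in>faces fs p. \<sigma> S \<oplus>\<^bsub>L S\<^esub> \<tau> S) (T - {j}))) =
     (\<lambda>T\<in>faces fs (Suc p). \<Oplus>\<^bsub>L T\<^esub>j\<in>T. eps T j \<odot>\<^bsub>L T\<^esub> rho T j (\<sigma> (T - {j}))) T \<oplus>\<^bsub>L T\<^esub>
     (\<lambda>T\<in>faces fs (Suc p). \<Oplus>\<^bsub>L T\<^esub>j\<in>T. eps T j \<odot>\<^bsub>L T\<^esub> rho T j (\<tau> (T - {j}))) T"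
    using T by simp
qed

lemma d_smult:
  assumes "\<sigma> \<in> carrier (C p)" and a: "a \<in> carrier (poly_ring n)"
  shows "d p (a \<odot>\<^bsub>C p\<^esub> \<sigma>) = a \<odot>\<^bsub>C (Suc p)\<^esub> d p \<sigma>"
  unfolding d_eq C_simps
proof (rule restrict_ext)
  fix T assume T: "T \<in> faces fs (Suc p)"
  note Tl = facesD[OF T]
  interpret LT: pmodule n "L T" using pmodule_L[OF Tl] .
  have "(\<Oplus>\<^bsub>L T\<^esub>j\<in>T. eps T j \<odot>\<^bsub>L T\<^esub> rho T j ((\<lambda>S\<in>faces fs p. a \<odot>\<^bsub>L S\<^esub> \<sigma> S) (T - {j}))) =
     (\<Oplus>\<^bsub>L T\<^esub>j\<in>T. a \<odot>\<^bsub>L T\<^esub> (eps T j \<odot>\<^bsub>L T\<^esub> rho T j (\<sigma> (T - {j}))))"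
  proof (rule LT.M.finsum_cong')
    fix j assume j: "j \<in> T"
    have TS: "T - {j} \<in> faces fs p" using faces_remove[OF T j] .
    have c: "\<sigma> (T - {j}) \<in> carrier (L (T - {j}))" using assms TS by auto
    show "eps T j \<odot>\<^bsub>L T\<^esub> rho T j ((\<lambda>S\<in>faces fs p. a \<odot>\<^bsub>L S\<^esub> \<sigma> S) (T - {j})) =
      a \<odot>\<^bsub>L T\<^esub> (eps T j \<odot>\<^bsub>L T\<^esub> rho T j (\<sigma> (T - {j})))"
      using TS c rho_smult[OF Tl j c a] rho_closed[OF Tl j c] LT.sm_commute[OF eps_in a] by simp
  qed (use summand_closed[OF assms(1) T] a in auto)
  also have "\<dots> = a \<odot>\<^bsub>L T\<^esub> (\<Oplus>\<^bsub>L T\<^esub>j\<in>T. eps T j \<odot>\<^bsub>L T\<^esub> rho T j (\<sigma> (T - {j})))"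
    using summand_closed[OF assms(1) T] a finite_face[OF Tl]
    by (intro LT.finsum_smult_ldistr[symmetric]) auto
  finally show "(\<Oplus>\<^bsub>L T\<^esub>j\<in>T. eps T j \<odot>\<^bsub>L T\<^esub> rho T j ((\<lambda>S\<in>faces fs p. a \<odot>\<^bsub>L S\<^esub> \<sigma> S) (T - {j}))) =
     a \<odot>\<^bsub>L T\<^esub> (\<lambda>T\<in>faces fs (Suc p). \<Oplus>\<^bsub>L T\<^esub>j\<in>T. eps T j \<odot>\<^bsub>L T\<^esub> rho T j (\<sigma> (T - {j}))) T"
    using T by simp
qed

lemma d_d:
  assumes "\<sigma> \<in> carrier (C p)"
  shows "d (Suc p) (d p \<sigma>) = \<zero>\<^bsub>C (Suc (Suc p))\<^esub>"
  unfolding d_eq[of "Suc p"] C_simps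
proof (rule restrict_ext)
  fix U assume U: "U \<in> faces fs (Suc (Suc p))"
  note Ul = facesD[OF U]
  interpret LU: pmodule n "L U" using pmodule_L[OF Ul] .
  \<comment> \<open>The contribution of the face U - {i} - {j} to the double differential when
    \<open>j\<close> is adjoined first and \<open>i\<close> second.\<close>
  define t where "t = (\<lambda>i j. (eps U i * eps (U - {i}) j) \<odot>\<^bsub>L U\<^esub> rho U i (rho (U - {i}) j (\<sigma> (U - {i} - {j}))))"
  have \<sigma>c: "\<sigma> (U - {i} - {j}) \<in> carrier (L (U - {i} - {j}))" if "i \<in> U" "j \<in> U" "i \<noteq> j" for i j
    using assms faces_remove[OF faces_remove[OF U that(1)], of j] that by auto
  have rc: "rho U i (rho (U - {i}) j (\<sigma> (U - {i} - {j}))) \<in> carrier (L U)" if "i \<in> U" "j \<in> U" "i \<noteq> j" for i j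
    using \<sigma>c[OF that] that Ul by (intro rho_closed) auto
  have tc: "t i j \<in> carrier (L U)" if "i \<in> U" "j \<in> U" "i \<noteq> j" for i j
    unfolding t_def using rc[OF that] by auto
  have "(\<Oplus>\<^bsub>L U\<^esub>i\<in>U. eps U i \<odot>\<^bsub>L U\<^esub> rho U i (d p \<sigma> (U - {i}))) = (\<Oplus>\<^bsub>L U\<^esub>i\<in>U. \<Oplus>\<^bsub>L U\<^esub>j\<in>U - {i}. t i j)"
  proof (rule LU.M.finsum_cong')
    fix i assume i: "i \<in> U"
    let ?T = "U - {i}"
    have T: "?T \<in> faces fs (Suc p)" using faces_remove[OF U i] .
    note Tl = facesD[OF T]
    interpret LT: pmodule n "L ?T" using pmodule_L[OF Tl] .
    have sc: "eps ?T j \<odot>\<^bsub>L ?T\<^esub> rho ?T j (\<sigma> (?T - {j})) \<in> carrier (L ?T)" if "j \<in> ?T" for j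
      using summand_closed[OF assms T that] by simp
    have "rho U i (d p \<sigma> ?T) = rho U i (\<Oplus>\<^bsub>L ?T\<^esub>j\<in>?T. eps ?T j \<odot>\<^bsub>L ?T\<^esub> rho ?T j (\<sigma> (?T - {j})))"
      using T by (simp add: d_eq)
    also have "\<dots> = (\<Oplus>\<^bsub>L U\<^esub>j\<in>?T. rho U i (eps ?T j \<odot>\<^bsub>L ?T\<^esub> rho ?T j (\<sigma> (?T - {j}))))"
      using rho_closed[OF Ul i] rho_add[OF Ul i] sc finite_face[OF Tl]
      by (intro LT.additive_finsum[OF LU.pmodule_axioms]) auto
    finally have "eps U i \<odot>\<^bsub>L U\<^esub> rho U i (d p \<sigma> ?T) =
       (\<Oplus>\<^bsub>L U\<^esub>j\<in>?T. eps U i \<odot>\<^bsub>L U\<^esub> rho U i (eps ?T j \<odot>\<^bsub>L ?T\<^esub> rho ?T j (\<sigma> (?T - {j}))))"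
      using LU.finsum_smult_ldistr[of ?T "eps U i" "\<lambda>j. rho U i (eps ?T j \<odot>\<^bsub>L ?T\<^esub> rho ?T j (\<sigma> (?T - {j})))"]
        rho_closed[OF Ul i sc] finite_face[OF Tl] by auto
    also have "\<dots> = (\<Oplus>\<^bsub>L U\<^esub>j\<in>?T. t i j)"
    proof (rule LU.M.finsum_cong')
      fix j assume j: "j \<in> ?T"
      then have ij: "i \<in> U" "j \<in> U" "i \<noteq> j" using i by auto
      have "rho ?T j (\<sigma> (?T - {j})) \<in> carrier (L ?T)" using \<sigma>c[OF ij] j Tl by (intro rho_closed) auto
      then have "rho U i (eps ?T j \<odot>\<^bsub>L ?T\<^esub> rho ?T j (\<sigma> (?T - {j}))) = eps ?T j \<odot>\<^bsub>L U\<^esub> rho U i (rho ?T j (\<sigma> (?T - {j})))"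
        using rho_smult[OF Ul i] by simp
      then show "eps U i \<odot>\<^bsub>L U\<^esub> rho U i (eps ?T j \<odot>\<^bsub>L ?T\<^esub> rho ?T j (\<sigma> (?T - {j}))) = t i j"
        unfolding t_def using rc[OF ij] by (simp add: LU.sm_mult)
    qed (use tc i in auto)
    finally show "eps U i \<odot>\<^bsub>L U\<^esub> rho U i (d p \<sigma> ?T) = (\<Oplus>\<^bsub>L U\<^esub>j\<in>U - {i}. t i j)" .
  qed (use tc in \<open>auto intro!: LU.M.finsum_closed\<close>)
  also have "\<dots> = \<zero>\<^bsub>L U\<^esub>"
  proof (rule LU.antisym_finsum[OF finite_face[OF Ul]], rule conjI)
    fix i j assume ij: "i \<in> U" "j \<in> U" "i \<noteq> j"
    show "t i j \<in> carrier (L U)" using tc[OF ij] .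
    have sw: "U - {i} - {j} = U - {j} - {i}" by auto
    have "t j i = (eps U j * eps (U - {j}) i) \<odot>\<^bsub>L U\<^esub> rho U i (rho (U - {i}) j (\<sigma> (U - {i} - {j})))"
      unfolding t_def using rho_commute[OF Ul ij \<sigma>c[OF ij]] sw by simp
    then have "t i j \<oplus>\<^bsub>L U\<^esub> t j i = ((eps U i * eps (U - {i}) j) + (eps U j * eps (U - {j}) i)) \<odot>\<^bsub>L U\<^esub>
        rho U i (rho (U - {i}) j (\<sigma> (U - {i} - {j})))"
      using rc[OF ij] by (simp add: t_def LU.sm_add_left)
    then show "t i j \<oplus>\<^bsub>L U\<^esub> t j i = \<zero>\<^bsub>L U\<^esub>"
      using rc[OF ij] eps_swap[OF finite_face[OF Ul] ij] by simp
  qed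
  finally show "(\<Oplus>\<^bsub>L U\<^esub>i\<in>U. eps U i \<odot>\<^bsub>L U\<^esub> rho U i (d p \<sigma> (U - {i}))) = \<zero>\<^bsub>L U\<^esub>" .
qed

abbreviation "Z p \<equiv> cech_cocycles n fs M p"
abbreviation "B p \<equiv> cech_coboundaries n fs M p"

lemma d_zero: "d p \<zero>\<^bsub>C p\<^esub> = \<zero>\<^bsub>C (Suc p)\<^esub>"
proof -
  interpret Cp: pmodule n "C p" by (rule pmodule_C)
  show ?thesis by (rule Cp.additive_zero[OF pmodule_C]) (use d_closed d_add in blast)+
qed

lemma submod_Z: "submod n (C p) (Z p)"
proof -
  interpret Cp: pmodule n "C p" by (rule pmodule_C)
  interpret Cq: pmodule n "C (Suc p)" by (rule pmodule_C)
  show ?thesis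
    unfolding submod_def cech_cocycles_def
  proof (intro conjI ballI)
    show "\<zero>\<^bsub>C p\<^esub> \<in> {\<sigma> \<in> carrier (C p). d p \<sigma> = \<zero>\<^bsub>C (Suc p)\<^esub>}" using d_zero Cp.M.zero_closed by blast
    show "x \<oplus>\<^bsub>C p\<^esub> y \<in> {\<sigma> \<in> carrier (C p). d p \<sigma> = \<zero>\<^bsub>C (Suc p)\<^esub>}"
      if "x \<in> {\<sigma> \<in> carrier (C p). d p \<sigma> = \<zero>\<^bsub>C (Suc p)\<^esub>}" "y \<in> {\<sigma> \<in> carrier (C p). d p \<sigma> = \<zero>\<^bsub>C (Suc p)\<^esub>}" for x y
      using that d_add[of x p y] Cp.M.a_closed[of x y] Cq.M.l_zero[OF Cq.M.zero_closed] by (simp del: C_simps)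
    show "a \<odot>\<^bsub>C p\<^esub> x \<in> {\<sigma> \<in> carrier (C p). d p \<sigma> = \<zero>\<^bsub>C (Suc p)\<^esub>}"
      if "a \<in> carrier (poly_ring n)" "x \<in> {\<sigma> \<in> carrier (C p). d p \<sigma> = \<zero>\<^bsub>C (Suc p)\<^esub>}" for a x
      using that d_smult[of x p a] Cp.smult_closed[of a x] by (simp del: C_simps)
  qed auto
qed

lemma submod_B: "submod n (C p) (B p)"
proof (cases p)
  case 0
  interpret Cp: pmodule n "C 0" by (rule pmodule_C)
  show ?thesis unfolding 0 cech_coboundaries_def by (auto simp: submod_def simp del: C_simps)
next
  case (Suc q)
  interpret Cp: pmodule n "C q" by (rule pmodule_C)
  show ?thesis
    unfolding Suc cech_coboundaries_def nat.case submod_def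
  proof (intro conjI ballI)
    show "d q ` carrier (C q) \<subseteq> carrier (C (Suc q))" using d_closed by blast
    show "\<zero>\<^bsub>C (Suc q)\<^esub> \<in> d q ` carrier (C q)" using d_zero[of q] Cp.M.zero_closed by (metis imageI)
    show "x \<oplus>\<^bsub>C (Suc q)\<^esub> y \<in> d q ` carrier (C q)" if xy: "x \<in> d q ` carrier (C q)" "y \<in> d q ` carrier (C q)" for x y
    proof -
      from xy obtain u v where "u \<in> carrier (C q)" "v \<in> carrier (C q)" "x = d q u" "y = d q v" by blast
      then show ?thesis using d_add[of u q v] Cp.M.a_closed[of u v] by (metis imageI)
    qed
    show "a \<odot>\<^bsub>C (Suc q)\<^esub> x \<in> d q ` carrier (C q)"
      if a: "a \<in> carrier (poly_ring n)" and x: "x \<in> d q ` carrier (C q)" for a x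
    proof -
      from x obtain u where "u \<in> carrier (C q)" "x = d q u" by blast
      then show ?thesis using d_smult[of u q a] a Cp.smult_closed[of a u] by (metis imageI)
    qed
  qed
qed

lemma B_subset_Z: "B p \<subseteq> Z p"
proof (cases p)
  case 0
  show ?thesis unfolding 0 using submodD(3)[OF submod_Z] by (auto simp: cech_coboundaries_def simp del: C_simps)
next
  case (Suc q)
  show ?thesis unfolding Suc cech_coboundaries_def cech_cocycles_def nat.case using d_closed d_d by blast
qed

end

section \<open>Cohomology modules as images of the cocycles\<close>

lemma (in pmodule) coset_iff: "x \<in> carrier M \<Longrightarrow> w \<in> B +>\<^bsub>M\<^esub> x \<longleftrightarrow> (\<exists>b\<in>B. w = b \<oplus> x)"
  by (auto simp: a_r_coset_def r_coset_def)

lemma (in pmodule) coset_eq_iff: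
  assumes B: "submod n M B" and x: "x \<in> carrier M" "y \<in> carrier M"
  shows "B +>\<^bsub>M\<^esub> x = B +>\<^bsub>M\<^esub> y \<longleftrightarrow> x \<ominus> y \<in> B"
proof
  note Bc = submodD[OF B]
  assume "B +>\<^bsub>M\<^esub> x = B +>\<^bsub>M\<^esub> y"
  moreover have "x \<in> B +>\<^bsub>M\<^esub> x" unfolding coset_iff[OF x(1)] using Bc x by (intro bexI[of _ \<zero>]) auto
  ultimately obtain b where b: "b \<in> B" "x = b \<oplus> y" using coset_iff x by auto
  then have "x \<ominus> y = b" using Bc(2)[of b] x by (simp add: a_minus_def M.a_assoc M.r_neg)
  then show "x \<ominus> y \<in> B" using b by simp
next
  note Bc = submodD[OF B]
  have *: "B +>\<^bsub>M\<^esub> x \<subseteq> B +>\<^bsub>M\<^esub> y" if xy: "x \<ominus> y \<in> B" "x \<in> carrier M" "y \<in> carrier M" for x y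
  proof
    fix w assume "w \<in> B +>\<^bsub>M\<^esub> x"
    then obtain b where b: "b \<in> B" "w = b \<oplus> x" using coset_iff xy(2) by auto
    have "x = (x \<ominus> y) \<oplus> y" using that by (simp add: a_minus_def M.a_assoc M.l_neg)
    then have "w = (b \<oplus> (x \<ominus> y)) \<oplus> y" using b that Bc(2)[of b] by (metis M.a_assoc M.minus_closed)
    then show "w \<in> B +>\<^bsub>M\<^esub> y" unfolding coset_iff[OF that(3)] using b that Bc(4) by blast
  qed
  assume xy: "x \<ominus> y \<in> B"
  moreover have "y \<ominus> x \<in> B"
  proof -
    have "y \<ominus> x = \<ominus> (x \<ominus> y)" using x by (simp add: a_minus_def M.minus_add M.a_comm)
    then show ?thesis using kspace_uminus[OF submod_kspace[OF B] xy] by simp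
  qed
  ultimately show "B +>\<^bsub>M\<^esub> x = B +>\<^bsub>M\<^esub> y" using * x by blast
qed

text \<open>Translates cosets and their renaming into a presentation. The second claim identifies
  the kernel, so that stability of the kernel becomes stability of the coboundaries.\<close>

lemma (in pmodule) presents_subquotient:
  assumes Z: "submod n M Z" and B: "submod n M B" and BZ: "B \<subseteq> Z"
    and inj: "inj_on \<phi> (carrier (subquotient M Z B))"
  defines "\<pi> \<equiv> \<lambda>z. \<phi> (B +>\<^bsub>M\<^esub> z)" and "Q \<equiv> gmod_image \<phi> (subquotient M Z B)"
  shows "presents n M Z \<pi> Q" "\<And>x. x \<in> Z \<Longrightarrow> \<pi> x = \<zero>\<^bsub>Q\<^esub> \<longleftrightarrow> x \<in> B"
proof -
  note Zc = submodD[OF Z] and Bc = submodD[OF B]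
  let ?S = "subquotient M Z B"
  have S: "carrier ?S = (\<lambda>z. B +>\<^bsub>M\<^esub> z) ` Z" "\<zero>\<^bsub>?S\<^esub> = B" "\<And>X Y. X \<oplus>\<^bsub>?S\<^esub> Y = X <+>\<^bsub>M\<^esub> Y"
    "\<And>a X. a \<odot>\<^bsub>?S\<^esub> X = (\<Union>x\<in>X. B +>\<^bsub>M\<^esub> (a \<odot>\<^bsub>M\<^esub> x))"
    "\<And>d. hcomp ?S d = (\<lambda>z. B +>\<^bsub>M\<^esub> z) ` (Z \<inter> hcomp M d)"
    by (simp_all add: subquotient_def)
  have inv: "inv_into (carrier ?S) \<phi> (\<phi> (B +>\<^bsub>M\<^esub> z)) = B +>\<^bsub>M\<^esub> z" if "z \<in> Z" for z
    using inv_into_f_f[OF inj] that S(1) by auto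
  have B0: "B +>\<^bsub>M\<^esub> \<zero> = B"
    using Bc(2) by (auto simp: set_eq_iff coset_iff)
  have add: "(B +>\<^bsub>M\<^esub> x) <+>\<^bsub>M\<^esub> (B +>\<^bsub>M\<^esub> y) = B +>\<^bsub>M\<^esub> (x \<oplus> y)" if xy: "x \<in> carrier M" "y \<in> carrier M" for x y
  proof (rule Set.set_eqI)
    fix w
    have "w \<in> (B +>\<^bsub>M\<^esub> x) <+>\<^bsub>M\<^esub> (B +>\<^bsub>M\<^esub> y) \<longleftrightarrow> (\<exists>b\<in>B. \<exists>b'\<in>B. w = (b \<oplus> x) \<oplus> (b' \<oplus> y))"
    proof -
      have "w \<in> (B +>\<^bsub>M\<^esub> x) <+>\<^bsub>M\<^esub> (B +>\<^bsub>M\<^esub> y) \<longleftrightarrow>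
          (\<exists>u v. u \<in> B +>\<^bsub>M\<^esub> x \<and> v \<in> B +>\<^bsub>M\<^esub> y \<and> w = u \<oplus> v)"
        by (auto simp: set_add_def set_mult_def)
      then show ?thesis unfolding coset_iff[OF xy(1)] coset_iff[OF xy(2)] by blast
    qed
    also have "\<dots> \<longleftrightarrow> (\<exists>b\<in>B. \<exists>b'\<in>B. w = (b \<oplus> b') \<oplus> (x \<oplus> y))"
    proof -
      have "(b \<oplus> x) \<oplus> (b' \<oplus> y) = (b \<oplus> b') \<oplus> (x \<oplus> y)" if "b \<in> B" "b' \<in> B" for b b'
        using xy that Bc(2) by (simp add: M.a_ac)
      then show ?thesis by auto
    qed
    also have "\<dots> \<longleftrightarrow> (\<exists>b\<in>B. w = b \<oplus> (x \<oplus> y))"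
    proof
      assume "\<exists>b\<in>B. w = b \<oplus> (x \<oplus> y)"
      then obtain b where b: "b \<in> B" "w = b \<oplus> (x \<oplus> y)" by auto
      have "b = b \<oplus> \<zero>" using b(1) Bc(2) by simp
      then show "\<exists>b\<in>B. \<exists>b'\<in>B. w = (b \<oplus> b') \<oplus> (x \<oplus> y)" using b Bc(3) by metis
    qed (use Bc(4) in blast)
    finally show "w \<in> (B +>\<^bsub>M\<^esub> x) <+>\<^bsub>M\<^esub> (B +>\<^bsub>M\<^esub> y) \<longleftrightarrow> w \<in> B +>\<^bsub>M\<^esub> (x \<oplus> y)"
      using xy by (simp add: coset_iff)
  qed
  have sm: "(\<Union>x'\<in>B +>\<^bsub>M\<^esub> x. B +>\<^bsub>M\<^esub> (a \<odot> x')) = B +>\<^bsub>M\<^esub> (a \<odot> x)"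
    if x: "x \<in> carrier M" and a: "a \<in> carrier (poly_ring n)" for x a
  proof -
    have "B +>\<^bsub>M\<^esub> (a \<odot> x') = B +>\<^bsub>M\<^esub> (a \<odot> x)" if x': "x' \<in> B +>\<^bsub>M\<^esub> x" for x'
    proof -
      obtain b where b: "b \<in> B" "x' = b \<oplus> x" using x' x by (auto simp: coset_iff)
      have bc: "b \<in> carrier M" using b Bc by auto
      have "a \<odot> x' \<ominus> a \<odot> x = a \<odot> b"
        using x a bc b(2) by (simp add: smult_r_distr a_minus_def M.a_assoc M.r_neg)
      then show ?thesis using x a bc b Bc(5) by (subst coset_eq_iff[OF B]) auto
    qed
    moreover have "x \<in> B +>\<^bsub>M\<^esub> x" unfolding coset_iff[OF x] using Bc x by (intro bexI[of _ \<zero>]) auto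
    ultimately show ?thesis by blast
  qed
  show "presents n M Z \<pi> Q"
    unfolding presents_def
  proof (intro conjI ballI allI)
    show "submod n M Z" by fact
    show "carrier Q = \<pi> ` Z" by (auto simp: Q_def \<pi>_def gmod_image_def Let_def S(1))
    show "\<zero>\<^bsub>Q\<^esub> = \<pi> \<zero>" by (simp add: Q_def \<pi>_def gmod_image_def Let_def S(2) B0)
    show "\<pi> x \<oplus>\<^bsub>Q\<^esub> \<pi> y = \<pi> (x \<oplus> y)" if "x \<in> Z" "y \<in> Z" for x y
      using that Zc(2) by (simp add: Q_def \<pi>_def gmod_image_def Let_def inv S(3) add)
    show "a \<odot>\<^bsub>Q\<^esub> \<pi> x = \<pi> (a \<odot> x)" if "a \<in> carrier (poly_ring n)" "x \<in> Z" for a x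
      using that Zc(2) by (simp add: Q_def \<pi>_def gmod_image_def Let_def inv S(4) sm)
    show "hcomp Q d = \<pi> ` (Z \<inter> hcomp M d)" for d
      by (simp add: Q_def \<pi>_def gmod_image_def Let_def S(5) image_image)
  qed
  show "\<pi> x = \<zero>\<^bsub>Q\<^esub> \<longleftrightarrow> x \<in> B" if "x \<in> Z" for x
  proof -
    have "\<pi> x = \<zero>\<^bsub>Q\<^esub> \<longleftrightarrow> \<phi> (B +>\<^bsub>M\<^esub> x) = \<phi> (B +>\<^bsub>M\<^esub> \<zero>)"
      by (simp add: Q_def \<pi>_def gmod_image_def Let_def S(2) B0)
    also have "\<dots> \<longleftrightarrow> B +>\<^bsub>M\<^esub> x = B +>\<^bsub>M\<^esub> \<zero>"
      using inj_on_eq_iff[OF inj] that Zc(3) S(1) by auto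
    also have "\<dots> \<longleftrightarrow> x \<in> B"
    proof -
      have "(- 1) \<odot> \<zero> = \<zero>" by (intro smult_r_null) auto
      then have z: "\<ominus> \<zero> = \<zero>" using sm_uminus_one[OF M.zero_closed] by metis
      have xc: "x \<in> carrier M" using that Zc(2) by blast
      have "x \<ominus> \<zero> = x" unfolding a_minus_def z using xc by (rule M.r_zero)
      then show ?thesis using coset_eq_iff[OF B xc M.zero_closed] by metis
    qed
    finally show ?thesis .
  qed
qed

lemma (in pmodule) kspace_finsum:
  assumes U: "kspace M U" and "finite A" "\<And>i. i \<in> A \<Longrightarrow> f i \<in> U"
  shows "finsum M f A \<in> U"
  using assms(2,3)
proof (induction A rule: finite_induct)
  case empty
  then show ?case using kspaceD[OF U] by simp
next
  case (insert a A)
  have "f \<in> A \<rightarrow> carrier M" "f a \<in> carrier M" using insert kspaceD(2)[OF U] by auto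
  then show ?case using insert kspaceD(4)[OF U] by simp
qed

section \<open>Descent data of Cech cohomology\<close>

context cech
begin

text \<open>Signs are constants and hence preserve every k-subspace, in particular the coefficient
  modules.\<close>

lemma eps_pconst: "eps T j = pconst ((- 1) ^ card {l \<in> T. l < j})"
proof -
  have "pconst ((- 1) ^ m) = ((- 1) ^ m :: 'k mpoly)" for m
    by (induction m) (simp_all add: pconst_mult pconst_uminus)
  then show ?thesis by (simp add: eps_def)
qed

text \<open>The Cech differential carries coefficient modules to coefficient modules and so commutes
  with extraction of coefficients. Kernels and images of such maps are stable under extraction,
  which is what passage to the subquotient demands.\<close>

lemma frob_struct_cohomology:
  assumes char: "CHAR('k) = p" "p > Suc 0" and M: "frob_struct n p M N"
    and hom: "\<And>f. f \<in> set fs \<Longrightarrow> \<exists>d. f \<in> homog n d"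
    and inj: "inj_on \<phi> (carrier (cech_cohomology n fs r M))"
  shows "\<exists>N'. frob_struct n p (gmod_image \<phi> (cech_cohomology n fs r M)) N'"
proof -
  have "\<forall>j<length fs. \<exists>d. fs ! j \<in> homog n d" using hom nth_mem by blast
  then obtain D where D: "\<And>j. j < length fs \<Longrightarrow> fs ! j \<in> homog n (D j)" by metis
  define NL where "NL = (\<lambda>S e. loc_N M (p ^ e) (N e) (F S) (sum D S))"
  define NC where "NC = (\<lambda>r e d0. \<Pi>\<^sub>E S\<in>faces fs r. NL S e d0)"
  obtain \<kappa>M where \<kappa>M: "\<And>e. frob_level n M (p ^ e) (N e) (\<kappa>M e)" using frob_struct_level[OF M] by blast
  have L: "frob_struct n p (L S) (NL S)" if "S \<subseteq> {..<length fs}" for S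
  proof -
    have "F S \<in> homog n (sum D S)"
      unfolding face_prod_def using that finite_face[OF that] D by (intro homog_prod) auto
    then show ?thesis unfolding NL_def by (rule frob_struct_loc[OF char M])
  qed
  have Cs: "frob_struct n p (C r) (NC r)" for r
    unfolding cech_cochains_def NC_def using char(2) L facesD finite_faces
    by (intro frob_struct_dsum) auto
  \<comment> \<open>A fraction u / F^(q k) goes to (g^(q k) u) / (F g)^(q k), and g^(q k) = (g^k)^q
    lies in R^(q).\<close>
  have rhoN: "rho T j X \<in> NL T e d0"
    if T: "T \<subseteq> {..<length fs}" "j \<in> T" and X: "X \<in> NL (T - {j}) e d0" for T j X e d0
  proof -
    let ?q = "p ^ e"
    have j: "j < length fs" using T by auto
    from X obtain u k where u: "X = fr (T - {j}) u (?q * k)" "u \<in> N e (d0 + int k * sum D (T - {j}))"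
      by (auto simp: NL_def loc_N_def)
    have uc: "u \<in> carrier M" using frob_level.N_carrier[OF \<kappa>M u(2)] .
    have e1: "(fs ! j) ^ (?q * k) = ((fs ! j) ^ k) ^ ?q" by (simp add: power_mult mult.commute)
    have "(fs ! j) ^ (?q * k) \<in> frob_polys n ?q"
      unfolding e1 using frobenius_power_in_frob_polys[of p "(fs ! j) ^ k" n e] char nth_in[OF j] by simp
    moreover have "(fs ! j) ^ (?q * k) \<in> homog n (int ?q * (int k * D j))"
      using homog_power[OF D[OF j], of "?q * k"] by (simp add: mult.assoc)
    ultimately have "(fs ! j) ^ (?q * k) \<odot> u \<in> N e (d0 + int k * sum D (T - {j}) + int k * D j)"
      using frob_level.N_smult[OF \<kappa>M _ _ u(2)] by blast
    also have "d0 + int k * sum D (T - {j}) + int k * D j = d0 + int k * sum D T"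
      using sum.remove[OF finite_face[OF T(1)] T(2), of D] by (simp add: algebra_simps)
    finally have "fr T ((fs ! j) ^ (?q * k) \<odot> u) (?q * k) \<in> NL T e d0"
      unfolding NL_def loc_N_def by blast
    then show ?thesis using rho_fr[OF T uc] u(1) by simp
  qed
  have dN: "d r \<sigma> \<in> NC (Suc r) e d0" if \<sigma>: "\<sigma> \<in> NC r e d0" for r \<sigma> e d0
    unfolding NC_def d_eq
  proof (rule restrict_PiE_iff[THEN iffD2], rule ballI)
    fix T assume T: "T \<in> faces fs (Suc r)"
    note Tl = facesD[OF T]
    interpret LT: pmodule n "L T" using pmodule_L[OF Tl] .
    obtain \<kappa>T where \<kappa>T: "\<And>e. frob_level n (L T) (p ^ e) (NL T e) (\<kappa>T e)"
      using frob_struct_level[OF L[OF Tl]] by blast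
    have kT: "kspace (L T) (NL T e d0)" using frob_level.kspace_N[OF \<kappa>T] .
    show "(\<Oplus>\<^bsub>L T\<^esub>j\<in>T. eps T j \<odot>\<^bsub>L T\<^esub> rho T j (\<sigma> (T - {j}))) \<in> NL T e d0"
    proof (rule LT.kspace_finsum[OF kT finite_face[OF Tl]])
      fix j assume j: "j \<in> T"
      have "\<sigma> (T - {j}) \<in> NL (T - {j}) e d0" using \<sigma> faces_remove[OF T j] by (auto simp: NC_def)
      then show "eps T j \<odot>\<^bsub>L T\<^esub> rho T j (\<sigma> (T - {j})) \<in> NL T e d0"
        unfolding eps_pconst using rhoN[OF Tl j] kspaceD(5)[OF kT] by blast
    qed
  qed
  have "\<exists>\<kappa>. \<forall>e. frob_level n (C r) (p ^ e) (NC r e) (\<kappa> e)" for r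
    using frob_struct_level[OF Cs[of r]] by metis
  then obtain \<kappa> where \<kappa>: "\<And>r e. frob_level n (C r) (p ^ e) (NC r e) (\<kappa> r e)" by metis
  have comm: "\<kappa> (Suc r) e a d0 (d r \<sigma>) = d r (\<kappa> r e a d0 \<sigma>)"
    if "a \<in> box n (p ^ e)" "\<sigma> \<in> carrier (C r)" for r e a d0 \<sigma>
  proof -
    \<comment> \<open>The differential preserves degrees, so \<open>kap_commute\<close> is used with
      shift 0.\<close>
    have "\<kappa> (Suc r) e a (d0 + 0) (d r \<sigma>) = d r (\<kappa> r e a d0 \<sigma>)"
    proof (rule frob_level.kap_commute[OF \<kappa> \<kappa>])
      show "d r \<in> carrier (C r) \<rightarrow> carrier (C (Suc r))" using d_closed by blast
      show "d r (x \<oplus>\<^bsub>C r\<^esub> y) = d r x \<oplus>\<^bsub>C (Suc r)\<^esub> d r y" if "x \<in> carrier (C r)" "y \<in> carrier (C r)" for x y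
        using d_add that by blast
      show "d r (xpow a \<odot>\<^bsub>C r\<^esub> u) = xpow a \<odot>\<^bsub>C (Suc r)\<^esub> d r u"
        if "a \<in> box n (p ^ e)" "u \<in> carrier (C r)" for a u
        using d_smult[OF that(2)] that(1) by (blast intro: xpow_in_poly_ring boxD)
      show "d r u \<in> NC (Suc r) e (d0 + 0)" if "u \<in> NC r e d0" for d0 u using dN[OF that] by simp
    qed (use that in auto)
    then show ?thesis by simp
  qed
  interpret Cr: pmodule n "C r" by (rule pmodule_C)
  define H where "H = gmod_image \<phi> (subquotient (C r) (Z r) (B r))"
  define \<pi> where "\<pi> = (\<lambda>z. \<phi> (B r +>\<^bsub>C r\<^esub> z))"
  note pres = Cr.presents_subquotient[OF submod_Z submod_B B_subset_Z inj[unfolded cech_cohomology_def],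
      folded H_def \<pi>_def]
  have Zk: "\<kappa> r e a d0 x \<in> Z r" if a: "a \<in> box n (p ^ e)" and x: "x \<in> Z r" for e a d0 x
  proof -
    have xc: "x \<in> carrier (C r)" "d r x = \<zero>\<^bsub>C (Suc r)\<^esub>" using x by (simp_all add: cech_cocycles_def del: C_simps)
    have "d r (\<kappa> r e a d0 x) = \<zero>\<^bsub>C (Suc r)\<^esub>"
      using comm[OF a xc(1), of d0] frob_level.kap_zero[OF \<kappa> a] unfolding xc(2) by simp
    then show ?thesis using frob_level.kap_closed[OF \<kappa> a xc(1)] by (simp add: cech_cocycles_def del: C_simps)
  qed
  have Bk: "\<kappa> r e a d0 x \<in> B r" if a: "a \<in> box n (p ^ e)" and x: "x \<in> B r" for e a d0 x
  proof (cases r)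
    case 0
    then have "x = \<zero>\<^bsub>C r\<^esub>" using x by (simp add: cech_coboundaries_def del: C_simps)
    then show ?thesis using frob_level.kap_zero[OF \<kappa> a, of r d0] submodD(3)[OF submod_B, of r] by (simp del: C_simps)
  next
    case (Suc s)
    then obtain y where y: "y \<in> carrier (C s)" "x = d s y" using x by (auto simp: cech_coboundaries_def simp del: C_simps)
    have "\<kappa> r e a d0 x = d s (\<kappa> s e a d0 y)" using comm[OF a y(1), of d0] y(2) Suc by simp
    then show ?thesis using frob_level.kap_closed[OF \<kappa> a y(1)] Suc by (simp add: cech_coboundaries_def del: C_simps)
  qed
  have BZ: "x \<in> B r \<Longrightarrow> x \<in> Z r" for x using B_subset_Z by blast
  have "frob_struct n p H (\<lambda>e d. \<pi> ` (Z r \<inter> NC r e d))"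
  proof (rule frob_struct_presents[OF Cs \<kappa> pres(1)])
    show "\<kappa> r e a d0 x \<in> Z r" if "a \<in> box n (p ^ e)" "x \<in> Z r" for e a d0 x using Zk that .
    show "\<pi> (\<kappa> r e a d0 x) = \<zero>\<^bsub>H\<^esub>" if "a \<in> box n (p ^ e)" "x \<in> Z r" "\<pi> x = \<zero>\<^bsub>H\<^esub>" for e a d0 x
    proof -
      have "x \<in> B r" using pres(2)[OF that(2)] that(3) unfolding \<pi>_def by blast
      then have "\<kappa> r e a d0 x \<in> B r" using Bk[OF that(1)] by blast
      then show ?thesis using pres(2)[OF BZ] unfolding \<pi>_def by blast
    qed
  qed
  then show ?thesis unfolding H_def cech_cohomology_def by blast
qed

text \<open>After inverting the generator \<open>fs ! j\<close>, the complex has the contracting homotopy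
  \<open>(h \<sigma>) S = \<plusminus> \<sigma> (insert j S)\<close>. We clear denominators in this homotopy.\<close>

lemma rho_kernel:
  assumes T: "insert j T \<subseteq> {..<length fs}" "j \<notin> T" and X: "X \<in> carrier (L T)"
    and zero: "rho (insert j T) j X = \<zero>\<^bsub>L (insert j T)\<^esub>"
  shows "\<exists>k. (fs ! j) ^ k \<odot>\<^bsub>L T\<^esub> X = \<zero>\<^bsub>L T\<^esub>"
proof -
  let ?g = "fs ! j" and ?U = "insert j T"
  have T': "T \<subseteq> {..<length fs}" and j: "j < length fs" using T by auto
  have g: "?g \<in> carrier (poly_ring n)" using nth_in[OF j] .
  have UT: "?U - {j} = T" using T by auto
  obtain y k where y: "y \<in> carrier M" "X = fr T y k" using carrier_L_cases[OF T' X] .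
  have gy: "?g ^ k \<odot> y \<in> carrier M" using g y by auto
  have "fr ?U (?g ^ k \<odot> y) k = \<zero>\<^bsub>L ?U\<^esub>"
    using rho_fr[OF T(1), of j y k] UT y zero by simp
  then obtain t where t: "F ?U ^ t \<odot> (?g ^ k \<odot> y) = \<zero>"
    using ploc.frac_eq_zero_iff[OF ploc_F[OF T(1)] gy] by auto
  have FU: "F ?U = F T * ?g" using F_remove[OF T(1), of j] UT by simp
  have "F T ^ t \<odot> (?g ^ (t + k) \<odot> y) = (F T ^ t * (?g ^ t * ?g ^ k)) \<odot> y"
    using F_in[OF T'] g y by (simp add: power_add sm_mult)
  also have "\<dots> = F ?U ^ t \<odot> (?g ^ k \<odot> y)"
    using F_in[OF T'] g y by (simp add: FU power_mult_distrib sm_mult)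
  finally have "F T ^ t \<odot> (?g ^ (t + k) \<odot> y) = \<zero>" using t by simp
  moreover have "?g ^ (t + k) \<odot> y \<in> carrier M" using g y by auto
  ultimately have "fr T (?g ^ (t + k) \<odot> y) k = \<zero>\<^bsub>L T\<^esub>"
    using ploc.frac_eq_zero_iff[OF ploc_F[OF T']] by blast
  then have "?g ^ (t + k) \<odot>\<^bsub>L T\<^esub> X = \<zero>\<^bsub>L T\<^esub>"
    using ploc.smult_frac[OF ploc_F[OF T'], of "?g ^ (t + k)" y k] g y by simp
  then show ?thesis by blast
qed

text \<open>This handles the error of the homotopy: on a face avoiding \<open>j\<close>, vanishing
  after inverting f_j means being killed by a power of f_j, and the finitely many faces admit a
  common exponent.\<close>

lemma nilpotent_cochain:
  assumes j: "j < length fs" and w: "w \<in> carrier (C r)"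
    and w1: "\<And>T. T \<in> faces fs r \<Longrightarrow> j \<in> T \<Longrightarrow> w T = \<zero>\<^bsub>L T\<^esub>"
    and w2: "\<And>T. T \<in> faces fs r \<Longrightarrow> j \<notin> T \<Longrightarrow> rho (insert j T) j (w T) = \<zero>\<^bsub>L (insert j T)\<^esub>"
  shows "\<exists>k. (fs ! j) ^ k \<odot>\<^bsub>C r\<^esub> w = \<zero>\<^bsub>C r\<^esub>"
proof -
  have "\<exists>k. (fs ! j) ^ k \<odot>\<^bsub>L T\<^esub> w T = \<zero>\<^bsub>L T\<^esub>" if T: "T \<in> faces fs r" for T
  proof -
    interpret LT: pmodule n "L T" using pmodule_L[OF facesD[OF T]] .
    have wT: "w T \<in> carrier (L T)" using w T by auto
    show ?thesis
    proof (cases "j \<in> T")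
      case True
      then have "(fs ! j) ^ 0 \<odot>\<^bsub>L T\<^esub> w T = \<zero>\<^bsub>L T\<^esub>" using w1[OF T] by simp
      then show ?thesis by blast
    next
      case False
      then show ?thesis using rho_kernel[OF _ False wT w2[OF T False]] facesD[OF T] j by simp
    qed
  qed
  then obtain k where k: "\<And>T. T \<in> faces fs r \<Longrightarrow> (fs ! j) ^ k T \<odot>\<^bsub>L T\<^esub> w T = \<zero>\<^bsub>L T\<^esub>" by metis
  define K where "K = sum k (faces fs r)"
  have "(fs ! j) ^ K \<odot>\<^bsub>L T\<^esub> w T = \<zero>\<^bsub>L T\<^esub>" if T: "T \<in> faces fs r" for T
  proof -
    interpret LT: pmodule n "L T" using pmodule_L[OF facesD[OF T]] .
    have wT: "w T \<in> carrier (L T)" using w T by auto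
    have "k T \<le> K" unfolding K_def using T finite_faces by (intro member_le_sum) auto
    then have "(fs ! j) ^ K = (fs ! j) ^ (K - k T) * (fs ! j) ^ k T" by (simp flip: power_add)
    then have "(fs ! j) ^ K \<odot>\<^bsub>L T\<^esub> w T = (fs ! j) ^ (K - k T) \<odot>\<^bsub>L T\<^esub> ((fs ! j) ^ k T \<odot>\<^bsub>L T\<^esub> w T)"
      using nth_in[OF j] wT by (simp add: LT.sm_mult)
    then show ?thesis using k[OF T] nth_in[OF j] LT.smult_r_null[of "(fs ! j) ^ (K - k T)"] by auto
  qed
  then have "(fs ! j) ^ K \<odot>\<^bsub>C r\<^esub> w = \<zero>\<^bsub>C r\<^esub>" by (auto simp: fun_eq_iff)
  then show ?thesis by blast
qed

lemma common_denominator: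
  assumes \<sigma>: "\<sigma> \<in> carrier (C r)"
  obtains x K where "\<And>S. S \<in> faces fs r \<Longrightarrow> x S \<in> carrier M \<and> \<sigma> S = fr S (x S) K"
proof -
  have "\<exists>x k. x \<in> carrier M \<and> \<sigma> S = fr S x k" if S: "S \<in> faces fs r" for S
  proof -
    have "\<sigma> S \<in> carrier (L S)" using \<sigma> S by auto
    then show ?thesis using carrier_L_cases[OF facesD[OF S]] by metis
  qed
  then obtain y k where y: "\<And>S. S \<in> faces fs r \<Longrightarrow> y S \<in> carrier M \<and> \<sigma> S = fr S (y S) (k S)" by metis
  define K where "K = sum k (faces fs r)"
  have "F S ^ (K - k S) \<odot> y S \<in> carrier M \<and> \<sigma> S = fr S (F S ^ (K - k S) \<odot> y S) K" if S: "S \<in> faces fs r" for S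
  proof -
    have "k S \<le> K" unfolding K_def using S finite_faces by (intro member_le_sum) auto
    then show ?thesis
      using y[OF S] ploc.frac_shift[OF ploc_F[OF facesD[OF S]], of "y S" "K - k S" "k S"] F_in[OF facesD[OF S]] by simp
  qed
  then show thesis by (rule that)
qed

lemma rho_zero:
  assumes T: "T \<subseteq> {..<length fs}" "j \<in> T"
  shows "rho T j \<zero>\<^bsub>L (T - {j})\<^esub> = \<zero>\<^bsub>L T\<^esub>"
proof -
  have T': "T - {j} \<subseteq> {..<length fs}" using T by auto
  interpret P: pmodule n "L (T - {j})" using pmodule_L[OF T'] .
  show ?thesis by (rule P.additive_zero[OF pmodule_L[OF T(1)]]) (use rho_closed[OF T] rho_add[OF T] in auto)
qed

text \<open>Multiplied by g^K the homotopy is defined before inverting g. Its differential agrees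
  with g^K \<sigma> on faces containing \<open>j0\<close>, and on the others after inverting g; a
  further power of g removes the discrepancy.\<close>

lemma homotopy:
  assumes j0: "j0 < length fs" and \<sigma>: "\<sigma> \<in> Z (Suc r)"
  shows "\<exists>k. \<exists>\<tau>\<in>carrier (C r). (fs ! j0) ^ k \<odot>\<^bsub>C (Suc r)\<^esub> \<sigma> = d r \<tau>"
proof -
  let ?g = "fs ! j0"
  have g: "?g \<in> carrier (poly_ring n)" using nth_in[OF j0] .
  have \<sigma>c: "\<sigma> \<in> carrier (C (Suc r))" and \<sigma>d: "d (Suc r) \<sigma> = \<zero>\<^bsub>C (Suc (Suc r))\<^esub>"
    using \<sigma> by (simp_all add: cech_cocycles_def del: C_simps)
  obtain x K where x: "\<And>S. S \<in> faces fs (Suc r) \<Longrightarrow> x S \<in> carrier M \<and> \<sigma> S = fr S (x S) K"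
    using common_denominator[OF \<sigma>c] by blast
  have gK: "?g ^ K \<in> carrier (poly_ring n)" using g by simp
  \<comment> \<open>On a face \<open>S\<close> without \<open>j0\<close>, \<sigma> (insert j0 S) is
    x / (F S g)^K. Omitting g^K from the denominator gives an element of the localization at F S,
    formally g^K times the value of the homotopy.\<close>
  define \<tau> where "\<tau> = (\<lambda>S\<in>faces fs r. if j0 \<in> S then \<zero>\<^bsub>L S\<^esub> else
      eps (insert j0 S) j0 \<odot>\<^bsub>L S\<^esub> fr S (x (insert j0 S)) K)"
  have ins: "insert j0 S \<in> faces fs (Suc r)" if "S \<in> faces fs r" "j0 \<notin> S" for S
    using that j0 by (auto simp: faces_def finite_face)
  have \<tau>c: "\<tau> \<in> carrier (C r)"
    unfolding C_simps \<tau>_def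
  proof (rule restrict_PiE_iff[THEN iffD2], rule ballI)
    fix S assume S: "S \<in> faces fs r"
    interpret LS: pmodule n "L S" using pmodule_L[OF facesD[OF S]] .
    show "(if j0 \<in> S then \<zero>\<^bsub>L S\<^esub> else eps (insert j0 S) j0 \<odot>\<^bsub>L S\<^esub> fr S (x (insert j0 S)) K) \<in> carrier (L S)"
      using x[OF ins[OF S]] ploc.frac_closed[OF ploc_F[OF facesD[OF S]]] by auto
  qed
  \<comment> \<open>Removing an index other than \<open>j0\<close> leaves a face that contains
    \<open>j0\<close>, where \<tau> vanishes. Only the term for \<open>j0\<close> survives, and its
    sign occurs squared.\<close>
  have d\<tau>1: "d r \<tau> T = ?g ^ K \<odot>\<^bsub>L T\<^esub> \<sigma> T" if T: "T \<in> faces fs (Suc r)" "j0 \<in> T" for T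
  proof -
    note Tl = facesD[OF T(1)]
    interpret LT: pmodule n "L T" using pmodule_L[OF Tl] .
    have \<sigma>T: "\<sigma> T \<in> carrier (L T)" using \<sigma>c T by auto
    have "d r \<tau> T = (\<Oplus>\<^bsub>L T\<^esub>j\<in>T. if j0 = j then ?g ^ K \<odot>\<^bsub>L T\<^esub> \<sigma> T else \<zero>\<^bsub>L T\<^esub>)"
      unfolding d_eq using T(1)
    proof (simp only: restrict_apply if_True, intro LT.M.finsum_cong')
      fix j assume j: "j \<in> T"
      have TS: "T - {j} \<in> faces fs r" using faces_remove[OF T(1) j] .
      show "eps T j \<odot>\<^bsub>L T\<^esub> rho T j (\<tau> (T - {j})) = (if j0 = j then ?g ^ K \<odot>\<^bsub>L T\<^esub> \<sigma> T else \<zero>\<^bsub>L T\<^esub>)"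
      proof (cases "j0 = j")
        case False
        then have "\<tau> (T - {j}) = \<zero>\<^bsub>L (T - {j})\<^esub>" using TS T(2) by (simp add: \<tau>_def)
        then show ?thesis using rho_zero[OF Tl j] False LT.smult_r_null[of "eps T j"] by simp
      next
        case True
        have xT: "x T \<in> carrier M" "\<sigma> T = fr T (x T) K" using x[OF T(1)] by auto
        have i: "insert j0 (T - {j}) = T" using True j by auto
        then have \<tau>e: "\<tau> (T - {j}) = eps T j \<odot>\<^bsub>L (T - {j})\<^esub> fr (T - {j}) (x T) K"
          using TS True by (simp add: \<tau>_def)
        have c: "fr (T - {j}) (x T) K \<in> carrier (L (T - {j}))"
          using ploc.frac_closed[OF ploc_F[OF facesD[OF TS]] xT(1)] .
        have "rho T j (\<tau> (T - {j})) = eps T j \<odot>\<^bsub>L T\<^esub> fr T (?g ^ K \<odot> x T) K"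
          unfolding \<tau>e using rho_smult[OF Tl j c eps_in] rho_fr[OF Tl j xT(1)] True by simp
        also have "fr T (?g ^ K \<odot> x T) K = ?g ^ K \<odot>\<^bsub>L T\<^esub> \<sigma> T"
          using ploc.smult_frac[OF ploc_F[OF Tl] gK xT(1)] xT(2) by simp
        finally have "eps T j \<odot>\<^bsub>L T\<^esub> rho T j (\<tau> (T - {j})) = (eps T j * eps T j) \<odot>\<^bsub>L T\<^esub> (?g ^ K \<odot>\<^bsub>L T\<^esub> \<sigma> T)"
          using gK \<sigma>T by (simp add: LT.sm_mult)
        then show ?thesis using True gK \<sigma>T by (simp add: eps_square)
      qed
    qed (use gK \<sigma>T in auto)
    also have "\<dots> = ?g ^ K \<odot>\<^bsub>L T\<^esub> \<sigma> T"
      using T finite_face[OF Tl] gK \<sigma>T by (intro LT.M.finsum_singleton) auto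
    finally show ?thesis .
  qed
  \<comment> \<open>The cocycle condition on insert j0 T expresses the image of \<sigma> T through
    \<sigma> on the other faces of insert j0 T; up to the factor \<open>c\<close> below these are
    the terms of d \<tau>.\<close>
  have d\<tau>2: "rho (insert j0 T) j0 (d r \<tau> T) = rho (insert j0 T) j0 (?g ^ K \<odot>\<^bsub>L T\<^esub> \<sigma> T)"
    if T: "T \<in> faces fs (Suc r)" "j0 \<notin> T" for T
  proof -
    define U where "U = insert j0 T"
    have UT: "U - {j0} = T" using T by (auto simp: U_def)
    have j0U: "j0 \<in> U" by (simp add: U_def)
    have U: "U \<in> faces fs (Suc (Suc r))" using T j0 facesD[OF T(1)] by (auto simp: U_def faces_def finite_face)
    note Tl = facesD[OF T(1)] and Ul = facesD[OF U]
    interpret LT: pmodule n "L T" using pmodule_L[OF Tl] .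
    interpret LU: pmodule n "L U" using pmodule_L[OF Ul] .
    have \<sigma>U: "\<sigma> (U - {j}) \<in> carrier (L (U - {j}))" "rho U j (\<sigma> (U - {j})) \<in> carrier (L U)" if "j \<in> U" for j
      using \<sigma>c faces_remove[OF U that] rho_closed[OF Ul that] by auto
    have \<sigma>T: "\<sigma> T \<in> carrier (L T)" "rho U j0 (\<sigma> T) \<in> carrier (L U)" using \<sigma>U[OF j0U] UT by auto
    define Y where "Y = (\<Oplus>\<^bsub>L U\<^esub>j\<in>T. eps U j \<odot>\<^bsub>L U\<^esub> rho U j (\<sigma> (U - {j})))"
    have TU: "j \<in> T \<Longrightarrow> j \<in> U" for j by (simp add: U_def)
    have tU: "eps U j \<odot>\<^bsub>L U\<^esub> rho U j (\<sigma> (U - {j})) \<in> carrier (L U)" if "j \<in> U" for j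
      using \<sigma>U(2)[OF that] by simp
    have Yc: "Y \<in> carrier (L U)" unfolding Y_def using tU TU by (intro LU.M.finsum_closed) auto
    have "\<zero>\<^bsub>L U\<^esub> = (\<Oplus>\<^bsub>L U\<^esub>j\<in>U. eps U j \<odot>\<^bsub>L U\<^esub> rho U j (\<sigma> (U - {j})))"
      using fun_cong[OF \<sigma>d, of U] U by (simp add: d_eq)
    also have "\<dots> = eps U j0 \<odot>\<^bsub>L U\<^esub> rho U j0 (\<sigma> (U - {j0})) \<oplus>\<^bsub>L U\<^esub> Y"
    proof -
      have "finsum (L U) (\<lambda>j. eps U j \<odot>\<^bsub>L U\<^esub> rho U j (\<sigma> (U - {j}))) (insert j0 T) =
          eps U j0 \<odot>\<^bsub>L U\<^esub> rho U j0 (\<sigma> (U - {j0})) \<oplus>\<^bsub>L U\<^esub> Y"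
        unfolding Y_def using T finite_face[OF Tl] tU TU j0U by (intro LU.M.finsum_insert) auto
      then show ?thesis by (simp only: U_def[symmetric])
    qed
    finally have cyc: "eps U j0 \<odot>\<^bsub>L U\<^esub> rho U j0 (\<sigma> T) \<oplus>\<^bsub>L U\<^esub> Y = \<zero>\<^bsub>L U\<^esub>" using UT by simp
    have Y: "Y = (- eps U j0) \<odot>\<^bsub>L U\<^esub> rho U j0 (\<sigma> T)"
      using cyc Yc \<sigma>T by (metis LU.sm_uminus LU.M.minus_equality LU.M.a_comm LU.smult_closed LU.M.minus_minus eps_in)
    \<comment> \<open>The factor relating the terms of d \<tau> to those of \<open>Y\<close>; by
      \<open>eps_swap\<close> it is the same for all \<open>j\<close>.\<close>
    define c where "c = - (eps U j0 * ?g ^ K)"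
    have c: "c \<in> carrier (poly_ring n)" using gK by (auto simp: c_def)
    have term_c: "eps T j \<odot>\<^bsub>L T\<^esub> rho T j (\<tau> (T - {j})) \<in> carrier (L T)" if "j \<in> T" for j
      using summand_closed[OF \<tau>c T(1) that] by simp
    have "rho U j0 (d r \<tau> T) = rho U j0 (\<Oplus>\<^bsub>L T\<^esub>j\<in>T. eps T j \<odot>\<^bsub>L T\<^esub> rho T j (\<tau> (T - {j})))"
      using T by (simp add: d_eq)
    also have "\<dots> = (\<Oplus>\<^bsub>L U\<^esub>j\<in>T. rho U j0 (eps T j \<odot>\<^bsub>L T\<^esub> rho T j (\<tau> (T - {j}))))"
      using rho_closed[OF Ul j0U] rho_add[OF Ul j0U] term_c finite_face[OF Tl] UT
      by (intro LT.additive_finsum[OF LU.pmodule_axioms]) auto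
    also have "\<dots> = (\<Oplus>\<^bsub>L U\<^esub>j\<in>T. c \<odot>\<^bsub>L U\<^esub> (eps U j \<odot>\<^bsub>L U\<^esub> rho U j (\<sigma> (U - {j}))))"
    proof (rule LU.M.finsum_cong')
      fix j assume j: "j \<in> T"
      then have jU: "j \<in> U" and jj: "j \<noteq> j0" using T by (auto simp: U_def)
      have TS: "T - {j} \<in> faces fs r" using faces_remove[OF T(1) j] .
      have US: "U - {j} \<in> faces fs (Suc r)" using faces_remove[OF U jU] .
      have i: "insert j0 (T - {j}) = U - {j}" using jj by (auto simp: U_def)
      have i2: "U - {j} - {j0} = T - {j}" using T by (auto simp: U_def)
      have j0T: "j0 \<notin> T - {j}" using T by simp
      have xU: "x (U - {j}) \<in> carrier M" "\<sigma> (U - {j}) = fr (U - {j}) (x (U - {j})) K" using x[OF US] by auto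
      define y where "y = fr (T - {j}) (x (U - {j})) K"
      have yc: "y \<in> carrier (L (T - {j}))"
        unfolding y_def using ploc.frac_closed[OF ploc_F[OF facesD[OF TS]] xU(1)] .
      have \<tau>e: "\<tau> (T - {j}) = eps (U - {j}) j0 \<odot>\<^bsub>L (T - {j})\<^esub> y"
        using TS T(2) i by (simp add: \<tau>_def y_def)
      have ry: "rho T j y \<in> carrier (L T)" using rho_closed[OF Tl j yc] .
      have "rho (U - {j}) j0 y = fr (U - {j}) (?g ^ K \<odot> x (U - {j})) K"
        using rho_fr[OF facesD[OF US], of j0 "x (U - {j})" K] xU(1) jj j0U i2 by (simp add: y_def)
      also have "\<dots> = ?g ^ K \<odot>\<^bsub>L (U - {j})\<^esub> \<sigma> (U - {j})"
        using ploc.smult_frac[OF ploc_F[OF facesD[OF US]] gK xU(1)] xU(2) by simp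
      finally have r1: "rho (U - {j}) j0 y = ?g ^ K \<odot>\<^bsub>L (U - {j})\<^esub> \<sigma> (U - {j})" .
      have "rho U j0 (rho T j y) = rho U j (rho (U - {j}) j0 y)"
        using rho_commute[OF Ul j0U jU, of y] jj yc i2 UT by simp
      also have "\<dots> = ?g ^ K \<odot>\<^bsub>L U\<^esub> rho U j (\<sigma> (U - {j}))"
        unfolding r1 using rho_smult[OF Ul jU \<sigma>U(1)[OF jU] gK] .
      finally have r2: "rho U j0 (rho T j y) = ?g ^ K \<odot>\<^bsub>L U\<^esub> rho U j (\<sigma> (U - {j}))" .
      have "eps T j \<odot>\<^bsub>L T\<^esub> rho T j (\<tau> (T - {j})) = (eps T j * eps (U - {j}) j0) \<odot>\<^bsub>L T\<^esub> rho T j y"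
        unfolding \<tau>e using rho_smult[OF Tl j yc eps_in] ry by (simp add: LT.sm_mult)
      then have "rho U j0 (eps T j \<odot>\<^bsub>L T\<^esub> rho T j (\<tau> (T - {j}))) =
          (eps T j * eps (U - {j}) j0) \<odot>\<^bsub>L U\<^esub> (?g ^ K \<odot>\<^bsub>L U\<^esub> rho U j (\<sigma> (U - {j})))"
        using rho_smult[OF Ul j0U, of "rho T j y" "eps T j * eps (U - {j}) j0"] ry UT r2 by simp
      also have "\<dots> = (eps T j * eps (U - {j}) j0 * ?g ^ K) \<odot>\<^bsub>L U\<^esub> rho U j (\<sigma> (U - {j}))"
        using gK \<sigma>U(2)[OF jU] by (simp add: LU.sm_mult)
      also have "eps T j * eps (U - {j}) j0 * ?g ^ K = c * eps U j"
      proof -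
        have sw: "eps U j0 * eps T j = - (eps U j * eps (U - {j}) j0)"
          using eps_swap[OF finite_face[OF Ul] j0U jU] jj UT by simp
        have "eps T j * eps (U - {j}) j0 = (eps U j0 * eps U j0) * (eps T j * eps (U - {j}) j0)"
          by (simp add: eps_square)
        also have "\<dots> = eps U j0 * (eps U j0 * eps T j) * eps (U - {j}) j0" by (simp add: mult_ac)
        also have "\<dots> = - (eps U j0 * eps U j * (eps (U - {j}) j0 * eps (U - {j}) j0))"
          unfolding sw by (simp add: mult_ac)
        also have "\<dots> = - (eps U j0 * eps U j)" by (simp add: eps_square)
        finally show ?thesis by (simp add: c_def mult_ac)
      qed
      finally show "rho U j0 (eps T j \<odot>\<^bsub>L T\<^esub> rho T j (\<tau> (T - {j}))) = c \<odot>\<^bsub>L U\<^esub> (eps U j \<odot>\<^bsub>L U\<^esub> rho U j (\<sigma> (U - {j})))"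
        using c \<sigma>U(2)[OF jU] by (simp add: LU.sm_mult)
    qed (use c tU TU in auto)
    also have "\<dots> = c \<odot>\<^bsub>L U\<^esub> Y"
      unfolding Y_def using c tU TU finite_face[OF Tl]
      by (intro LU.finsum_smult_ldistr[symmetric]) auto
    also have "\<dots> = (c * - eps U j0) \<odot>\<^bsub>L U\<^esub> rho U j0 (\<sigma> T)"
      unfolding Y using c \<sigma>T by (intro LU.sm_mult[symmetric]) auto
    also have "c * - eps U j0 = ?g ^ K"
    proof -
      have "c * - eps U j0 = (eps U j0 * eps U j0) * ?g ^ K" by (simp add: c_def mult_ac)
      then show ?thesis by (simp add: eps_square)
    qed
    also have "?g ^ K \<odot>\<^bsub>L U\<^esub> rho U j0 (\<sigma> T) = rho U j0 (?g ^ K \<odot>\<^bsub>L T\<^esub> \<sigma> T)"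
      using rho_smult[OF Ul j0U, of "\<sigma> T" "?g ^ K"] \<sigma>T gK UT by simp
    finally show ?thesis unfolding U_def .
  qed
  interpret CS: pmodule n "C (Suc r)" by (rule pmodule_C)
  \<comment> \<open>The error of the homotopy, to which \<open>nilpotent_cochain\<close> applies by
    the two computations above.\<close>
  define w where "w = ?g ^ K \<odot>\<^bsub>C (Suc r)\<^esub> \<sigma> \<oplus>\<^bsub>C (Suc r)\<^esub> (- 1) \<odot>\<^bsub>C (Suc r)\<^esub> d r \<tau>"
  have d\<tau>c: "d r \<tau> \<in> carrier (C (Suc r))" using d_closed[OF \<tau>c] .
  have g\<sigma>c: "?g ^ K \<odot>\<^bsub>C (Suc r)\<^esub> \<sigma> \<in> carrier (C (Suc r))" using gK \<sigma>c by (rule CS.smult_closed)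
  have w_minus: "w = ?g ^ K \<odot>\<^bsub>C (Suc r)\<^esub> \<sigma> \<ominus>\<^bsub>C (Suc r)\<^esub> d r \<tau>"
    unfolding w_def a_minus_def using CS.sm_uminus_one[OF d\<tau>c] by metis
  have wT: "w T = ?g ^ K \<odot>\<^bsub>L T\<^esub> \<sigma> T \<oplus>\<^bsub>L T\<^esub> (- 1) \<odot>\<^bsub>L T\<^esub> d r \<tau> T" if "T \<in> faces fs (Suc r)" for T
    using that by (simp add: w_def)
  have "\<exists>k. ?g ^ k \<odot>\<^bsub>C (Suc r)\<^esub> w = \<zero>\<^bsub>C (Suc r)\<^esub>"
  proof (rule nilpotent_cochain[OF j0])
    show "w \<in> carrier (C (Suc r))"
      unfolding w_minus using g\<sigma>c d\<tau>c by (rule CS.M.minus_closed)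
    fix T assume T: "T \<in> faces fs (Suc r)"
    note Tl = facesD[OF T]
    interpret LT: pmodule n "L T" using pmodule_L[OF Tl] .
    have c: "?g ^ K \<odot>\<^bsub>L T\<^esub> \<sigma> T \<in> carrier (L T)" "d r \<tau> T \<in> carrier (L T)"
      using \<sigma>c d\<tau>c T gK by (auto simp: PiE_iff)
    show "w T = \<zero>\<^bsub>L T\<^esub>" if "j0 \<in> T"
      using wT[OF T] d\<tau>1[OF T that] c by (simp add: LT.sm_uminus_one LT.M.r_neg)
    assume j: "j0 \<notin> T"
    define U where "U = insert j0 T"
    have Ul: "U \<subseteq> {..<length fs}" "j0 \<in> U" and UT: "U - {j0} = T" using Tl j0 j by (auto simp: U_def)
    interpret LU: pmodule n "L U" using pmodule_L[OF Ul(1)] .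
    have m1: "- 1 \<in> carrier (poly_ring n :: 'k mpoly ring)" by auto
    have c2: "(- 1) \<odot>\<^bsub>L T\<^esub> d r \<tau> T \<in> carrier (L T)" using LT.smult_closed[OF m1 c(2)] .
    have rc: "rho U j0 (?g ^ K \<odot>\<^bsub>L T\<^esub> \<sigma> T) \<in> carrier (L U)"
      using rho_closed[OF Ul, of "?g ^ K \<odot>\<^bsub>L T\<^esub> \<sigma> T"] c UT by simp
    have "rho U j0 (w T) = rho U j0 (?g ^ K \<odot>\<^bsub>L T\<^esub> \<sigma> T) \<oplus>\<^bsub>L U\<^esub> rho U j0 ((- 1) \<odot>\<^bsub>L T\<^esub> d r \<tau> T)"
      using rho_add[OF Ul, of "?g ^ K \<odot>\<^bsub>L T\<^esub> \<sigma> T" "(- 1) \<odot>\<^bsub>L T\<^esub> d r \<tau> T"] c c2 UT wT[OF T] by simp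
    also have "rho U j0 ((- 1) \<odot>\<^bsub>L T\<^esub> d r \<tau> T) = (- 1) \<odot>\<^bsub>L U\<^esub> rho U j0 (d r \<tau> T)"
      using rho_smult[OF Ul, of "d r \<tau> T" "- 1"] c m1 UT by simp
    also have "rho U j0 (d r \<tau> T) = rho U j0 (?g ^ K \<odot>\<^bsub>L T\<^esub> \<sigma> T)"
      using d\<tau>2[OF T j] by (simp add: U_def)
    finally show "rho (insert j0 T) j0 (w T) = \<zero>\<^bsub>L (insert j0 T)\<^esub>"
      using rc by (simp add: LU.sm_uminus_one LU.M.r_neg flip: U_def)
  qed
  then obtain k where k: "?g ^ k \<odot>\<^bsub>C (Suc r)\<^esub> w = \<zero>\<^bsub>C (Suc r)\<^esub>" ..
  have gk: "?g ^ k \<in> carrier (poly_ring n)" using g by simp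
  have "?g ^ k \<odot>\<^bsub>C (Suc r)\<^esub> (?g ^ K \<odot>\<^bsub>C (Suc r)\<^esub> \<sigma>) \<ominus>\<^bsub>C (Suc r)\<^esub> ?g ^ k \<odot>\<^bsub>C (Suc r)\<^esub> d r \<tau> = \<zero>\<^bsub>C (Suc r)\<^esub>"
    using k unfolding w_minus a_minus_def
    using CS.smult_r_distr[OF gk g\<sigma>c CS.M.a_inv_closed[OF d\<tau>c]] CS.smult_r_minus[OF gk d\<tau>c] by metis
  then have "?g ^ k \<odot>\<^bsub>C (Suc r)\<^esub> (?g ^ K \<odot>\<^bsub>C (Suc r)\<^esub> \<sigma>) = ?g ^ k \<odot>\<^bsub>C (Suc r)\<^esub> d r \<tau>"
    using CS.minus_eq_zero_iff[OF CS.smult_closed[OF gk g\<sigma>c] CS.smult_closed[OF gk d\<tau>c]] by blast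
  then have "?g ^ (k + K) \<odot>\<^bsub>C (Suc r)\<^esub> \<sigma> = d r (?g ^ k \<odot>\<^bsub>C r\<^esub> \<tau>)"
    using CS.sm_mult[OF gk gK \<sigma>c] d_smult[OF \<tau>c gk] by (simp add: power_add del: C_simps)
  moreover have "?g ^ k \<odot>\<^bsub>C r\<^esub> \<tau> \<in> carrier (C r)"
    using module.smult_closed[OF pmodule.is_module[OF pmodule_C] gk \<tau>c] .
  ultimately show ?thesis by blast
qed

lemma nilpotent_cohomology:
  assumes j0: "j0 < length fs" and \<sigma>: "\<sigma> \<in> Z r"
  shows "\<exists>k. (fs ! j0) ^ k \<odot>\<^bsub>C r\<^esub> \<sigma> \<in> B r"
proof (cases r)
  case (Suc s)
  then show ?thesis using homotopy[OF j0, of \<sigma> s] \<sigma> by (auto simp: cech_coboundaries_def simp del: C_simps)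
next
  \<comment> \<open>Below degree 0 there are no cochains and hence no homotopy. A 0-cocycle becomes
    zero when the single generator is inverted, so it is itself killed by a power of that
    generator.\<close>
  case 0
  have \<sigma>c: "\<sigma> \<in> carrier (C 0)" and \<sigma>d: "d 0 \<sigma> = \<zero>\<^bsub>C (Suc 0)\<^esub>"
    using \<sigma> 0 by (simp_all add: cech_cocycles_def del: C_simps)
  have "\<exists>k. (fs ! j0) ^ k \<odot>\<^bsub>C 0\<^esub> \<sigma> = \<zero>\<^bsub>C 0\<^esub>"
  proof (rule nilpotent_cochain[OF j0 \<sigma>c])
    fix T assume T: "T \<in> faces fs 0"
    then have Te: "T = {}" by (auto simp: faces_def finite_face)
    show "\<sigma> T = \<zero>\<^bsub>L T\<^esub>" if "j0 \<in> T" using that Te by simp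
    have U: "{j0} \<in> faces fs (Suc 0)" using j0 by (auto simp: faces_def)
    interpret LU: pmodule n "L {j0}" using pmodule_L[OF facesD[OF U]] .
    have c: "rho {j0} j0 (\<sigma> {}) \<in> carrier (L {j0})"
      using rho_closed[OF facesD[OF U], of j0 "\<sigma> {}"] \<sigma>c T Te by auto
    have "{l \<in> {j0}. l < j0} = {}" by auto
    then have e: "eps {j0} j0 = 1" unfolding eps_def by (simp only: card.empty power_0)
    have "\<zero>\<^bsub>L {j0}\<^esub> = (\<Oplus>\<^bsub>L {j0}\<^esub>j\<in>{j0}. eps {j0} j \<odot>\<^bsub>L {j0}\<^esub> rho {j0} j (\<sigma> ({j0} - {j})))"
      using fun_cong[OF \<sigma>d, of "{j0}"] U by (simp add: d_eq)
    also have "\<dots> = rho {j0} j0 (\<sigma> {})"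
      using c e by (subst LU.M.finsum_insert) auto
    finally show "rho (insert j0 T) j0 (\<sigma> T) = \<zero>\<^bsub>L (insert j0 T)\<^esub>" using Te by simp
  qed
  then show ?thesis using 0 by (auto simp: cech_coboundaries_def simp del: C_simps)
qed

end

section \<open>Homogeneous generators\<close>

text \<open>Induction on the number of coordinates. A finite set \<open>B0\<close> settles the first
  \<open>n\<close> of them; it suffices for elements whose last coordinate is at least a bound for
  those of \<open>B0\<close>, and below this bound there are finitely many slices with fixed last
  coordinate.\<close>

lemma dickson:
  fixes A :: "(nat \<Rightarrow> nat) set"
  shows "\<exists>B\<subseteq>A. finite B \<and> (\<forall>a\<in>A. \<exists>b\<in>B. \<forall>i<n. b i \<le> a i)"
proof (induction n arbitrary: A)
  case 0
  show ?case
  proof (cases "A = {}")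
    case False
    then obtain a where "a \<in> A" by auto
    then show ?thesis by (intro exI[of _ "{a}"]) auto
  qed auto
next
  case (Suc n)
  obtain B0 where B0: "B0 \<subseteq> A" "finite B0" "\<forall>a\<in>A. \<exists>b\<in>B0. \<forall>i<n. b i \<le> a i" using Suc[of A] by auto
  define m where "m = (\<Sum>b\<in>B0. b n)"
  have m: "b n \<le> m" if "b \<in> B0" for b unfolding m_def using B0(2) that by (intro member_le_sum) auto
  have "\<forall>c. \<exists>B\<subseteq>{a \<in> A. a n = c}. finite B \<and> (\<forall>a\<in>{a \<in> A. a n = c}. \<exists>b\<in>B. \<forall>i<n. b i \<le> a i)"
    using Suc by blast
  from choice[OF this] obtain B1 where B1': "\<forall>c. B1 c \<subseteq> {a \<in> A. a n = c} \<and> finite (B1 c) \<and>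
      (\<forall>a\<in>{a \<in> A. a n = c}. \<exists>b\<in>B1 c. \<forall>i<n. b i \<le> a i)" by (elim exE)
  have B1: "B1 c \<subseteq> {a \<in> A. a n = c}" "finite (B1 c)"
    "a \<in> A \<Longrightarrow> a n = c \<Longrightarrow> \<exists>b\<in>B1 c. \<forall>i<n. b i \<le> a i" for c a
    using B1'[THEN spec, of c] by auto
  let ?B = "B0 \<union> (\<Union>c<m. B1 c)"
  have "\<exists>b\<in>?B. \<forall>i<Suc n. b i \<le> a i" if a: "a \<in> A" for a
  proof (cases "a n < m")
    case True
    obtain b where b: "b \<in> B1 (a n)" "\<forall>i<n. b i \<le> a i" using B1(3)[OF a] by auto
    then have "b n = a n" using B1(1) by blast
    then have "\<forall>i<Suc n. b i \<le> a i" using b less_Suc_eq by auto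
    then show ?thesis using b(1) True by blast
  next
    case False
    obtain b where b: "b \<in> B0" "\<forall>i<n. b i \<le> a i" using B0(3) a by auto
    then have "\<forall>i<Suc n. b i \<le> a i" using m[OF b(1)] False less_Suc_eq by auto
    then show ?thesis using b(1) by blast
  qed
  moreover have "?B \<subseteq> A"
  proof
    fix b assume "b \<in> ?B"
    then consider "b \<in> B0" | c where "b \<in> B1 c" by blast
    then show "b \<in> A"
    proof cases
      case 2
      then show ?thesis using B1(1)[of c] by blast
    qed (use B0(1) in blast)
  qed
  moreover have "finite ?B" using B0(2) B1(2) by simp
  ultimately show ?case by blast
qed

lemma lookup_single_mult:
  fixes g :: "'k::field mpoly"
  shows "Poly_Mapping.lookup (Poly_Mapping.single h c * g) (h + b) = c * Poly_Mapping.lookup g b"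
proof (rule poly_keys_induct[of _ g])
  fix a :: "nat \<Rightarrow>\<^sub>0 nat" and e :: 'k and g' :: "'k mpoly"
  assume "Poly_Mapping.lookup (Poly_Mapping.single h c * g') (h + b) = c * Poly_Mapping.lookup g' b"
  then show "Poly_Mapping.lookup (Poly_Mapping.single h c * (Poly_Mapping.single a e + g')) (h + b) =
      c * Poly_Mapping.lookup (Poly_Mapping.single a e + g') b"
    by (simp add: distrib_left lookup_add mult_single lookup_single when_def)
qed simp

lemma ideal_closed:
  fixes I :: "'k::field mpoly set"
  assumes "ideal I (poly_ring n)"
  shows "f \<in> I \<Longrightarrow> g \<in> I \<Longrightarrow> f + g \<in> I" "a \<in> carrier (poly_ring n) \<Longrightarrow> f \<in> I \<Longrightarrow> a * f \<in> I" "0 \<in> I"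
    "I \<subseteq> carrier (poly_ring n)"
proof -
  interpret ideal I "poly_ring n" by fact
  show "f \<in> I \<Longrightarrow> g \<in> I \<Longrightarrow> f + g \<in> I"
    using additive_subgroup.a_closed[OF ideal.axioms(1)[OF assms], of f g] by simp
  show "a \<in> carrier (poly_ring n) \<Longrightarrow> f \<in> I \<Longrightarrow> a * f \<in> I" using I_l_closed[of f a] by simp
  show "0 \<in> I" using additive_subgroup.zero_closed[OF ideal.axioms(1)[OF assms]] by simp
  show "I \<subseteq> carrier (poly_ring n)" using a_subset .
qed

lemma ideal_genideal:
  fixes G :: "'k::field mpoly set"
  assumes "G \<subseteq> carrier (poly_ring n)"
  shows "ideal (genideal (poly_ring n) G) (poly_ring n)" "G \<subseteq> genideal (poly_ring n) G"
    "ideal J (poly_ring n) \<Longrightarrow> G \<subseteq> J \<Longrightarrow> genideal (poly_ring n) G \<subseteq> J"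
proof -
  interpret cring "poly_ring n :: 'k mpoly ring" by (rule cring_poly_ring)
  show "ideal (genideal (poly_ring n) G) (poly_ring n)" using genideal_ideal[OF assms] .
  show "G \<subseteq> genideal (poly_ring n) G" using genideal_self[OF assms] .
  show "ideal J (poly_ring n) \<Longrightarrow> G \<subseteq> J \<Longrightarrow> genideal (poly_ring n) G \<subseteq> J" using genideal_minimal .
qed

text \<open>Division by finitely many polynomials whose leading monomials generate, by Dickson's lemma,
  all leading monomials of homogeneous elements of the ideal.\<close>

lemma ex_homogeneous_generators:
  fixes I :: "'k::field mpoly set"
  assumes "homogeneous_ideal n I"
  shows "\<exists>fs. homogeneous_generators n I fs"
proof -
  have I: "ideal I (poly_ring n)" and I_gen: "I = genideal (poly_ring n) {f \<in> I. \<exists>d. f \<in> homog n d}"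
    using assms unfolding homogeneous_ideal_def by blast+
  note Ic = ideal_closed[OF I]
  define H where "H = {f \<in> I. f \<noteq> 0 \<and> (\<exists>d. f \<in> homog n d)}"
  \<comment> \<open>Leading exponents for the linear order on finitely supported maps; the division
    uses its compatibility with addition.\<close>
  define lm :: "'k mpoly \<Rightarrow> nat \<Rightarrow>\<^sub>0 nat" where "lm = (\<lambda>f. Max (Poly_Mapping.keys f))"
  have lm_in: "lm f \<in> Poly_Mapping.keys f" if "f \<noteq> 0" for f
    unfolding lm_def using ex_key[OF that] by (intro Max_in) auto
  have lm_ge: "m \<le> lm f" if "m \<in> Poly_Mapping.keys f" for m f
    unfolding lm_def using that by (intro Max_ge) auto
  let ?A = "(\<lambda>f. Poly_Mapping.lookup (lm f)) ` H"
  obtain B where B: "B \<subseteq> ?A" "finite B" "\<forall>a\<in>?A. \<exists>b\<in>B. \<forall>i<n. b i \<le> a i"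
    using dickson[of ?A n] by (elim exE conjE)
  from finite_subset_image[OF B(2,1)] obtain G where "G \<subseteq> H \<and> finite G \<and> B = (\<lambda>f. Poly_Mapping.lookup (lm f)) ` G"
    by (elim exE)
  then have G: "G \<subseteq> H" "finite G" "B = (\<lambda>f. Poly_Mapping.lookup (lm f)) ` G" by blast+
  have GI: "G \<subseteq> I" and Gc: "G \<subseteq> carrier (poly_ring n)" using G(1) Ic(4) by (auto simp: H_def)
  define J where "J = genideal (poly_ring n) G"
  note J = ideal_genideal[OF Gc, folded J_def]
  note Jc = ideal_closed[OF J(1)]
  have HJ: "f \<in> J" if "f \<in> I" "f \<in> homog n d" for f d
    using that
  \<comment> \<open>Termination: cancelling the leading term strictly shrinks the set of exponents
    of degree \<open>d\<close> lying at or below some exponent of \<open>f\<close>. Fixing the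
    degree makes this set finite, which takes the place of well-foundedness of the order.\<close>
  proof (induction "card {m \<in> exps n. int (monom_deg m) = d \<and> (\<exists>m'\<in>Poly_Mapping.keys f. m \<le> m')}"
      arbitrary: f rule: less_induct)
    case less
    show ?case
    proof (cases "f = 0")
      case False
      then have fH: "f \<in> H" using less.prems by (auto simp: H_def)
      define a where "a = lm f"
      have a: "a \<in> Poly_Mapping.keys f" "\<And>m. m \<in> Poly_Mapping.keys f \<Longrightarrow> m \<le> a"
        using lm_in[OF False] lm_ge by (simp_all add: a_def)
      have ad: "a \<in> exps n" "int (monom_deg a) = d"
        using a(1) less.prems keys_poly_ring[OF homog_in_poly_ring[OF less.prems(2)]] by (auto simp: homog_def)
      from B(3) fH G(3) obtain g where g: "g \<in> G" "\<forall>i<n. Poly_Mapping.lookup (lm g) i \<le> Poly_Mapping.lookup a i"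
        unfolding a_def by fastforce
      define b where "b = lm g"
      have g0: "g \<noteq> 0" using g(1) G(1) by (auto simp: H_def)
      obtain e where ge: "g \<in> homog n e" using g(1) G(1) by (auto simp: H_def)
      have b: "b \<in> Poly_Mapping.keys g" "\<And>m. m \<in> Poly_Mapping.keys g \<Longrightarrow> m \<le> b"
        using lm_in[OF g0] lm_ge by (simp_all add: b_def)
      have be: "b \<in> exps n" "int (monom_deg b) = e"
        using b(1) ge keys_poly_ring[OF homog_in_poly_ring[OF ge]] by (auto simp: homog_def)
      define h where "h = a - b"
      have ha: "a = h + b"
      proof (rule poly_mapping_eqI)
        fix i show "Poly_Mapping.lookup a i = Poly_Mapping.lookup (h + b) i"
          using g(2) be(1) ad(1) exps_lookup[of _ n i]
          by (cases "i < n") (auto simp: h_def b_def lookup_add lookup_minus)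
      qed
      have hex: "h \<in> exps n" using ad(1) ha exps_add by blast
      have hd: "int (monom_deg h) + e = d" using ad(2) be(2) ha by (simp add: monom_deg_add)
      define c where "c = - (Poly_Mapping.lookup f a / Poly_Mapping.lookup g b)"
      define s where "s = Poly_Mapping.single h c * g"
      have sJ: "s \<in> J" "s \<in> I" unfolding s_def using g(1) J(2) GI hex by (auto intro!: Jc(2) Ic(2))
      have "s \<in> homog n d"
        using homog_mult[OF homog_single[OF hex, of c] ge] hd by (simp add: s_def)
      then have f': "f + s \<in> homog n d" "f + s \<in> I" using less.prems sJ by (auto intro: homog_add Ic(1))
      have sk: "m \<le> a" if "m \<in> Poly_Mapping.keys s" for m
      proof -
        from that obtain m' where m': "m' \<in> Poly_Mapping.keys g" "m = h + m'"
          unfolding s_def using Poly_Mapping.keys_mult[of "Poly_Mapping.single h c" g] by (auto split: if_splits)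
        show ?thesis unfolding m'(2) ha using b(2)[OF m'(1)] by (rule add_left_mono)
      qed
      have "Poly_Mapping.lookup (f + s) a = 0"
        using b(1) by (simp add: lookup_add s_def lookup_single_mult c_def in_keys_iff ha)
      then have a': "a \<notin> Poly_Mapping.keys (f + s)" by (simp add: in_keys_iff)
      have le: "m < a" if m: "m \<in> Poly_Mapping.keys (f + s)" for m
      proof -
        have "m \<in> Poly_Mapping.keys f \<union> Poly_Mapping.keys s" using Poly_Mapping.keys_add[of f s] m by blast
        then have "m \<le> a" using a(2) sk by blast
        moreover have "m \<noteq> a" using m a' by auto
        ultimately show ?thesis by simp
      qed
      let ?S = "\<lambda>f. {m \<in> exps n. int (monom_deg m) = d \<and> (\<exists>m'\<in>Poly_Mapping.keys f. m \<le> m')}"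
      have "?S (f + s) \<subset> ?S f"
      proof (rule psubsetI)
        show "?S (f + s) \<subseteq> ?S f"
        proof
          fix m assume m: "m \<in> ?S (f + s)"
          then obtain m' where "m' \<in> Poly_Mapping.keys (f + s)" "m \<le> m'" by auto
          then have "m \<le> a" using le by force
          then show "m \<in> ?S f" using a(1) m by blast
        qed
        have "a \<in> ?S f" using a(1) ad by auto
        moreover have "a \<notin> ?S (f + s)" using le by (auto simp: not_le)
        ultimately show "?S (f + s) \<noteq> ?S f" by blast
      qed
      moreover have "finite (?S f)" by (rule finite_subset[OF _ finite_monomials[of n d]]) auto
      ultimately have "card (?S (f + s)) < card (?S f)" by (rule psubset_card_mono[rotated])
      from less.hyps[OF this f'(2,1)] have "f + s \<in> J" .
      moreover have "(- 1) * s \<in> J" using sJ(1) by (intro Jc(2)) auto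
      ultimately have "(f + s) + (- 1) * s \<in> J" by (rule Jc(1))
      then show ?thesis by simp
    qed (simp add: Jc(3))
  qed
  have "I = J"
  proof
    show "J \<subseteq> I" using J(3)[OF I GI] .
    have sub: "{f \<in> I. \<exists>d. f \<in> homog n d} \<subseteq> carrier (poly_ring n)" using Ic(4) by auto
    show "I \<subseteq> J" using ideal_genideal(3)[OF sub J(1)] HJ I_gen by blast
  qed
  moreover obtain fs where "set fs = G" using finite_list[OF G(2)] by blast
  ultimately have "homogeneous_generators n I fs"
    unfolding homogeneous_generators_def J_def using G(1) by (auto simp: H_def)
  then show ?thesis by blast
qed

text \<open>Guarantees that the choice made in \<open>local_cohomology\<close> is meaningful for the
  maximal ideal; the list chosen there may be a different one.\<close>

lemma irrelevant_homogeneous_generators: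
  "homogeneous_generators n (irrelevant_ideal n :: 'k::field mpoly set) (map pvar [0..<n])"
proof -
  have "(pvar i :: 'k mpoly) \<in> homog n 1" if "i < n" for i
    using homog_xpow[OF exps_single[OF that, of 1]] by (simp add: pvar_conv)
  then show ?thesis
    by (auto simp: homogeneous_generators_def irrelevant_ideal_def atLeast0LessThan)
qed

section \<open>Local cohomology\<close>

lemma cech_generators:
  assumes "pmodule n M" "homogeneous_generators n I fs"
  shows "cech n M fs"
proof -
  have "set fs \<subseteq> carrier (poly_ring n)"
    using assms(2) homog_in_poly_ring unfolding homogeneous_generators_def by blast
  then show ?thesis using assms(1) by (simp add: cech_def cech_axioms_def)
qed

text \<open>Of the two choices in the definition only the defining properties are retained, so what
  follows is valid for any homogeneous generators and any copy of the cohomology.\<close>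

lemma local_cohomology_eq:
  fixes M :: "('k::field mpoly, 'b) gmod"
  assumes "homogeneous_generators n I fs0" and inf: "infinite (UNIV :: 'b set)"
  obtains fs \<phi> where "homogeneous_generators n I fs"
    "inj_on (\<phi> :: _ \<Rightarrow> 'b) (carrier (cech_cohomology n fs r M))"
    "local_cohomology n I r M = gmod_image \<phi> (cech_cohomology n fs r M)"
proof -
  define fs where "fs = (SOME fs. homogeneous_generators n I fs)"
  define \<phi> :: "_ \<Rightarrow> 'b" where "\<phi> = (SOME \<phi>. inj_on \<phi> (carrier (cech_cohomology n fs r M)))"
  have "homogeneous_generators n I fs" unfolding fs_def using assms(1) by (rule someI)
  moreover have "inj_on \<phi> (carrier (cech_cohomology n fs r M))"
    unfolding \<phi>_def by (rule someI_ex[OF ex_inj_on_cech_cohomology[OF inf]])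
  moreover have "local_cohomology n I r M = gmod_image \<phi> (cech_cohomology n fs r M)"
    by (simp add: local_cohomology_def Let_def fs_def \<phi>_def)
  ultimately show thesis by (rule that)
qed

lemma frob_struct_local_cohomology:
  fixes M :: "('k::field mpoly, 'b) gmod"
  assumes char: "CHAR('k) = p" "p > Suc 0" and M: "frob_struct n p M N"
    and gen: "homogeneous_generators n I fs0" and inf: "infinite (UNIV :: 'b set)"
  shows "\<exists>N'. frob_struct n p (local_cohomology n I r M) N'"
proof -
  obtain fs and \<phi> :: "_ \<Rightarrow> 'b" where fs: "homogeneous_generators n I fs"
    "inj_on \<phi> (carrier (cech_cohomology n fs r M))"
    "local_cohomology n I r M = gmod_image \<phi> (cech_cohomology n fs r M)"
    using local_cohomology_eq[OF gen inf] .
  interpret cech n M fs using cech_generators[OF frob_struct_pmodule[OF M] fs(1)] .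
  have "\<And>f. f \<in> set fs \<Longrightarrow> \<exists>d. f \<in> homog n d" using fs(1) by (simp add: homogeneous_generators_def)
  then show ?thesis unfolding fs(3) using frob_struct_cohomology[OF char M _ fs(2)] by blast
qed

text \<open>The homotopy yields nilpotency for the generators chosen in the definition, which may
  not be the variables; an ideal containing them contains the whole maximal ideal. Closure under
  sums comes from (r + s)^q = r^q + s^q for a large power \<open>q\<close> of
  \<open>p\<close>.\<close>

lemma (in pmodule) nilpotent_ideal:
  assumes char: "CHAR('k) = p" "p > Suc 0" and h: "h \<in> carrier M"
  shows "ideal {r \<in> carrier (poly_ring n). \<exists>k. r ^ k \<odot> h = \<zero>} (poly_ring n)" (is "ideal ?A _")
proof -
  interpret R: cring "poly_ring n :: 'k mpoly ring" by (rule cring_poly_ring)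
  have mult: "a * r \<in> ?A" if "a \<in> carrier (poly_ring n)" "r \<in> ?A" for a r
  proof -
    from that obtain k where "r ^ k \<odot> h = \<zero>" by auto
    then have "(a * r) ^ k \<odot> h = \<zero>" using that h by (simp add: power_mult_distrib sm_mult smult_r_null)
    then show ?thesis using that by auto
  qed
  have add: "r + s \<in> ?A" if "r \<in> ?A" "s \<in> ?A" for r s
  proof -
    from that obtain k l where k: "r ^ k \<odot> h = \<zero>" "s ^ l \<odot> h = \<zero>"
      and rs: "r \<in> carrier (poly_ring n)" "s \<in> carrier (poly_ring n)" by auto
    let ?q = "p ^ (k + l)"
    have q: "k + l \<le> ?q"
      using char less_exp[of "k + l"] power_mono[of 2 p "k + l"] by linarith
    have *: "r ^ ?q \<odot> h = \<zero>" if "r ^ k \<odot> h = \<zero>" "k \<le> ?q" "r \<in> carrier (poly_ring n)" for r k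
    proof -
      have "r ^ ?q = r ^ (?q - k) * r ^ k" using that by (simp flip: power_add)
      then show ?thesis using that h by (simp add: sm_mult smult_r_null)
    qed
    have "r ^ ?q \<odot> h = \<zero>" "s ^ ?q \<odot> h = \<zero>" using *[OF k(1)] *[OF k(2)] q rs by auto
    then have "(r + s) ^ ?q \<odot> h = \<zero>"
      using rs h char frobenius_add[of p r s "k + l"] by (simp add: sm_add_left)
    then show ?thesis using rs by blast
  qed
  show ?thesis
  proof (rule idealI)
    show "ring (poly_ring n :: 'k mpoly ring)" by (rule R.ring_axioms)
    show "subgroup ?A (add_monoid (poly_ring n))"
    proof (rule group.subgroupI)
      show "group (add_monoid (poly_ring n :: 'k mpoly ring))" using R.a_comm_group by (rule comm_group.axioms(2))
      have "0 ^ Suc 0 \<odot> h = \<zero>" using h by simp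
      then show "?A \<noteq> {}" by blast
      show "inv\<^bsub>add_monoid (poly_ring n)\<^esub> a \<in> ?A" if "a \<in> ?A" for a
      proof -
        have "\<ominus>\<^bsub>poly_ring n\<^esub> a = - a"
          using that R.minus_equality[of "- a" a] by simp
        then show ?thesis using mult[of "- 1" a] that by (simp add: a_inv_def)
      qed
      show "a \<otimes>\<^bsub>add_monoid (poly_ring n)\<^esub> b \<in> ?A" if "a \<in> ?A" "b \<in> ?A" for a b using add[OF that] by simp
    qed auto
    show "x \<otimes>\<^bsub>poly_ring n\<^esub> a \<in> ?A" if "a \<in> ?A" "x \<in> carrier (poly_ring n)" for a x using mult[OF that(2,1)] by simp
    show "a \<otimes>\<^bsub>poly_ring n\<^esub> x \<in> ?A" if "a \<in> ?A" "x \<in> carrier (poly_ring n)" for a x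
      using mult[OF that(2,1)] by (simp add: mult.commute)
  qed
qed

lemma local_cohomology_torsion:
  fixes M :: "('k::field mpoly, 'b) gmod"
  assumes char: "CHAR('k) = p" "p > Suc 0" and M: "pmodule n M" and inf: "infinite (UNIV :: 'b set)"
    and h: "h \<in> carrier (local_cohomology n (irrelevant_ideal n) r M)" and i: "i < n"
  shows "\<exists>k. pvar i ^ k \<odot>\<^bsub>local_cohomology n (irrelevant_ideal n) r M\<^esub> h =
      \<zero>\<^bsub>local_cohomology n (irrelevant_ideal n) r M\<^esub>"
proof -
  let ?H = "local_cohomology n (irrelevant_ideal n) r M"
  obtain fs and \<phi> :: "_ \<Rightarrow> 'b" where fs: "homogeneous_generators n (irrelevant_ideal n) fs"
    "inj_on \<phi> (carrier (cech_cohomology n fs r M))"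
    "?H = gmod_image \<phi> (cech_cohomology n fs r M)"
    using local_cohomology_eq[OF irrelevant_homogeneous_generators inf] .
  interpret cech n M fs using cech_generators[OF M fs(1)] .
  interpret Cr: pmodule n "C r" by (rule pmodule_C)
  define \<pi> where "\<pi> = (\<lambda>z. \<phi> (B r +>\<^bsub>C r\<^esub> z))"
  have pres: "presents n (C r) (Z r) \<pi> ?H" "\<And>x. x \<in> Z r \<Longrightarrow> \<pi> x = \<zero>\<^bsub>?H\<^esub> \<longleftrightarrow> x \<in> B r"
    using Cr.presents_subquotient[OF submod_Z submod_B B_subset_Z fs(2)[unfolded cech_cohomology_def]]
    unfolding fs(3) cech_cohomology_def \<pi>_def by blast+
  interpret H: pmodule n ?H using presents_pmodule[OF Cr.pmodule_axioms pres(1)] .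
  obtain \<sigma> where \<sigma>: "\<sigma> \<in> Z r" "h = \<pi> \<sigma>" using h pres(1) by (auto simp: presents_def)
  let ?A = "{a \<in> carrier (poly_ring n). \<exists>k. a ^ k \<odot>\<^bsub>?H\<^esub> h = \<zero>\<^bsub>?H\<^esub>}"
  have A: "ideal ?A (poly_ring n)" using H.nilpotent_ideal[OF char h] .
  have "set fs \<subseteq> ?A"
  proof
    fix f assume f: "f \<in> set fs"
    then obtain j where j: "j < length fs" "f = fs ! j" by (auto simp: in_set_conv_nth)
    have fc: "f \<in> carrier (poly_ring n)" using f fs_in by auto
    obtain k where k: "f ^ k \<odot>\<^bsub>C r\<^esub> \<sigma> \<in> B r" using nilpotent_cohomology[OF j(1) \<sigma>(1)] j(2) by blast
    have fk: "f ^ k \<in> carrier (poly_ring n)" using fc by simp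
    have "f ^ k \<odot>\<^bsub>?H\<^esub> h = \<pi> (f ^ k \<odot>\<^bsub>C r\<^esub> \<sigma>)"
      using pres(1) fk \<sigma> unfolding presents_def by blast
    also have "\<dots> = \<zero>\<^bsub>?H\<^esub>" using pres(2) k B_subset_Z by blast
    finally show "f \<in> ?A" using fc by blast
  qed
  then have "genideal (poly_ring n) (set fs) \<subseteq> ?A" using ideal_genideal(3)[OF fs_in A] by blast
  then have "irrelevant_ideal n \<subseteq> ?A" using fs(1) by (simp add: homogeneous_generators_def)
  moreover have "pvar i \<in> (irrelevant_ideal n :: 'k mpoly set)"
    unfolding irrelevant_ideal_def
  proof (rule subsetD[OF ideal_genideal(2)])
    show "pvar ` {..<n} \<subseteq> carrier (poly_ring n :: 'k mpoly ring)" using pvar_in_poly_ring by auto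
  qed (use i in auto)
  ultimately show ?thesis by blast
qed

section \<open>Graded modules\<close>

context frob_level
begin

lemma kap_all_zero:
  assumes x: "x \<in> carrier M" and z: "\<And>a d. a \<in> box n q \<Longrightarrow> \<kappa> a d x = \<zero>"
  shows "x = \<zero>"
proof -
  have "{xpow a \<odot> \<kappa> a d x |a d. a \<in> box n q} \<subseteq> {\<zero>}" using z by (auto intro!: smult_r_null)
  from asum_subset_kspace[OF in_asum_kap[OF x] this] have "x \<in> {\<zero>}"
    by (auto simp: kspace_def intro!: smult_r_null)
  then show ?thesis by simp
qed

lemma finite_kap: "a \<in> box n q \<Longrightarrow> x \<in> carrier M \<Longrightarrow> finite {d. \<kappa> a d x \<noteq> \<zero>}"
proof -
  assume a: "a \<in> box n q" and "x \<in> carrier M"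
  from \<open>x \<in> carrier M\<close> show ?thesis
  proof (induction rule: generate_induct)
    case (add a' u d' s)
    have "{d. \<kappa> a d (xpow a' \<odot> u \<oplus> s) \<noteq> \<zero>} \<subseteq> insert d' {d. \<kappa> a d s \<noteq> \<zero>}"
      using add a by (auto simp: kap_add kap_xpow split: if_splits)
    then show ?case using add.IH finite_subset by blast
  qed (use a in \<open>simp add: kap_zero\<close>)
qed

lemma box_expscale_unique:
  assumes "a \<in> box n q" "a' \<in> box n q" "a + expscale q h = a' + expscale q h'" "h \<in> exps n" "h' \<in> exps n"
  shows "a = a' \<and> h = h'"
proof -
  have *: "Poly_Mapping.lookup a i = Poly_Mapping.lookup a' i \<and> Poly_Mapping.lookup h i = Poly_Mapping.lookup h' i" for i
  proof (cases "i < n")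
    case True
    have e: "Poly_Mapping.lookup a i + q * Poly_Mapping.lookup h i = Poly_Mapping.lookup a' i + q * Poly_Mapping.lookup h' i"
      using arg_cong[OF assms(3), of "\<lambda>f. Poly_Mapping.lookup f i"] by (simp add: lookup_add)
    have l: "Poly_Mapping.lookup a i < q" "Poly_Mapping.lookup a' i < q" using assms True by (auto simp: box_def)
    have "Poly_Mapping.lookup a i = Poly_Mapping.lookup a' i"
      using arg_cong[OF e, of "\<lambda>x. x mod q"] l by simp
    then show ?thesis using e q_pos by simp
  next
    case False
    then show ?thesis using assms boxD exps_lookup by (metis not_less)
  qed
  then show ?thesis by (auto intro: poly_mapping_eqI)
qed

lemma expscale_zero: "expscale k 0 = 0"
  by (rule poly_mapping_eqI) simp

lemma xpow_expscale_N:
  assumes "u \<in> N d" "h \<in> exps n"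
  shows "xpow (expscale q h) \<odot> u \<in> N (d + int (monom_deg h))"
proof (rule N_smult[OF frob_polys_xpow[OF assms(2)] _ assms(1)])
  show "xpow (expscale q h) \<in> homog n (int q * int (monom_deg h))"
    using homog_xpow[OF exps_expscale[OF assms(2)], of q] by (simp add: monom_deg_expscale[OF assms(2)])
qed

text \<open>As long as no coordinate of \<open>a + b\<close> reaches \<open>q\<close>,
  multiplication by x^b merely relabels the coefficient. With \<open>b\<close> a unit vector this
  restricts the coefficients of socle elements.\<close>

lemma kap_shift:
  assumes a: "a \<in> box n q" and ab: "a + b \<in> box n q" and x: "x \<in> carrier M"
  shows "\<kappa> (a + b) d (xpow b \<odot> x) = \<kappa> a d x"
proof -
  have b: "b \<in> exps n" using ab boxD exps_add by blast
  have xb: "xpow b \<in> carrier (poly_ring n)" using b by (rule xpow_in_poly_ring)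
  from x show ?thesis
  proof (induction rule: generate_induct)
    case zero
    then show ?case using a ab by (simp add: kap_zero smult_r_null[OF xb])
  next
    case (add a' u d' s)
    have uc: "u \<in> carrier M" using add N_carrier by blast
    have "a' + b \<in> exps n" using add(1) b boxD exps_add by blast
    \<comment> \<open>The sum a' + b may leave the box and carry into \<open>h\<close>; uniqueness
      of division shows that its remainder is \<open>a + b\<close> only when a' = a.\<close>
    then obtain a'' h where ah: "a'' \<in> box n q" "h \<in> exps n" "a' + b = a'' + expscale q h"
      using exps_divmod[OF _ q_pos] by metis
    define w where "w = xpow (expscale q h) \<odot> u"
    have w: "w \<in> N (d' + int (monom_deg h))" unfolding w_def using xpow_expscale_N add ah by blast
    have "xpow b \<odot> (xpow a' \<odot> u) = (xpow (a' + b) :: 'k mpoly) \<odot> u"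
      unfolding xpow_add mult.commute[of "xpow a'"]
      using xb add(1) uc by (intro sm_mult[symmetric]) auto
    also have "\<dots> = xpow a'' \<odot> w"
      unfolding w_def ah(3) xpow_add using ah uc by (intro sm_mult xpow_in_poly_ring exps_expscale boxD[of a'' n q]) auto
    finally have e: "xpow b \<odot> (xpow a' \<odot> u) = xpow a'' \<odot> w" .
    have "\<kappa> (a + b) d (xpow a'' \<odot> w) = \<kappa> a d (xpow a' \<odot> u)"
    proof (cases "a + b = a''")
      case True
      have "a' + b = (a + expscale q h) + b"
        unfolding ah(3) True[symmetric] by (simp only: add_ac)
      then have "a' + expscale q 0 = a + expscale q h" by (simp add: expscale_zero)
      then have "a' = a \<and> 0 = h" using box_expscale_unique[OF add(1) a _ _ ah(2)] by simp
      then have "a' = a" "h = 0" by auto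
      then have "w = u" "d' + int (monom_deg h) = d'" using uc by (simp_all add: w_def expscale_zero)
      then show ?thesis using kap_xpow[OF ab ah(1) w] kap_xpow[OF a add(1,2)] True \<open>a' = a\<close> by simp
    next
      case False
      have "a \<noteq> a'"
      proof
        assume "a = a'"
        then have "a + b + expscale q 0 = a'' + expscale q h"
          using ah(3) by (simp add: expscale_zero)
        then show False using box_expscale_unique[OF ab ah(1) _ exps_zero ah(2)] False by simp
      qed
      then show ?thesis using False kap_xpow[OF ab ah(1) w] kap_xpow[OF a add(1,2)] by simp
    qed
    moreover have "xpow a'' \<odot> w \<in> carrier M" using smult_closed[OF xb add(3)] e by simp
    moreover have "xpow b \<odot> (xpow a' \<odot> u \<oplus> s) = xpow a'' \<odot> w \<oplus> xpow b \<odot> s"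
      using smult_r_distr[OF xb add(3,4)] e by simp
    ultimately show ?case
      using add(3,4,5) a ab smult_closed[OF xb add(4)] by (simp add: kap_add)
  qed
qed

end

text \<open>A descent datum with q = 1: the box is {0}, and \<open>\<kappa> 0 d\<close> is the
  projection to degree \<open>d\<close>.\<close>

locale graded = frob_level n M "Suc 0" "hcomp M" \<kappa>
  for n :: nat and M :: "('k::field mpoly, 'b) gmod" (structure) and \<kappa>
begin

definition pr :: "int \<Rightarrow> 'b \<Rightarrow> 'b" where "pr d x = \<kappa> 0 d x"

lemma hcomp_carrier: "x \<in> hcomp M d \<Longrightarrow> x \<in> carrier M" by (rule N_carrier)

lemma pr_in: "x \<in> carrier M \<Longrightarrow> pr d x \<in> hcomp M d" by (simp add: pr_def kap_in)
lemma pr_closed [simp]: "x \<in> carrier M \<Longrightarrow> pr d x \<in> carrier M" by (simp add: pr_def)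
lemma pr_add: "x \<in> carrier M \<Longrightarrow> y \<in> carrier M \<Longrightarrow> pr d (x \<oplus> y) = pr d x \<oplus> pr d y"
  by (simp add: pr_def kap_add)
lemma pr_zero: "pr d \<zero> = \<zero>" by (simp add: pr_def kap_zero)
lemma pr_minus: "x \<in> carrier M \<Longrightarrow> y \<in> carrier M \<Longrightarrow> pr d (x \<ominus> y) = pr d x \<ominus> pr d y"
  by (simp add: pr_def kap_minus)
lemma pr_hcomp: "x \<in> hcomp M d' \<Longrightarrow> pr d x = (if d = d' then x else \<zero>)"
  using kap_xpow[of 0 0 x d' d] hcomp_carrier[of x d'] by (simp add: pr_def)
lemma pr_smult: "r \<in> homog n c \<Longrightarrow> x \<in> carrier M \<Longrightarrow> pr (d + c) (r \<odot> x) = r \<odot> pr d x"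
  using kap_smult[of r c 0 x d] homog_in_poly_ring[of r n c] by (simp add: pr_def frob_polys_1)
lemma pr_pconst: "x \<in> carrier M \<Longrightarrow> pr d (pconst c \<odot> x) = pconst c \<odot> pr d x"
  by (simp add: pr_def kap_pconst)
lemma hcomp_smult: "r \<in> homog n c \<Longrightarrow> x \<in> hcomp M d \<Longrightarrow> r \<odot> x \<in> hcomp M (d + c)"
  using N_smult[of r c x d] homog_in_poly_ring[of r n c] by (simp add: frob_polys_1)
lemma pr_all_zero: "x \<in> carrier M \<Longrightarrow> (\<And>d. pr d x = \<zero>) \<Longrightarrow> x = \<zero>"
  using kap_all_zero[of x] by (simp add: pr_def)
lemma finite_pr: "x \<in> carrier M \<Longrightarrow> finite {d. pr d x \<noteq> \<zero>}"
  using finite_kap[of 0 x] by (simp add: pr_def)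

lemma pr_finsum:
  assumes "finite A" "\<And>d. d \<in> A \<Longrightarrow> u d \<in> hcomp M d"
  shows "pr d (\<Oplus>d'\<in>A. u d') = (if d \<in> A then u d else \<zero>)"
proof -
  have c: "u \<in> A \<rightarrow> carrier M" using assms(2) hcomp_carrier by blast
  have "pr d (\<Oplus>d'\<in>A. u d') = (\<Oplus>d'\<in>A. pr d (u d'))"
    using c assms(1) pr_add by (intro additive_finsum[OF pmodule_axioms]) auto
  also have "\<dots> = (\<Oplus>d'\<in>A. if d = d' then u d' else \<zero>)"
    using c assms(2) by (intro M.finsum_cong') (auto simp: pr_hcomp)
  also have "\<dots> = (if d \<in> A then u d else \<zero>)"
  proof (cases "d \<in> A")
    case True
    then show ?thesis using M.finsum_singleton[OF True assms(1) c] by simp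
  next
    case False
    then have "(\<Oplus>d'\<in>A. if d = d' then u d' else \<zero>) = (\<Oplus>d'\<in>A. \<zero>)"
      by (intro M.finsum_cong') auto
    then show ?thesis using False by simp
  qed
  finally show ?thesis .
qed

text \<open>Both existence and uniqueness of components come from the projections: an element all of
  whose projections vanish is zero, and projecting a decomposition returns its terms.\<close>

lemma graded_module: "graded_module n M"
  unfolding graded_module_def
proof (intro conjI allI ballI)
  show "module (poly_ring n) M" by (rule is_module)
  show "subgroup (hcomp M d) (add_monoid M)" for d
  proof (rule group.subgroupI)
    show "group (add_monoid M)" using M.a_comm_group by (rule comm_group.axioms(2))
    show "hcomp M d \<subseteq> carrier (add_monoid M)" using hcomp_carrier by auto
    show "hcomp M d \<noteq> {}" using kspaceD(3)[OF kspace_N] by blast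
    show "inv\<^bsub>add_monoid M\<^esub> a \<in> hcomp M d" if "a \<in> hcomp M d" for a
      using kspace_uminus[OF kspace_N that] by (simp add: a_inv_def)
    show "a \<otimes>\<^bsub>add_monoid M\<^esub> b \<in> hcomp M d" if "a \<in> hcomp M d" "b \<in> hcomp M d" for a b
      using kspaceD(4)[OF kspace_N that] by simp
  qed
  show "a \<odot> x \<in> hcomp M (d + e)" if "a \<in> homog n d" "x \<in> hcomp M e" for d e a x
    using hcomp_smult[OF that] by (simp add: add.commute)
  fix x assume x: "x \<in> carrier M"
  show "\<exists>!u. (\<forall>d. u d \<in> hcomp M d) \<and> finite {d. u d \<noteq> \<zero>} \<and> x = (\<Oplus>d\<in>{d. u d \<noteq> \<zero>}. u d)"
  proof (rule ex1I[of _ "\<lambda>d. pr d x"])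
    let ?A = "{d. pr d x \<noteq> \<zero>}"
    have c: "(\<lambda>d. pr d x) \<in> ?A \<rightarrow> carrier M" using x by auto
    have s: "(\<Oplus>d\<in>?A. pr d x) \<in> carrier M" using c by (rule M.finsum_closed)
    have "x \<ominus> (\<Oplus>d\<in>?A. pr d x) = \<zero>"
    proof (rule pr_all_zero)
      show "x \<ominus> (\<Oplus>d\<in>?A. pr d x) \<in> carrier M" using x s by (rule M.minus_closed)
      fix d
      have "pr d (\<Oplus>d\<in>?A. pr d x) = pr d x"
        using pr_finsum[OF finite_pr[OF x], of "\<lambda>d. pr d x" d] pr_in[OF x] by simp
      then show "pr d (x \<ominus> (\<Oplus>d\<in>?A. pr d x)) = \<zero>"
        unfolding pr_minus[OF x s] using minus_eq_zero_iff[of "pr d x" "pr d x"] x by simp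
    qed
    then show "(\<forall>d. pr d x \<in> hcomp M d) \<and> finite ?A \<and> x = (\<Oplus>d\<in>?A. pr d x)"
      using minus_eq_zero_iff[OF x s] finite_pr[OF x] pr_in[OF x] by simp
    fix u assume u: "(\<forall>d. u d \<in> hcomp M d) \<and> finite {d. u d \<noteq> \<zero>} \<and> x = (\<Oplus>d\<in>{d. u d \<noteq> \<zero>}. u d)"
    show "u = (\<lambda>d. pr d x)"
    proof
      fix d
      have "pr d x = pr d (\<Oplus>d\<in>{d. u d \<noteq> \<zero>}. u d)" using u by simp
      also have "\<dots> = u d" using u pr_finsum[of "{d. u d \<noteq> \<zero>}" u d] by auto
      finally show "u d = pr d x" ..
    qed
  qed
qed

end

lemma graded_iso_presents:
  assumes M: "pmodule n M" and gm: "graded_module n M" "graded_module n Q"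
    and pres: "presents n M (carrier M) \<phi> Q" and inj: "inj_on \<phi> (carrier M)"
  shows "graded_iso n M Q"
proof -
  interpret pmodule n M by fact
  have Q: "carrier Q = \<phi> ` carrier M"
    "\<And>x y. x \<in> carrier M \<Longrightarrow> y \<in> carrier M \<Longrightarrow> \<phi> x \<oplus>\<^bsub>Q\<^esub> \<phi> y = \<phi> (x \<oplus>\<^bsub>M\<^esub> y)"
    "\<And>a x. a \<in> carrier (poly_ring n) \<Longrightarrow> x \<in> carrier M \<Longrightarrow> a \<odot>\<^bsub>Q\<^esub> \<phi> x = \<phi> (a \<odot>\<^bsub>M\<^esub> x)"
    "\<And>d. hcomp Q d = \<phi> ` (carrier M \<inter> hcomp M d)"
    using pres unfolding presents_def by blast+
  have sub: "hcomp M d \<subseteq> carrier M" for d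
    using gm(1) subgroup.subset[of "hcomp M d" "add_monoid M"] by (auto simp: graded_module_def)
  define \<psi> where "\<psi> = inv_into (carrier M) \<phi>"
  have \<psi>: "\<psi> (\<phi> x) = x" if "x \<in> carrier M" for x unfolding \<psi>_def using inv_into_f_f[OF inj that] .
  have "\<phi> \<in> graded_hom n M Q"
    using sub by (auto simp: graded_hom_def Q)
  moreover have "\<psi> \<in> graded_hom n Q M"
    unfolding graded_hom_def
  proof (intro CollectI conjI ballI allI)
    show "\<psi> \<in> carrier Q \<rightarrow> carrier M" using \<psi> by (auto simp: Q(1))
    show "\<psi> (x \<oplus>\<^bsub>Q\<^esub> y) = \<psi> x \<oplus>\<^bsub>M\<^esub> \<psi> y" if "x \<in> carrier Q" "y \<in> carrier Q" for x y
      using that by (auto simp: Q \<psi>)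
    show "\<psi> (a \<odot>\<^bsub>Q\<^esub> x) = a \<odot>\<^bsub>M\<^esub> \<psi> x" if "a \<in> carrier (poly_ring n)" "x \<in> carrier Q" for a x
      using that by (auto simp: Q \<psi>)
    show "\<psi> ` hcomp Q d \<subseteq> hcomp M d" for d using \<psi> by (auto simp: Q(4))
  qed
  moreover have "\<forall>x\<in>carrier M. \<psi> (\<phi> x) = x" "\<forall>y\<in>carrier Q. \<phi> (\<psi> y) = y" using \<psi> by (auto simp: Q(1))
  ultimately show ?thesis unfolding graded_iso_def using gm by blast
qed

section \<open>Finite bases of spaces with bounded independent sets\<close>

context pmodule
begin

definition indep :: "'b set \<Rightarrow> bool" where
  "indep W \<longleftrightarrow> (\<forall>w\<in>W. w \<notin> kspan M (W - {w}))"

lemma kspace_pconst_cancel: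
  assumes U: "kspace M U" and "x \<in> carrier M" "pconst c \<odot> x \<in> U" "c \<noteq> 0" shows "x \<in> U"
proof -
  have "pconst (inverse c) \<odot> (pconst c \<odot> x) \<in> U" using kspaceD(5)[OF U assms(3)] .
  moreover have "pconst (inverse c) \<odot> (pconst c \<odot> x) = pconst (inverse c * c) \<odot> x"
    unfolding pconst_mult using assms by (intro sm_mult[symmetric]) auto
  ultimately show ?thesis using assms by simp
qed

lemma indep_insert:
  assumes W: "indep W" "W \<subseteq> carrier M" and v: "v \<in> carrier M" "v \<notin> kspan M W"
  shows "indep (insert v W)"
  unfolding indep_def
proof
  fix w assume w: "w \<in> insert v W"
  have vW: "v \<notin> W" using kspan_base[OF W(2)] v by blast
  show "w \<notin> kspan M (insert v W - {w})"
  proof (cases "w = v")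
    case True
    then show ?thesis using v(2) vW by simp
  next
    case False
    then have wW: "w \<in> W" using w by simp
    have i: "insert v W - {w} = insert v (W - {w})" using False by auto
    have W': "W - {w} \<subseteq> carrier M" "insert v (W - {w}) \<subseteq> carrier M" using W v by auto
    note k = kspaceD[OF kspace_kspan[OF W(2)]]
    show ?thesis
    proof
      assume "w \<in> kspan M (insert v W - {w})"
      then obtain c s where s: "s \<in> kspan M (W - {w})" "w = pconst c \<odot> v \<oplus> s"
        unfolding i using kspan_insertE[OF _ W'(2)] by metis
      have sc: "s \<in> carrier M" using kspaceD(2)[OF kspace_kspan[OF W'(1)] s(1)] .
      have c0: "c \<noteq> 0"
      proof
        assume "c = 0"
        then have "w = s" using s(2) sc v by simp
        then show False using W(1) wW s(1) by (auto simp: indep_def)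
      qed
      have "s \<in> kspan M W" using s(1) kspan_mono[of "W - {w}" W] by auto
      moreover have "w \<in> kspan M W" using kspan_base[OF W(2) wW] .
      ultimately have "w \<ominus> s \<in> kspan M W" by (rule kspace_minus[OF kspace_kspan[OF W(2)], rotated])
      moreover have "w \<ominus> s = pconst c \<odot> v" using s(2) sc v by (simp add: a_minus_def M.a_assoc M.r_neg)
      ultimately have "v \<in> kspan M W"
        using kspace_pconst_cancel[OF kspace_kspan[OF W(2)] v(1) _ c0] by simp
      then show False using v(2) by simp
    qed
  qed
qed

text \<open>Every finite set is spanned by at most \<open>C\<close> of its own elements, so an
  independent set has at most \<open>C\<close> elements, and one of maximal size spans.\<close>

lemma ex_basis:
  assumes V: "kspace M V"
    and bound: "\<And>S. finite S \<Longrightarrow> S \<subseteq> V \<Longrightarrow> \<exists>W\<subseteq>S. card W \<le> C \<and> S \<subseteq> kspan M W"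
  obtains W where "finite W" "W \<subseteq> V" "indep W" "V \<subseteq> kspan M W"
proof -
  have Vc: "V \<subseteq> carrier M" using kspaceD(1)[OF V] .
  let ?I = "\<lambda>W. finite W \<and> W \<subseteq> V \<and> indep W"
  have le: "card S \<le> C" if S: "?I S" for S
  proof (rule ccontr)
    assume "\<not> card S \<le> C"
    obtain W where W: "W \<subseteq> S" "card W \<le> C" "S \<subseteq> kspan M W" using bound[of S] S by auto
    then have "W \<noteq> S" using \<open>\<not> card S \<le> C\<close> by auto
    then obtain s where s: "s \<in> S" "s \<notin> W" using W(1) by auto
    then have "W \<subseteq> S - {s}" using W(1) by auto
    then have "s \<in> kspan M (S - {s})" using W(3) s(1) kspan_mono by blast
    then show False using S s(1) by (auto simp: indep_def)
  qed
  have "?I {}" by (simp add: indep_def)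
  then obtain W where W: "?I W" "\<And>S. ?I S \<Longrightarrow> card S \<le> card W"
    using ex_has_greatest_nat[of ?I "{}" card "Suc C"] le by (metis le_imp_less_Suc)
  have "V \<subseteq> kspan M W"
  proof (rule ccontr)
    assume "\<not> V \<subseteq> kspan M W"
    then obtain v where v: "v \<in> V" "v \<notin> kspan M W" by auto
    have Wc: "W \<subseteq> carrier M" using W(1) Vc by auto
    have "?I (insert v W)" using indep_insert[OF _ Wc _ v(2)] W(1) v(1) Vc by auto
    then have "card (insert v W) \<le> card W" using W(2) by blast
    moreover have "v \<notin> W" using v(2) kspan_base[OF Wc] by blast
    ultimately show False using W(1) by simp
  qed
  then show thesis using that W(1) by blast
qed

text \<open>The coefficient along \<open>w\<close> modulo the span of the other elements of
  \<open>W\<close>. In this form linearity follows from uniqueness, without families of coefficients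
  indexed by \<open>W\<close>.\<close>

definition coord :: "'b set \<Rightarrow> 'b \<Rightarrow> 'b \<Rightarrow> 'k" where
  "coord W w v = (THE c. \<exists>s\<in>kspan M (W - {w}). v = pconst c \<odot> w \<oplus> s)"

context
  fixes W assumes W: "indep W" "W \<subseteq> carrier M"
begin

text \<open>Two different coefficients would put a non-zero multiple of \<open>w\<close>, hence
  \<open>w\<close>, into the span of the others.\<close>

lemma coord_eqI:
  assumes w: "w \<in> W" and s: "s \<in> kspan M (W - {w})" "v = pconst c \<odot> w \<oplus> s"
  shows "coord W w v = c"
  unfolding coord_def
proof (rule the_equality)
  show "\<exists>s\<in>kspan M (W - {w}). v = pconst c \<odot> w \<oplus> s" using s by blast
  fix c' assume "\<exists>s\<in>kspan M (W - {w}). v = pconst c' \<odot> w \<oplus> s"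
  then obtain s' where s': "s' \<in> kspan M (W - {w})" "v = pconst c' \<odot> w \<oplus> s'" by auto
  have k: "kspace M (kspan M (W - {w}))" using W(2) by (intro kspace_kspan) auto
  have c: "s \<in> carrier M" "s' \<in> carrier M" "w \<in> carrier M" using kspaceD(2)[OF k s(1)] kspaceD(2)[OF k s'(1)] w W(2) by auto
  show "c' = c"
  proof (rule ccontr)
    assume ne: "c' \<noteq> c"
    have "pconst (c' - c) \<odot> w = pconst c' \<odot> w \<ominus> pconst c \<odot> w"
    proof -
      have e: "pconst (c' - c) = pconst c' + - pconst c"
        using pconst_add[of c' "- c"] by (simp add: pconst_uminus)
      have "(pconst c' + - pconst c) \<odot> w = pconst c' \<odot> w \<oplus> (- pconst c) \<odot> w"
        using c by (intro sm_add_left) auto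
      then show ?thesis unfolding e a_minus_def using c sm_uminus[of "pconst c" w] by simp
    qed
    also have "\<dots> = s \<ominus> s'"
    proof -
      have e: "pconst c' \<odot> w \<oplus> s' = pconst c \<odot> w \<oplus> s" using s(2) s'(2) by simp
      have ac: "pconst c' \<odot> w \<in> carrier M" "pconst c \<odot> w \<in> carrier M" using c by auto
      have "pconst c' \<odot> w = (pconst c' \<odot> w \<oplus> s') \<oplus> \<ominus> s'" using ac c by (simp add: M.a_assoc M.r_neg)
      also have "\<dots> = pconst c \<odot> w \<oplus> (s \<oplus> \<ominus> s')" unfolding e using ac c by (simp add: M.a_assoc)
      finally have "pconst c' \<odot> w \<ominus> pconst c \<odot> w = (pconst c \<odot> w \<oplus> (s \<oplus> \<ominus> s')) \<oplus> \<ominus> (pconst c \<odot> w)"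
        by (simp add: a_minus_def)
      also have "\<dots> = (s \<oplus> \<ominus> s') \<oplus> (pconst c \<odot> w \<oplus> \<ominus> (pconst c \<odot> w))"
        using ac c by (simp add: M.a_ac)
      also have "\<dots> = s \<ominus> s'" using ac c by (simp add: M.r_neg a_minus_def)
      finally show ?thesis .
    qed
    finally have "pconst (c' - c) \<odot> w \<in> kspan M (W - {w})" using kspace_minus[OF k s(1) s'(1)] by simp
    then have "w \<in> kspan M (W - {w})" using kspace_pconst_cancel[OF k c(3)] ne by simp
    then show False using W(1) w by (auto simp: indep_def)
  qed
qed

lemma coordE:
  assumes w: "w \<in> W" and v: "v \<in> kspan M W"
  obtains s where "s \<in> kspan M (W - {w})" "v = pconst (coord W w v) \<odot> w \<oplus> s"
proof -
  have i: "insert w (W - {w}) = W" using w by auto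
  have vi: "v \<in> kspan M (insert w (W - {w}))" "insert w (W - {w}) \<subseteq> carrier M"
    unfolding i using v W(2) .
  obtain c s where s: "s \<in> kspan M (W - {w})" "v = pconst c \<odot> w \<oplus> s"
    using kspan_insertE[OF vi] .
  then show thesis using that coord_eqI[OF w s] by simp
qed

lemma coord_add:
  assumes w: "w \<in> W" and v: "v \<in> kspan M W" "v' \<in> kspan M W"
  shows "coord W w (v \<oplus> v') = coord W w v + coord W w v'"
proof -
  obtain s where s: "s \<in> kspan M (W - {w})" "v = pconst (coord W w v) \<odot> w \<oplus> s" using coordE w v(1) .
  obtain s' where s': "s' \<in> kspan M (W - {w})" "v' = pconst (coord W w v') \<odot> w \<oplus> s'" using coordE w v(2) .
  have k: "kspace M (kspan M (W - {w}))" using W(2) by (intro kspace_kspan) auto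
  have c: "s \<in> carrier M" "s' \<in> carrier M" "w \<in> carrier M" using kspaceD(2)[OF k s(1)] kspaceD(2)[OF k s'(1)] w W(2) by auto
  have "v \<oplus> v' = (pconst (coord W w v) \<odot> w \<oplus> s) \<oplus> (pconst (coord W w v') \<odot> w \<oplus> s')"
    using s(2) s'(2) by metis
  also have "\<dots> = pconst (coord W w v + coord W w v') \<odot> w \<oplus> (s \<oplus> s')"
    using c by (simp add: pconst_add sm_add_left M.a_ac)
  finally show ?thesis by (rule coord_eqI[OF w kspaceD(4)[OF k s(1) s'(1)]])
qed

lemma coord_pconst:
  assumes w: "w \<in> W" and v: "v \<in> kspan M W"
  shows "coord W w (pconst c \<odot> v) = c * coord W w v"
proof -
  obtain s where s: "s \<in> kspan M (W - {w})" "v = pconst (coord W w v) \<odot> w \<oplus> s" using coordE w v .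
  have k: "kspace M (kspan M (W - {w}))" using W(2) by (intro kspace_kspan) auto
  have sc: "s \<in> carrier M" "w \<in> carrier M" using kspaceD(2)[OF k s(1)] w W(2) by auto
  have "pconst c \<odot> v = pconst c \<odot> (pconst (coord W w v) \<odot> w \<oplus> s)" using s(2) by metis
  also have "\<dots> = pconst (c * coord W w v) \<odot> w \<oplus> pconst c \<odot> s"
    using sc by (simp add: pconst_mult smult_r_distr sm_mult)
  finally show ?thesis by (rule coord_eqI[OF w kspaceD(5)[OF k s(1)]])
qed

lemma coord_basis:
  assumes w: "w \<in> W" "w' \<in> W"
  shows "coord W w w' = (if w = w' then 1 else 0)"
proof -
  have W': "W - {w} \<subseteq> carrier M" using W by auto
  note k = kspaceD[OF kspace_kspan[OF W']]
  have wc: "w \<in> carrier M" "w' \<in> carrier M" using w W by auto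
  show ?thesis
  proof (cases "w = w'")
    case True
    then show ?thesis using coord_eqI[OF w(1) k(3), of w 1] wc by simp
  next
    case False
    then have "w' \<in> kspan M (W - {w})" using kspan_base[OF W'] w by auto
    from coord_eqI[OF w(1) this, of w' 0] show ?thesis using False wc by simp
  qed
qed

lemma coord_zero: "w \<in> W \<Longrightarrow> coord W w \<zero> = 0"
  using coord_pconst[of w \<zero> 0] kspaceD(3)[OF kspace_kspan[OF W(2)]] by simp

lemma coord_finsum:
  assumes "finite W" "v \<in> kspan M W"
  shows "v = (\<Oplus>w\<in>W. pconst (coord W w v) \<odot> w)"
proof -
  have "v \<in> kspan M W \<and> v = (\<Oplus>w\<in>W. pconst (coord W w v) \<odot> w)"
    using assms(2) unfolding kspan_def[of M W]
  proof (induction rule: asum.induct)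
    case asum_zero
    have "(\<Oplus>w\<in>W. pconst (coord W w \<zero>) \<odot> w) = (\<Oplus>w\<in>W. \<zero>)"
      using W(2) by (intro M.finsum_cong') (auto simp: coord_zero)
    then show ?case using kspaceD(3)[OF kspace_kspan[OF W(2)]] by (simp add: kspan_def)
  next
    case (asum_step x s)
    then obtain c w where x: "x = pconst c \<odot> w" "w \<in> W" by auto
    have s: "s \<in> kspan M W" "s = (\<Oplus>w\<in>W. pconst (coord W w s) \<odot> w)"
      using asum_step.IH by (simp_all add: kspan_def)
    have wk: "w \<in> kspan M W" using kspan_base[OF W(2) x(2)] .
    have xk: "x \<in> kspan M W" unfolding x(1) using kspaceD(5)[OF kspace_kspan[OF W(2)] wk] .
    have co: "coord W w' (x \<oplus> s) = (if w = w' then c else 0) + coord W w' s" if "w' \<in> W" for w'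
      using that x wk coord_add[OF that xk s(1)] coord_pconst[OF that wk, of c] coord_basis[OF that x(2)] by auto
    have "(\<Oplus>w'\<in>W. pconst (coord W w' (x \<oplus> s)) \<odot> w') =
       (\<Oplus>w'\<in>W. (if w = w' then pconst c \<odot> w' else \<zero>) \<oplus> pconst (coord W w' s) \<odot> w')"
      using W(2) by (intro M.finsum_cong') (auto simp: co pconst_add sm_add_left)
    also have "\<dots> = (\<Oplus>w'\<in>W. (if w = w' then pconst c \<odot> w' else \<zero>)) \<oplus> (\<Oplus>w'\<in>W. pconst (coord W w' s) \<odot> w')"
      using W(2) by (intro M.finsum_addf) auto
    also have "(\<Oplus>w'\<in>W. (if w = w' then pconst c \<odot> w' else \<zero>)) = x"
      unfolding x(1) using W(2) by (intro M.finsum_singleton[OF x(2) assms(1)]) auto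
    finally have "x \<oplus> s = (\<Oplus>w\<in>W. pconst (coord W w (x \<oplus> s)) \<odot> w)" using s(2) by simp
    moreover have "x \<oplus> s \<in> kspan M W" using kspaceD(4)[OF kspace_kspan[OF W(2)] xk s(1)] .
    ultimately show ?case by (simp add: kspan_def)
  qed
  then show ?thesis ..
qed

end

end

section \<open>The socle\<close>

lemma exps_diff:
  fixes b c :: "nat \<Rightarrow>\<^sub>0 nat"
  assumes "b \<in> exps n" "\<And>i. i < n \<Longrightarrow> Poly_Mapping.lookup c i \<le> Poly_Mapping.lookup b i" "c \<in> exps n"
  shows "b - c \<in> exps n" "b - c + c = b"
proof -
  show "b - c \<in> exps n" using assms(1) by (simp add: exps_iff lookup_minus)
  show "b - c + c = b"
  proof (rule poly_mapping_eqI)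
    fix i show "Poly_Mapping.lookup (b - c + c) i = Poly_Mapping.lookup b i"
      using assms(2)[of i] exps_lookup[OF assms(1), of i] exps_lookup[OF assms(3), of i]
      by (cases "i < n") (auto simp: lookup_add lookup_minus)
  qed
qed

lemma lookup_expscale_single: "Poly_Mapping.lookup (expscale k (Poly_Mapping.single j 1)) i = (if i = j then k else 0)"
  by (simp add: lookup_single when_def)

definition top_exp :: "nat \<Rightarrow> nat \<Rightarrow> (nat \<Rightarrow>\<^sub>0 nat)" where
  "top_exp n q = (\<Sum>i<n. Poly_Mapping.single i (q - 1))"

lemma lookup_top_exp: "Poly_Mapping.lookup (top_exp n q) i = (if i < n then q - 1 else 0)"
  by (simp add: top_exp_def lookup_sum lookup_single when_def)

lemma top_exp_exps: "top_exp n q \<in> exps n" by (simp add: exps_iff lookup_top_exp)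

lemma top_exp_box: "q > 0 \<Longrightarrow> top_exp n q \<in> box n q"
  by (simp add: box_def top_exp_exps lookup_top_exp)

lemma monom_deg_top_exp: "monom_deg (top_exp n q) = n * (q - 1)"
  by (simp add: monom_deg_exps[OF top_exp_exps] lookup_top_exp)

context frob_level
begin

text \<open>Some coordinate a_i is below q - 1, so multiplication by x_i carries the coefficient at
  \<open>a\<close> unchanged to another place in the box; but x_i v = 0.\<close>

lemma kap_socle:
  assumes v: "v \<in> carrier M" "\<And>i. i < n \<Longrightarrow> pvar i \<odot> v = \<zero>"
    and a: "a \<in> box n q" "a \<noteq> top_exp n q"
  shows "\<kappa> a d v = \<zero>"
proof -
  have "\<exists>i<n. Poly_Mapping.lookup a i \<noteq> q - 1"
  proof (rule ccontr)
    assume "\<not> ?thesis"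
    then have "a = top_exp n q"
      using exps_lookup[OF boxD[OF a(1)]] by (intro poly_mapping_eqI) (simp add: lookup_top_exp)
    then show False using a by simp
  qed
  then obtain i where i: "i < n" "Poly_Mapping.lookup a i \<noteq> q - 1" by auto
  then have i2: "Suc (Poly_Mapping.lookup a i) < q" using a(1) by (auto simp: box_def)
  let ?b = "Poly_Mapping.single i (1::nat)"
  have "a + ?b \<in> box n q"
    using a(1) i i2 by (auto simp: box_def exps_add lookup_add lookup_single when_def)
  then have "\<kappa> (a + ?b) d (xpow ?b \<odot> v) = \<kappa> a d v" using kap_shift[OF a(1) _ v(1)] by blast
  moreover have "xpow ?b \<odot> v = \<zero>" using v(2)[OF i(1)] by (simp add: pvar_conv)
  ultimately show ?thesis using kap_zero[OF \<open>a + ?b \<in> box n q\<close>] by simp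
qed

text \<open>The coefficients off the top exponent vanish by \<open>kap_socle\<close>, and at the top
  only degree index \<open>d0\<close> survives; so both sides have the same coefficients.\<close>

lemma socle_top:
  assumes v: "v \<in> carrier M" "\<And>i. i < n \<Longrightarrow> pvar i \<odot> v = \<zero>"
    and d0: "\<And>d. d \<noteq> d0 \<Longrightarrow> \<kappa> (top_exp n q) d v = \<zero>"
  shows "xpow (top_exp n q) \<odot> \<kappa> (top_exp n q) d0 v = v"
proof -
  let ?t = "top_exp n q"
  have t: "?t \<in> box n q" using top_exp_box q_pos .
  define v' where "v' = \<kappa> ?t d0 v"
  have v': "v' \<in> N d0" unfolding v'_def using kap_in t v by blast
  have c: "xpow ?t \<odot> v' \<in> carrier M" using t N_carrier[OF v'] by auto
  have "v \<ominus> xpow ?t \<odot> v' = \<zero>"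
  proof (rule kap_all_zero)
    show "v \<ominus> xpow ?t \<odot> v' \<in> carrier M" using v c by auto
    fix a d assume a: "a \<in> box n q"
    have "\<kappa> a d v = \<kappa> a d (xpow ?t \<odot> v')"
      unfolding kap_xpow[OF a t v'] using kap_socle[OF v a] d0[of d] by (auto simp: v'_def)
    then show "\<kappa> a d (v \<ominus> xpow ?t \<odot> v') = \<zero>"
      unfolding kap_minus[OF a v(1) c] using minus_eq_zero_iff kap_closed[OF a c] by simp
  qed
  then show ?thesis using minus_eq_zero_iff[OF v(1) c] by (simp add: v'_def)
qed

end

section \<open>Torsion modules with descent data and their socle in degree -n\<close>

locale torsion_frob =
  fixes n p :: nat and M :: "('k::field mpoly, 'b) gmod" (structure)
    and N :: "nat \<Rightarrow> int \<Rightarrow> 'b set" and \<kappa> :: "nat \<Rightarrow> (nat \<Rightarrow>\<^sub>0 nat) \<Rightarrow> int \<Rightarrow> 'b \<Rightarrow> 'b"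
  assumes p: "p > Suc 0" and level: "\<And>e. frob_level n M (p ^ e) (N e) (\<kappa> e)"
    and struct: "frob_struct n p M N"
    and torsion: "\<And>h i. h \<in> carrier M \<Longrightarrow> i < n \<Longrightarrow> \<exists>k. pvar i ^ k \<odot> h = \<zero>"

sublocale torsion_frob \<subseteq> graded n M "\<kappa> 0"
  using level[of 0] struct by (simp add: graded_def frob_struct_def)

context torsion_frob
begin

lemma pow_ge: "e < p ^ e"
  using p less_exp[of e] power_mono[of 2 p e] by linarith

lemma int_top: "int (n * (p ^ e - 1)) = int n * (int (p ^ e) - 1)"
proof -
  have "1 \<le> p ^ e" using p by simp
  then have "int (p ^ e - 1) = int (p ^ e) - int 1" by (rule of_nat_diff)
  then show ?thesis by (simp only: of_nat_mult of_nat_1)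
qed

text \<open>The piece x^a N_d lives in degree q d + |a|, so this coefficient sees only that
  homogeneous component. This links level \<open>e\<close> to the grading.\<close>

lemma kap_pr:
  assumes a: "a \<in> box n (p ^ e)" and x: "x \<in> carrier M"
  shows "\<kappa> e a d (pr D x) = (if D = int (p ^ e) * d + int (monom_deg a) then \<kappa> e a d x else \<zero>)"
proof -
  interpret l: frob_level n M "p ^ e" "N e" "\<kappa> e" by (rule level)
  from x show ?thesis
  proof (induction rule: l.generate_induct)
    case zero
    then show ?case using a by (simp add: pr_zero l.kap_zero)
  next
    case (add b u d1 s)
    have "xpow b \<odot> u \<in> hcomp M (int (p ^ e) * d1 + int (monom_deg b))"
      using hcomp_smult[OF homog_xpow[OF boxD[OF add(1)]]] l.N_hcomp add(2) by blast
    then have "pr D (xpow b \<odot> u) = (if D = int (p ^ e) * d1 + int (monom_deg b) then xpow b \<odot> u else \<zero>)"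
      by (rule pr_hcomp)
    then show ?case
      using add a by (auto simp: pr_add l.kap_add l.kap_zero l.kap_xpow)
  qed
qed

lemma kap_degree:
  assumes a: "a \<in> box n (p ^ e)" and x: "x \<in> hcomp M D" and ne: "\<kappa> e a d x \<noteq> \<zero>"
  shows "D = int (p ^ e) * d + int (monom_deg a)"
proof -
  have "pr D x = x" using pr_hcomp[OF x] by simp
  then show ?thesis using kap_pr[OF a hcomp_carrier[OF x], of d D] ne by (auto split: if_splits)
qed

text \<open>An element of the socle is \<open>x\<^sup>q\<^sup>-\<^sup>1 v'\<close> with \<open>v'\<close> of degree divisible by \<open>q\<close>, so its degree is
  \<open>-n\<close> modulo every power \<open>q\<close> of \<open>p\<close>.\<close>

lemma socle_degree:
  assumes v: "v \<in> hcomp M D" "v \<noteq> \<zero>" "\<And>i. i < n \<Longrightarrow> pvar i \<odot> v = \<zero>"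
  shows "D = - int n"
proof -
  \<comment> \<open>Chosen so that p^e exceeds |D + n|; divisibility by p^e then forces D + n =
    0.\<close>
  define e where "e = nat \<bar>D + int n\<bar>"
  interpret l: frob_level n M "p ^ e" "N e" "\<kappa> e" by (rule level)
  let ?t = "top_exp n (p ^ e)"
  have t: "?t \<in> box n (p ^ e)" using top_exp_box l.q_pos .
  have "\<exists>d. \<kappa> e ?t d v \<noteq> \<zero>"
  proof (rule ccontr)
    assume "\<not> ?thesis"
    then have "v = \<zero>"
      using l.kap_socle[OF hcomp_carrier[OF v(1)] v(3)] by (intro l.kap_all_zero[OF hcomp_carrier[OF v(1)]]) blast
    then show False using v by simp
  qed
  then obtain d where "\<kappa> e ?t d v \<noteq> \<zero>" by blast
  then have "D = int (p ^ e) * d + int (n * (p ^ e - 1))"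
    using kap_degree[OF t v(1)] by (simp add: monom_deg_top_exp)
  also have "int (n * (p ^ e - 1)) = int n * (int (p ^ e) - 1)"
    by (rule int_top)
  finally have "D + int n = int (p ^ e) * (d + int n)" by (simp add: algebra_simps)
  then have dv: "int (p ^ e) dvd D + int n" by simp
  have "\<bar>D + int n\<bar> < int (p ^ e)" using pow_ge[of e] unfolding e_def by linarith
  then have "D + int n = 0" using dvd_imp_le_int[OF _ dv] by (cases "D + int n = 0") auto
  then show ?thesis by simp
qed

text \<open>By torsion only finitely many monomials do not kill \<open>x\<close>. One of largest
  degree moves \<open>x\<close> to a non-zero element killed by all variables, and
  \<open>socle_degree\<close> gives its degree.\<close>

lemma socle_multiple:
  assumes x: "x \<in> hcomp M D" "x \<noteq> \<zero>"
  obtains b where "b \<in> exps n" "xpow b \<odot> x \<noteq> \<zero>" "D + int (monom_deg b) = - int n"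
proof -
  have xc: "x \<in> carrier M" using x(1) hcomp_carrier by blast
  obtain k where k: "\<And>i. i < n \<Longrightarrow> pvar i ^ k i \<odot> x = \<zero>" using torsion[OF xc] by metis
  define T where "T = {b \<in> exps n. xpow b \<odot> x \<noteq> \<zero>}"
  \<comment> \<open>A monomial whose i-th exponent reaches \<open>k i\<close> kills
    \<open>x\<close>; the sum of the \<open>k i\<close> is a common bound for all
    coordinates.\<close>
  have "T \<subseteq> box n (\<Sum>i<n. k i)"
  proof
    fix b assume b: "b \<in> T"
    have "Poly_Mapping.lookup b i < (\<Sum>i<n. k i)" if i: "i < n" for i
    proof -
      have "Poly_Mapping.lookup b i < k i"
      proof (rule ccontr)
        assume nl: "\<not> ?thesis"
        let ?c = "expscale (k i) (Poly_Mapping.single i 1)"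
        have c: "?c \<in> exps n" using i by (intro exps_expscale) simp
        have le: "Poly_Mapping.lookup ?c l \<le> Poly_Mapping.lookup b l" for l
          unfolding lookup_expscale_single using nl by auto
        have "b \<in> exps n" using b by (simp add: T_def)
        note bc = exps_diff[OF this le c]
        have "xpow b \<odot> x = (xpow (b - ?c) * xpow ?c) \<odot> x" using bc(2) by (simp flip: xpow_add)
        also have "\<dots> = xpow (b - ?c) \<odot> (xpow ?c \<odot> x)"
          using bc(1) c xc by (intro sm_mult xpow_in_poly_ring)
        also have "xpow ?c \<odot> x = \<zero>" using k[OF i] by (simp add: pvar_conv xpow_power)
        also have "xpow (b - ?c) \<odot> \<zero> = \<zero>" using bc(1) by (intro smult_r_null xpow_in_poly_ring)
        finally show False using b by (simp add: T_def)
      qed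
      also have "k i \<le> (\<Sum>i<n. k i)" using i by (intro member_le_sum) auto
      finally show ?thesis .
    qed
    then show "b \<in> box n (\<Sum>i<n. k i)" using b by (simp add: box_def T_def)
  qed
  then have fT: "finite T" using finite_box finite_subset by blast
  have "0 \<in> T" using x xc by (simp add: T_def)
  then have "Max (monom_deg ` T) \<in> monom_deg ` T" using fT by (intro Max_in) auto
  then obtain b where b: "b \<in> T" "monom_deg b = Max (monom_deg ` T)" by auto
  have b1: "b \<in> exps n" "xpow b \<odot> x \<noteq> \<zero>" using b(1) by (auto simp: T_def)
  have xb: "xpow b \<in> carrier (poly_ring n)" using b1(1) by (rule xpow_in_poly_ring)
  have "xpow b \<odot> x \<in> hcomp M (D + int (monom_deg b))" using hcomp_smult[OF homog_xpow[OF b1(1)] x(1)] .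
  moreover have "pvar i \<odot> (xpow b \<odot> x) = \<zero>" if i: "i < n" for i
  proof (rule ccontr)
    let ?s = "Poly_Mapping.single i (1::nat)"
    assume "pvar i \<odot> (xpow b \<odot> x) \<noteq> \<zero>"
    moreover have "pvar i \<odot> (xpow b \<odot> x) = xpow (?s + b) \<odot> x"
      unfolding pvar_conv xpow_add using i xb xc b1(1) by (intro sm_mult[symmetric] xpow_in_poly_ring) auto
    ultimately have "?s + b \<in> T" using i b1(1) by (simp add: T_def exps_add)
    then have "monom_deg (?s + b) \<le> monom_deg b" unfolding b(2) using fT by (intro Max_ge) auto
    then show False by (simp add: monom_deg_add)
  qed
  ultimately have "D + int (monom_deg b) = - int n" using socle_degree b1(2) by blast
  then show thesis using that b1 by blast
qed

abbreviation "V \<equiv> hcomp M (- int n)"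

text \<open>A non-zero x_i v would have degree -n + 1 and, by \<open>socle_multiple\<close>, a
  monomial multiple of degree -n; multiplication by monomials never lowers degrees.\<close>

lemma V_socle: "v \<in> V \<Longrightarrow> i < n \<Longrightarrow> pvar i \<odot> v = \<zero>"
proof (rule ccontr)
  assume v: "v \<in> V" and i: "i < n" and ne: "pvar i \<odot> v \<noteq> \<zero>"
  have "(pvar i :: 'k mpoly) \<in> homog n 1"
    using homog_xpow[OF exps_single[OF i, of 1]] by (simp add: pvar_conv)
  then have "pvar i \<odot> v \<in> hcomp M (- int n + 1)" using hcomp_smult v by blast
  then obtain b where "- int n + 1 + int (monom_deg b) = - int n" using socle_multiple ne by metis
  then show False by simp
qed

text \<open>A top coefficient with degree index \<open>d\<close> contributes in degree q d + n (q -
  1), and this equals -n only for d = -n.\<close>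

lemma V_top:
  assumes v: "v \<in> V" defines "t \<equiv> \<lambda>e. top_exp n (p ^ e)"
  shows "xpow (t e) \<odot> \<kappa> e (t e) (- int n) v = v"
  unfolding t_def
proof (rule frob_level.socle_top[OF level hcomp_carrier[OF v] V_socle[OF v]])
  interpret l: frob_level n M "p ^ e" "N e" "\<kappa> e" by (rule level)
  fix d assume d: "d \<noteq> - int n"
  show "\<kappa> e (top_exp n (p ^ e)) d v = \<zero>"
  proof (rule ccontr)
    assume "\<kappa> e (top_exp n (p ^ e)) d v \<noteq> \<zero>"
    then have "- int n = int (p ^ e) * d + int (n * (p ^ e - 1))"
      using kap_degree[OF top_exp_box[OF l.q_pos] v] by (simp add: monom_deg_top_exp)
    also have "int (n * (p ^ e - 1)) = int n * (int (p ^ e) - 1)"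
      by (rule int_top)
    finally have "int (p ^ e) * (d + int n) = 0" by (simp add: algebra_simps)
    then show False using d l.q_pos p by simp
  qed
qed

text \<open>The top coefficients of elements of \<open>S\<close> lie in a space of bounded
  dimension, and multiplication by x^t, with t the top exponent, returns the elements themselves. So
  spanning coefficients yield a spanning subset of \<open>S\<close>.\<close>

lemma V_bounded:
  obtains C where "\<And>S. finite S \<Longrightarrow> S \<subseteq> V \<Longrightarrow> \<exists>W\<subseteq>S. card W \<le> C \<and> S \<subseteq> kspan M W"
proof -
  obtain C where C: "\<And>S. finite S \<Longrightarrow> S \<subseteq> carrier M \<Longrightarrow> \<exists>e0. \<forall>e\<ge>e0. \<exists>W. finite W \<and> card W \<le> C \<and>
     W \<subseteq> (\<Union>d. N e d) \<and> S \<subseteq> span_bounded n (C * p ^ e) M W"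
    using frob_struct_fin_gen[OF struct] by metis
  have "\<exists>W\<subseteq>S. card W \<le> card (box n C) * C \<and> S \<subseteq> kspan M W" if S: "finite S" "S \<subseteq> V" for S
  proof -
    have Sc: "S \<subseteq> carrier M" using S(2) hcomp_carrier by blast
    \<comment> \<open>Any sufficiently high level will do: how high depends on \<open>S\<close>, but
      the bound does not.\<close>
    obtain e W where W: "finite W" "card W \<le> C" "W \<subseteq> (\<Union>d. N e d)" "S \<subseteq> span_bounded n (C * p ^ e) M W"
      using C[OF S(1) Sc] by (metis order_refl)
    interpret l: frob_level n M "p ^ e" "N e" "\<kappa> e" by (rule level)
    let ?t = "top_exp n (p ^ e)"
    have t: "?t \<in> box n (p ^ e)" using top_exp_box l.q_pos .
    have xt: "xpow ?t \<in> carrier (poly_ring n)" using t by simp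
    obtain Y where Y: "finite Y" "Y \<subseteq> carrier M" "card Y \<le> card (box n C) * C"
      "\<And>a d x. a \<in> box n (p ^ e) \<Longrightarrow> x \<in> S \<Longrightarrow> \<kappa> e a d x \<in> kspan M Y"
      using l.kap_kspan_card[OF W(1,3,2,4)] by blast
    define U where "U = \<kappa> e ?t (- int n) ` S"
    have "U \<subseteq> kspan M Y" using Y(4)[OF t] by (auto simp: U_def)
    then obtain W0 where W0: "W0 \<subseteq> U" "finite W0" "card W0 \<le> card Y" "U \<subseteq> kspan M W0"
      using kspan_exchange[OF Y(1,2)] by metis
    have W0c: "W0 \<subseteq> carrier M" using W0(1) Sc l.kap_closed[OF t] by (auto simp: U_def)
    let ?W = "(\<lambda>w. xpow ?t \<odot> w) ` W0"
    have Wc: "?W \<subseteq> carrier M" using W0c xt by auto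
    have "?W \<subseteq> S"
    proof
      fix w assume "w \<in> ?W"
      then obtain u where u: "u \<in> W0" "w = xpow ?t \<odot> u" by auto
      then obtain v where v: "v \<in> S" "u = \<kappa> e ?t (- int n) v" using W0(1) by (auto simp: U_def)
      have "w = v" unfolding u(2) v(2) using V_top v(1) S(2) by blast
      then show "w \<in> S" using v(1) by simp
    qed
    moreover have "card ?W \<le> card (box n C) * C"
      using card_image_le[OF W0(2), of "\<lambda>w. xpow ?t \<odot> w"] W0(3) Y(3) by linarith
    moreover have "S \<subseteq> kspan M ?W"
    proof
      fix v assume v: "v \<in> S"
      define v' where "v' = \<kappa> e ?t (- int n) v"
      have "v' \<in> asum M {pconst c \<odot> y |c y. y \<in> W0}" using W0(4) v by (auto simp: U_def v'_def kspan_def)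
      then have "xpow ?t \<odot> v' \<in> asum M {pconst c \<odot> y |c y. y \<in> ?W}"
      proof (rule asum_map[OF pmodule_axioms pmodule_axioms kspan_gens[OF W0c] kspan_gens[OF Wc],
            where \<phi> = "\<lambda>v. xpow ?t \<odot> v", rotated 3])
        show "xpow ?t \<odot> \<zero> = \<zero>" using smult_r_null[OF xt] .
        show "xpow ?t \<odot> (x \<oplus> y) = xpow ?t \<odot> x \<oplus> xpow ?t \<odot> y" if "x \<in> carrier M" "y \<in> carrier M" for x y
          using smult_r_distr[OF xt that] .
        fix z assume "z \<in> {pconst c \<odot> y |c y. y \<in> W0}"
        then obtain c y where z: "z = pconst c \<odot> y" "y \<in> W0" by auto
        have "xpow ?t \<odot> z = pconst c \<odot> (xpow ?t \<odot> y)"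
          unfolding z(1) using sm_commute[OF xt, of "pconst c" y] z(2) W0c by auto
        then show "xpow ?t \<odot> z \<in> asum M {pconst c \<odot> y |c y. y \<in> ?W}"
          using z(2) by (intro asum_base[OF _ kspan_gens[OF Wc]]) blast
      qed
      moreover have "xpow ?t \<odot> v' = v" unfolding v'_def using V_top v S(2) by blast
      ultimately show "v \<in> kspan M ?W" by (simp add: kspan_def)
    qed
    ultimately show ?thesis by blast
  qed
  then show thesis using that by blast
qed

text \<open>Vectors dual to the monomials: z = x^(t-a) v', where v = x^t v' and \<open>a\<close>
  lies in the box. Then x^a z = v. If b_j > a_j for some j, then x^b z is a multiple of x_j^q v' =
  0; any other b different from a has smaller degree, and x^b z has no component in degree
  -n.\<close>

lemma socle_dual:
  assumes a: "a \<in> exps n" and v: "v \<in> V"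
  obtains z where "z \<in> hcomp M (- int n - int (monom_deg a))"
    "\<And>b. b \<in> exps n \<Longrightarrow> pr (- int n) (xpow b \<odot> z) = (if b = a then v else \<zero>)"
proof -
  \<comment> \<open>The same \<open>e\<close> serves as a bound for the exponents and as the level,
    because e < p^e.\<close>
  obtain e where "a \<in> box n e" using ex_box[of "{a}" n] a by auto
  then have aq: "a \<in> box n (p ^ e)" using box_mono[of e "p ^ e" n] pow_ge[of e] by auto
  interpret l: frob_level n M "p ^ e" "N e" "\<kappa> e" by (rule level)
  let ?q = "p ^ e" and ?t = "top_exp n (p ^ e)"
  have t: "?t \<in> box n ?q" using top_exp_box l.q_pos .
  define v' where "v' = \<kappa> e ?t (- int n) v"
  have vc: "v \<in> carrier M" using v hcomp_carrier by blast
  have v': "v' \<in> N e (- int n)" unfolding v'_def using l.kap_in[OF t vc] .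
  have v'c: "v' \<in> carrier M" using l.N_carrier[OF v'] .
  have vt: "xpow ?t \<odot> v' = v" unfolding v'_def using V_top[OF v] .
  have ta: "?t - a \<in> exps n" "?t - a + a = ?t"
    using aq l.q_pos by (auto intro!: exps_diff[OF top_exp_exps] simp: lookup_top_exp box_def)
  define z where "z = xpow (?t - a) \<odot> v'"
  have zc: "z \<in> carrier M" unfolding z_def by (intro smult_closed xpow_in_poly_ring ta(1) v'c)
  have degt: "int (monom_deg (?t - a)) + int (monom_deg a) = int n * (int ?q - 1)"
  proof -
    have "monom_deg (?t - a) + monom_deg a = n * (?q - 1)"
      using monom_deg_add[of "?t - a" a] ta(2) by (simp add: monom_deg_top_exp)
    then have "int (monom_deg (?t - a)) + int (monom_deg a) = int (n * (?q - 1))" by (metis of_nat_add)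
    also have "\<dots> = int n * (int ?q - 1)" by (rule int_top)
    finally show ?thesis .
  qed
  have zd: "z \<in> hcomp M (- int n - int (monom_deg a))"
  proof -
    have "v' \<in> hcomp M (int ?q * - int n)" using v' l.N_hcomp by blast
    then have "z \<in> hcomp M (int ?q * - int n + int (monom_deg (?t - a)))"
      unfolding z_def by (rule hcomp_smult[OF homog_xpow[OF ta(1)]])
    also have "int ?q * - int n + int (monom_deg (?t - a)) = - int n - int (monom_deg a)"
      using degt by (simp add: algebra_simps)
    finally show ?thesis .
  qed
  \<comment> \<open>Write e_j for the j-th unit vector, so that x_j x^t = x^(t - (q-1) e_j) x_j^q.
    As x_j v = 0 and x_j^q v' lies in \<open>N\<close>, reading off the coefficient at t - (q-1) e_j
    gives x_j^q v' = 0.\<close>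
  have kill: "xpow (expscale ?q (Poly_Mapping.single j 1)) \<odot> v' = \<zero>" if j: "j < n" for j
  proof -
    let ?s = "Poly_Mapping.single j (1::nat)" and ?c = "Poly_Mapping.single j (?q - 1)"
    define w where "w = xpow (expscale ?q ?s) \<odot> v'"
    have s: "?s \<in> exps n" "?c \<in> exps n" "expscale ?q ?s \<in> exps n" using j by auto
    have w: "w \<in> N e (- int n + int (monom_deg ?s))"
      unfolding w_def using l.xpow_expscale_N[OF v' s(1)] .
    have tc: "?t - ?c \<in> exps n" "?t - ?c + ?c = ?t"
      using s j by (auto intro!: exps_diff[OF top_exp_exps] simp: lookup_top_exp lookup_single when_def)
    have tb: "?t - ?c \<in> box n ?q"
      using tc(1) l.q_pos by (auto simp: box_def lookup_minus lookup_top_exp)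
    have e: "?c + ?s = expscale ?q ?s"
      by (rule poly_mapping_eqI) (use l.q_pos in \<open>auto simp: lookup_add lookup_single when_def\<close>)
    have "\<zero> = pvar j \<odot> (xpow ?t \<odot> v')" using V_socle[OF v j] vt by simp
    also have "\<dots> = (xpow ?t * pvar j) \<odot> v'"
      unfolding mult.commute[of "xpow ?t"]
      by (intro sm_mult[symmetric] pvar_in_poly_ring xpow_in_poly_ring top_exp_exps v'c j)
    also have "xpow ?t * pvar j = (xpow (?t - ?c) * xpow (expscale ?q ?s) :: 'k mpoly)"
    proof -
      have "?t + ?s = ?t - ?c + (?c + ?s)" by (simp only: tc(2) flip: add.assoc)
      then show ?thesis unfolding pvar_conv xpow_add[symmetric] e by simp
    qed
    also have "\<dots> \<odot> v' = xpow (?t - ?c) \<odot> w"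
      unfolding w_def using tc(1) s(3) v'c by (intro sm_mult xpow_in_poly_ring)
    finally have "xpow (?t - ?c) \<odot> w = \<zero>" ..
    then have "\<kappa> e (?t - ?c) (- int n + int (monom_deg ?s)) \<zero> = w"
      using l.kap_xpow[OF tb tb w, of "- int n + int (monom_deg ?s)"] by simp
    then show ?thesis unfolding w_def[symmetric] using l.kap_zero[OF tb] by simp
  qed
  have "pr (- int n) (xpow b \<odot> z) = (if b = a then v else \<zero>)" if b: "b \<in> exps n" for b
  proof (cases "b = a")
    case True
    have "xpow b \<odot> z = v"
      unfolding True z_def vt[symmetric] using sm_mult[of "xpow (?t - a)" "xpow a" v'] sm_commute[of "xpow a" "xpow (?t - a)" v']
        xpow_in_poly_ring[OF a] xpow_in_poly_ring[OF ta(1)] v'c ta(2) by (metis xpow_add)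
    then show ?thesis using True pr_hcomp[OF v] by simp
  next
    case False
    have xz: "xpow b \<odot> z \<in> hcomp M (- int n - int (monom_deg a) + int (monom_deg b))"
      using hcomp_smult[OF homog_xpow[OF b] zd] .
    show ?thesis
    proof (cases "\<exists>j<n. Poly_Mapping.lookup a j < Poly_Mapping.lookup b j")
      case True
      then obtain j where j: "j < n" "Poly_Mapping.lookup a j < Poly_Mapping.lookup b j" by auto
      let ?s = "expscale ?q (Poly_Mapping.single j 1)"
      have s: "?s \<in> exps n" using j by (intro exps_expscale) simp
      have bt: "b + (?t - a) \<in> exps n" using b ta(1) by (simp add: exps_add)
      have aj: "Poly_Mapping.lookup a j < ?q" using aq j(1) by (simp add: box_def)
      have le: "Poly_Mapping.lookup ?s i \<le> Poly_Mapping.lookup (b + (?t - a)) i" for i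
        unfolding lookup_expscale_single using j aj by (auto simp: lookup_add lookup_minus lookup_top_exp)
      note r = exps_diff[OF bt le s]
      have "xpow b \<odot> z = (xpow b * xpow (?t - a)) \<odot> v'"
        unfolding z_def using b ta(1) v'c by (intro sm_mult[symmetric] xpow_in_poly_ring)
      also have "xpow b * xpow (?t - a) = (xpow (b + (?t - a) - ?s) * xpow ?s :: 'k mpoly)"
        using r(2) by (metis xpow_add)
      also have "\<dots> \<odot> v' = xpow (b + (?t - a) - ?s) \<odot> (xpow ?s \<odot> v')"
        using r(1) s v'c by (intro sm_mult xpow_in_poly_ring)
      also have "\<dots> = \<zero>" using kill[OF j(1)] smult_r_null[OF xpow_in_poly_ring[OF r(1)]] by simp
      finally show ?thesis using False pr_zero by simp
    next
      case ge: False
      have "monom_deg b < monom_deg a"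
      proof -
        obtain j where "Poly_Mapping.lookup b j \<noteq> Poly_Mapping.lookup a j"
          using False poly_mapping_eqI[of b a] by auto
        moreover have jn: "j < n"
          using calculation exps_lookup[OF a, of j] exps_lookup[OF b, of j] by (cases "j < n") auto
        ultimately have j: "j < n" "Poly_Mapping.lookup b j < Poly_Mapping.lookup a j"
          using ge by (meson linorder_neqE_nat)+
        show ?thesis unfolding monom_deg_exps[OF a] monom_deg_exps[OF b]
        proof (rule sum_strict_mono_ex1)
          show "\<forall>i\<in>{..<n}. Poly_Mapping.lookup b i \<le> Poly_Mapping.lookup a i"
            using ge by (meson lessThan_iff not_less)
        qed (use j in auto)
      qed
      then show ?thesis using pr_hcomp[OF xz, of "- int n"] False by simp
    qed
  qed
  then show thesis using that zd by blast
qed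

end

section \<open>The graded dual of the polynomial ring\<close>

lemma starE_simps:
  "carrier (starE n :: ('k::field mpoly, _) gmod) = {\<psi> \<in> extensional (carrier (poly_ring n)).
     (\<forall>p\<in>carrier (poly_ring n). \<forall>q\<in>carrier (poly_ring n). \<psi> (p + q) = \<psi> p + \<psi> q) \<and>
     (\<forall>c. \<forall>p\<in>carrier (poly_ring n). \<psi> (pconst c * p) = c * \<psi> p) \<and>
     finite {d. \<exists>p\<in>homog n d. \<psi> p \<noteq> 0}}"
  "\<zero>\<^bsub>starE n\<^esub> = (\<lambda>p\<in>carrier (poly_ring n :: 'k mpoly ring). 0)"
  "\<psi> \<oplus>\<^bsub>starE n\<^esub> \<psi>' = (\<lambda>p\<in>carrier (poly_ring n :: 'k mpoly ring). \<psi> p + \<psi>' p)"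
  "a \<odot>\<^bsub>starE n\<^esub> \<psi> = (\<lambda>p\<in>carrier (poly_ring n :: 'k mpoly ring). \<psi> (a * p))"
  "hcomp (starE n :: ('k::field mpoly, _) gmod) i =
     {\<psi> \<in> carrier (starE n). \<forall>d. d \<noteq> - i \<longrightarrow> (\<forall>p\<in>homog n d. \<psi> p = 0)}"
  by (simp_all add: starE_def Let_def)

abbreviation starE_pow :: "nat \<Rightarrow> nat \<Rightarrow> ('k::field mpoly, nat \<Rightarrow> 'k mpoly \<Rightarrow> 'k) gmod" where
  "starE_pow n c \<equiv> gmod_dsum {..<c} (\<lambda>_. gmod_shift (int n) (starE n))"

lemma gmod_shift_simps [simp]:
  "carrier (gmod_shift t Q) = carrier Q" "\<zero>\<^bsub>gmod_shift t Q\<^esub> = \<zero>\<^bsub>Q\<^esub>"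
  "x \<oplus>\<^bsub>gmod_shift t Q\<^esub> y = x \<oplus>\<^bsub>Q\<^esub> y" "a \<odot>\<^bsub>gmod_shift t Q\<^esub> x = a \<odot>\<^bsub>Q\<^esub> x"
  "hcomp (gmod_shift t Q) d = hcomp Q (d + t)"
  by (simp_all add: gmod_shift_def)

lemma starEI:
  assumes "\<psi> \<in> extensional (carrier (poly_ring n))"
    and "\<And>p q. p \<in> carrier (poly_ring n) \<Longrightarrow> q \<in> carrier (poly_ring n) \<Longrightarrow> \<psi> (p + q) = \<psi> p + \<psi> q"
    and "\<And>c p. p \<in> carrier (poly_ring n) \<Longrightarrow> \<psi> (pconst c * p) = c * \<psi> p"
    and "finite {d. \<exists>p\<in>homog n d. \<psi> p \<noteq> 0}"
  shows "\<psi> \<in> carrier (starE n)"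
  using assms by (simp add: starE_simps(1))

lemma starED:
  assumes "\<psi> \<in> carrier (starE n)"
  shows "\<psi> \<in> extensional (carrier (poly_ring n))"
    "p \<in> carrier (poly_ring n) \<Longrightarrow> q \<in> carrier (poly_ring n) \<Longrightarrow> \<psi> (p + q) = \<psi> p + \<psi> q"
    "p \<in> carrier (poly_ring n) \<Longrightarrow> \<psi> (pconst c * p) = c * \<psi> p"
    "finite {d. \<exists>p\<in>homog n d. \<psi> p \<noteq> 0}"
  using assms by (simp_all add: starE_simps(1))

lemma starE_eqI:
  fixes \<psi> \<psi>' :: "'k::field mpoly \<Rightarrow> 'k"
  assumes \<psi>: "\<psi> \<in> carrier (starE n)" "\<psi>' \<in> carrier (starE n)"
    and eq: "\<And>a. a \<in> exps n \<Longrightarrow> \<psi> (xpow a) = \<psi>' (xpow a)"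
  shows "\<psi> = \<psi>'"
proof (rule extensionalityI[OF starED(1)[OF \<psi>(1)] starED(1)[OF \<psi>(2)]])
  fix f :: "'k mpoly" assume f: "f \<in> carrier (poly_ring n)"
  have z: "\<psi> 0 = 0" if "\<psi> \<in> carrier (starE n)" for \<psi> :: "'k mpoly \<Rightarrow> 'k"
    using starED(3)[OF that, of 0 0] by simp
  show "\<psi> f = \<psi>' f"
  proof (rule poly_keys_induct[of _ f])
    show "\<psi> 0 = \<psi>' 0" unfolding z[OF \<psi>(1)] z[OF \<psi>(2)] ..
    fix a :: "nat \<Rightarrow>\<^sub>0 nat" and c :: 'k and g :: "'k mpoly"
    assume a: "a \<in> Poly_Mapping.keys f" and g: "Poly_Mapping.keys g \<subseteq> Poly_Mapping.keys f" "\<psi> g = \<psi>' g"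
    have an: "a \<in> exps n" using keys_poly_ring[OF f a] .
    have gP: "g \<in> carrier (poly_ring n)" using g(1) f by (auto simp: in_poly_ring_iff)
    have s: "Poly_Mapping.single a c \<in> carrier (poly_ring n)" using an by (rule single_in_poly_ring)
    have x: "(xpow a :: 'k mpoly) \<in> carrier (poly_ring n)" using an by (rule xpow_in_poly_ring)
    have "\<psi> (Poly_Mapping.single a c) = \<psi>' (Poly_Mapping.single a c)"
      unfolding single_conv starED(3)[OF \<psi>(1) x] starED(3)[OF \<psi>(2) x] eq[OF an] ..
    then show "\<psi> (Poly_Mapping.single a c + g) = \<psi>' (Poly_Mapping.single a c + g)"
      using starED(2)[OF \<psi>(1) s gP] starED(2)[OF \<psi>(2) s gP] g(2) by simp
  qed
qed

section \<open>Torsion modules with descent data\<close>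

locale torsion_frob_basis = torsion_frob n p M N \<kappa>
  for n p :: nat and M :: "('k::field mpoly, 'b) gmod" (structure) and N \<kappa> +
  fixes W :: "'b set" and c :: nat and b :: "nat \<Rightarrow> 'b"
  assumes W: "finite W" "W \<subseteq> V" "indep W" "V \<subseteq> kspan M W" and b: "bij_betw b {..<c} W"
begin

lemma W_carrier: "W \<subseteq> carrier M"
  using W(2) hcomp_carrier by blast

lemma b_in: "i < c \<Longrightarrow> b i \<in> W"
  using b by (auto simp: bij_betw_def)

abbreviation "pr0 \<equiv> pr (- int n)"

lemma pr0_kspan: "x \<in> carrier M \<Longrightarrow> pr0 x \<in> kspan M W"
  using pr_in W(4) by blast

text \<open>Taking coordinates along the basis of \<open>V\<close> splits a functional with values
  in \<open>V\<close> into \<open>c\<close> scalar functionals, that is, into elements of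
  \<open>c\<close> copies of the graded dual.\<close>

definition \<phi> :: "'b \<Rightarrow> nat \<Rightarrow> 'k mpoly \<Rightarrow> 'k" where
  "\<phi> m = (\<lambda>i\<in>{..<c}. \<lambda>r\<in>carrier (poly_ring n). coord W (b i) (pr0 (r \<odot> m)))"

lemma \<phi>_apply: "i < c \<Longrightarrow> r \<in> carrier (poly_ring n) \<Longrightarrow> \<phi> m i r = coord W (b i) (pr0 (r \<odot> m))"
  by (simp add: \<phi>_def)

lemma \<phi>_add_apply: "i < c \<Longrightarrow> r \<in> carrier (poly_ring n) \<Longrightarrow> x \<in> carrier M \<Longrightarrow> y \<in> carrier M \<Longrightarrow>
    \<phi> (x \<oplus> y) i r = \<phi> x i r + \<phi> y i r"
  using coord_add[OF W(3) W_carrier b_in, of i "pr0 (r \<odot> x)" "pr0 (r \<odot> y)"] pr0_kspan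
  by (simp add: \<phi>_apply smult_r_distr pr_add)

lemma \<phi>_pconst_apply: "i < c \<Longrightarrow> r \<in> carrier (poly_ring n) \<Longrightarrow> x \<in> carrier M \<Longrightarrow>
    \<phi> (pconst s \<odot> x) i r = s * \<phi> x i r"
proof -
  assume a: "i < c" "r \<in> carrier (poly_ring n)" "x \<in> carrier M"
  have "r \<odot> (pconst s \<odot> x) = pconst s \<odot> (r \<odot> x)" using a by (intro sm_commute) auto
  then show ?thesis using a coord_pconst[OF W(3) W_carrier b_in[OF a(1)] pr0_kspan, of "r \<odot> x" s]
    by (simp add: \<phi>_apply pr_pconst)
qed

lemma \<phi>_starE:
  assumes m: "m \<in> carrier M" and i: "i < c"
  shows "\<phi> m i \<in> carrier (starE n)"
proof (rule starEI)
  show "\<phi> m i \<in> extensional (carrier (poly_ring n))" using i by (simp add: \<phi>_def)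
  show "\<phi> m i (p + q) = \<phi> m i p + \<phi> m i q" if "p \<in> carrier (poly_ring n)" "q \<in> carrier (poly_ring n)" for p q
    using coord_add[OF W(3) W_carrier b_in[OF i], of "pr0 (p \<odot> m)" "pr0 (q \<odot> m)"] pr0_kspan that m i
    by (simp add: \<phi>_apply sm_add_left pr_add)
  show "\<phi> m i (pconst s * p) = s * \<phi> m i p" if "p \<in> carrier (poly_ring n)" for s p
    using coord_pconst[OF W(3) W_carrier b_in[OF i], of "pr0 (p \<odot> m)" s] pr0_kspan that m i
    by (simp add: \<phi>_apply sm_mult pr_pconst)
  \<comment> \<open>A polynomial of degree \<open>d\<close> sees only the component of
    \<open>m\<close> in degree -n - d, and \<open>m\<close> has finitely many non-zero
    components.\<close>
  have "{d. \<exists>p\<in>homog n d. \<phi> m i p \<noteq> 0} \<subseteq> (\<lambda>D. - int n - D) ` {D. pr D m \<noteq> \<zero>}"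
  proof
    fix d assume "d \<in> {d. \<exists>p\<in>homog n d. \<phi> m i p \<noteq> 0}"
    then obtain r where r: "r \<in> homog n d" "\<phi> m i r \<noteq> 0" by auto
    have rP: "r \<in> carrier (poly_ring n)" using r(1) by (rule homog_in_poly_ring)
    have "pr (- int n - d + d) (r \<odot> m) = r \<odot> pr (- int n - d) m" by (rule pr_smult[OF r(1) m])
    then have "r \<odot> pr (- int n - d) m \<noteq> \<zero>"
      using r(2) \<phi>_apply[OF i rP, of m] coord_zero[OF W(3) W_carrier b_in[OF i]] by auto
    then have "pr (- int n - d) m \<noteq> \<zero>" using smult_r_null[OF rP] by metis
    then show "d \<in> (\<lambda>D. - int n - D) ` {D. pr D m \<noteq> \<zero>}"
      by (intro image_eqI[of _ _ "- int n - d"]) auto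
  qed
  then show "finite {d. \<exists>p\<in>homog n d. \<phi> m i p \<noteq> 0}"
    using finite_pr[OF m] finite_subset by blast
qed

lemma \<phi>_closed: "m \<in> carrier M \<Longrightarrow> \<phi> m \<in> carrier (starE_pow n c)"
  using \<phi>_starE by (auto simp: PiE_iff) (simp add: \<phi>_def)

text \<open>For z = x - y all parts of degree -n of multiples r z vanish. A monomial that moves a
  non-zero component of z to a non-zero element of degree -n contradicts this.\<close>

lemma inj_\<phi>: "inj_on \<phi> (carrier M)"
proof (rule inj_onI, rule ccontr)
  fix x y assume x: "x \<in> carrier M" and y: "y \<in> carrier M" and eq: "\<phi> x = \<phi> y" and ne: "x \<noteq> y"
  have pr_eq: "pr0 (r \<odot> x) = pr0 (r \<odot> y)" if r: "r \<in> carrier (poly_ring n)" for r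
  proof -
    have co: "coord W w (pr0 (r \<odot> x)) = coord W w (pr0 (r \<odot> y))" if w: "w \<in> W" for w
    proof -
      obtain i where i: "i < c" "w = b i" using w b by (auto simp: bij_betw_def)
      then show ?thesis using \<phi>_apply[OF i(1) r] eq by metis
    qed
    have k: "pr0 (r \<odot> x) \<in> kspan M W" "pr0 (r \<odot> y) \<in> kspan M W" using pr0_kspan r x y by auto
    have "pr0 (r \<odot> x) = (\<Oplus>w\<in>W. pconst (coord W w (pr0 (r \<odot> x))) \<odot> w)"
      by (rule coord_finsum[OF W(3) W_carrier W(1) k(1)])
    also have "\<dots> = (\<Oplus>w\<in>W. pconst (coord W w (pr0 (r \<odot> y))) \<odot> w)"
      using co W_carrier by (intro M.finsum_cong') auto
    also have "\<dots> = pr0 (r \<odot> y)"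
      by (rule coord_finsum[OF W(3) W_carrier W(1) k(2), symmetric])
    finally show ?thesis .
  qed
  define z where "z = x \<ominus> y"
  have z: "z \<in> carrier M" "z \<noteq> \<zero>" unfolding z_def using x y ne minus_eq_zero_iff by auto
  have rz: "pr0 (r \<odot> z) = \<zero>" if r: "r \<in> carrier (poly_ring n)" for r
  proof -
    have "r \<odot> z = r \<odot> x \<ominus> r \<odot> y"
      unfolding z_def a_minus_def using r x y by (simp add: smult_r_distr smult_r_minus)
    then show ?thesis using pr_eq[OF r] r x y minus_eq_zero_iff[of "pr0 (r \<odot> y)" "pr0 (r \<odot> y)"]
      by (simp add: pr_minus)
  qed
  obtain D where D: "pr D z \<noteq> \<zero>" using pr_all_zero[OF z(1)] z(2) by blast
  obtain a where a: "a \<in> exps n" "xpow a \<odot> pr D z \<noteq> \<zero>" "D + int (monom_deg a) = - int n"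
    using socle_multiple[OF pr_in[OF z(1)] D] by blast
  have "pr0 (xpow a \<odot> z) = xpow a \<odot> pr D z"
    using pr_smult[OF homog_xpow[OF a(1)] z(1), of D] a(3) by simp
  then show False using rz[OF xpow_in_poly_ring[OF a(1)]] a(2) by simp
qed

text \<open>For each pair in \<open>A\<close> a multiple of the image of a dual vector is subtracted
  from \<open>t\<close>, until nothing is left. The clause on degrees records that the preimage is
  homogeneous when all pairs share one degree; it yields surjectivity on each graded piece.\<close>

lemma \<phi>_preimage:
  assumes "finite A" "\<And>i a. (i, a) \<in> A \<Longrightarrow> i < c \<and> a \<in> exps n" "t \<in> carrier (starE_pow n c)"
    and "\<And>i a. i < c \<Longrightarrow> a \<in> exps n \<Longrightarrow> (i, a) \<notin> A \<Longrightarrow> t i (xpow a) = 0"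
  shows "\<exists>m\<in>carrier M. \<phi> m = t \<and> (\<forall>D. (\<forall>(i, a)\<in>A. - int n - int (monom_deg a) = D) \<longrightarrow> m \<in> hcomp M D)"
  using assms
proof (induction A arbitrary: t rule: finite_induct)
  case (empty t)
  have "\<phi> \<zero> = t"
  proof
    fix i
    show "\<phi> \<zero> i = t i"
    proof (cases "i < c")
      case True
      have t: "t i \<in> carrier (starE n)" using empty.prems(2) True by (auto simp: PiE_iff)
      show ?thesis
      proof (rule starE_eqI[OF \<phi>_starE[OF M.zero_closed True] t])
        fix a assume a: "a \<in> exps n"
        have "\<phi> \<zero> i (xpow a) = coord W (b i) \<zero>"
          using \<phi>_apply[OF True xpow_in_poly_ring[OF a]] smult_r_null[OF xpow_in_poly_ring[OF a]] pr_zero by simp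
        then show "\<phi> \<zero> i (xpow a) = t i (xpow a)"
          using empty.prems(3)[OF True a] coord_zero[OF W(3) W_carrier b_in[OF True]] by simp
      qed
    next
      case False
      then show ?thesis using empty.prems(2) by (auto simp: \<phi>_def PiE_iff extensional_def)
    qed
  qed
  moreover have "\<zero> \<in> hcomp M D" for D using kspaceD(3)[OF kspace_N] .
  ultimately show ?case by (intro bexI[of _ \<zero>]) auto
next
  case (insert ia A t)
  obtain i a where ia: "ia = (i, a)" by force
  have i: "i < c" and a: "a \<in> exps n" using insert.prems(1)[of i a] ia by auto
  have xa: "(xpow a :: 'k mpoly) \<in> carrier (poly_ring n)" using a by (rule xpow_in_poly_ring)
  have biV: "b i \<in> V" using b_in[OF i] W(2) by auto
  obtain z where z: "z \<in> hcomp M (- int n - int (monom_deg a))"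
    "\<And>a'. a' \<in> exps n \<Longrightarrow> pr0 (xpow a' \<odot> z) = (if a' = a then b i else \<zero>)"
    using socle_dual[OF a biV] by blast
  have zc: "z \<in> carrier M" using z(1) hcomp_carrier by blast
  define s where "s = t i (xpow a)"
  have tj: "t j \<in> carrier (starE n)" if "j < c" for j using insert.prems(2) that by (auto simp: PiE_iff)
  have \<phi>z: "\<phi> z j (xpow a') = (if j = i \<and> a' = a then 1 else 0)" if "j < c" "a' \<in> exps n" for j a'
  proof -
    have "b j = b i \<longleftrightarrow> j = i" using b i that(1) by (auto simp: bij_betw_def inj_on_def)
    then show ?thesis
      using \<phi>_apply[OF that(1) xpow_in_poly_ring[OF that(2)], of z] z(2)[OF that(2)]
        coord_basis[OF W(3) W_carrier b_in[OF that(1)] b_in[OF i]] coord_zero[OF W(3) W_carrier b_in[OF that(1)]]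
      by auto
  qed
  define t' where "t' = (\<lambda>j\<in>{..<c}. \<lambda>r\<in>carrier (poly_ring n). t j r - s * \<phi> z j r)"
  have t'_apply: "t' j r = t j r - s * \<phi> z j r" if "j < c" "r \<in> carrier (poly_ring n)" for j r
    using that by (simp add: t'_def)
  have t'j: "t' j \<in> carrier (starE n)" if j: "j < c" for j
  proof (rule starEI)
    note T = starED[OF tj[OF j]] and Z = starED[OF \<phi>_starE[OF zc j]]
    show "t' j \<in> extensional (carrier (poly_ring n))" using j by (simp add: t'_def)
    show "t' j (p + q) = t' j p + t' j q" if "p \<in> carrier (poly_ring n)" "q \<in> carrier (poly_ring n)" for p q
      using that j by (simp add: t'_apply T(2) Z(2) algebra_simps)
    show "t' j (pconst e * p) = e * t' j p" if "p \<in> carrier (poly_ring n)" for e p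
      using that j by (simp add: t'_apply T(3) Z(3) right_diff_distrib mult.left_commute)
    have "{d. \<exists>p\<in>homog n d. t' j p \<noteq> 0} \<subseteq> {d. \<exists>p\<in>homog n d. t j p \<noteq> 0} \<union> {d. \<exists>p\<in>homog n d. \<phi> z j p \<noteq> 0}"
    proof
      fix d assume "d \<in> {d. \<exists>p\<in>homog n d. t' j p \<noteq> 0}"
      then obtain r where r: "r \<in> homog n d" "t' j r \<noteq> 0" by auto
      then have "t j r \<noteq> 0 \<or> \<phi> z j r \<noteq> 0" using t'_apply[OF j homog_in_poly_ring[OF r(1)]] by auto
      then show "d \<in> {d. \<exists>p\<in>homog n d. t j p \<noteq> 0} \<union> {d. \<exists>p\<in>homog n d. \<phi> z j p \<noteq> 0}" using r(1) by blast
    qed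
    then show "finite {d. \<exists>p\<in>homog n d. t' j p \<noteq> 0}" using T(4) Z(4) by (meson finite_UnI finite_subset)
  qed
  have "t' \<in> carrier (starE_pow n c)" using t'j by (auto simp: PiE_iff) (simp add: t'_def)
  moreover have "t' j (xpow a') = 0" if j: "j < c" "a' \<in> exps n" "(j, a') \<notin> A" for j a'
    using j insert.prems(3)[of j a'] \<phi>z[OF j(1,2)] t'_apply[OF j(1) xpow_in_poly_ring[OF j(2)]]
    by (cases "(j, a') = ia") (auto simp: s_def ia)
  ultimately obtain m where m: "m \<in> carrier M" "\<phi> m = t'"
    "\<And>D. (\<forall>(i, a)\<in>A. - int n - int (monom_deg a) = D) \<Longrightarrow> m \<in> hcomp M D"
    using insert.IH[of t'] insert.prems(1) by blast
  define m' where "m' = m \<oplus> pconst s \<odot> z"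
  have "\<phi> m' = t"
  proof
    fix j
    show "\<phi> m' j = t j"
    proof (cases "j < c")
      case True
      show ?thesis
      proof (rule extensionalityI)
        show "\<phi> m' j \<in> extensional (carrier (poly_ring n))" using True by (simp add: \<phi>_def)
        show "t j \<in> extensional (carrier (poly_ring n))" by (rule starED(1)[OF tj[OF True]])
        fix r :: "'k mpoly" assume r: "r \<in> carrier (poly_ring n)"
        show "\<phi> m' j r = t j r"
          using \<phi>_add_apply[OF True r m(1), of "pconst s \<odot> z"] \<phi>_pconst_apply[OF True r zc, of s] zc
            t'_apply[OF True r] m(2) by (simp add: m'_def)
      qed
    next
      case False
      then show ?thesis using insert.prems(2) by (auto simp: \<phi>_def PiE_iff extensional_def)
    qed
  qed
  moreover have "m' \<in> carrier M" unfolding m'_def using m(1) zc by simp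
  moreover have "m' \<in> hcomp M D" if D: "\<forall>(i, a)\<in>insert ia A. - int n - int (monom_deg a) = D" for D
  proof -
    have "m \<in> hcomp M D" using m(3) D by blast
    moreover have "z \<in> hcomp M D" using z(1) D ia by auto
    ultimately show ?thesis unfolding m'_def using kspaceD(4,5)[OF kspace_N] by blast
  qed
  ultimately show ?case by blast
qed

text \<open>This rests on the finiteness condition in \<open>starE\<close>: finitely many degrees
  carry non-zero values, and each contains finitely many monomials.\<close>

lemma starE_support:
  assumes t: "t \<in> carrier (starE_pow n c)"
  shows "finite {(i, a). i < c \<and> a \<in> exps n \<and> t i (xpow a) \<noteq> 0}"
proof -
  have "finite {a \<in> exps n. t i (xpow a) \<noteq> 0}" if i: "i < c" for i
  proof -
    have ti: "t i \<in> carrier (starE n)" using t i by (auto simp: PiE_iff)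
    have "{a \<in> exps n. t i (xpow a) \<noteq> 0} \<subseteq>
        (\<Union>d\<in>{d. \<exists>p\<in>homog n d. t i p \<noteq> 0}. {a \<in> exps n. int (monom_deg a) = d})"
      using homog_xpow by fastforce
    then show ?thesis using starED(4)[OF ti] finite_monomials by (meson finite_UN_I finite_subset)
  qed
  then have "finite (\<Union>i<c. Pair i ` {a \<in> exps n. t i (xpow a) \<noteq> 0})" by auto
  then show ?thesis by (rule rev_finite_subset) auto
qed

lemma presents_\<phi>: "presents n M (carrier M) \<phi> (starE_pow n c)"
  unfolding presents_def
proof (intro conjI ballI allI)
  show "submod n M (carrier M)" by (rule submod_carrier)
  show "carrier (starE_pow n c) = \<phi> ` carrier M"
  proof
    show "\<phi> ` carrier M \<subseteq> carrier (starE_pow n c)" using \<phi>_closed by blast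
    show "carrier (starE_pow n c) \<subseteq> \<phi> ` carrier M"
    proof
      fix t :: "nat \<Rightarrow> 'k mpoly \<Rightarrow> 'k" assume t: "t \<in> carrier (starE_pow n c)"
      have "\<exists>m\<in>carrier M. \<phi> m = t \<and> (\<forall>D. (\<forall>(i, a)\<in>{(i, a). i < c \<and> a \<in> exps n \<and> t i (xpow a) \<noteq> 0}.
          - int n - int (monom_deg a) = D) \<longrightarrow> m \<in> hcomp M D)"
        by (rule \<phi>_preimage[OF starE_support[OF t] _ t]) auto
      then show "t \<in> \<phi> ` carrier M" by blast
    qed
  qed
  show "\<zero>\<^bsub>starE_pow n c\<^esub> = \<phi> \<zero>"
    using smult_r_null pr_zero coord_zero[OF W(3) W_carrier b_in]
    by (auto simp: fun_eq_iff \<phi>_def starE_simps(2) restrict_def)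
  show "\<phi> x \<oplus>\<^bsub>starE_pow n c\<^esub> \<phi> y = \<phi> (x \<oplus> y)" if "x \<in> carrier M" "y \<in> carrier M" for x y
  proof
    fix i show "(\<phi> x \<oplus>\<^bsub>starE_pow n c\<^esub> \<phi> y) i = \<phi> (x \<oplus> y) i"
    proof (cases "i < c")
      case True
      have "(\<lambda>r\<in>carrier (poly_ring n). \<phi> x i r + \<phi> y i r) = \<phi> (x \<oplus> y) i"
      proof (rule extensionalityI[of _ "carrier (poly_ring n)"])
        show "\<phi> (x \<oplus> y) i \<in> extensional (carrier (poly_ring n))" using True by (simp add: \<phi>_def)
      qed (use \<phi>_add_apply[OF True _ that] in auto)
      then show ?thesis using True by (simp add: starE_simps(3))
    qed (simp add: \<phi>_def)
  qed
  show "a \<odot>\<^bsub>starE_pow n c\<^esub> \<phi> x = \<phi> (a \<odot> x)" if a: "a \<in> carrier (poly_ring n)" and x: "x \<in> carrier M" for a x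
  proof
    fix i show "(a \<odot>\<^bsub>starE_pow n c\<^esub> \<phi> x) i = \<phi> (a \<odot> x) i"
    proof (cases "i < c")
      case True
      have "(\<lambda>r\<in>carrier (poly_ring n). \<phi> x i (a * r)) = \<phi> (a \<odot> x) i"
      proof (rule extensionalityI[of _ "carrier (poly_ring n)"])
        show "\<phi> (a \<odot> x) i \<in> extensional (carrier (poly_ring n))" using True by (simp add: \<phi>_def)
        fix r :: "'k mpoly" assume r: "r \<in> carrier (poly_ring n)"
        have "(a * r) \<odot> x = r \<odot> (a \<odot> x)" using sm_mult[OF r a x] by (simp add: mult.commute)
        then show "(\<lambda>r\<in>carrier (poly_ring n). \<phi> x i (a * r)) r = \<phi> (a \<odot> x) i r"
          using \<phi>_apply[OF True] r a by simp
      qed auto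
      then show ?thesis using True by (simp add: starE_simps(4))
    qed (simp add: \<phi>_def)
  qed
  show "hcomp (starE_pow n c) d = \<phi> ` (carrier M \<inter> hcomp M d)" for d
  proof
    show "\<phi> ` (carrier M \<inter> hcomp M d) \<subseteq> hcomp (starE_pow n c) d"
    proof
      fix t assume "t \<in> \<phi> ` (carrier M \<inter> hcomp M d)"
      then obtain x where x: "x \<in> carrier M" "x \<in> hcomp M d" "t = \<phi> x" by blast
      have "\<phi> x i r = 0" if i: "i < c" and r: "r \<in> homog n e" "e \<noteq> - (d + int n)" for i r e
      proof -
        have "r \<odot> x \<in> hcomp M (d + e)" by (rule hcomp_smult[OF r(1) x(2)])
        then have "pr0 (r \<odot> x) = \<zero>" using pr_hcomp r(2) by simp
        then show ?thesis using \<phi>_apply[OF i homog_in_poly_ring[OF r(1)]] coord_zero[OF W(3) W_carrier b_in[OF i]] by simp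
      qed
      then show "t \<in> hcomp (starE_pow n c) d"
        using \<phi>_starE[OF x(1)] by (auto simp: x(3) PiE_iff starE_simps(5)) (simp add: \<phi>_def)
    qed
    show "hcomp (starE_pow n c) d \<subseteq> \<phi> ` (carrier M \<inter> hcomp M d)"
    proof
      fix t :: "nat \<Rightarrow> 'k mpoly \<Rightarrow> 'k" assume td: "t \<in> hcomp (starE_pow n c) d"
      then have t: "t \<in> carrier (starE_pow n c)" by (auto simp: PiE_iff starE_simps(5))
      have t0: "t i r = 0" if "i < c" "r \<in> homog n e" "e \<noteq> - (d + int n)" for i r e
        using td that by (auto simp: PiE_iff starE_simps(5))
      let ?A = "{(i, a). i < c \<and> a \<in> exps n \<and> t i (xpow a) \<noteq> 0}"
      have "\<exists>m\<in>carrier M. \<phi> m = t \<and> (\<forall>D. (\<forall>(i, a)\<in>?A. - int n - int (monom_deg a) = D) \<longrightarrow> m \<in> hcomp M D)"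
        by (rule \<phi>_preimage[OF starE_support[OF t] _ t]) auto
      moreover have "\<forall>(i, a)\<in>?A. - int n - int (monom_deg a) = d"
      proof clarify
        fix i a assume "i < c" "a \<in> exps n" "t i (xpow a) \<noteq> 0"
        then have "int (monom_deg a) = - (d + int n)" using t0 homog_xpow by blast
        then show "- int n - int (monom_deg a) = d" by simp
      qed
      ultimately show "t \<in> \<phi> ` (carrier M \<inter> hcomp M d)" by blast
    qed
  qed
qed

text \<open>\<open>graded_iso\<close> also asks that the target be a graded module. This is
  inherited from \<open>M\<close> along \<phi>, by the descent lemma for presentations at level q =
  1 with zero kernel.\<close>

lemma graded_iso_starE: "graded_iso n M (starE_pow n c)"
proof (rule graded_iso_presents[OF pmodule_axioms graded_module _ presents_\<phi> inj_\<phi>])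
  have ker: "x = \<zero>" if "x \<in> carrier M" "\<phi> x = \<zero>\<^bsub>starE_pow n c\<^esub>" for x
  proof -
    have "\<phi> x = \<phi> \<zero>" using that presents_\<phi> by (simp add: presents_def)
    then show ?thesis using inj_onD[OF inj_\<phi>] that(1) M.zero_closed by blast
  qed
  obtain \<kappa>' where "frob_level n (starE_pow n c) (Suc 0) (\<lambda>d. \<phi> ` (carrier M \<inter> hcomp M d)) \<kappa>'"
  proof (rule presents_frob_level[OF presents_\<phi>])
    fix a d x assume a: "a \<in> box n (Suc 0)" and x: "x \<in> carrier M"
    show "\<kappa> 0 a d x \<in> carrier M" using a x by simp
    assume "\<phi> x = \<zero>\<^bsub>starE_pow n c\<^esub>"
    then have "\<kappa> 0 a d x = \<zero>" using ker[OF x] kap_zero[OF a] by simp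
    then show "\<phi> (\<kappa> 0 a d x) = \<zero>\<^bsub>starE_pow n c\<^esub>" using presents_\<phi> by (simp add: presents_def)
  qed
  moreover have "(\<lambda>d. \<phi> ` (carrier M \<inter> hcomp M d)) = hcomp (starE_pow n c)"
    using presents_\<phi> by (simp add: presents_def fun_eq_iff)
  ultimately have "graded n (starE_pow n c) \<kappa>'" by (simp add: graded_def)
  then show "graded_module n (starE_pow n c :: ('k mpoly, nat \<Rightarrow> 'k mpoly \<Rightarrow> 'k) gmod)" by (rule graded.graded_module)
qed

end

lemma (in torsion_frob) ex_graded_iso_starE: "\<exists>c. graded_iso n M (starE_pow n c)"
proof -
  obtain C where C: "\<And>S. finite S \<Longrightarrow> S \<subseteq> V \<Longrightarrow> \<exists>W\<subseteq>S. card W \<le> C \<and> S \<subseteq> kspan M W"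
    using V_bounded by blast
  obtain W where W: "finite W" "W \<subseteq> V" "indep W" "V \<subseteq> kspan M W"
    using ex_basis[OF kspace_N C] by blast
  obtain b where "bij_betw b {0..<card W} W" using ex_bij_betw_nat_finite[OF W(1)] by blast
  then have "torsion_frob_basis n p M N \<kappa> W (card W) b"
    using W torsion_frob_axioms
    by (simp add: torsion_frob_basis_def torsion_frob_basis_axioms_def atLeast0LessThan)
  then show ?thesis using torsion_frob_basis.graded_iso_starE by blast
qed

theorem theorem3p4:
  fixes n s p :: nat
    and I :: "nat \<Rightarrow> 'k::field mpoly set"
    and i :: "nat \<Rightarrow> nat"
    and T :: "('k mpoly, 'k mpoly) gmod \<Rightarrow> ('k mpoly, 'k mpoly) gmod"
  assumes char: "CHAR('k) = p" "p > 0"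
    and homogeneous: "\<And>j. j \<in> {1..s} \<Longrightarrow> homogeneous_ideal n (I j)"
    and T: "T = foldr (\<lambda>j. local_cohomology n (I j) (i j)) [1..<Suc s]"
  shows "\<exists>c::nat. graded_iso n
           (local_cohomology n (irrelevant_ideal n) (i 0) (T (ring_gmod n)))
           (gmod_dsum {..<c} (\<lambda>_. gmod_shift (int n) (starE n)))"
proof -
  have "prime p" using prime_CHAR_semidom[where ?'a = 'k] char by simp
  then have p: "p > Suc 0" using prime_gt_1_nat by auto
  note inf = infinite_UNIV_mpoly[where ?'k = 'k]
  \<comment> \<open>Through the composition only the existence of descent data is tracked; torsion
    enters with the last functor, whose ideal is the maximal one.\<close>
  have step: "\<exists>N. frob_struct n p (foldr (\<lambda>j. local_cohomology n (I j) (i j)) js (ring_gmod n)) N"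
    if "set js \<subseteq> {1..s}" for js
    using that
  proof (induction js)
    case Nil
    show ?case using frob_struct_ring[OF p] by auto
  next
    case (Cons j js)
    then obtain N where "frob_struct n p (foldr (\<lambda>j. local_cohomology n (I j) (i j)) js (ring_gmod n)) N" by auto
    moreover obtain fs where "homogeneous_generators n (I j) fs"
      using ex_homogeneous_generators[OF homogeneous, of j] Cons.prems by auto
    ultimately show ?case using frob_struct_local_cohomology[OF char(1) p _ _ inf] by auto
  qed
  let ?TR = "T (ring_gmod n)"
  have "set [1..<Suc s] \<subseteq> {1..s}" by auto
  then have "\<exists>N. frob_struct n p ?TR N" unfolding T by (rule step)
  then obtain N where N: "frob_struct n p ?TR N" ..
  let ?H = "local_cohomology n (irrelevant_ideal n) (i 0) ?TR"
  obtain N' where N': "frob_struct n p ?H N'"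
    using frob_struct_local_cohomology[OF char(1) p N irrelevant_homogeneous_generators inf] by blast
  obtain \<kappa> where \<kappa>: "\<And>e. frob_level n ?H (p ^ e) (N' e) (\<kappa> e)" using frob_struct_level[OF N'] by blast
  have "torsion_frob n p ?H N' \<kappa>"
    using p \<kappa> N' local_cohomology_torsion[OF char(1) p frob_struct_pmodule[OF N] inf]
    by (simp add: torsion_frob_def)
  then show ?thesis by (rule torsion_frob.ex_graded_iso_starE)
qed

end
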